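(* Let $1\le q<\infty$. A set $C\subseteq\mathcal{D}'_{L^q}$ is compact if and only if for some $m\in\mathbb{N}_0$ the set $L_{2m}*C=\{L_{2m}*S: S\in C\}$ is (contained in $L^q$ and) compact in $L^q$.
   Context: All spaces consist of complex-valued functions or distributions on $\mathbb{R}^n$. For $1\le p\le\infty$, $\mathcal{D}_{L^p}$ is the space of $C^\infty$-functions all of whose derivatives lie in $L^p$, with the topology defined by the (semi-)norms $\varphi\mapsto\sup_{|\alpha|\le m}\|\partial^\alpha\varphi\|_p$, $m\in\mathbb{N}_0$. $\dot{\mathcal{B}}$ is the subspace of $\mathcal{D}_{L^\infty}$ of functions all of whose derivatives vanish at infinity. $\mathcal{D}'_{L^q}$ is the strong dual of $\mathcal{D}_{L^p}$, $1/p+1/q=1$, if $q>1$, and $\mathcal{D}'_{L^1}$ is the strong dual of $\dot{\mathcal{B}}$; compactness in $\mathcal{D}'_{L^q}$ refers to this strong topology. With the Fourier transform $\mathcal{F}\varphi(y)=\int_{\mathbb{R}^n}e^{-iyx}\varphi(x)\,dx$, the Bessel kernel is $L_s=\mathcal{F}^{-1}((1+|x|^2)^{-s/2})$; thus $L_0=\delta$, and $L_{2m}$ is the temperate fundamental solution of $(1-\Delta_n)^m$, where $\Delta_n$ is the Laplacian on $\mathbb{R}^n$. *)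

theory Defs
  imports "HOL-Analysis.Analysis" "HOL-Probability.Essential_Supremum"
begin

subsection \<open>Topologies given by seminorms, and strong duals\<close>

text \<open>
  Both functions on \<open>\<real>\<^sup>n\<close> and functionals on a function space have a type of the form
  \<open>'x \<Rightarrow> complex\<close>; \<open>X\<close> is the carrier of a linear subspace.
\<close>

definition seminorm_topology ::
    "('x \<Rightarrow> complex) set \<Rightarrow> (('x \<Rightarrow> complex) \<Rightarrow> real) set \<Rightarrow> ('x \<Rightarrow> complex) topology" where
  "seminorm_topology X P = topology (\<lambda>U. U \<subseteq> X \<and>
     (\<forall>f\<in>U. \<exists>F \<epsilon>. finite F \<and> F \<subseteq> P \<and> \<epsilon> > 0 \<and>
        {g\<in>X. \<forall>p\<in>F. p (\<lambda>x. g x - f x) < \<epsilon>} \<subseteq> U))"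

lemma openin_seminorm_topology:
  "openin (seminorm_topology X P) U \<longleftrightarrow> U \<subseteq> X \<and>
     (\<forall>f\<in>U. \<exists>F \<epsilon>. finite F \<and> F \<subseteq> P \<and> \<epsilon> > 0 \<and>
        {g\<in>X. \<forall>p\<in>F. p (\<lambda>x. g x - f x) < \<epsilon>} \<subseteq> U)"
proof -
  let ?N = "\<lambda>U f. \<exists>F \<epsilon>. finite F \<and> F \<subseteq> P \<and> \<epsilon> > (0::real) \<and>
        {g\<in>X. \<forall>p\<in>F. p (\<lambda>x. g x - f x) < \<epsilon>} \<subseteq> U"
  have inter: "?N (U \<inter> V) f" if "?N U f" "?N V f" for U V f
  proof -
    from that(1) obtain F \<epsilon> where F: "finite F" "F \<subseteq> P" "\<epsilon> > 0"
      "{g\<in>X. \<forall>p\<in>F. p (\<lambda>x. g x - f x) < \<epsilon>} \<subseteq> U" by blast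
    from that(2) obtain G \<delta> where G: "finite G" "G \<subseteq> P" "\<delta> > 0"
      "{g\<in>X. \<forall>p\<in>G. p (\<lambda>x. g x - f x) < \<delta>} \<subseteq> V" by blast
    have "{g\<in>X. \<forall>p\<in>F \<union> G. p (\<lambda>x. g x - f x) < min \<epsilon> \<delta>} \<subseteq> U \<inter> V"
      using F(4) G(4) by auto
    then show ?thesis
      using F(1-3) G(1-3) by (intro exI[of _ "F \<union> G"] exI[of _ "min \<epsilon> \<delta>"]) auto
  qed
  have union: "?N (\<Union>K) f" if "U \<in> K" "?N U f" for K U f
    using that by (meson Union_upper order_trans)
  have "istopology (\<lambda>U. U \<subseteq> X \<and> (\<forall>f\<in>U. ?N U f))"
    unfolding istopology_def
  proof (rule conjI; intro allI impI)
    fix S T assume "S \<subseteq> X \<and> (\<forall>f\<in>S. ?N S f)" "T \<subseteq> X \<and> (\<forall>f\<in>T. ?N T f)"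
    then show "S \<inter> T \<subseteq> X \<and> (\<forall>f\<in>S \<inter> T. ?N (S \<inter> T) f)"
      by (intro conjI ballI inter) auto
  next
    fix K assume K: "\<forall>U\<in>K. U \<subseteq> X \<and> (\<forall>f\<in>U. ?N U f)"
    show "\<Union>K \<subseteq> X \<and> (\<forall>f\<in>\<Union>K. ?N (\<Union>K) f)"
    proof (intro conjI ballI)
      show "\<Union>K \<subseteq> X" using K by blast
      fix f assume "f \<in> \<Union>K"
      then obtain U where "U \<in> K" "f \<in> U" by blast
      then show "?N (\<Union>K) f" using K by (intro union[of U]) auto
    qed
  qed
  then show ?thesis
    unfolding seminorm_topology_def by (simp add: topology_inverse')
qed

lemma topspace_seminorm_topology [simp]: "topspace (seminorm_topology X P) = X"
proof
  show "topspace (seminorm_topology X P) \<subseteq> X"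
    using openin_topspace[of "seminorm_topology X P"] unfolding openin_seminorm_topology by blast
  have "openin (seminorm_topology X P) X"
    unfolding openin_seminorm_topology
    by (auto intro!: exI[of _ "{}"] exI[of _ "1::real"])
  then show "X \<subseteq> topspace (seminorm_topology X P)"
    by (rule openin_subset)
qed

definition linear_functional :: "('x \<Rightarrow> complex) set \<Rightarrow> (('x \<Rightarrow> complex) \<Rightarrow> complex) \<Rightarrow> bool" where
  "linear_functional X S \<longleftrightarrow>
     (\<forall>\<phi>\<in>X. \<forall>\<psi>\<in>X. S (\<lambda>x. \<phi> x + \<psi> x) = S \<phi> + S \<psi>) \<and>
     (\<forall>c. \<forall>\<phi>\<in>X. S (\<lambda>x. c * \<phi> x) = c * S \<phi>)"

text \<open>
  A functional on \<open>X\<close> is represented by a total function vanishing outside \<open>X\<close>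
  (rather than by an extensional function, so that differences of functionals are again
  of this form).
\<close>

definition dual_space ::
    "('x \<Rightarrow> complex) set \<Rightarrow> (('x \<Rightarrow> complex) \<Rightarrow> real) set \<Rightarrow> (('x \<Rightarrow> complex) \<Rightarrow> complex) set" where
  "dual_space X P = {S. (\<forall>\<phi>. \<phi> \<notin> X \<longrightarrow> S \<phi> = 0) \<and> linear_functional X S \<and>
     continuous_map (seminorm_topology X P) euclidean S}"

text \<open>Nonemptiness is required since the supremum of the empty set of reals is unspecified.\<close>

definition bounded_sets ::
    "('x \<Rightarrow> complex) set \<Rightarrow> (('x \<Rightarrow> complex) \<Rightarrow> real) set \<Rightarrow> ('x \<Rightarrow> complex) set set" where
  "bounded_sets X P = {B. B \<noteq> {} \<and> B \<subseteq> X \<and> (\<forall>p\<in>P. bdd_above (p ` B))}"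

definition strong_dual_topology ::
    "('x \<Rightarrow> complex) set \<Rightarrow> (('x \<Rightarrow> complex) \<Rightarrow> real) set \<Rightarrow> (('x \<Rightarrow> complex) \<Rightarrow> complex) topology" where
  "strong_dual_topology X P = seminorm_topology (dual_space X P)
     ((\<lambda>B S. SUP \<phi>\<in>B. norm (S \<phi>)) ` bounded_sets X P)"


subsection \<open>Smooth functions\<close>

definition partial_deriv :: "'n::finite \<Rightarrow> (real^'n \<Rightarrow> complex) \<Rightarrow> real^'n \<Rightarrow> complex" where
  "partial_deriv i f x = frechet_derivative f (at x) (axis i 1)"

text \<open>
  A multi-index \<open>\<alpha>\<close> is encoded as the list of the coordinates with respect to which one
  differentiates, so \<open>\<bar>\<alpha>\<bar>\<close> is the length of the list. For smooth functions the order of the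
  entries is irrelevant.
\<close>

definition partial_derivs :: "'n::finite list \<Rightarrow> (real^'n \<Rightarrow> complex) \<Rightarrow> real^'n \<Rightarrow> complex" where
  "partial_derivs \<alpha> f = foldr partial_deriv \<alpha> f"

definition smooth :: "(real^'n::finite \<Rightarrow> complex) \<Rightarrow> bool" where
  "smooth f \<longleftrightarrow> (\<forall>\<alpha> x. partial_derivs \<alpha> f differentiable (at x))"

definition test_functions :: "(real^'n::finite \<Rightarrow> complex) set" where
  "test_functions = {\<phi>. smooth \<phi> \<and> compact (closure {x. \<phi> x \<noteq> 0})}"


subsection \<open>Lebesgue spaces\<close>

definition Lp :: "ennreal \<Rightarrow> (real^'n::finite \<Rightarrow> complex) set" where
  "Lp p = {f \<in> borel_measurable lborel.
     if p = \<infinity> then esssup lborel (\<lambda>x. ereal (norm (f x))) < \<infinity>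
     else integrable lborel (\<lambda>x. norm (f x) powr enn2real p)}"

definition Lp_norm :: "ennreal \<Rightarrow> (real^'n::finite \<Rightarrow> complex) \<Rightarrow> real" where
  "Lp_norm p f =
     (if p = \<infinity> then real_of_ereal (esssup lborel (\<lambda>x. ereal (norm (f x))))
      else (\<integral>x. norm (f x) powr enn2real p \<partial>lborel) powr (1 / enn2real p))"

definition conj_exponent :: "ennreal \<Rightarrow> ennreal" where
  "conj_exponent q = inverse (1 - inverse q)"

lemma conj_exponent:
  assumes "1 \<le> q"
  shows "inverse (conj_exponent q) + inverse q = 1"
proof -
  have "inverse q \<le> 1 \<and> inverse (inverse (1 - inverse q)) = 1 - inverse q"
  proof (cases q)
    case (real r)
    then have r: "1 \<le> r" using assms by simp
    then have iq: "inverse q = ennreal (inverse r)" using real by (simp add: inverse_ennreal)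
    have le: "inverse q \<le> 1" using r by (simp add: iq inverse_le_1_iff)
    have d: "1 - inverse q = ennreal (1 - inverse r)"
      using r ennreal_minus[of "inverse r" 1] by (simp add: iq)
    have "inverse (inverse (1 - inverse q)) = 1 - inverse q"
    proof (cases "r = 1")
      case True
      then show ?thesis by (simp add: d)
    next
      case False
      then have "0 < 1 - inverse r" using r by (simp add: field_simps)
      then show ?thesis by (simp only: d inverse_ennreal positive_imp_inverse_positive inverse_inverse_eq)
    qed
    with le show ?thesis by simp
  qed simp_all
  then show ?thesis
    unfolding conj_exponent_def by (simp add: diff_add_cancel_ennreal)
qed


subsection \<open>The spaces \<open>D_Lp\<close>, their subspace of functions vanishing at infinity, and the duals\<close>

definition D_L :: "ennreal \<Rightarrow> (real^'n::finite \<Rightarrow> complex) set" where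
  "D_L p = {\<phi>. smooth \<phi> \<and> (\<forall>\<alpha>. partial_derivs \<alpha> \<phi> \<in> Lp p)}"

definition D_L_seminorm :: "ennreal \<Rightarrow> nat \<Rightarrow> (real^'n::finite \<Rightarrow> complex) \<Rightarrow> real" where
  "D_L_seminorm p m \<phi> = (SUP \<alpha>\<in>{\<alpha>. length \<alpha> \<le> m}. Lp_norm p (partial_derivs \<alpha> \<phi>))"

definition B_dot :: "(real^'n::finite \<Rightarrow> complex) set" where
  "B_dot = {\<phi> \<in> D_L \<infinity>. \<forall>\<alpha>. (partial_derivs \<alpha> \<phi> \<longlongrightarrow> 0) at_infinity}"

text \<open>The space whose strong dual is \<open>D'_Lq\<close>.\<close>

definition predual :: "ennreal \<Rightarrow> (real^'n::finite \<Rightarrow> complex) set" where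
  "predual q = (if q = 1 then B_dot else D_L (conj_exponent q))"

definition D'_L :: "ennreal \<Rightarrow> ((real^'n::finite \<Rightarrow> complex) \<Rightarrow> complex) set" where
  "D'_L q = dual_space (predual q) (range (D_L_seminorm (conj_exponent q)))"

definition D'_L_topology :: "ennreal \<Rightarrow> ((real^'n::finite \<Rightarrow> complex) \<Rightarrow> complex) topology" where
  "D'_L_topology q = strong_dual_topology (predual q) (range (D_L_seminorm (conj_exponent q)))"


subsection \<open>\<open>L^q\<close> as a space of distributions\<close>

definition pairing :: "(real^'n::finite \<Rightarrow> complex) \<Rightarrow> (real^'n \<Rightarrow> complex) \<Rightarrow> complex" where
  "pairing g \<phi> = (\<integral>x. g x * \<phi> x \<partial>lborel)"

definition regular_distribution ::
    "(real^'n::finite \<Rightarrow> complex) \<Rightarrow> (real^'n \<Rightarrow> complex) \<Rightarrow> complex" where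
  "regular_distribution g \<phi> = (if \<phi> \<in> test_functions then pairing g \<phi> else 0)"

text \<open>
  Identifying \<open>g\<close> with its regular distribution amounts to identifying functions that agree
  almost everywhere. All representatives of \<open>T\<close> have the same norm, so the infimum
  below is just the norm of any of them.
\<close>

definition L_dist :: "ennreal \<Rightarrow> ((real^'n::finite \<Rightarrow> complex) \<Rightarrow> complex) set" where
  "L_dist q = regular_distribution ` Lp q"

definition L_dist_norm :: "ennreal \<Rightarrow> ((real^'n::finite \<Rightarrow> complex) \<Rightarrow> complex) \<Rightarrow> real" where
  "L_dist_norm q T = (INF g\<in>{g \<in> Lp q. regular_distribution g = T}. Lp_norm q g)"

definition L_dist_topology :: "ennreal \<Rightarrow> ((real^'n::finite \<Rightarrow> complex) \<Rightarrow> complex) topology" where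
  "L_dist_topology q = seminorm_topology (L_dist q) {L_dist_norm q}"


subsection \<open>Bessel kernels and convolution\<close>

definition fourier :: "(real^'n::finite \<Rightarrow> complex) \<Rightarrow> real^'n \<Rightarrow> complex" where
  "fourier \<phi> y = (\<integral>x. exp (- \<i> * complex_of_real (y \<bullet> x)) * \<phi> x \<partial>lborel)"

definition inverse_fourier :: "(real^'n::finite \<Rightarrow> complex) \<Rightarrow> real^'n \<Rightarrow> complex" where
  "inverse_fourier \<phi> y = fourier \<phi> (- y) / complex_of_real ((2 * pi) ^ CARD('n))"

text \<open>The inverse Fourier transform of a temperate distribution, by transposition.\<close>

definition inverse_fourier_dist ::
    "((real^'n::finite \<Rightarrow> complex) \<Rightarrow> complex) \<Rightarrow> (real^'n \<Rightarrow> complex) \<Rightarrow> complex" where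
  "inverse_fourier_dist T \<phi> = T (inverse_fourier \<phi>)"

text \<open>
  The values of the Bessel kernel are meaningful on Schwartz functions; only its values on
  test functions are used below.
\<close>

definition bessel_kernel :: "real \<Rightarrow> (real^'n::finite \<Rightarrow> complex) \<Rightarrow> complex" where
  "bessel_kernel s = inverse_fourier_dist
     (pairing (\<lambda>x. complex_of_real ((1 + (norm x)\<^sup>2) powr (- s / 2))))"

text \<open>
  \<open>\<langle>L * S, \<phi>\<rangle> = \<langle>S\<^sub>x, \<langle>L\<^sub>y, \<phi> (x + y)\<rangle>\<rangle>\<close>. For \<open>L\<close> a Bessel kernel and \<open>\<phi>\<close> a test function the inner
  function of \<open>x\<close> has all its derivatives in every \<open>L\<^sup>p\<close> and vanishing at infinity, hence
  belongs to \<open>predual q\<close> for each \<open>q \<ge> 1\<close>.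
\<close>

definition convolution ::
    "((real^'n::finite \<Rightarrow> complex) \<Rightarrow> complex) \<Rightarrow> ((real^'n \<Rightarrow> complex) \<Rightarrow> complex) \<Rightarrow>
     (real^'n \<Rightarrow> complex) \<Rightarrow> complex" where
  "convolution L S \<phi> =
     (if \<phi> \<in> test_functions then S (\<lambda>x. L (\<lambda>y. \<phi> (x + y))) else 0)"

end

theory Submission
  imports
    "HOL-Probability.Characteristic_Functions"
    "HOL-Probability.Sinc_Integral"
    Defs
begin

text \<open>
  The Bessel kernel \<open>L\<^bsub>2m\<^esub>\<close> is a superposition of heat kernels with weight \<open>t\<^bsup>m-1\<^esup>e\<^bsup>-t\<^esup>/(m-1)!\<close>,
  and convolution with it is inverse to \<open>(1 - \<Delta>)\<^sup>m\<close>. By Hoelder's inequality \<open>(1 - \<Delta>)\<^sup>m\<close> maps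
  \<open>L\<^sup>q\<close> continuously into \<open>D'_Lq\<close>, which gives one direction.

  Conversely, a compact \<open>C\<close> is strongly bounded, hence equicontinuous: \<open>\<bar>S \<phi>\<bar> \<le> c p\<^sub>K(\<phi>)\<close> for one
  seminorm \<open>p\<^sub>K\<close> of the predual and all \<open>S \<in> C\<close>. For large \<open>m\<close> split the superposition at a small
  time \<open>\<tau>\<close>. The part with \<open>t \<le> \<tau>\<close> maps \<open>\<phi>\<close> to a function whose \<open>p\<^sub>K\<close>-seminorm is at most a small
  multiple of \<open>\<parallel>\<phi>\<parallel>\<^sub>p\<close>, and the part with \<open>t > \<tau>\<close> maps the unit ball of \<open>L\<^sup>p\<close> into a bounded subset
  of the predual. Since the norm of \<open>L\<^sup>q\<close> is the dual norm on test functions, convolution with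
  \<open>L\<^bsub>2m\<^esub>\<close> is therefore continuous from \<open>C\<close>, with the strong topology, to \<open>L\<^sup>q\<close>. A representative of
  \<open>L\<^bsub>2m\<^esub> * S\<close> in \<open>L\<^sup>q\<close> is the locally uniform limit, as \<open>\<tau>\<close> tends to 0, of \<open>S\<close> applied to translates of the
  kernel truncated to \<open>t > \<tau>\<close>.
\<close>

section \<open>Smooth functions\<close>

text \<open>For q = 1 a functional bounded in the supremum norm on test functions need only be a
  measure, so a representative in L^q cannot be read off from duality. It is constructed first as a
  continuous function; for continuous functions the converse of Hoelder's inequality is proved by
  explicit extremal functions, for q = 1 and q > 1 alike. The time splitting is forced by the strong
  topology, which controls functionals only on bounded sets. With the full kernel, the image of the
  unit ball of L^p is controlled only in seminorms of limited order and need not be bounded in the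
  predual; away from t = 0 all orders are controlled. The order of the kernel is found by counting
  powers of t. Each derivative moved onto a heat kernel costs t^(-1/2), and its normalisation costs
  t^(-n/2). The weight t^k exp (-t) / k! with k = m - 1 absorbs j such square roots if j \<le> k, by
  the crude estimate t \<le> sqrt (2 * t) for t \<le> 1. With at most K derivatives and the n roots
  of the normalisation, k = n + K suffices.\<close>

lemma partial_derivs_Nil [simp]: "partial_derivs [] f = f"
  by (simp add: partial_derivs_def)

lemma partial_derivs_Cons [simp]:
  "partial_derivs (i # \<alpha>) f = partial_deriv i (partial_derivs \<alpha> f)"
  by (simp add: partial_derivs_def)

lemma partial_derivs_append: "partial_derivs (\<alpha> @ \<beta>) f = partial_derivs \<alpha> (partial_derivs \<beta> f)"
  by (simp add: partial_derivs_def)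

lemma smooth_differentiable: "smooth f \<Longrightarrow> f differentiable (at x)"
  unfolding smooth_def by (metis partial_derivs_Nil)

lemma smooth_partial_derivs [intro, simp]: "smooth f \<Longrightarrow> smooth (partial_derivs \<alpha> f)"
  unfolding smooth_def by (simp flip: partial_derivs_append)

lemma smooth_partial_deriv [intro, simp]: "smooth f \<Longrightarrow> smooth (partial_deriv i f)"
  using smooth_partial_derivs[of f "[i]"] by simp

text \<open>Smoothness is a greatest fixed point: a class of differentiable functions closed under
  \<open>partial_deriv\<close> contains all iterated derivatives of its members. This is applied to
  polynomials, exponentials and bumps, without a formula for the general derivative.\<close>

lemma smooth_coinduct:
  assumes "f \<in> W"
    and "\<And>g x. g \<in> W \<Longrightarrow> g differentiable (at x)"
    and "\<And>g i. g \<in> W \<Longrightarrow> partial_deriv i g \<in> W"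
  shows "smooth f"
proof -
  have "partial_derivs \<alpha> f \<in> W" for \<alpha>
    by (induction \<alpha>) (use assms in auto)
  with assms(2) show ?thesis
    unfolding smooth_def by blast
qed

lemma partial_derivI:
  "(f has_derivative D) (at x) \<Longrightarrow> partial_deriv i f x = D (axis i 1)"
  unfolding partial_deriv_def by (metis frechet_derivative_at)

lemma has_derivative_partial_deriv:
  fixes f :: "real^'n::finite \<Rightarrow> complex"
  assumes "f differentiable (at x)"
  shows "(f has_derivative (\<lambda>v. \<Sum>i\<in>UNIV. v $ i *\<^sub>R partial_deriv i f x)) (at x)"
proof -
  obtain D where D: "(f has_derivative D) (at x)"
    using assms unfolding differentiable_def by blast
  then have lin: "linear D"
    by (simp add: has_derivative_linear)
  have "D v = (\<Sum>i\<in>UNIV. v $ i *\<^sub>R partial_deriv i f x)" for v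
  proof -
    have "v = (\<Sum>i\<in>UNIV. v $ i *\<^sub>R axis i 1)"
      by (simp add: vec_eq_iff axis_def if_distrib cong: if_cong)
    then have "D v = (\<Sum>i\<in>UNIV. v $ i *\<^sub>R D (axis i 1))"
      by (metis (no_types, lifting) lin linear_sum linear_cmul sum.cong)
    then show ?thesis
      by (simp add: partial_derivI[OF D])
  qed
  then show ?thesis using D by presburger
qed

lemma has_derivative_smooth:
  "smooth f \<Longrightarrow> (f has_derivative (\<lambda>v. \<Sum>i\<in>UNIV. v $ i *\<^sub>R partial_deriv i f x)) (at x)"
  by (intro has_derivative_partial_deriv smooth_differentiable)

lemma smooth_isCont: "smooth f \<Longrightarrow> isCont f x"
  by (intro differentiable_imp_continuous_within smooth_differentiable)

lemma smooth_continuous_on: "smooth f \<Longrightarrow> continuous_on A f"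
  by (intro continuous_at_imp_continuous_on ballI smooth_isCont)

lemma smooth_borel_measurable [intro]: "smooth f \<Longrightarrow> f \<in> borel_measurable borel"
  by (intro borel_measurable_continuous_onI smooth_continuous_on)

lemma continuous_on_partial_derivs: "smooth f \<Longrightarrow> continuous_on A (partial_derivs \<alpha> f)"
  by (intro smooth_continuous_on smooth_partial_derivs)

lemma borel_measurable_partial_derivs [intro]:
  "smooth f \<Longrightarrow> partial_derivs \<alpha> f \<in> borel_measurable borel"
  by (intro smooth_borel_measurable smooth_partial_derivs)

lemma partial_deriv_const [simp]: "partial_deriv i (\<lambda>x. c) = (\<lambda>x. 0)"
  by (rule ext, subst partial_derivI) (auto intro!: derivative_eq_intros)

lemma partial_deriv_add:
  assumes "f differentiable (at x)" "g differentiable (at x)"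
  shows "partial_deriv i (\<lambda>x. f x + g x) x = partial_deriv i f x + partial_deriv i g x"
  by (subst partial_derivI[OF has_derivative_add[OF
        has_derivative_partial_deriv[OF assms(1)] has_derivative_partial_deriv[OF assms(2)]]])
     (simp add: axis_def if_distrib[of "\<lambda>t. t *\<^sub>R _"] cong: if_cong)

lemma partial_deriv_mult:
  assumes "f differentiable (at x)" "g differentiable (at x)"
  shows "partial_deriv i (\<lambda>x. f x * g x) x = partial_deriv i f x * g x + f x * partial_deriv i g x"
  by (subst partial_derivI[OF has_derivative_mult[OF
        has_derivative_partial_deriv[OF assms(1)] has_derivative_partial_deriv[OF assms(2)]]])
     (simp add: axis_def if_distrib[of "\<lambda>t. t *\<^sub>R _"] cong: if_cong)

lemma partial_deriv_cmult:
  assumes "f differentiable (at x)"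
  shows "partial_deriv i (\<lambda>x. c * f x) x = c * partial_deriv i f x"
  using partial_deriv_mult[of "\<lambda>_. c" x f i] assms by simp

lemma smooth_const [intro, simp]: "smooth (\<lambda>x. c)"
  by (rule smooth_coinduct[of _ "range (\<lambda>c x. c)"]) auto

lemma partial_derivs_add:
  assumes "smooth f" "smooth g"
  shows "partial_derivs \<alpha> (\<lambda>x. f x + g x) = (\<lambda>x. partial_derivs \<alpha> f x + partial_derivs \<alpha> g x)"
proof (induction \<alpha>)
  case (Cons i \<alpha>)
  show ?case
    unfolding partial_derivs_Cons Cons.IH
    by (intro ext partial_deriv_add smooth_differentiable smooth_partial_derivs assms)
qed simp

lemma smooth_add [intro]:
  assumes "smooth f" "smooth g" shows "smooth (\<lambda>x. f x + g x)"
  unfolding smooth_def partial_derivs_add[OF assms]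
  by (intro allI differentiable_add smooth_differentiable smooth_partial_derivs assms)

lemma partial_derivs_cmult:
  assumes "smooth f"
  shows "partial_derivs \<alpha> (\<lambda>x. c * f x) = (\<lambda>x. c * partial_derivs \<alpha> f x)"
proof (induction \<alpha>)
  case (Cons i \<alpha>)
  show ?case
    unfolding partial_derivs_Cons Cons.IH
    by (intro ext partial_deriv_cmult smooth_differentiable smooth_partial_derivs assms)
qed simp

lemma smooth_cmult [intro]:
  assumes "smooth f" shows "smooth (\<lambda>x. c * f x)"
  unfolding smooth_def partial_derivs_cmult[OF assms]
  by (intro allI differentiable_mult differentiable_const smooth_differentiable smooth_partial_derivs assms)

lemma partial_derivs_diff:
  assumes "smooth f" "smooth g"
  shows "partial_derivs \<alpha> (\<lambda>x. f x - g x) = (\<lambda>x. partial_derivs \<alpha> f x - partial_derivs \<alpha> g x)"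
  using partial_derivs_add[OF assms(1) smooth_cmult[OF assms(2), of "-1"], of \<alpha>]
    partial_derivs_cmult[OF assms(2), of \<alpha> "-1"] by simp

lemma smooth_diff [intro]:
  assumes "smooth f" "smooth g" shows "smooth (\<lambda>x. f x - g x)"
  using smooth_add[OF assms(1) smooth_cmult[OF assms(2), of "-1"]] by simp

lemma smooth_sum [intro]:
  "(\<And>i. i \<in> I \<Longrightarrow> smooth (f i)) \<Longrightarrow> smooth (\<lambda>x. \<Sum>i\<in>I. f i x)"
  by (induction I rule: infinite_finite_induct) auto

section \<open>Derivatives of affine substitutions\<close>

lemma has_derivative_affine:
  fixes f :: "real^'n::finite \<Rightarrow> complex"
  assumes "f differentiable (at (c *\<^sub>R x + a))"
  shows "((\<lambda>x. f (c *\<^sub>R x + a)) has_derivative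
           (\<lambda>v. \<Sum>i\<in>UNIV. (c * v $ i) *\<^sub>R partial_deriv i f (c *\<^sub>R x + a))) (at x)"
proof -
  have "((\<lambda>x. c *\<^sub>R x + a) has_derivative (\<lambda>v. c *\<^sub>R v)) (at x)"
    by (auto intro!: derivative_eq_intros)
  from has_derivative_compose[OF this has_derivative_partial_deriv[OF assms]]
  show ?thesis by (simp add: o_def)
qed

lemma partial_deriv_affine:
  assumes "f differentiable (at (c *\<^sub>R x + a))"
  shows "partial_deriv i (\<lambda>x. f (c *\<^sub>R x + a)) x = of_real c * partial_deriv i f (c *\<^sub>R x + a)"
  by (subst partial_derivI[OF has_derivative_affine[OF assms]])
     (simp add: axis_def if_distrib[of "\<lambda>t. c * t"] if_distrib[of "\<lambda>t. t *\<^sub>R _"] cong: if_cong,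
      simp add: scaleR_conv_of_real)

lemma partial_derivs_affine:
  assumes "smooth f"
  shows "partial_derivs \<alpha> (\<lambda>x. f (c *\<^sub>R x + a)) =
         (\<lambda>x. of_real c ^ length \<alpha> * partial_derivs \<alpha> f (c *\<^sub>R x + a))"
proof (induction \<alpha>)
  case (Cons i \<alpha>)
  have d: "(\<lambda>x. partial_derivs \<alpha> f (c *\<^sub>R x + a)) differentiable (at x)" for x
    using has_derivative_affine[OF smooth_differentiable[OF smooth_partial_derivs[OF assms]]]
    unfolding differentiable_def by blast
  show ?case
    using assms d by (simp add: Cons fun_eq_iff partial_deriv_cmult partial_deriv_affine smooth_differentiable)
qed simp

lemma smooth_affine [intro]:
  assumes "smooth f" shows "smooth (\<lambda>x. f (c *\<^sub>R x + a))"
  unfolding smooth_def partial_derivs_affine[OF assms]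
proof (intro allI differentiable_mult differentiable_const)
  fix \<alpha> x
  show "(\<lambda>x. partial_derivs \<alpha> f (c *\<^sub>R x + a)) differentiable (at x)"
    using has_derivative_affine[OF smooth_differentiable[OF smooth_partial_derivs[OF assms]]]
    unfolding differentiable_def by blast
qed

lemma smooth_translate [intro]: "smooth f \<Longrightarrow> smooth (\<lambda>x. f (x + a))"
  using smooth_affine[of f 1 a] by simp

lemma partial_derivs_translate:
  "smooth f \<Longrightarrow> partial_derivs \<alpha> (\<lambda>x. f (x + a)) = (\<lambda>x. partial_derivs \<alpha> f (x + a))"
  using partial_derivs_affine[of f \<alpha> 1 a] by simp

section \<open>The Leibniz rule for derivatives indexed by lists\<close>

fun splits :: "'a list \<Rightarrow> ('a list \<times> 'a list) list" where
  "splits [] = [([], [])]"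
| "splits (i # \<alpha>) =
     map (\<lambda>(\<beta>, \<gamma>). (i # \<beta>, \<gamma>)) (splits \<alpha>) @ map (\<lambda>(\<beta>, \<gamma>). (\<beta>, i # \<gamma>)) (splits \<alpha>)"

text \<open>Isolates the only term of the Leibniz sum without a derivative on the first factor. When
  that factor is a dilated cutoff, all other terms carry a small factor.\<close>

lemma splits_Nil_fst:
  "\<exists>xs. splits \<alpha> = xs @ [([], \<alpha>)] \<and> (\<forall>(\<beta>, \<gamma>)\<in>set xs. \<beta> \<noteq> [])"
proof (induction \<alpha>)
  case (Cons i \<alpha>)
  then obtain xs where xs: "splits \<alpha> = xs @ [([], \<alpha>)]" "\<forall>(\<beta>, \<gamma>)\<in>set xs. \<beta> \<noteq> []" by blast
  show ?case
    by (rule exI[of _ "map (\<lambda>(\<beta>, \<gamma>). (i # \<beta>, \<gamma>)) (splits \<alpha>) @ map (\<lambda>(\<beta>, \<gamma>). (\<beta>, i # \<gamma>)) xs"])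
       (use xs in auto)
qed simp

lemma sum_list_differentiable:
  fixes f :: "'b \<Rightarrow> real^'n::finite \<Rightarrow> complex"
  assumes "\<And>s. s \<in> set xs \<Longrightarrow> f s differentiable (at x)"
  shows "(\<lambda>x. \<Sum>s\<leftarrow>xs. f s x) differentiable (at x)"
    and "partial_deriv i (\<lambda>x. \<Sum>s\<leftarrow>xs. f s x) x = (\<Sum>s\<leftarrow>xs. partial_deriv i (f s) x)"
proof -
  have "(\<lambda>x. \<Sum>s\<leftarrow>xs. f s x) differentiable (at x) \<and>
    partial_deriv i (\<lambda>x. \<Sum>s\<leftarrow>xs. f s x) x = (\<Sum>s\<leftarrow>xs. partial_deriv i (f s) x)"
    using assms by (induction xs) (auto simp: partial_deriv_add intro!: differentiable_add)
  then show "(\<lambda>x. \<Sum>s\<leftarrow>xs. f s x) differentiable (at x)"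
    and "partial_deriv i (\<lambda>x. \<Sum>s\<leftarrow>xs. f s x) x = (\<Sum>s\<leftarrow>xs. partial_deriv i (f s) x)" by auto
qed

lemma sum_list_add: "(\<Sum>s\<leftarrow>xs. f s + g s) = (\<Sum>s\<leftarrow>xs. f s) + (\<Sum>s\<leftarrow>xs. (g s :: 'b::comm_monoid_add))"
  by (induction xs) (auto simp: algebra_simps)

text \<open>\<open>splits\<close> enumerates, with multiplicity, the ways of sending each entry of
  \<alpha> to one of the two factors. Hence no binomial coefficients occur and each induction step
  is the ordinary product rule.\<close>

lemma Leibniz_partial_derivs:
  assumes "smooth f" "smooth g"
  shows "partial_derivs \<alpha> (\<lambda>x. f x * g x) =
    (\<lambda>x. \<Sum>s\<leftarrow>splits \<alpha>. partial_derivs (fst s) f x * partial_derivs (snd s) g x)"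
proof (induction \<alpha>)
  case (Cons i \<alpha>)
  have d: "(\<lambda>x. partial_derivs \<beta> f x * partial_derivs \<gamma> g x) differentiable (at x)" for x \<beta> \<gamma>
    using assms by (intro differentiable_mult) (auto intro: smooth_differentiable)
  show ?case
    using assms d
    by (simp add: Cons fun_eq_iff sum_list_differentiable(2) partial_deriv_mult smooth_differentiable
      sum_list_add o_def case_prod_beta)
qed simp

lemma smooth_mult [intro]:
  assumes "smooth f" "smooth g" shows "smooth (\<lambda>x. f x * g x)"
  unfolding smooth_def Leibniz_partial_derivs[OF assms]
  using assms by (intro allI sum_list_differentiable(1) differentiable_mult) (auto intro: smooth_differentiable)

section \<open>Decaying functions and their integrals\<close>

lemma norm_sum_partial_deriv_le:
  fixes v :: "real^'n::finite"
  assumes "\<And>i. norm (d i :: complex) \<le> B"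
  shows "norm (\<Sum>i\<in>UNIV. v $ i *\<^sub>R d i) \<le> real CARD('n) * B * norm v"
proof -
  have "norm (v $ i *\<^sub>R d i) \<le> B * norm v" for i
    using assms[of i] component_le_norm_cart[of v i]
    by (simp add: mult.commute) (metis abs_ge_zero mult_mono norm_ge_zero order_trans)
  then have "norm (\<Sum>i\<in>UNIV. v $ i *\<^sub>R d i) \<le> (\<Sum>i\<in>(UNIV::'n set). B * norm v)"
    by (intro sum_norm_le) auto
  then show ?thesis by simp
qed

lemma norm_diff_le_partial_deriv:
  fixes f :: "real^'n::finite \<Rightarrow> complex"
  assumes "\<And>z. z \<in> closed_segment x y \<Longrightarrow> f differentiable (at z)"
    and "\<And>i z. z \<in> closed_segment x y \<Longrightarrow> norm (partial_deriv i f z) \<le> B"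
  shows "norm (f y - f x) \<le> real CARD('n) * B * norm (y - x)"
proof -
  let ?S = "closed_segment x y"
  let ?D = "\<lambda>z v. \<Sum>i\<in>UNIV. v $ i *\<^sub>R partial_deriv i f z"
  have 1: "(f has_derivative ?D z) (at z within ?S)" if "z \<in> ?S" for z
    by (rule has_derivative_at_withinI, rule has_derivative_partial_deriv) (rule assms(1)[OF that])
  have 2: "onorm (?D z) \<le> real CARD('n) * B" if "z \<in> ?S" for z
    by (rule onorm_le) (rule norm_sum_partial_deriv_le, rule assms(2)[OF that])
  show ?thesis
    by (rule differentiable_bound[OF convex_closed_segment 1 2]) (simp_all add: ends_in_segment)
qed

lemma integrable_norm_bound:
  fixes f :: "'w \<Rightarrow> 'b::{banach,second_countable_topology}"
  assumes "integrable M B" "f \<in> borel_measurable M" "\<And>w. w \<in> space M \<Longrightarrow> norm (f w) \<le> B w"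
  shows "integrable M f"
proof (rule Bochner_Integration.integrable_bound[OF assms(1,2)], rule AE_I2)
  fix w assume "w \<in> space M"
  from assms(3)[OF this] show "norm (f w) \<le> norm (B w)" by simp
qed

text \<open>Dominated convergence for the first-order remainder divided by the length of the
  increment. By the mean value inequality the difference of the values and the linear part each
  contribute at most \<open>?n * B w\<close>, hence the dominating function
  \<open>2 * ?n * B w\<close>.\<close>

lemma has_derivative_integral:
  fixes g :: "real^'n::finite \<Rightarrow> 'w \<Rightarrow> complex"
  assumes diff: "\<And>w x. w \<in> space M \<Longrightarrow> (\<lambda>x. g x w) differentiable (at x)"
    and int: "\<And>x. integrable M (g x)"
    and meas: "\<And>i x. (\<lambda>w. partial_deriv i (\<lambda>x. g x w) x) \<in> borel_measurable M"
    and B: "integrable M B" "\<And>i x w. w \<in> space M \<Longrightarrow> norm (partial_deriv i (\<lambda>x. g x w) x) \<le> B w"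
  shows "((\<lambda>x. \<integral>w. g x w \<partial>M) has_derivative
          (\<lambda>v. \<Sum>i\<in>UNIV. v $ i *\<^sub>R (\<integral>w. partial_deriv i (\<lambda>x. g x w) x \<partial>M))) (at x)"
proof -
  let ?d = "\<lambda>i w. partial_deriv i (\<lambda>x. g x w) x"
  let ?D = "\<lambda>v. \<Sum>i\<in>UNIV. v $ i *\<^sub>R (\<integral>w. ?d i w \<partial>M)"
  let ?n = "real CARD('n)"
  have intd: "integrable M (?d i)" for i
    by (rule integrable_norm_bound[OF B(1) meas]) (use B(2) in auto)
  have "bounded_linear ?D"
    by (intro bounded_linear_sum bounded_linear_compose[OF bounded_linear_scaleR_left]
        bounded_linear_vec_nth)
  moreover have "((\<lambda>y. ((\<integral>w. g y w \<partial>M) - (\<integral>w. g x w \<partial>M) - ?D (y - x)) /\<^sub>R norm (y - x)) \<longlongrightarrow> 0) (at x)"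
    unfolding tendsto_at_iff_sequentially o_def
  proof (intro allI impI)
    fix X :: "nat \<Rightarrow> real^'n" assume X: "\<forall>i. X i \<in> UNIV - {x}" "X \<longlonglongrightarrow> x"
    define s where "s k w = (g (X k) w - g x w - (\<Sum>i\<in>UNIV. (X k - x) $ i *\<^sub>R ?d i w)) /\<^sub>R norm (X k - x)"
      for k w
    have s_int: "integrable M (s k)" for k
      unfolding s_def using int intd by (intro integrable_scaleR_right Bochner_Integration.integrable_diff Bochner_Integration.integrable_sum) auto
    have "(\<lambda>k. \<integral>w. s k w \<partial>M) \<longlonglongrightarrow> (\<integral>w. 0 \<partial>M)"
    proof (rule integral_dominated_convergence[where w = "\<lambda>w. 2 * ?n * B w"])
      show "AE w in M. (\<lambda>k. s k w) \<longlonglongrightarrow> 0"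
      proof (rule AE_I2)
        fix w assume w: "w \<in> space M"
        have "((\<lambda>y. (g y w - g x w - (\<Sum>i\<in>UNIV. (y - x) $ i *\<^sub>R ?d i w)) /\<^sub>R norm (y - x)) \<longlongrightarrow> 0) (at x)"
          using has_derivative_partial_deriv[OF diff[OF w, of x]] unfolding has_derivative_def
          by (simp add: has_derivative_at_within)
        with X show "(\<lambda>k. s k w) \<longlonglongrightarrow> 0"
          unfolding tendsto_at_iff_sequentially s_def o_def by blast
      qed
      show "AE w in M. norm (s k w) \<le> 2 * ?n * B w" for k
      proof (rule AE_I2)
        fix w assume w: "w \<in> space M"
        have 1: "norm (g (X k) w - g x w) \<le> ?n * B w * norm (X k - x)"
          by (rule norm_diff_le_partial_deriv) (use diff B w in auto)
        have 2: "norm (\<Sum>i\<in>UNIV. (X k - x) $ i *\<^sub>R ?d i w) \<le> ?n * B w * norm (X k - x)"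
          by (rule norm_sum_partial_deriv_le) (use B w in auto)
        have "norm (X k - x) > 0" using X by auto
        then show "norm (s k w) \<le> 2 * ?n * B w"
          unfolding s_def using norm_triangle_ineq4[of "g (X k) w - g x w" "\<Sum>i\<in>UNIV. (X k - x) $ i *\<^sub>R ?d i w"] 1 2
          by (simp add: divide_simps mult.commute)
      qed
    qed (use s_int B in auto)
    moreover have "(\<integral>w. s k w \<partial>M) = ((\<integral>w. g (X k) w \<partial>M) - (\<integral>w. g x w \<partial>M) - ?D (X k - x)) /\<^sub>R norm (X k - x)" for k
    proof -
      have "(\<integral>w. (\<Sum>i\<in>UNIV. (X k - x) $ i *\<^sub>R ?d i w) \<partial>M) = ?D (X k - x)"
        by (subst Bochner_Integration.integral_sum) (use intd in auto)
      moreover have "integrable M (\<lambda>w. \<Sum>i\<in>UNIV. (X k - x) $ i *\<^sub>R ?d i w)"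
        using intd by auto
      ultimately show ?thesis
        unfolding s_def using int by simp
    qed
    ultimately show "(\<lambda>k. ((\<integral>w. g (X k) w \<partial>M) - (\<integral>w. g x w \<partial>M) - ?D (X k - x)) /\<^sub>R norm (X k - x)) \<longlonglongrightarrow> 0"
      by simp
  qed
  ultimately show ?thesis
    unfolding has_derivative_def by (simp add: has_derivative_at_within)
qed

lemma
  fixes f :: "real^'n::finite \<Rightarrow> 'w \<Rightarrow> complex"
  assumes sm: "\<And>w. w \<in> space M \<Longrightarrow> smooth (\<lambda>x. f x w)"
    and meas: "\<And>\<alpha> x. (\<lambda>w. partial_derivs \<alpha> (\<lambda>x. f x w) x) \<in> borel_measurable M"
    and bound: "\<And>\<alpha>. \<exists>B. integrable M B \<and>
      (\<forall>w\<in>space M. \<forall>x. norm (partial_derivs \<alpha> (\<lambda>x. f x w) x) \<le> B w)"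
  shows smooth_integral: "smooth (\<lambda>x. \<integral>w. f x w \<partial>M)"
    and partial_derivs_integral: "partial_derivs \<alpha> (\<lambda>x. \<integral>w. f x w \<partial>M) =
      (\<lambda>x. \<integral>w. partial_derivs \<alpha> (\<lambda>x. f x w) x \<partial>M)"
proof -
  let ?g = "\<lambda>\<alpha> x w. partial_derivs \<alpha> (\<lambda>x. f x w) x"
  have int: "integrable M (?g \<alpha> x)" for \<alpha> x
  proof -
    obtain B where B: "integrable M B" "\<forall>w\<in>space M. \<forall>x. norm (?g \<alpha> x w) \<le> B w"
      using bound by meson
    show ?thesis
      by (rule integrable_norm_bound[OF B(1) meas]) (use B(2) in auto)
  qed
  have der: "((\<lambda>x. \<integral>w. ?g \<alpha> x w \<partial>M) has_derivative
      (\<lambda>v. \<Sum>i\<in>UNIV. v $ i *\<^sub>R (\<integral>w. ?g (i # \<alpha>) x w \<partial>M))) (at x)" for \<alpha> x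
  proof -
    have "\<forall>i. \<exists>B. integrable M B \<and> (\<forall>w\<in>space M. \<forall>x. norm (?g (i # \<alpha>) x w) \<le> B w)"
      using bound by blast
    then obtain B where B: "\<And>i. integrable M (B i)"
      "\<And>i w x. w \<in> space M \<Longrightarrow> norm (?g (i # \<alpha>) x w) \<le> B i w" by metis
    \<comment> \<open>A single dominating function must serve all directions i at once, so the
      finitely many given ones are added.\<close>
    have Bsum: "norm (?g (i # \<alpha>) x w) \<le> (\<Sum>i\<in>UNIV. B i w)" if "w \<in> space M" for i x w
    proof -
      have "0 \<le> B j w" for j using B(2)[OF that] norm_ge_zero order_trans by blast
      then have "B i w \<le> (\<Sum>i\<in>UNIV. B i w)" by (intro member_le_sum) auto
      with B(2)[OF that] show ?thesis using order_trans by blast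
    qed
    show ?thesis
      using has_derivative_integral[of M "?g \<alpha>" "\<lambda>w. \<Sum>i\<in>UNIV. B i w" x]
        meas[of "_ # \<alpha>"] int B(1) Bsum smooth_differentiable[OF smooth_partial_derivs[OF sm]] by simp
  qed
  show eq: "partial_derivs \<alpha> (\<lambda>x. \<integral>w. f x w \<partial>M) = (\<lambda>x. \<integral>w. ?g \<alpha> x w \<partial>M)" for \<alpha>
  proof (induction \<alpha>)
    case (Cons i \<alpha>)
    have "partial_deriv i (\<lambda>x. \<integral>w. ?g \<alpha> x w \<partial>M) x = (\<integral>w. ?g (i # \<alpha>) x w \<partial>M)" for x
      by (subst partial_derivI[OF der])
         (simp add: axis_def if_distrib[of "\<lambda>t. t *\<^sub>R _"] cong: if_cong)
    then show ?case
      by (simp add: Cons)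
  qed simp
  show "smooth (\<lambda>x. \<integral>w. f x w \<partial>M)"
    unfolding smooth_def eq using der differentiable_def by blast
qed

section \<open>A reference weight, and functions decaying at its rate\<close>

definition weight :: "real^'n::finite \<Rightarrow> real" where
  "weight x = inverse ((1 + (norm x)\<^sup>2) ^ CARD('n))"

lemma weight_pos [simp]: "0 < weight x"
  by (simp add: weight_def add_pos_nonneg)

lemma weight_nonneg [simp]: "0 \<le> weight x"
  using weight_pos less_imp_le by blast

lemma weight_le_1: "weight x \<le> 1"
  unfolding weight_def by (rule inverse_le_1_iff[THEN iffD2]) (simp add: one_le_power)

lemma continuous_weight: "continuous_on A weight"
  unfolding weight_def by (intro continuous_intros) (simp add: add_nonneg_eq_0_iff)

lemma borel_measurable_weight [measurable]: "weight \<in> borel_measurable borel"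
  by (intro borel_measurable_continuous_onI continuous_weight)

text \<open>A Peetre-type inequality. For y = c x + a, |c x|^2 \<le> 2 |y|^2 + 2 |a|^2 leads to 1 +
  |x|^2 \<le> 2 (1 + 1/c^2) (1 + |a|^2) (1 + |y|^2). The dependence on c is kept explicit because c
  = 1 / sqrt (2 * t) will later be integrated over t.\<close>

lemma weight_affine:
  fixes x :: "real^'n::finite"
  assumes "c \<noteq> 0"
  shows "weight (c *\<^sub>R x + a) \<le> (2 * (1 + 1 / c\<^sup>2) * (1 + (norm a)\<^sup>2)) ^ CARD('n) * weight x"
proof -
  let ?y = "c *\<^sub>R x + a"
  let ?K = "2 * (1 + 1 / c\<^sup>2) * (1 + (norm a)\<^sup>2)"
  have "norm (c *\<^sub>R x) \<le> norm ?y + norm a"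
    using norm_triangle_ineq4[of ?y a] by simp
  then have "(norm (c *\<^sub>R x))\<^sup>2 \<le> (norm ?y + norm a)\<^sup>2"
    by (intro power_mono) auto
  also have "\<dots> \<le> 2 * (norm ?y)\<^sup>2 + 2 * (norm a)\<^sup>2"
    using sum_squares_bound[of "norm ?y" "norm a"] by (simp add: power2_sum)
  finally have "c\<^sup>2 * (norm x)\<^sup>2 \<le> 2 * (norm ?y)\<^sup>2 + 2 * (norm a)\<^sup>2"
    by (simp add: power_mult_distrib)
  then have le: "(norm x)\<^sup>2 \<le> (1 / c\<^sup>2) * (2 * (norm ?y)\<^sup>2 + 2 * (norm a)\<^sup>2)"
    using assms by (simp add: field_simps)
  have "1 + (norm x)\<^sup>2 \<le> 2 * (1 + (1 / c\<^sup>2)) * ((1 + (norm a)\<^sup>2) * (1 + (norm ?y)\<^sup>2))"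
  proof -
    let ?P = "(1 + (norm a)\<^sup>2) * (1 + (norm ?y)\<^sup>2)"
    have p1: "1 \<le> ?P" "(norm ?y)\<^sup>2 + (norm a)\<^sup>2 \<le> ?P"
      by (simp_all add: algebra_simps)
    have "(1 / c\<^sup>2) * (2 * (norm ?y)\<^sup>2 + 2 * (norm a)\<^sup>2) \<le> (1 / c\<^sup>2) * (2 * ?P)"
      using p1 by (intro mult_left_mono) auto
    with le p1(1) have "1 + (norm x)\<^sup>2 \<le> ?P + (1 / c\<^sup>2) * (2 * ?P)"
      by linarith
    also have "P + r * (2 * P) \<le> 2 * (1 + r) * P" if "1 \<le> P" for P r :: real
      using that by (simp add: algebra_simps)
    from this[OF p1(1)] have "?P + (1 / c\<^sup>2) * (2 * ?P) \<le> 2 * (1 + 1 / c\<^sup>2) * ?P" .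
    finally show ?thesis .
  qed
  then have "(1 + (norm x)\<^sup>2) ^ CARD('n) \<le> (?K * (1 + (norm ?y)\<^sup>2)) ^ CARD('n)"
    by (intro power_mono) (auto simp: mult.assoc)
  then have "(1 + (norm x)\<^sup>2) ^ CARD('n) \<le> ?K ^ CARD('n) * (1 + (norm ?y)\<^sup>2) ^ CARD('n)"
    by (simp only: power_mult_distrib)
  moreover have "0 < (1 + (norm x)\<^sup>2) ^ CARD('n)" "0 < (1 + (norm ?y)\<^sup>2) ^ CARD('n)"
    by (simp_all add: add_pos_nonneg)
  ultimately show ?thesis
    unfolding weight_def by (simp add: field_simps)
qed

lemma weight_translate:
  fixes x :: "real^'n::finite"
  shows "weight (x + a) \<le> (4 * (1 + (norm a)\<^sup>2)) ^ CARD('n) * weight x"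
  using weight_affine[of 1 x a] by simp

lemma tendsto_weight: "(weight \<longlongrightarrow> 0) (at_infinity :: (real^'n::finite) filter)"
proof -
  have "filterlim (\<lambda>x::real^'n. (1 + (norm x)\<^sup>2) ^ CARD('n)) at_top at_infinity"
    by (intro filterlim_pow_at_top filterlim_tendsto_add_at_top[OF tendsto_const]
        filterlim_norm_at_top) auto
  then show ?thesis
    unfolding weight_def by (intro tendsto_inverse_0_at_top)
qed

text \<open>Lebesgue measure is the image of a product measure indexed by \<open>Basis\<close>; the
  proof consists of reindexing the coordinates by \<open>axis i 1\<close>.\<close>

lemma
  fixes f :: "'n::finite \<Rightarrow> real \<Rightarrow> 'b::{real_normed_field,banach,second_countable_topology}"
  assumes f: "\<And>i. integrable lborel (f i)"
  shows integrable_prod_coord: "integrable lborel (\<lambda>x::real^'n. \<Prod>i\<in>UNIV. f i (x $ i))"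
    and integral_prod_coord: "integral\<^sup>L lborel (\<lambda>x::real^'n. \<Prod>i\<in>UNIV. f i (x $ i)) = (\<Prod>i\<in>UNIV. \<integral>t. f i t \<partial>lborel)"
proof -
  interpret product_sigma_finite "\<lambda>b::real^'n. lborel :: real measure" ..
  let ?ax = "\<lambda>i::'n. axis i (1::real)"
  have inj: "inj ?ax" by (auto simp: inj_on_def axis_eq_axis)
  have B: "Basis = range ?ax" by (auto simp: Basis_vec_def)
  define F where "F b = f (inv ?ax b)" for b
  have Fax: "F (?ax i) = f i" for i unfolding F_def by (simp add: inv_f_f[OF inj])
  have eq: "(\<Prod>i\<in>UNIV. f i (x $ i)) = (\<Prod>b\<in>Basis. F b (x \<bullet> b))" for x :: "real^'n"
    unfolding B by (subst prod.reindex[OF inj]) (simp add: Fax cart_eq_inner_axis)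
  have eq2: "(\<Prod>b\<in>Basis. F b ((\<Sum>b\<in>Basis. g b *\<^sub>R b) \<bullet> b)) = (\<Prod>b\<in>Basis. F b (g b))" for g :: "real^'n \<Rightarrow> real"
    by (intro prod.cong refl) simp
  have Fi: "integrable lborel (F b)" for b unfolding F_def by (rule f)
  have Fm: "F b \<in> borel_measurable borel" for b
    using borel_measurable_integrable[OF Fi] by simp
  have meas: "(\<lambda>x. \<Prod>b\<in>Basis. F b (x \<bullet> b)) \<in> borel_measurable (borel :: (real^'n) measure)"
    using Fm by measurable
  have meas2: "(\<lambda>g. \<Sum>b\<in>Basis. g b *\<^sub>R b) \<in> (\<Pi>\<^sub>M b\<in>Basis. lborel) \<rightarrow>\<^sub>M (borel :: (real^'n) measure)"
    by measurable
  show "integrable lborel (\<lambda>x::real^'n. \<Prod>i\<in>UNIV. f i (x $ i))"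
    unfolding eq lborel_eq[where 'a="real^'n"]
    by (subst integrable_distr_eq[OF meas2 meas]) (simp only: eq2, intro product_integrable_prod Fi finite_Basis)
  have "integral\<^sup>L lborel (\<lambda>x::real^'n. \<Prod>i\<in>UNIV. f i (x $ i)) = (\<Prod>b\<in>Basis. \<integral>t. F b t \<partial>lborel)"
    unfolding eq
    by (subst lborel_eq, subst integral_distr[OF meas2 meas]) (simp only: eq2, intro product_integral_prod Fi finite_Basis)
  also have "\<dots> = (\<Prod>i\<in>UNIV. \<integral>t. f i t \<partial>lborel)"
    unfolding B by (subst prod.reindex[OF inj]) (simp add: Fax)
  finally show "integral\<^sup>L lborel (\<lambda>x::real^'n. \<Prod>i\<in>UNIV. f i (x $ i)) = (\<Prod>i\<in>UNIV. \<integral>t. f i t \<partial>lborel)" .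
qed

text \<open>Each factor 1 + (x $ i)^2 is at most 1 + |x|^2, so \<open>weight\<close> is dominated by
  the product of the one-variable functions 1 / (1 + t^2). This explains the exponent n in
  \<open>weight\<close>.\<close>

lemma integrable_weight [simp]: "integrable lborel (weight :: real^'n::finite \<Rightarrow> real)"
proof -
  have 1: "integrable lborel (\<lambda>t::real. inverse (1 + t\<^sup>2))"
    using integrable_inverse_1_plus_square by (simp add: set_integrable_def)
  have "integrable lborel (\<lambda>x::real^'n. \<Prod>i\<in>UNIV. inverse (1 + (x $ i)\<^sup>2))"
    by (rule integrable_prod_coord[OF 1])
  then show ?thesis
  proof (rule Bochner_Integration.integrable_bound)
    show "AE x::real^'n in lborel. norm (weight x) \<le> norm (\<Prod>i\<in>UNIV. inverse (1 + (x $ i)\<^sup>2) :: real)" 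
    proof (rule AE_I2)
      fix x :: "real^'n"
      have "(\<Prod>i\<in>UNIV. 1 + (x $ i)\<^sup>2) \<le> (\<Prod>i\<in>(UNIV::'n set). 1 + (norm x)\<^sup>2)"
        using component_le_norm_cart[of x] by (intro prod_mono) (auto simp: abs_le_square_iff[symmetric])
      then have "(\<Prod>i\<in>UNIV. 1 + (x $ i)\<^sup>2) \<le> (1 + (norm x)\<^sup>2) ^ CARD('n)" by simp
      moreover have "0 < (\<Prod>i\<in>UNIV. 1 + (x $ i)\<^sup>2)"
        by (intro prod_pos) (auto simp: add_pos_nonneg)
      ultimately have "weight x \<le> inverse (\<Prod>i\<in>UNIV. 1 + (x $ i)\<^sup>2)"
        unfolding weight_def by (intro le_imp_inverse_le)
      then show "norm (weight x) \<le> norm (\<Prod>i\<in>UNIV. inverse (1 + (x $ i)\<^sup>2) :: real)"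
        using prod_inversef[of "\<lambda>i. 1 + (x $ i)\<^sup>2" UNIV]
        by (simp add: o_def prod_nonneg)
    qed
  qed auto
qed

lemma integrable_weight_bound:
  fixes f :: "real^'n::finite \<Rightarrow> 'b::{banach,second_countable_topology}"
  assumes "f \<in> borel_measurable borel" "\<And>x. norm (f x) \<le> C * weight x"
  shows "integrable lborel f"
  by (rule integrable_norm_bound[of _ "\<lambda>x. C * weight x"]) (use assms in auto)

text \<open>One fixed rate for all derivatives, weaker than the Schwartz condition. It is enough for
  integration by parts, for all derivatives to lie in every L^p and for them to vanish at infinity;
  and test functions, the Gaussian and the truncated Bessel kernels all satisfy it.\<close>

definition decaying :: "(real^'n::finite \<Rightarrow> complex) \<Rightarrow> bool" where
  "decaying f \<longleftrightarrow> smooth f \<and> (\<forall>\<alpha>. \<exists>C. \<forall>x. norm (partial_derivs \<alpha> f x) \<le> C * weight x)"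

lemma decaying_bound:
  assumes "decaying f"
  shows "\<exists>C>0. \<forall>x. norm (partial_derivs \<alpha> f x) \<le> C * weight x"
proof -
  obtain C where C: "\<And>x. norm (partial_derivs \<alpha> f x) \<le> C * weight x"
    using assms unfolding decaying_def by blast
  have "norm (partial_derivs \<alpha> f x) \<le> (\<bar>C\<bar> + 1) * weight x" for x
    by (rule order_trans[OF C]) (auto intro: mult_right_mono)
  then show ?thesis by (intro exI[of _ "\<bar>C\<bar> + 1"]) auto
qed

lemma decaying_bounded:
  assumes "decaying f"
  shows "\<exists>B>0. \<forall>x. norm (partial_derivs \<alpha> f x) \<le> B"
proof -
  obtain B where B: "B > 0" "\<And>x. norm (partial_derivs \<alpha> f x) \<le> B * weight x"
    using decaying_bound[OF assms] by blast
  have "norm (partial_derivs \<alpha> f x) \<le> B" for x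
  proof -
    have "B * weight x \<le> B * 1" using B(1) by (intro mult_left_mono weight_le_1) auto
    then show ?thesis using B(2)[of x] by linarith
  qed
  with B(1) show ?thesis by blast
qed

lemma decaying_smooth: "decaying f \<Longrightarrow> smooth f"
  by (simp add: decaying_def)

lemma decaying_partial_derivs: "decaying f \<Longrightarrow> decaying (partial_derivs \<alpha> f)"
  by (simp add: decaying_def flip: partial_derivs_append)

lemma decaying_partial_deriv: "decaying f \<Longrightarrow> decaying (partial_deriv i f)"
  using decaying_partial_derivs[of f "[i]"] by simp

lemma decaying_integrable: "decaying f \<Longrightarrow> integrable lborel f"
proof -
  assume f: "decaying f"
  obtain C where "\<And>x. norm (f x) \<le> C * weight x"
    using decaying_bound[OF f, of "[]"] by auto
  then show ?thesis
    by (rule integrable_weight_bound[OF smooth_borel_measurable[OF decaying_smooth[OF f]]])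
qed

lemma decaying_affine:
  assumes f: "decaying f" and "c \<noteq> 0"
  shows "decaying (\<lambda>x. f (c *\<^sub>R x + a))"
  unfolding decaying_def
proof (intro conjI allI)
  fix \<alpha> :: "'a list"
  obtain C where C: "C > 0" "\<And>x. norm (partial_derivs \<alpha> f x) \<le> C * weight x"
    using decaying_bound[OF f] by blast
  let ?K = "(2 * (1 + 1 / c\<^sup>2) * (1 + (norm a)\<^sup>2)) ^ CARD('a)"
  have "norm (partial_derivs \<alpha> (\<lambda>x. f (c *\<^sub>R x + a)) x) \<le> (\<bar>c\<bar> ^ length \<alpha> * C * ?K) * weight x" for x
  proof -
    have "norm (partial_derivs \<alpha> (\<lambda>x. f (c *\<^sub>R x + a)) x) \<le> \<bar>c\<bar> ^ length \<alpha> * (C * weight (c *\<^sub>R x + a))"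
      using C(2)[of "c *\<^sub>R x + a"]
      by (simp add: partial_derivs_affine decaying_smooth[OF f] norm_mult norm_power mult_left_mono)
    also have "\<dots> \<le> \<bar>c\<bar> ^ length \<alpha> * (C * (?K * weight x))"
      by (intro mult_left_mono weight_affine assms) (use C in auto)
    finally show ?thesis by (simp only: mult.assoc)
  qed
  then show "\<exists>C. \<forall>x. norm (partial_derivs \<alpha> (\<lambda>x. f (c *\<^sub>R x + a)) x) \<le> C * weight x" by blast
qed (use f in \<open>auto simp: decaying_def\<close>)

lemma decaying_translate: "decaying f \<Longrightarrow> decaying (\<lambda>x. f (x + a))"
  using decaying_affine[of f 1 a] by simp

lemma norm_sum_list_le:
  fixes F :: "'s \<Rightarrow> 'x \<Rightarrow> complex"
  assumes "\<And>s. s \<in> set xs \<Longrightarrow> \<exists>C. \<forall>x. norm (F s x) \<le> C * W x"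
  shows "\<exists>C. \<forall>x. norm (\<Sum>s\<leftarrow>xs. F s x) \<le> C * W x"
  using assms
proof (induction xs)
  case Nil
  show ?case by (rule exI[of _ 0]) auto
next
  case (Cons s xs)
  obtain C D where "\<And>x. norm (\<Sum>s\<leftarrow>xs. F s x) \<le> C * W x" "\<And>x. norm (F s x) \<le> D * W x"
    using Cons by (metis list.set_intros)
  then have "norm (\<Sum>s\<leftarrow>s # xs. F s x) \<le> (D + C) * W x" for x
    by (simp add: distrib_right) (metis add_mono add.commute norm_triangle_le)
  then show ?case by blast
qed

lemma decaying_mult:
  assumes f: "decaying f" and g: "decaying g"
  shows "decaying (\<lambda>x. f x * g x)"
  unfolding decaying_def Leibniz_partial_derivs[OF decaying_smooth[OF f] decaying_smooth[OF g]]
proof (intro conjI allI norm_sum_list_le)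
  fix \<alpha> and s :: "'a list \<times> 'a list"
  obtain C where C: "C > 0" "\<And>x. norm (partial_derivs (fst s) f x) \<le> C * weight x"
    using decaying_bound[OF f] by blast
  obtain D where D: "D > 0" "\<And>x. norm (partial_derivs (snd s) g x) \<le> D * weight x"
    using decaying_bound[OF g] by blast
  have "norm (partial_derivs (fst s) f x * partial_derivs (snd s) g x) \<le> (C * D) * weight x" for x
  proof -
    have "norm (partial_derivs (fst s) f x * partial_derivs (snd s) g x) \<le> (C * weight x) * (D * 1)"
      unfolding norm_mult
    proof (intro mult_mono C D)
      show "norm (partial_derivs (snd s) g x) \<le> D * 1"
        using D(2)[of x] weight_le_1[of x] D(1) by (meson less_imp_le mult_left_mono order_trans)
    qed (use C in auto)
    then show ?thesis by (simp add: ac_simps)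
  qed
  then show "\<exists>C. \<forall>x. norm (partial_derivs (fst s) f x * partial_derivs (snd s) g x) \<le> C * weight x" by blast
qed (use f g in \<open>auto simp: decaying_def\<close>)

section \<open>Affine change of variables and integration by parts\<close>

lemma
  fixes f :: "real^'n::finite \<Rightarrow> 'b::{banach,second_countable_topology}"
  assumes "c \<noteq> 0"
  shows integrable_affine_iff: "integrable lborel (\<lambda>x. f (c *\<^sub>R x + a)) \<longleftrightarrow> integrable lborel f"
    and integral_affine: "(\<integral>x. f x \<partial>lborel) = \<bar>c\<bar> ^ CARD('n) *\<^sub>R (\<integral>x. f (c *\<^sub>R x + a) \<partial>lborel)"
proof -
  have imp: "integrable lborel (\<lambda>x. f (c *\<^sub>R x + a))" if "integrable lborel f" "c \<noteq> 0" for f :: "real^'n \<Rightarrow> 'b" and c a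
  proof -
    have m: "f \<in> borel_measurable borel" using that(1) by (auto dest: borel_measurable_integrable)
    have "integrable (density (distr lborel borel (\<lambda>x. a + c *\<^sub>R x)) (\<lambda>_. ennreal (\<bar>c\<bar> ^ DIM(real^'n)))) f"
      using that lborel_affine[OF that(2), of a] by simp
    then have "integrable (distr lborel borel (\<lambda>x. a + c *\<^sub>R x)) (\<lambda>x. \<bar>c\<bar> ^ DIM(real^'n) *\<^sub>R f x)"
      by (subst (asm) integrable_density) (use m in auto)
    then have "integrable (distr lborel borel (\<lambda>x. a + c *\<^sub>R x)) f"
      using that(2) integrable_scaleR_right[of "inverse (\<bar>c\<bar> ^ DIM(real^'n))"] by fastforce
    then have "integrable lborel (\<lambda>x. f (a + c *\<^sub>R x))"
      by (subst (asm) integrable_distr_eq) (use m in auto)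
    then show ?thesis by (simp add: add.commute)
  qed
  show iff: "integrable lborel (\<lambda>x. f (c *\<^sub>R x + a)) \<longleftrightarrow> integrable lborel f"
  proof
    have eq: "c *\<^sub>R ((1 / c) *\<^sub>R x + - (a /\<^sub>R c)) + a = x" for x
      using assms by (simp only: scaleR_add_right scaleR_minus_right) simp
    assume "integrable lborel (\<lambda>x. f (c *\<^sub>R x + a))"
    from imp[OF this, of "1 / c" "- (a /\<^sub>R c)"] show "integrable lborel f"
      unfolding eq using assms by simp
  qed (rule imp[OF _ assms])
  show "(\<integral>x. f x \<partial>lborel) = \<bar>c\<bar> ^ CARD('n) *\<^sub>R (\<integral>x. f (c *\<^sub>R x + a) \<partial>lborel)"
  proof (cases "integrable lborel f")
    case True
    then have m: "f \<in> borel_measurable borel" by (auto dest: borel_measurable_integrable)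
    show ?thesis
    proof -
      have "(\<integral>x. f x \<partial>lborel) = integral\<^sup>L (density (distr lborel borel (\<lambda>x. a + c *\<^sub>R x)) (\<lambda>_. ennreal (\<bar>c\<bar> ^ DIM(real^'n)))) f"
        using lborel_affine[OF assms, of a] by simp
      also have "\<dots> = integral\<^sup>L (distr lborel borel (\<lambda>x. a + c *\<^sub>R x)) (\<lambda>x. \<bar>c\<bar> ^ DIM(real^'n) *\<^sub>R f x)"
        by (rule integral_density) (use m in auto)
      also have "\<dots> = \<bar>c\<bar> ^ DIM(real^'n) *\<^sub>R integral\<^sup>L (distr lborel borel (\<lambda>x. a + c *\<^sub>R x)) f"
        by simp
      also have "integral\<^sup>L (distr lborel borel (\<lambda>x. a + c *\<^sub>R x)) f = (\<integral>x. f (a + c *\<^sub>R x) \<partial>lborel)"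
        by (rule integral_distr) (use m in auto)
      finally show ?thesis by (simp add: add.commute)
    qed
  next
    \<comment> \<open>Neither function is integrable, and both integrals have the default value
      0.\<close>
    case False
    then show ?thesis using iff by (simp add: not_integrable_integral_eq)
  qed
qed

text \<open>By translation invariance every difference quotient of f has integral 0; the quotients
  converge to the derivative under a fixed multiple of \<open>weight\<close>.\<close>

lemma integral_partial_deriv:
  fixes f :: "real^'n::finite \<Rightarrow> complex"
  assumes f: "decaying f"
  shows "(\<integral>x. partial_deriv i f x \<partial>lborel) = 0"
proof -
  define h where "h k = 1 / real (Suc k)" for k
  have h: "h k > 0" "h k \<le> 1" for k by (auto simp: h_def)
  have h0: "h \<longlonglongrightarrow> 0" unfolding h_def by (rule LIMSEQ_Suc[OF lim_1_over_n])
  let ?q = "\<lambda>k x. (f (x + h k *\<^sub>R axis i 1) - f x) /\<^sub>R h k"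
  have sm: "smooth f" by (rule decaying_smooth[OF f])
  have fi: "integrable lborel f" by (rule decaying_integrable[OF f])
  have fi': "integrable lborel (\<lambda>x. f (x + a))" for a
    using integrable_affine_iff[of 1 f a] fi by simp
  have q0: "(\<integral>x. ?q k x \<partial>lborel) = 0" for k
    using integral_affine[of 1 f "h k *\<^sub>R axis i 1"] fi fi' by simp
  have "\<forall>j. \<exists>C. C > 0 \<and> (\<forall>x. norm (partial_deriv j f x) \<le> C * weight x)"
    using decaying_bound[OF f, of "[_]"] by simp
  then obtain C where C: "\<And>j. C j > 0" "\<And>j x. norm (partial_deriv j f x) \<le> C j * weight x" by metis
  define D where "D = (\<Sum>j\<in>UNIV. C j)"
  have D: "norm (partial_deriv j f x) \<le> D * weight x" for j x
  proof -
    have "C j \<le> D" unfolding D_def by (rule member_le_sum) (use C(1) less_imp_le in auto)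
    then show ?thesis using C(2)[of j x] by (meson mult_right_mono order_trans weight_nonneg)
  qed
  have D0: "D \<ge> 0" unfolding D_def using C(1) by (simp add: sum_nonneg less_imp_le)
  let ?n = "real CARD('n)"
  have "(\<lambda>k. \<integral>x. ?q k x \<partial>lborel) \<longlonglongrightarrow> (\<integral>x. partial_deriv i f x \<partial>lborel)"
  \<comment> \<open>Points of the segment are within distance \<open>h k\<close> \<le> 1 of x, where
    \<open>weight_translate\<close> costs the factor (4 * (1 + 1))^n = 8^n.\<close>
  proof (rule integral_dominated_convergence[where w = "\<lambda>x. ?n * D * (8 ^ CARD('n)) * weight x"])
    show "partial_deriv i f \<in> borel_measurable lborel"
      using sm by (simp add: smooth_borel_measurable)
    show "?q k \<in> borel_measurable lborel" for k
      using borel_measurable_integrable[OF fi] borel_measurable_integrable[OF fi'] by auto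
    show "AE x in lborel. (\<lambda>k. ?q k x) \<longlonglongrightarrow> partial_deriv i f x"
    proof (rule AE_I2)
      fix x
      let ?F = "\<lambda>t. f (x + t *\<^sub>R axis i 1)" and ?v = "partial_deriv i f x"
      have F: "(?F has_derivative (\<lambda>t. t *\<^sub>R ?v)) (at 0)"
      proof -
        have "((\<lambda>t. x + t *\<^sub>R axis i 1) has_derivative (\<lambda>t. t *\<^sub>R axis i 1)) (at 0)"
          by (auto intro!: derivative_eq_intros)
        from has_derivative_compose[OF this, of f "\<lambda>v. \<Sum>j\<in>UNIV. v $ j *\<^sub>R partial_deriv j f x"] has_derivative_smooth[OF sm]
        have "(?F has_derivative
            (\<lambda>t. \<Sum>j\<in>UNIV. (t *\<^sub>R axis i 1) $ j *\<^sub>R partial_deriv j f x)) (at 0)"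
          by simp
        moreover have "(\<Sum>j\<in>UNIV. (t *\<^sub>R axis i 1) $ j *\<^sub>R partial_deriv j f x) = t *\<^sub>R ?v" for t :: real
          by (simp add: axis_def if_distrib[of "\<lambda>s. t * s"] if_distrib[of "\<lambda>t. t *\<^sub>R _"] cong: if_cong)
        ultimately show ?thesis by simp
      qed
      then have "((\<lambda>t. norm ((?F t - ?F 0 - t *\<^sub>R ?v) /\<^sub>R norm t)) \<longlongrightarrow> 0) (at 0)"
        unfolding has_derivative_def by (intro tendsto_norm_zero) (simp add: has_derivative_at_within)
      moreover have "norm ((?F t - ?F 0 - t *\<^sub>R ?v) /\<^sub>R norm t) = norm ((?F t - f x) /\<^sub>R t - ?v)" if "t \<noteq> 0" for t
      proof -
        have "(?F t - f x) /\<^sub>R t - ?v = (?F t - ?F 0 - t *\<^sub>R ?v) /\<^sub>R t"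
          using that by (simp add: scaleR_diff_right)
        then show ?thesis by simp
      qed
      then have "\<forall>\<^sub>F t in at 0. norm ((?F t - ?F 0 - t *\<^sub>R ?v) /\<^sub>R norm t) = norm ((?F t - f x) /\<^sub>R t - ?v)"
        unfolding eventually_at_filter by (intro always_eventually) blast
      ultimately have "((\<lambda>t. norm ((?F t - f x) /\<^sub>R t - ?v)) \<longlongrightarrow> 0) (at 0)"
        by (rule Lim_transform_eventually)
      then have "((\<lambda>t. (?F t - f x) /\<^sub>R t) \<longlongrightarrow> ?v) (at 0)"
        by (subst Lim_null) (rule tendsto_norm_zero_cancel)
      then show "(\<lambda>k. ?q k x) \<longlonglongrightarrow> partial_deriv i f x"
      proof (rule filterlim_compose)
        show "filterlim h (at 0) sequentially"
          using h0 h(1) by (intro filterlim_atI) (auto simp: less_imp_neq[symmetric])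
      qed
    qed
    show "AE x in lborel. norm (?q k x) \<le> ?n * D * (8 ^ CARD('n)) * weight x" for k
    proof (rule AE_I2)
      fix x
      have "norm (f (x + h k *\<^sub>R axis i 1) - f x) \<le> ?n * (D * (8 ^ CARD('n) * weight x)) * norm (x + h k *\<^sub>R axis i 1 - x)"
      proof (rule norm_diff_le_partial_deriv)
        fix j z assume z: "z \<in> closed_segment x (x + h k *\<^sub>R axis i 1)"
        then have zx: "norm (z - x) \<le> 1"
          using segment_bound(1)[OF z] h[of k] by (simp add: norm_axis_1)
        have "weight z \<le> (4 * (1 + (norm (z - x))\<^sup>2)) ^ CARD('n) * weight x"
          using weight_translate[of x "z - x"] by simp
        also have "\<dots> \<le> 8 ^ CARD('n) * weight x"
          using zx by (intro mult_right_mono power_mono) (auto simp: abs_square_le_1)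
        finally show "norm (partial_deriv j f z) \<le> D * (8 ^ CARD('n) * weight x)"
          using D[of j z] D0 by (meson mult_left_mono order_trans)
      qed (use sm smooth_differentiable in auto)
      then show "norm (?q k x) \<le> ?n * D * (8 ^ CARD('n)) * weight x"
        unfolding norm_scaleR using h[of k] by (simp add: norm_axis_1 field_simps)
    qed
  qed auto
  then show ?thesis unfolding q0 by (simp add: LIMSEQ_const_iff)
qed

lemma integral_by_parts:
  fixes f g :: "real^'n::finite \<Rightarrow> complex"
  assumes f: "decaying f" and g: "decaying g"
  shows "(\<integral>x. partial_deriv i f x * g x \<partial>lborel) = - (\<integral>x. f x * partial_deriv i g x \<partial>lborel)"
proof -
  have "0 = (\<integral>x. partial_deriv i (\<lambda>x. f x * g x) x \<partial>lborel)"
    by (simp add: integral_partial_deriv decaying_mult f g)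
  also have "\<dots> = (\<integral>x. partial_deriv i f x * g x + f x * partial_deriv i g x \<partial>lborel)"
    using f g by (simp add: partial_deriv_mult smooth_differentiable decaying_smooth)
  also have "\<dots> = (\<integral>x. partial_deriv i f x * g x \<partial>lborel) + (\<integral>x. f x * partial_deriv i g x \<partial>lborel)"
    by (intro Bochner_Integration.integral_add decaying_integrable decaying_mult decaying_partial_deriv f g)
  finally show ?thesis by (simp add: eq_neg_iff_add_eq_0)
qed

section \<open>Polynomials, the Gaussian and a cutoff function\<close>

inductive polyfun :: "(real^'n::finite \<Rightarrow> complex) \<Rightarrow> bool" where
  const: "polyfun (\<lambda>x. c)"
| coord: "polyfun (\<lambda>x. of_real (x $ i))"
| add: "polyfun p \<Longrightarrow> polyfun r \<Longrightarrow> polyfun (\<lambda>x. p x + r x)"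
| mult: "polyfun p \<Longrightarrow> polyfun r \<Longrightarrow> polyfun (\<lambda>x. p x * r x)"

lemma polyfun_cmult: "polyfun p \<Longrightarrow> polyfun (\<lambda>x. c * p x)"
  by (intro polyfun.mult polyfun.const)

lemma polyfun_diff: "polyfun p \<Longrightarrow> polyfun r \<Longrightarrow> polyfun (\<lambda>x. p x - r x)"
  using polyfun.add[OF _ polyfun_cmult[of r "-1"], of p] by simp

lemma polyfun_power: "polyfun p \<Longrightarrow> polyfun (\<lambda>x. p x ^ k)"
  by (induction k) (auto intro: polyfun.mult polyfun.const)

lemma polyfun_sum: "(\<And>i. i \<in> I \<Longrightarrow> polyfun (p i)) \<Longrightarrow> polyfun (\<lambda>x. \<Sum>i\<in>I. p i x)"
  by (induction I rule: infinite_finite_induct) (auto intro: polyfun.const polyfun.add)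

lemma norm_vec_sq: "(norm (x::real^'n::finite))\<^sup>2 = (\<Sum>i\<in>UNIV. (x $ i)\<^sup>2)"
  unfolding power2_norm_eq_inner inner_vec_def by (simp add: power2_eq_square)

lemma polyfun_norm_sq: "polyfun (\<lambda>x. of_real ((norm x)\<^sup>2))"
  unfolding norm_vec_sq of_real_sum of_real_power
  by (intro polyfun_sum polyfun_power polyfun.coord)

lemma has_derivative_coord:
  "((\<lambda>x::real^'n::finite. complex_of_real (x $ i)) has_derivative (\<lambda>v. of_real (v $ i))) (at x)"
  by (intro bounded_linear_imp_has_derivative bounded_linear_compose[OF bounded_linear_of_real]
      bounded_linear_vec_nth)

lemma polyfun_differentiable: "polyfun p \<Longrightarrow> p differentiable (at x)"
proof (induction rule: polyfun.induct)
  case (coord i)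
  show ?case using has_derivative_coord differentiable_def by blast
qed (auto intro: differentiable_add differentiable_mult)

lemma partial_deriv_coord: "partial_deriv j (\<lambda>x. of_real (x $ i)) x = (if i = j then 1 else 0)"
  by (subst partial_derivI[OF has_derivative_coord]) (simp add: axis_def)

lemma polyfun_partial_deriv: "polyfun p \<Longrightarrow> polyfun (partial_deriv i p)"
proof (induction rule: polyfun.induct)
  case (coord j)
  have "partial_deriv i (\<lambda>x. complex_of_real (x $ j)) = (\<lambda>x. if j = i then 1 else 0)"
    by (rule ext) (rule partial_deriv_coord)
  then show ?case by (simp add: polyfun.const)
next
  case (add p r)
  have "partial_deriv i (\<lambda>x. p x + r x) = (\<lambda>x. partial_deriv i p x + partial_deriv i r x)"
    using add by (intro ext partial_deriv_add polyfun_differentiable)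
  then show ?case using add by (simp add: polyfun.add)
next
  case (mult p r)
  have "partial_deriv i (\<lambda>x. p x * r x) = (\<lambda>x. partial_deriv i p x * r x + p x * partial_deriv i r x)"
    using mult by (intro ext partial_deriv_mult polyfun_differentiable)
  then show ?case using mult by (simp add: polyfun.add polyfun.mult)
qed (simp add: polyfun.const)

lemma polyfun_smooth: "polyfun p \<Longrightarrow> smooth p"
  by (rule smooth_coinduct[of _ "Collect polyfun"])
     (auto intro: polyfun_differentiable polyfun_partial_deriv)

lemma polyfun_bound:
  assumes "polyfun p"
  shows "\<exists>C\<ge>0. \<exists>N. \<forall>x. norm (p x) \<le> C * (1 + (norm x)\<^sup>2) ^ N"
  using assms
proof (induction rule: polyfun.induct)
  case (const c)
  show ?case by (rule exI[of _ "norm c"], simp, rule exI[of _ 0]) simp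
next
  case (coord i)
  have "norm (complex_of_real (x $ i)) \<le> 1 * (1 + (norm x)\<^sup>2) ^ 1" for x :: "real^'a"
  proof -
    have "norm x \<le> 1 + (norm x)\<^sup>2"
      using sum_squares_bound[of "norm x" 1] norm_ge_zero[of x] by (simp del: norm_ge_zero)
    then show ?thesis using component_le_norm_cart[of x i] by simp
  qed
  then show ?case by (metis zero_le_one)
next
  case (add p r)
  then obtain C N D M where CD: "C \<ge> 0" "D \<ge> 0"
    and p: "\<And>x. norm (p x) \<le> C * (1 + (norm x)\<^sup>2) ^ N"
    and r: "\<And>x. norm (r x) \<le> D * (1 + (norm x)\<^sup>2) ^ M" by metis
  have "norm (p x + r x) \<le> (C + D) * (1 + (norm x)\<^sup>2) ^ (N + M)" for x
  proof -
    have "C * (1 + (norm x)\<^sup>2) ^ N \<le> C * (1 + (norm x)\<^sup>2) ^ (N + M)"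
         "D * (1 + (norm x)\<^sup>2) ^ M \<le> D * (1 + (norm x)\<^sup>2) ^ (N + M)"
      using CD by (auto intro!: mult_left_mono power_increasing)
    then show ?thesis
      using p[of x] r[of x] norm_triangle_ineq[of "p x" "r x"] by (simp add: distrib_right)
  qed
  then show ?case using CD by (metis add_nonneg_nonneg)
next
  case (mult p r)
  then obtain C N D M where CD: "C \<ge> 0" "D \<ge> 0"
    and p: "\<And>x. norm (p x) \<le> C * (1 + (norm x)\<^sup>2) ^ N"
    and r: "\<And>x. norm (r x) \<le> D * (1 + (norm x)\<^sup>2) ^ M" by metis
  have "norm (p x * r x) \<le> (C * D) * (1 + (norm x)\<^sup>2) ^ (N + M)" for x
    using mult_mono[OF p[of x] r[of x]] CD by (simp add: norm_mult power_add ac_simps)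
  then show ?case using CD by (metis mult_nonneg_nonneg)
qed

section \<open>The Gaussian and its derivatives\<close>

lemma power_times_exp_bounded:
  "\<exists>K>0. \<forall>r\<ge>0. r ^ k * exp (- r :: real) \<le> K"
proof (cases "k = 0")
  case True
  then show ?thesis by (intro exI[of _ 1]) auto
next
  case False
  have "r ^ k * exp (- r) \<le> real k ^ k" if "r \<ge> 0" for r
  proof -
    \<comment> \<open>Passing through (1 + r/k)^k \<le> exp r produces the constant k^k; the
      division makes k = 0 a separate case.\<close>
    have "(r / real k) ^ k \<le> (1 + r / real k) ^ k"
      using that by (intro power_mono) auto
    also have "\<dots> \<le> exp r"
      by (rule exp_ge_one_plus_x_over_n_power_n) (use that False in auto)
    finally have "r ^ k \<le> real k ^ k * exp r"
      using False by (simp add: power_divide field_simps)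
    then show ?thesis by (simp add: exp_minus field_simps)
  qed
  then show ?thesis using False by (intro exI[of _ "real k ^ k"]) auto
qed

text \<open>The standard normal density. The heat kernel of \<Delta> at time t is the density of
  sqrt (2 * t) times a standard normal variable, which is the origin of that factor below.\<close>

definition gauss :: "real^'n::finite \<Rightarrow> complex" where
  "gauss x = of_real (exp (- (norm x)\<^sup>2 / 2) / sqrt (2 * pi) ^ CARD('n))"

lemma has_derivative_gauss:
  fixes x :: "real^'n::finite"
  shows "(gauss has_derivative (\<lambda>v. - of_real (x \<bullet> v) * gauss x)) (at x)"
proof -
  have "((\<lambda>x::real^'n. exp (- (x \<bullet> x) / 2) / sqrt (2 * pi) ^ CARD('n)) has_derivative
      (\<lambda>v. - (x \<bullet> v) * (exp (- (x \<bullet> x) / 2) / sqrt (2 * pi) ^ CARD('n)))) (at x)"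
    by (auto intro!: derivative_eq_intros simp: inner_commute algebra_simps)
  from has_derivative_of_real[OF this] show ?thesis
    by (simp only: gauss_def[abs_def] power2_norm_eq_inner of_real_mult of_real_minus)
qed

lemma partial_deriv_gauss: "partial_deriv i gauss x = - of_real (x $ i) * gauss x"
  by (subst partial_derivI[OF has_derivative_gauss]) (simp add: cart_eq_inner_axis)

lemma gauss_differentiable: "gauss differentiable (at x)"
  using has_derivative_gauss differentiable_def by blast

text \<open>With r = 1 + |x|^2 the exponential is exp (1/2) exp (- r/2), and r^(N+n) exp (- r/2) is
  bounded. N powers of r pay for the polynomial and the remaining n become
  \<open>weight\<close>.\<close>

lemma polyfun_gauss_bound:
  assumes "polyfun p"
  shows "\<exists>C. \<forall>x::real^'n::finite. norm (p x * gauss x) \<le> C * weight x"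
proof -
  obtain C N where C: "C \<ge> 0" "\<And>x. norm (p x) \<le> C * (1 + (norm x)\<^sup>2) ^ N"
    using polyfun_bound[OF assms] by blast
  let ?k = "N + CARD('n)"
  obtain K where K: "K > 0" "\<And>r. r \<ge> 0 \<Longrightarrow> r ^ ?k * exp (- r :: real) \<le> K"
    using power_times_exp_bounded by metis
  let ?S = "sqrt (2 * pi) ^ CARD('n)"
  have "norm (p x * gauss x) \<le> (C * (2 ^ ?k * exp (1/2) * K / ?S)) * weight x" for x :: "real^'n"
  proof -
    define r where "r = 1 + (norm x)\<^sup>2"
    have r: "r \<ge> 1" by (simp add: r_def)
    have "r ^ ?k * exp (- r / 2) \<le> 2 ^ ?k * K"
      using K(2)[of "r / 2"] r by (simp add: power_divide field_simps)
    from mult_left_mono[OF this, of "exp (1/2)"]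
    have "r ^ ?k * exp (1/2 - r / 2) \<le> 2 ^ ?k * exp (1/2) * K"
      using exp_add[of "1/2" "- r / 2"] by (simp add: ac_simps)
    moreover have "exp (- (norm x)\<^sup>2 / 2) = exp (1/2 - r / 2)"
      by (simp add: r_def field_simps)
    ultimately have e: "r ^ N * exp (- (norm x)\<^sup>2 / 2) \<le> (2 ^ ?k * exp (1/2) * K) * weight x"
    proof -
      assume *: "r ^ ?k * exp (1/2 - r / 2) \<le> 2 ^ ?k * exp (1/2) * K"
        "exp (- (norm x)\<^sup>2 / 2) = exp (1/2 - r / 2)"
      have "0 < r ^ CARD('n)" using r by simp
      with *(1) show ?thesis
        unfolding *(2) weight_def r_def[symmetric] divide_inverse[symmetric]
        by (simp only: pos_le_divide_eq power_add ac_simps)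
    qed
    have "norm (p x * gauss x) \<le> C * r ^ N * (exp (- (norm x)\<^sup>2 / 2) / ?S)"
      using C(2)[of x] by (auto simp: norm_mult gauss_def r_def norm_divide norm_power intro!: mult_right_mono divide_right_mono)
    also have "\<dots> = C * (r ^ N * exp (- (norm x)\<^sup>2 / 2)) / ?S" by simp
    also have "\<dots> \<le> C * ((2 ^ ?k * exp (1/2) * K) * weight x) / ?S"
      by (intro divide_right_mono mult_left_mono e C(1)) simp
    finally show ?thesis by simp
  qed
  then show ?thesis by blast
qed

lemma partial_derivs_gauss: "\<exists>p. polyfun p \<and> partial_derivs \<alpha> gauss = (\<lambda>x. p x * gauss x)"
proof (induction \<alpha>)
  case Nil
  show ?case by (rule exI[of _ "\<lambda>x. 1"]) (simp add: polyfun.const)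
next
  case (Cons i \<alpha>)
  then obtain p where p: "polyfun p" "partial_derivs \<alpha> gauss = (\<lambda>x. p x * gauss x)" by blast
  have "partial_deriv i (\<lambda>x. p x * gauss x) = (\<lambda>x. (partial_deriv i p x - p x * of_real (x $ i)) * gauss x)"
    by (rule ext, subst partial_deriv_mult[OF polyfun_differentiable[OF p(1)] gauss_differentiable])
       (simp add: partial_deriv_gauss algebra_simps)
  with p show ?case
    by (intro exI[of _ "\<lambda>x. partial_deriv i p x - p x * of_real (x $ i)"])
       (intro conjI polyfun_diff polyfun.mult polyfun.coord polyfun_partial_deriv, simp_all)
qed

lemma decaying_gauss: "decaying gauss"
  unfolding decaying_def smooth_def
proof (intro conjI allI)
  fix \<alpha> and x :: "real^'n"
  obtain p where p: "polyfun p" "partial_derivs \<alpha> gauss = (\<lambda>x::real^'n. p x * gauss x)"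
    using partial_derivs_gauss by blast
  show "partial_derivs \<alpha> gauss differentiable at x"
    unfolding p by (intro differentiable_mult polyfun_differentiable p gauss_differentiable)
  show "\<exists>C. \<forall>x::real^'n. norm (partial_derivs \<alpha> gauss x) \<le> C * weight x"
    unfolding p by (rule polyfun_gauss_bound[OF p(1)])
qed

lemma smooth_gauss: "smooth gauss"
  by (rule decaying_smooth[OF decaying_gauss])

lemma gauss_minus: "gauss (- x) = gauss x"
  by (simp add: gauss_def)

lemma gauss_prod: "gauss (x::real^'n::finite) = (\<Prod>i\<in>UNIV. complex_of_real (std_normal_density (x $ i)))"
proof -
  have "exp (- (norm x)\<^sup>2 / 2) = (\<Prod>i\<in>UNIV. exp (- (x $ i)\<^sup>2 / 2))"
    unfolding norm_vec_sq by (subst exp_sum[symmetric]) (auto simp: sum_negf sum_divide_distrib)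
  then show ?thesis
    unfolding gauss_def std_normal_density_def of_real_prod[symmetric]
    by (simp add: prod_dividef)
qed

text \<open>The integrand factorises over the coordinates, and each factor integrates to the
  characteristic function of the standard normal distribution.\<close>

lemma integral_exp_gauss:
  fixes \<xi> :: "real^'n::finite"
  shows "(\<integral>x. exp (\<i> * of_real (\<xi> \<bullet> x)) * gauss x \<partial>lborel) = of_real (exp (- (norm \<xi>)\<^sup>2 / 2))"
proof -
  let ?f = "\<lambda>i t. exp (\<i> * of_real (\<xi> $ i * t)) * complex_of_real (std_normal_density t)"
  have eq: "exp (\<i> * of_real (\<xi> \<bullet> x)) * gauss x = (\<Prod>i\<in>UNIV. ?f i (x $ i))" for x
    unfolding gauss_prod prod.distrib
    by (subst exp_sum[symmetric]) (auto simp: inner_vec_def sum_distrib_left)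
  have int: "integrable lborel (?f i)" for i
    by (rule integrable_norm_bound[OF integrable_normal_density[of 1 0]])
       (auto simp: norm_mult)
  have "(\<integral>t. ?f i t \<partial>lborel) = complex_of_real (exp (- (\<xi> $ i)\<^sup>2 / 2))" for i
  proof -
    have "char std_normal_distribution (\<xi> $ i) = (\<integral>t. ?f i t \<partial>lborel)"
      unfolding char_def
      by (subst integral_density) (auto simp: scaleR_conv_of_real mult.commute)
    then show ?thesis by (simp add: char_std_normal_distribution)
  qed
  then have "(\<integral>x. exp (\<i> * of_real (\<xi> \<bullet> x)) * gauss x \<partial>lborel) = (\<Prod>i\<in>UNIV. complex_of_real (exp (- (\<xi> $ i)\<^sup>2 / 2)))"
    unfolding eq integral_prod_coord[OF int] by (simp only:)
  also have "\<dots> = of_real (exp (- (norm \<xi>)\<^sup>2 / 2))"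
    unfolding norm_vec_sq of_real_prod[symmetric]
    by (subst exp_sum[symmetric]) (auto simp: sum_negf sum_divide_distrib)
  finally show ?thesis .
qed

lemma integral_gauss: "integral\<^sup>L lborel (gauss :: real^'n::finite \<Rightarrow> complex) = 1"
  using integral_exp_gauss[of "0::real^'n"] by simp

lemma integrable_gauss: "integrable lborel gauss"
  by (rule decaying_integrable[OF decaying_gauss])

section \<open>Test functions\<close>

lemma partial_derivs_vanish:
  assumes "open U" "\<And>x. x \<in> U \<Longrightarrow> f x = 0" "x \<in> U"
  shows "partial_derivs \<alpha> f x = 0"
  using assms(3)
proof (induction \<alpha> arbitrary: x)
  case (Cons i \<alpha>)
  have "((\<lambda>x. 0) has_derivative (\<lambda>x. 0)) (at x)" by simp
  then have "(partial_derivs \<alpha> f has_derivative (\<lambda>x. 0)) (at x)"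
    by (rule has_derivative_transform_within_open[OF _ assms(1) Cons.prems]) (simp add: Cons.IH)
  then show ?case by (simp add: partial_derivI)
qed (use assms in simp)

lemma test_functions_iff:
  "\<phi> \<in> test_functions \<longleftrightarrow> smooth \<phi> \<and> (\<exists>R. \<forall>x. norm x > R \<longrightarrow> \<phi> x = 0)"
proof -
  have "compact (closure {x. \<phi> x \<noteq> 0}) \<longleftrightarrow> (\<exists>R. \<forall>x. norm x > R \<longrightarrow> \<phi> x = 0)"
    unfolding compact_closure bounded_iff by (intro ex_cong1) (use not_le in blast)
  then show ?thesis by (auto simp: test_functions_def)
qed

lemma test_functions_smooth: "\<phi> \<in> test_functions \<Longrightarrow> smooth \<phi>"
  by (simp add: test_functions_iff)

lemma partial_derivs_outside:
  assumes "\<And>x. norm x > R \<Longrightarrow> \<phi> x = 0" "norm x > R"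
  shows "partial_derivs \<alpha> \<phi> x = 0"
proof (rule partial_derivs_vanish[of "{x. R < norm x}"])
  show "open {x::real^'a. R < norm x}" by (intro open_Collect_less continuous_intros)
qed (use assms in auto)

lemma test_functions_partial_derivs:
  "\<phi> \<in> test_functions \<Longrightarrow> partial_derivs \<alpha> \<phi> \<in> test_functions"
  unfolding test_functions_iff using partial_derivs_outside smooth_partial_derivs by metis

lemma test_functions_mult:
  "\<phi> \<in> test_functions \<Longrightarrow> smooth f \<Longrightarrow> (\<lambda>x. \<phi> x * f x) \<in> test_functions"
  unfolding test_functions_iff by (metis mult_zero_left smooth_mult)

lemma test_functions_cmult:
  "\<phi> \<in> test_functions \<Longrightarrow> (\<lambda>x. c * \<phi> x) \<in> test_functions"
  using test_functions_mult[of \<phi> "\<lambda>_. c"] by (simp add: mult.commute)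

lemma test_functions_add:
  assumes "\<phi> \<in> test_functions" "\<psi> \<in> test_functions"
  shows "(\<lambda>x. \<phi> x + \<psi> x) \<in> test_functions"
proof -
  obtain R S where "\<And>x. norm x > R \<Longrightarrow> \<phi> x = 0" "\<And>x. norm x > S \<Longrightarrow> \<psi> x = 0"
    using assms unfolding test_functions_iff by auto
  then have "\<forall>x. norm x > max R S \<longrightarrow> \<phi> x + \<psi> x = 0" by auto
  then show ?thesis
    using assms unfolding test_functions_iff by blast
qed

lemma test_functions_affine:
  assumes "\<phi> \<in> test_functions" "c \<noteq> 0"
  shows "(\<lambda>x. \<phi> (c *\<^sub>R x + a)) \<in> test_functions"
proof -
  obtain R where R: "\<And>x. norm x > R \<Longrightarrow> \<phi> x = 0"
    using assms unfolding test_functions_iff by auto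
  have "\<phi> (c *\<^sub>R x + a) = 0" if "norm x > (R + norm a) / \<bar>c\<bar>" for x
  proof (rule R)
    have "R + norm a < norm (c *\<^sub>R x)"
      using that assms by (simp add: field_simps)
    also have "\<dots> \<le> norm (c *\<^sub>R x + a) + norm a"
      using norm_triangle_ineq4[of "c *\<^sub>R x + a" a] by simp
    finally show "norm (c *\<^sub>R x + a) > R" by simp
  qed
  then show ?thesis
    using assms unfolding test_functions_iff by (auto intro: smooth_affine)
qed

lemma test_functions_translate:
  "\<phi> \<in> test_functions \<Longrightarrow> (\<lambda>x. \<phi> (x + a)) \<in> test_functions"
  using test_functions_affine[of \<phi> 1 a] by simp

lemma compact_support_bound:
  fixes f :: "real^'n::finite \<Rightarrow> complex"
  assumes "continuous_on UNIV f" "\<And>x. norm x > R \<Longrightarrow> f x = 0"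
  shows "\<exists>C>0. \<forall>x. norm (f x) \<le> C * weight x"
proof -
  have "continuous_on (cball 0 R) (\<lambda>x. norm (f x) / weight x)"
    by (intro continuous_intros continuous_weight continuous_on_subset[OF assms(1)])
       (auto simp: less_imp_neq[symmetric])
  then have "bounded ((\<lambda>x. norm (f x) / weight x) ` cball 0 R)"
    by (intro compact_imp_bounded compact_continuous_image) auto
  then obtain C where C: "C > 0" "\<And>x. x \<in> cball 0 R \<Longrightarrow> norm (norm (f x) / weight x) \<le> C"
    unfolding bounded_pos by auto
  have "norm (f x) \<le> C * weight x" for x
  proof (cases "norm x > R")
    case False
    then show ?thesis using C(2)[of x] by (simp add: field_simps)
  qed (use assms C in simp)
  with C show ?thesis by blast
qed

lemma test_functions_decaying: "\<phi> \<in> test_functions \<Longrightarrow> decaying \<phi>"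
  unfolding decaying_def test_functions_iff
  using compact_support_bound continuous_on_partial_derivs partial_derivs_outside by metis

section \<open>A smooth bump, with all its derivatives in one explicit family\<close>

definition bump :: "(real^'n::finite \<Rightarrow> complex) \<Rightarrow> nat \<Rightarrow> real^'n \<Rightarrow> complex" where
  "bump p k x = (if norm x < 1
     then p x * of_real (inverse (1 - (norm x)\<^sup>2) ^ k * exp (- inverse (1 - (norm x)\<^sup>2))) else 0)"

text \<open>A bound by the squared distance to any point outside the open unit ball will force the
  derivative 0 at that point. With s = 1 / (1 - |y|^2), two powers of 1/s are split off: 1/s \<le> 2
  |y - x|, while s^(k+2) exp (-s) stays bounded.\<close>

lemma bump_quadratic:
  fixes p :: "real^'n::finite \<Rightarrow> complex"
  assumes "polyfun p"
  shows "\<exists>C. \<forall>x y. norm x \<ge> 1 \<longrightarrow> norm (bump p k y) \<le> C * (norm (y - x))\<^sup>2"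
proof -
  obtain C N where C: "C \<ge> 0" "\<And>x. norm (p x) \<le> C * (1 + (norm x)\<^sup>2) ^ N"
    using polyfun_bound[OF assms] by blast
  obtain K where K: "K > 0" "\<And>r. r \<ge> 0 \<Longrightarrow> r ^ (k + 2) * exp (- r :: real) \<le> K"
    using power_times_exp_bounded by metis
  have "norm (bump p k y) \<le> (C * 2 ^ N * K * 4) * (norm (y - x))\<^sup>2" if x: "norm x \<ge> 1" for x y
  proof (cases "norm y < 1")
    case True
    define s where "s = inverse (1 - (norm y)\<^sup>2)"
    have y1: "(norm y)\<^sup>2 < 1" using True by (simp add: abs_square_less_1)
    then have s: "s > 0" "1 - (norm y)\<^sup>2 = inverse s" by (auto simp: s_def)
    have py: "norm (p y) \<le> C * 2 ^ N"
      by (rule order_trans[OF C(2)]) (use y1 C(1) in \<open>auto intro!: mult_left_mono power_mono\<close>)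
    have "1 - (norm y)\<^sup>2 = (1 - norm y) * (1 + norm y)"
      by (simp add: power2_eq_square algebra_simps)
    also have "\<dots> \<le> norm (y - x) * 2"
      using x True norm_triangle_ineq2[of x y] by (intro mult_mono) (auto simp: norm_minus_commute)
    finally have "inverse s \<le> 2 * norm (y - x)" using s by simp
    then have sq: "(inverse s)\<^sup>2 \<le> 4 * (norm (y - x))\<^sup>2"
      using power_mono[of "inverse s" "2 * norm (y - x)" 2] s by (simp add: power_mult_distrib)
    have "s ^ k * exp (- s) = s ^ (k + 2) * exp (- s) * (inverse s)\<^sup>2"
    proof -
      have "s\<^sup>2 * (inverse s)\<^sup>2 = 1"
        using s(1) by (simp flip: power_mult_distrib)
      then show ?thesis
        by (metis (no_types, opaque_lifting) mult.assoc mult.commute mult_1_right power_add)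
    qed
    also have "\<dots> \<le> K * (4 * (norm (y - x))\<^sup>2)"
      by (intro mult_mono K sq) (use s K in auto)
    finally have e: "s ^ k * exp (- s) \<le> K * (4 * (norm (y - x))\<^sup>2)" .
    have "norm (bump p k y) = norm (p y) * (s ^ k * exp (- s))"
      using True s unfolding bump_def s_def[symmetric] by (simp add: norm_mult norm_power del: of_real_mult of_real_power)
    also have "\<dots> \<le> (C * 2 ^ N) * (K * (4 * (norm (y - x))\<^sup>2))"
      by (intro mult_mono py e) (use s C in auto)
    finally show ?thesis by simp
  qed (use C K in \<open>simp add: bump_def\<close>)
  then show ?thesis by blast
qed

lemma has_derivative_bump_outside:
  assumes "polyfun p" "norm x \<ge> 1"
  shows "(bump p k has_derivative (\<lambda>v. 0)) (at x)"
proof -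
  obtain C where C: "\<And>x y. norm x \<ge> 1 \<Longrightarrow> norm (bump p k y) \<le> C * (norm (y - x))\<^sup>2"
    using bump_quadratic[OF assms(1)] by blast
  have "norm (bump p k y - bump p k x - 0) / norm (y - x) \<le> C * norm (y - x)" if "y \<noteq> x" for y
  proof -
    have "bump p k x = 0" using assms by (simp add: bump_def)
    with that show ?thesis
      using C[OF assms(2), of y] by (simp add: field_simps power2_eq_square)
  qed
  moreover have "((\<lambda>y. C * norm (y - x)) \<longlongrightarrow> 0) (at x)"
    by (auto intro!: tendsto_eq_intros)
  ultimately show ?thesis
    using has_derivativeI_sandwich[of 1 "\<lambda>v. 0" UNIV x "bump p k" "\<lambda>y. C * norm (y - x)"] by simp
qed

text \<open>With s = 1 / (1 - |x|^2) the derivative of s^k exp (-s) along v is (x \<bullet> v) (2 k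
  s^(k+1) - 2 s^(k+2)) exp (-s). Factoring out s^(k+2) turns the missing powers of s into powers of
  1 - |x|^2, so the remaining factor is again a polynomial and the family is closed under
  derivatives.\<close>

lemma bump_inside:
  fixes p :: "real^'n::finite \<Rightarrow> complex"
  assumes p: "polyfun p" and x: "norm x < 1"
  shows "bump p k differentiable (at x)"
    and "partial_deriv i (bump p k) x =
      bump (\<lambda>x. partial_deriv i p x * (1 - of_real ((norm x)\<^sup>2))\<^sup>2
        + of_nat (2 * k) * (of_real (x $ i) * (p x * (1 - of_real ((norm x)\<^sup>2))))
        - 2 * (of_real (x $ i) * p x)) (k + 2) x"
proof -
  define s where "s = inverse (1 - x \<bullet> x)"
  have "x \<bullet> x < 1" using x by (simp add: abs_square_less_1 flip: power2_norm_eq_inner)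
  then have ne: "1 - x \<bullet> x \<noteq> 0" "s \<noteq> 0" by (auto simp: s_def)
  let ?u = "\<lambda>x::real^'n. inverse (1 - x \<bullet> x) ^ k * exp (- inverse (1 - x \<bullet> x))"
  have u: "(?u has_derivative (\<lambda>v. (x \<bullet> v) * (of_nat (2 * k) * s ^ (k + 1) - 2 * s ^ (k + 2)) * exp (- s))) (at x)"
    using ne
    apply (auto intro!: derivative_eq_intros simp: s_def[symmetric] inner_commute)
    apply (rule ext)
    apply (cases k)
     apply (auto simp: algebra_simps power2_eq_square s_def[symmetric])
    done
  let ?Dp = "\<lambda>v. \<Sum>i\<in>UNIV. v $ i *\<^sub>R partial_deriv i p x"
  have pu: "((\<lambda>x. p x * of_real (?u x)) has_derivative
     (\<lambda>v. p x * of_real ((x \<bullet> v) * (of_nat (2 * k) * s ^ (k + 1) - 2 * s ^ (k + 2)) * exp (- s)) + ?Dp v * of_real (?u x))) (at x)"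
    by (intro has_derivative_mult has_derivative_of_real u has_derivative_partial_deriv polyfun_differentiable p)
  have b: "(bump p k has_derivative
     (\<lambda>v. p x * of_real ((x \<bullet> v) * (of_nat (2 * k) * s ^ (k + 1) - 2 * s ^ (k + 2)) * exp (- s)) + ?Dp v * of_real (?u x))) (at x)"
    by (rule has_derivative_transform_within_open[OF pu, of "ball 0 1"])
       (use x in \<open>auto simp: bump_def power2_norm_eq_inner\<close>)
  then show "bump p k differentiable (at x)" by (auto simp: differentiable_def)
  have "?Dp (axis i 1) = partial_deriv i p x"
    by (simp add: axis_def if_distrib[of "\<lambda>t. t *\<^sub>R _"] cong: if_cong)
  then have "partial_deriv i (bump p k) x = p x * of_real ((x $ i) * (of_nat (2 * k) * s ^ (k + 1) - 2 * s ^ (k + 2)) * exp (- s)) + partial_deriv i p x * of_real (s ^ k * exp (- s))"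
    by (subst partial_derivI[OF b]) (simp add: cart_eq_inner_axis s_def)
  also have "\<dots> = (partial_deriv i p x * (of_real (inverse s))\<^sup>2
        + of_nat (2 * k) * (of_real (x $ i) * (p x * of_real (inverse s)))
        - 2 * (of_real (x $ i) * p x)) * of_real (s ^ (k + 2) * exp (- s))"
    using ne by (simp add: field_simps power2_eq_square)
  finally show "partial_deriv i (bump p k) x =
      bump (\<lambda>x. partial_deriv i p x * (1 - of_real ((norm x)\<^sup>2))\<^sup>2
        + of_nat (2 * k) * (of_real (x $ i) * (p x * (1 - of_real ((norm x)\<^sup>2))))
        - 2 * (of_real (x $ i) * p x)) (k + 2) x"
    using x by (simp add: bump_def power2_norm_eq_inner s_def)
qed

lemma smooth_bump: 
  assumes "polyfun (p :: real^'n::finite \<Rightarrow> complex)" shows "smooth (bump p k)"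
proof (rule smooth_coinduct[of _ "{bump p k | p k. polyfun (p :: real^'n \<Rightarrow> complex)}"])
  fix g :: "real^'n \<Rightarrow> complex" and i x
  assume "g \<in> {bump p k | p k. polyfun (p :: real^'n \<Rightarrow> complex)}"
  then obtain p k where p: "polyfun p" and g: "g = bump p k" by blast
  show "g differentiable at x"
  proof (cases "norm x < 1")
    case True
    then show ?thesis unfolding g by (rule bump_inside(1)[OF p])
  next
    case False
    then have "1 \<le> norm x" by simp
    from has_derivative_bump_outside[OF p this] show ?thesis
      unfolding g differentiable_def by blast
  qed
  let ?q = "\<lambda>x. partial_deriv i p x * (1 - of_real ((norm x)\<^sup>2))\<^sup>2
        + of_nat (2 * k) * (of_real (x $ i) * (p x * (1 - of_real ((norm x)\<^sup>2))))
        - 2 * (of_real (x $ i) * p x)"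
  have "partial_deriv i g x = bump ?q (k + 2) x" for x
  proof (cases "norm x < 1")
    case False
    then have "partial_deriv i (bump p k) x = 0"
      by (subst partial_derivI[OF has_derivative_bump_outside[OF p]]) auto
    with False show ?thesis by (simp add: g bump_def)
  qed (simp only: g bump_inside(2)[OF p])
  moreover have "polyfun ?q"
    by (intro polyfun_diff polyfun.add polyfun.mult polyfun_partial_deriv polyfun_power
        polyfun.const polyfun.coord polyfun_norm_sq p)
  ultimately show "partial_deriv i g \<in> {bump p k | p k. polyfun (p :: real^'n \<Rightarrow> complex)}"
    by blast
qed (use assms in blast)

definition cutoff :: "real^'n::finite \<Rightarrow> real" where
  "cutoff x = (if norm x < 1 then exp (1 - inverse (1 - (norm x)\<^sup>2)) else 0)"

lemma cutoff_0 [simp]: "cutoff 0 = 1"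
  by (simp add: cutoff_def)

lemma cutoff_nonneg: "0 \<le> cutoff x"
  by (simp add: cutoff_def)

lemma cutoff_pos: "norm x < 1 \<Longrightarrow> 0 < cutoff x"
  by (simp add: cutoff_def)

lemma cutoff_le_1: "cutoff x \<le> 1"
proof (cases "norm x < 1")
  case True
  then have "(norm x)\<^sup>2 < 1" by (simp add: abs_square_less_1)
  then have "1 \<le> inverse (1 - (norm x)\<^sup>2)" by (simp add: one_le_inverse)
  then show ?thesis by (simp add: cutoff_def)
qed (simp add: cutoff_def)

lemma cutoff_outside: "norm x \<ge> 1 \<Longrightarrow> cutoff x = 0"
  by (simp add: cutoff_def)

lemma cutoff_test: "(\<lambda>x. complex_of_real (cutoff x)) \<in> test_functions"
proof -
  have "(\<lambda>x::real^'a. complex_of_real (cutoff x)) = (\<lambda>x. exp 1 * bump (\<lambda>x. 1) 0 x)"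
    by (simp add: fun_eq_iff cutoff_def bump_def exp_diff exp_minus field_simps flip: exp_of_real)
  then have "smooth (\<lambda>x::real^'a. complex_of_real (cutoff x))"
    by (simp add: smooth_cmult smooth_bump polyfun.const)
  then show ?thesis
    unfolding test_functions_iff by (auto intro!: exI[of _ 1] simp: cutoff_outside)
qed

lemma cutoff_scale_test: "r \<noteq> 0 \<Longrightarrow> (\<lambda>x. complex_of_real (cutoff (r *\<^sub>R x))) \<in> test_functions"
  using test_functions_affine[OF cutoff_test, of r 0] by simp

lemma continuous_cutoff: "continuous_on A cutoff"
proof -
  have "continuous_on A (\<lambda>x. Re (complex_of_real (cutoff x)))"
    by (intro continuous_on_Re smooth_continuous_on test_functions_smooth cutoff_test)
  then show ?thesis by simp
qed

section \<open>Lebesgue spaces\<close>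

text \<open>For finite q the conjugate exponent is never 1: it is \<infinity> for q = 1, and a real
  number above 1 otherwise. Many estimates below are proved separately in these two regimes.\<close>

lemma conj_exponent_cases:
  assumes "1 \<le> q" "q < \<infinity>"
  obtains "q = 1" "conj_exponent q = \<infinity>"
    | r s where "q = ennreal r" "conj_exponent q = ennreal s" "1 < r" "1 < s" "1 / r + 1 / s = 1"
proof -
  from assms(2) obtain r where q: "q = ennreal r" "r \<ge> 0" by (cases q) auto
  with assms(1) have r: "r \<ge> 1" by simp
  show ?thesis
  proof (cases "r = 1")
    case True
    with q have "q = 1" by simp
    then show ?thesis by (intro that(1)) (simp_all add: conj_exponent_def)
  next
    case False
    with r have r1: "r > 1" by simp
    define s where "s = inverse (1 - 1 / r)"
    have d: "1 - 1 / r > 0" "1 - 1 / r < 1" using r1 by (simp_all add: field_simps)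
    have "conj_exponent q = inverse (ennreal 1 - ennreal (1 / r))"
      unfolding conj_exponent_def q(1) using r1 by (simp add: inverse_ennreal divide_inverse)
    also have "\<dots> = inverse (ennreal (1 - 1 / r))"
      using r1 by (subst ennreal_minus) auto
    also have "\<dots> = ennreal s"
      unfolding s_def by (rule inverse_ennreal[OF d(1)])
    finally have "conj_exponent q = ennreal s" .
    moreover have "s > 1" unfolding s_def using d by (simp add: one_less_inverse)
    moreover have "1 / r + 1 / s = 1" by (simp add: s_def divide_inverse)
    ultimately show ?thesis using q r1 that(2) by blast
  qed
qed

lemma one_le_conj_exponent: "1 \<le> q \<Longrightarrow> q < \<infinity> \<Longrightarrow> 1 \<le> conj_exponent q"
  by (rule conj_exponent_cases[of q]) auto

section \<open>Membership, domination and sums in L^p\<close>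

lemma Lp_measurable: "f \<in> Lp p \<Longrightarrow> f \<in> borel_measurable borel"
  by (simp add: Lp_def)

lemma Lp_ennreal:
  "r \<ge> 0 \<Longrightarrow> f \<in> Lp (ennreal r) \<longleftrightarrow> f \<in> borel_measurable borel \<and> integrable lborel (\<lambda>x. norm (f x) powr r)"
  by (simp add: Lp_def)

lemma Lp_norm_ennreal:
  "r \<ge> 0 \<Longrightarrow> Lp_norm (ennreal r) f = (\<integral>x. norm (f x) powr r \<partial>lborel) powr (1 / r)"
  by (simp add: Lp_norm_def)

lemma emeasure_lborel_UNIV_nonzero: "emeasure lborel (space (lborel :: 'a::euclidean_space measure)) \<noteq> 0"
  by (simp add: emeasure_lborel_UNIV)

lemma esssup_norm_nonneg: "0 \<le> esssup lborel (\<lambda>x::real^'n::finite. ereal (norm (f x :: complex)))"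
proof (cases "(\<lambda>x. ereal (norm (f x))) \<in> borel_measurable lborel")
  case True
  have "esssup lborel (\<lambda>x::real^'n. 0 :: ereal) \<le> esssup lborel (\<lambda>x. ereal (norm (f x)))"
    by (rule esssup_mono) auto
  then show ?thesis using esssup_const[OF emeasure_lborel_UNIV_nonzero[where 'a = "real^'n"], of "0::ereal"] by simp
qed (simp add: esssup_non_measurable)

lemma Lp_norm_nonneg [simp]: "0 \<le> Lp_norm p f"
  using esssup_norm_nonneg[of f] by (simp add: Lp_norm_def real_of_ereal_pos)

lemma
  fixes f :: "real^'n::finite \<Rightarrow> complex"
  assumes "f \<in> borel_measurable borel" "\<And>x. norm (f x) \<le> C"
  shows Lp_infinity_bounded: "f \<in> Lp \<infinity>" and Lp_norm_infinity_le: "Lp_norm \<infinity> f \<le> C"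
proof -
  have le: "esssup lborel (\<lambda>x. ereal (norm (f x))) \<le> ereal C"
    by (rule esssup_I) (use assms in auto)
  then show "f \<in> Lp \<infinity>"
    unfolding Lp_def using assms(1) le_less_trans[OF le, of \<infinity>] by simp
  show "Lp_norm \<infinity> f \<le> C"
    using le esssup_norm_nonneg[of f] unfolding Lp_norm_def
    by (cases "esssup lborel (\<lambda>x. ereal (norm (f x)))") auto
qed

text \<open>A closed set of full Lebesgue measure is the whole space, so for a continuous function
  the essential bound holds at every point.\<close>

lemma norm_le_Lp_norm_infinity:
  fixes f :: "real^'n::finite \<Rightarrow> complex"
  assumes f: "f \<in> Lp \<infinity>" and cont: "continuous_on UNIV f"
  shows "norm (f x) \<le> Lp_norm \<infinity> f"
proof -
  let ?e = "esssup lborel (\<lambda>x. ereal (norm (f x)))"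
  have "?e = ereal (Lp_norm \<infinity> f)"
    using f esssup_norm_nonneg[of f] unfolding Lp_def Lp_norm_def by (cases ?e) auto
  then have "AE x in lborel. x \<in> {x. norm (f x) \<le> Lp_norm \<infinity> f}"
    using esssup_AE[where M = lborel and f = "\<lambda>x. ereal (norm (f x))"] by simp
  then have "AE x in lebesgue. x \<in> {x. norm (f x) \<le> Lp_norm \<infinity> f}"
    by (rule AE_completion)
  moreover have "closed {x. norm (f x) \<le> Lp_norm \<infinity> f}"
    by (intro closed_Collect_le continuous_intros cont)
  ultimately show ?thesis
    using mem_closed_if_AE_lebesgue by blast
qed

text \<open>For p = \<infinity> continuity of g turns its essential bound into a pointwise one,
  which then passes to f; for finite p the powers are compared under the integral.\<close>

lemma
  fixes f g :: "real^'n::finite \<Rightarrow> complex"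
  assumes p: "1 \<le> p" and g: "g \<in> Lp p" "continuous_on UNIV g"
    and f: "f \<in> borel_measurable borel" and C: "C \<ge> 0" and le: "\<And>x. norm (f x) \<le> C * norm (g x)"
  shows Lp_dominated: "f \<in> Lp p" and Lp_norm_dominated: "Lp_norm p f \<le> C * Lp_norm p g"
proof -
  have "f \<in> Lp p \<and> Lp_norm p f \<le> C * Lp_norm p g"
  proof (cases "p = \<infinity>")
    case True
    have "norm (f x) \<le> C * Lp_norm \<infinity> g" for x
      using norm_le_Lp_norm_infinity[of g x] g True C le[of x] by (meson mult_left_mono order_trans)
    then show ?thesis
      using Lp_infinity_bounded Lp_norm_infinity_le f True by blast
  next
    case False
    then obtain r where r: "p = ennreal r" "r \<ge> 0" by (cases p) auto
    with p have r1: "r \<ge> 1" by simp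
    have gi: "integrable lborel (\<lambda>x. norm (g x) powr r)"
      using g r by (simp add: Lp_ennreal)
    have bd: "norm (f x) powr r \<le> C powr r * norm (g x) powr r" for x
      using le[of x] r C by (simp add: powr_mult[symmetric] powr_mono2)
    have fi: "integrable lborel (\<lambda>x. norm (f x) powr r)"
      by (rule integrable_norm_bound[of _ "\<lambda>x. C powr r * norm (g x) powr r"]) (use gi f bd in auto)
    have "(\<integral>x. norm (f x) powr r \<partial>lborel) \<le> (\<integral>x. C powr r * norm (g x) powr r \<partial>lborel)"
      by (rule integral_mono) (use fi gi bd in auto)
    then have "(\<integral>x. norm (f x) powr r \<partial>lborel) powr (1 / r) \<le> (C powr r * (\<integral>x. norm (g x) powr r \<partial>lborel)) powr (1 / r)"
      using r1 by (intro powr_mono2) auto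
    also have "\<dots> = C * (\<integral>x. norm (g x) powr r \<partial>lborel) powr (1 / r)"
      using C r1 by (simp add: powr_mult powr_powr)
    finally show ?thesis
      using fi f r by (simp add: Lp_ennreal Lp_norm_ennreal)
  qed
  then show "f \<in> Lp p" "Lp_norm p f \<le> C * Lp_norm p g" by auto
qed

lemma Lp_uminus: "f \<in> Lp p \<Longrightarrow> (\<lambda>x. - f x) \<in> Lp p"
  unfolding Lp_def by (simp split: if_splits)

lemma Lp_add:
  fixes f g :: "real^'n::finite \<Rightarrow> complex"
  assumes p: "1 \<le> p" and f: "f \<in> Lp p" and g: "g \<in> Lp p"
  shows "(\<lambda>x. f x + g x) \<in> Lp p"
proof (cases "p = \<infinity>")
  case True
  let ?F = "\<lambda>x. ereal (norm (f x))" and ?G = "\<lambda>x. ereal (norm (g x))"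
  have m: "f \<in> borel_measurable borel" "g \<in> borel_measurable borel"
    using f g by (auto dest: Lp_measurable)
  have "esssup lborel (\<lambda>x. ereal (norm (f x + g x))) \<le> esssup lborel (\<lambda>x. ?F x + ?G x)"
    by (rule esssup_mono) (use m in \<open>auto simp: norm_triangle_ineq\<close>)
  also have "\<dots> \<le> esssup lborel ?F + esssup lborel ?G" by (rule esssup_add)
  also have "\<dots> < \<infinity>" using f g True by (simp add: Lp_def)
  finally show ?thesis using True m by (simp add: Lp_def)
next
  case False
  then obtain r where r: "p = ennreal r" "r \<ge> 0" by (cases p) auto
  have fg: "f \<in> borel_measurable borel" "g \<in> borel_measurable borel"
    "integrable lborel (\<lambda>x. norm (f x) powr r)" "integrable lborel (\<lambda>x. norm (g x) powr r)"
    using f g r by (auto simp: Lp_ennreal)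
  have "integrable lborel (\<lambda>x. norm (f x + g x) powr r)"
  proof (rule integrable_norm_bound[of _ "\<lambda>x. 2 powr r * (norm (f x) powr r + norm (g x) powr r)"])
    fix x
    \<comment> \<open>Only membership is wanted, so the crude factor 2^r takes the place of
      Minkowski's inequality.\<close>
    have "norm (f x + g x) \<le> 2 * max (norm (f x)) (norm (g x))"
      using norm_triangle_ineq[of "f x" "g x"] by auto
    then have "norm (f x + g x) powr r \<le> 2 powr r * max (norm (f x)) (norm (g x)) powr r"
      using r by (simp add: powr_mult[symmetric] powr_mono2)
    also have "max (norm (f x)) (norm (g x)) powr r \<le> norm (f x) powr r + norm (g x) powr r"
      by (auto simp: max_def)
    finally show "norm (norm (f x + g x) powr r) \<le> 2 powr r * (norm (f x) powr r + norm (g x) powr r)" by simp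
  qed (use fg in auto)
  then show ?thesis using r fg by (simp add: Lp_ennreal)
qed

lemma Lp_diff: "1 \<le> p \<Longrightarrow> f \<in> Lp p \<Longrightarrow> g \<in> Lp p \<Longrightarrow> (\<lambda>x. f x - g x) \<in> Lp p"
  using Lp_add[OF _ _ Lp_uminus, of p f g] by simp

lemma continuous_on_weight_complex: "continuous_on A (\<lambda>x. complex_of_real (weight x))"
  by (intro continuous_intros continuous_weight)

lemma weight_Lp:
  assumes p: "1 \<le> p"
  shows "(\<lambda>x. complex_of_real (weight x)) \<in> Lp p"
proof (cases "p = \<infinity>")
  case True
  have "norm (complex_of_real (weight x)) \<le> 1" for x :: "real^'a"
    using weight_le_1[of x] by simp
  moreover have "(\<lambda>x::real^'a. complex_of_real (weight x)) \<in> borel_measurable borel"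
    by measurable
  ultimately show ?thesis
    using True Lp_infinity_bounded by blast
next
  case False
  then obtain r where r: "p = ennreal r" "r \<ge> 0" by (cases p) auto
  with p have r1: "r \<ge> 1" by simp
  have "integrable lborel (\<lambda>x::real^'a. weight x powr r)"
  proof (rule integrable_weight_bound[of _ 1])
    fix x :: "real^'a"
    have "weight x powr r \<le> weight x powr 1"
      by (rule powr_mono') (use r1 weight_le_1 in auto)
    then show "norm (weight x powr r) \<le> 1 * weight x" by simp
  qed simp
  then show ?thesis using r by (simp add: Lp_ennreal)
qed

lemma
  fixes f :: "real^'n::finite \<Rightarrow> complex"
  assumes p: "1 \<le> p" and f: "f \<in> borel_measurable borel" and C: "C \<ge> 0"
    and le: "\<And>x. norm (f x) \<le> C * weight x"
  shows Lp_weight_bound: "f \<in> Lp p"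
    and Lp_norm_weight_bound: "Lp_norm p f \<le> C * Lp_norm p (\<lambda>x::real^'n. complex_of_real (weight x))"
  using Lp_dominated[OF p weight_Lp[OF p] continuous_on_weight_complex f C]
    Lp_norm_dominated[OF p weight_Lp[OF p] continuous_on_weight_complex f C] le by auto

section \<open>Hoelder's inequality and averages of translates\<close>

lemma Hoelder_real:
  fixes f g :: "'w \<Rightarrow> real"
  assumes rs: "1 < r" "1 < s" "1 / r + 1 / s = 1"
    and f: "f \<in> borel_measurable M" "\<And>x. 0 \<le> f x" "integrable M (\<lambda>x. f x powr r)"
    and g: "g \<in> borel_measurable M" "\<And>x. 0 \<le> g x" "integrable M (\<lambda>x. g x powr s)"
  shows "integrable M (\<lambda>x. f x * g x)"
    and "(\<integral>x. f x * g x \<partial>M) \<le> (\<integral>x. f x powr r \<partial>M) powr (1 / r) * (\<integral>x. g x powr s \<partial>M) powr (1 / s)"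
proof -
  have young: "a * b \<le> a powr r / r + b powr s / s" if "a \<ge> 0" "b \<ge> 0" for a b
    using Youngs_inequality[of r s a b] rs that by simp
  show int: "integrable M (\<lambda>x. f x * g x)"
    by (rule integrable_norm_bound[of _ "\<lambda>x. f x powr r / r + g x powr s / s"])
       (use f g young in auto)
  define A where "A = (\<integral>x. f x powr r \<partial>M) powr (1 / r)"
  define B where "B = (\<integral>x. g x powr s \<partial>M) powr (1 / s)"
  have AB: "A \<ge> 0" "B \<ge> 0" by (auto simp: A_def B_def)
  have Ar: "A powr r = (\<integral>x. f x powr r \<partial>M)" and Bs: "B powr s = (\<integral>x. g x powr s \<partial>M)"
    using rs by (auto simp: A_def B_def powr_powr)
  have "(\<integral>x. f x * g x \<partial>M) \<le> A * B"
  proof (cases "A = 0 \<or> B = 0")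
    case True
    have "AE x in M. f x * g x = 0"
    proof (cases "A = 0")
      case True
      then have "(\<integral>x. f x powr r \<partial>M) = 0" using Ar by simp
      then have "AE x in M. f x powr r = 0"
        by (subst (asm) integral_nonneg_eq_0_iff_AE) (use f in auto)
      then show ?thesis by eventually_elim simp
    next
      case False
      then have "(\<integral>x. g x powr s \<partial>M) = 0" using True Bs by simp
      then have "AE x in M. g x powr s = 0"
        by (subst (asm) integral_nonneg_eq_0_iff_AE) (use g in auto)
      then show ?thesis by eventually_elim simp
    qed
    then have "(\<integral>x. f x * g x \<partial>M) = 0"
      by (simp add: integral_eq_zero_AE)
    then show ?thesis using AB by simp
  next
    case False
    \<comment> \<open>Young's inequality is applied to f / A and g / B, whose powers integrate to 1;
      the two terms then give 1/r + 1/s = 1.\<close>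
    with AB have pos: "A > 0" "B > 0" by auto
    have "(\<integral>x. (f x / A) * (g x / B) \<partial>M) \<le> (\<integral>x. (f x powr r / A powr r) / r + (g x powr s / B powr s) / s \<partial>M)"
    proof (rule integral_mono)
      show "integrable M (\<lambda>x. (f x / A) * (g x / B))" using int by simp
      show "(f x / A) * (g x / B) \<le> (f x powr r / A powr r) / r + (g x powr s / B powr s) / s" for x
        using young[of "f x / A" "g x / B"] f(2)[of x] g(2)[of x] pos by (simp add: powr_divide)
    qed (use f g in auto)
    also have "\<dots> = (A powr r / A powr r) / r + (B powr s / B powr s) / s"
      unfolding Ar Bs using f g by simp
    also have "\<dots> = 1" using rs pos by simp
    finally show ?thesis using pos by (simp add: field_simps)
  qed
  then show "(\<integral>x. f x * g x \<partial>M) \<le> (\<integral>x. f x powr r \<partial>M) powr (1 / r) * (\<integral>x. g x powr s \<partial>M) powr (1 / s)"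
    by (simp add: A_def B_def)
qed

text \<open>For q = 1 the factor f is bounded pointwise, which is where its continuity enters;
  otherwise this is the real inequality for the moduli.\<close>

lemma
  fixes f g :: "real^'n::finite \<Rightarrow> complex"
  assumes q: "1 \<le> q" "q < \<infinity>" and g: "g \<in> Lp q"
    and f: "f \<in> Lp (conj_exponent q)" "continuous_on UNIV f"
  shows Hoelder_integrable: "integrable lborel (\<lambda>x. g x * f x)"
    and Hoelder: "norm (pairing g f) \<le> Lp_norm q g * Lp_norm (conj_exponent q) f"
proof -
  have mf: "f \<in> borel_measurable borel" and mg: "g \<in> borel_measurable borel"
    using f g by (auto dest: Lp_measurable)
  have *: "integrable lborel (\<lambda>x. norm (g x) * norm (f x)) \<and>
    (\<integral>x. norm (g x) * norm (f x) \<partial>lborel) \<le> Lp_norm q g * Lp_norm (conj_exponent q) f"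
    using q
  proof (cases rule: conj_exponent_cases)
    case 1
    have fx: "norm (f x) \<le> Lp_norm \<infinity> f" for x
      using norm_le_Lp_norm_infinity f 1 by metis
    have gi: "integrable lborel (\<lambda>x. norm (g x))"
      using g 1 Lp_ennreal[of 1 g] by simp
    have ng: "Lp_norm q g = (\<integral>x. norm (g x) \<partial>lborel)"
      using 1 Lp_norm_ennreal[of 1 g] by (simp add: integral_nonneg_AE)
    have int: "integrable lborel (\<lambda>x. norm (g x) * norm (f x))"
      by (rule integrable_norm_bound[of _ "\<lambda>x. norm (g x) * Lp_norm \<infinity> f"])
         (use gi fx mf mg in \<open>auto intro!: mult_left_mono\<close>)
    have "(\<integral>x. norm (g x) * norm (f x) \<partial>lborel) \<le> (\<integral>x. norm (g x) * Lp_norm \<infinity> f \<partial>lborel)"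
      by (rule integral_mono) (use int gi fx in \<open>auto intro!: mult_left_mono\<close>)
    with int show ?thesis using 1 ng by simp
  next
    case (2 r s)
    have "(\<lambda>x. norm (f x)) \<in> borel_measurable borel" "(\<lambda>x. norm (g x)) \<in> borel_measurable borel"
      using mf mg by measurable
    with 2 show ?thesis
      using Hoelder_real[of r s "\<lambda>x. norm (g x)" lborel "\<lambda>x. norm (f x)"] f g
      by (simp add: Lp_ennreal Lp_norm_ennreal)
  qed
  show int: "integrable lborel (\<lambda>x. g x * f x)"
    by (rule integrable_norm_bound[OF conjunct1[OF *]]) (use mf mg in \<open>auto simp: norm_mult\<close>)
  have "norm (pairing g f) \<le> (\<integral>x. norm (g x * f x) \<partial>lborel)"
    unfolding pairing_def by (rule integral_norm_bound)
  then show "norm (pairing g f) \<le> Lp_norm q g * Lp_norm (conj_exponent q) f"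
    using * by (simp add: norm_mult)
qed

lemma Lp_norm_tendsto_zero:
  fixes f :: "nat \<Rightarrow> real^'n::finite \<Rightarrow> complex"
  assumes p: "1 \<le> p" "p < \<infinity>" and g: "integrable lborel (\<lambda>x. (g x :: real) powr enn2real p)"
    and f: "\<And>k. f k \<in> borel_measurable borel" and le: "\<And>k x. norm (f k x) \<le> g x"
    and lim: "\<And>x. (\<lambda>k. f k x) \<longlonglongrightarrow> 0"
  shows "(\<lambda>k. Lp_norm p (f k)) \<longlonglongrightarrow> 0"
proof -
  obtain r where r: "p = ennreal r" "r \<ge> 0" using p(2) by (cases p) auto
  with p have r1: "r \<ge> 1" by simp
  have "(\<lambda>k. \<integral>x. norm (f k x) powr r \<partial>lborel) \<longlonglongrightarrow> integral\<^sup>L lborel (\<lambda>x::real^'n. 0)"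
  proof (rule integral_dominated_convergence[where w = "\<lambda>x. g x powr r"])
    show "AE x in lborel. (\<lambda>k. norm (f k x) powr r) \<longlonglongrightarrow> 0"
      by (rule AE_I2, rule tendsto_zero_powrI[OF tendsto_norm_zero[OF lim] tendsto_const]) (use r1 in auto)
    show "AE x in lborel. norm (norm (f k x) powr r) \<le> g x powr r" for k
      by (rule AE_I2) (use le r in \<open>auto intro!: powr_mono2\<close>)
  qed (use f g r in auto)
  then have "(\<lambda>k. \<integral>x. norm (f k x) powr r \<partial>lborel) \<longlonglongrightarrow> 0" by simp
  then have "(\<lambda>k. (\<integral>x. norm (f k x) powr r \<partial>lborel) powr (1 / r)) \<longlonglongrightarrow> 0"
    by (rule tendsto_zero_powrI[OF _ tendsto_const]) (use r1 in auto)
  then show ?thesis using r by (simp add: Lp_norm_ennreal)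
qed

text \<open>Young's convolution inequality, for averages of translates over an arbitrary measure.
  For finite r, Hoelder with |k| = |k|^(1/s) |k|^(1/r) gives |F x|^r \<le> K^(r-1) times the average
  of |\<phi>|^r with weight |k|, where K is the total mass of |k|; Fubini and translation invariance
  then turn this into K^r times the integral of |\<phi>|^r.\<close>

lemma
  fixes \<phi> :: "real^'n::finite \<Rightarrow> complex" and k :: "'w \<Rightarrow> complex"
  assumes M: "sigma_finite_measure M" and k: "integrable M k" and b: "b \<in> M \<rightarrow>\<^sub>M borel"
    and cont: "continuous_on UNIV \<phi>" and bd: "\<And>x. norm (\<phi> x) \<le> B" and \<phi>: "\<phi> \<in> Lp p"
    and p: "p = \<infinity> \<or> (\<exists>r>1. p = ennreal r)"
  shows Lp_average: "(\<lambda>x. \<integral>w. k w * \<phi> (x + b w) \<partial>M) \<in> Lp p"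
    and Lp_norm_average: "Lp_norm p (\<lambda>x. \<integral>w. k w * \<phi> (x + b w) \<partial>M) \<le> (\<integral>w. norm (k w) \<partial>M) * Lp_norm p \<phi>"
proof -
  interpret M: sigma_finite_measure M by fact
  interpret P: pair_sigma_finite M "lborel :: (real^'n) measure" ..
  let ?F = "\<lambda>x. \<integral>w. k w * \<phi> (x + b w) \<partial>M"
  have m\<phi>: "\<phi> \<in> borel_measurable borel" by (rule borel_measurable_continuous_onI[OF cont])
  have mk: "k \<in> borel_measurable M" using k by auto
  have mF: "?F \<in> borel_measurable borel"
  proof -
    have "(\<lambda>(x, w). k w * \<phi> (x + b w)) \<in> borel_measurable (borel \<Otimes>\<^sub>M M)"
      using m\<phi> mk b by measurable
    then show ?thesis
      by (rule M.borel_measurable_lebesgue_integral)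
  qed
  have bd2: "integrable M (\<lambda>w. norm (k w) * h (\<phi> (x + b w)))"
    if "h \<in> borel_measurable borel" "\<And>x. norm (h (\<phi> x)) \<le> B'" for h :: "complex \<Rightarrow> real" and B' x
    by (rule integrable_norm_bound[of _ "\<lambda>w. norm (k w) * B'"])
       (use k that mk m\<phi> b in \<open>auto simp: abs_mult intro!: mult_left_mono\<close>)
  have nF: "norm (?F x) \<le> (\<integral>w. norm (k w) * norm (\<phi> (x + b w)) \<partial>M)" for x
    using integral_norm_bound[of M "\<lambda>w. k w * \<phi> (x + b w)"] by (simp add: norm_mult)
  have "?F \<in> Lp p \<and> Lp_norm p ?F \<le> (\<integral>w. norm (k w) \<partial>M) * Lp_norm p \<phi>"
    using p
  proof
    assume p: "p = \<infinity>"
    have "norm (?F x) \<le> (\<integral>w. norm (k w) \<partial>M) * Lp_norm \<infinity> \<phi>" for x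
    proof -
      have "(\<integral>w. norm (k w) * norm (\<phi> (x + b w)) \<partial>M) \<le> (\<integral>w. norm (k w) * Lp_norm \<infinity> \<phi> \<partial>M)"
        by (rule integral_mono)
           (use bd2[of norm B] bd k norm_le_Lp_norm_infinity[of \<phi>] \<phi> p cont in \<open>auto intro!: mult_left_mono\<close>)
      with nF[of x] show ?thesis by simp
    qed
    then show ?thesis
      using p Lp_infinity_bounded[OF mF] Lp_norm_infinity_le[OF mF] by blast
  next
    assume "\<exists>r>1. p = ennreal r"
    then obtain r where r: "r > 1" "p = ennreal r" by blast
    define K where "K = (\<integral>w. norm (k w) \<partial>M)"
    have K: "K \<ge> 0" by (simp add: K_def)
    define s where "s = r / (r - 1)"
    have s: "s > 1" "1 / s + 1 / r = 1" using r by (auto simp: s_def field_simps)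
    have \<phi>i: "integrable lborel (\<lambda>x. norm (\<phi> x) powr r)" using \<phi> r by (simp add: Lp_ennreal)
    let ?G = "\<lambda>w x. norm (k w) * norm (\<phi> (x + b w)) powr r"
    have mG: "(\<lambda>(w, x). ?G w x) \<in> borel_measurable (M \<Otimes>\<^sub>M lborel)"
      using m\<phi> mk b by measurable
    have shift: "integrable lborel (\<lambda>x. norm (\<phi> (x + a)) powr r)"
      "(\<integral>x. norm (\<phi> (x + a)) powr r \<partial>lborel) = (\<integral>x. norm (\<phi> x) powr r \<partial>lborel)" for a
      using integrable_affine_iff[of 1 "\<lambda>x. norm (\<phi> x) powr r" a] integral_affine[of 1 "\<lambda>x. norm (\<phi> x) powr r" a] \<phi>i
      by simp_all
    have Gi: "integrable (M \<Otimes>\<^sub>M lborel) (\<lambda>(w, x). ?G w x)"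
    proof (rule P.Fubini_integrable[OF mG])
      show "integrable M (\<lambda>w. \<integral>x. norm (case (w, x) of (w, x) \<Rightarrow> ?G w x) \<partial>lborel)"
        using k by (simp add: shift)
      show "AE w in M. integrable lborel (\<lambda>x. case (w, x) of (w, x) \<Rightarrow> ?G w x)"
        by (simp add: shift)
    qed
    have pt: "norm (?F x) powr r \<le> K powr (r - 1) * (\<integral>w. ?G w x \<partial>M)" for x
    proof -
      have "norm (\<phi> x) powr r \<le> B powr r" for x
        using bd[of x] r by (intro powr_mono2) auto
      then have Gx: "integrable M (\<lambda>w. ?G w x)"
        by (intro bd2[of "\<lambda>z. norm z powr r" "B powr r"]) auto
      have kk: "norm (k w) = norm (k w) powr (1 / s) * norm (k w) powr (1 / r)" for w
        using s by (simp flip: powr_add)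
      have e1: "(norm (k w) powr (1 / s)) powr s = norm (k w)" for w using s by (simp add: powr_powr)
      have e2: "(norm (k w) powr (1 / r) * norm (\<phi> (x + b w))) powr r = ?G w x" for w
        using r by (simp add: powr_mult powr_powr)
      have "(\<integral>w. norm (k w) powr (1 / s) * (norm (k w) powr (1 / r) * norm (\<phi> (x + b w))) \<partial>M)
         \<le> (\<integral>w. (norm (k w) powr (1 / s)) powr s \<partial>M) powr (1 / s)
          * (\<integral>w. (norm (k w) powr (1 / r) * norm (\<phi> (x + b w))) powr r \<partial>M) powr (1 / r)"
        by (rule Hoelder_real(2)[of s r]) (use s r mk m\<phi> b k Gx in \<open>auto simp: e1 e2\<close>)
      then have "(\<integral>w. norm (k w) * norm (\<phi> (x + b w)) \<partial>M) \<le> K powr (1 / s) * (\<integral>w. ?G w x \<partial>M) powr (1 / r)"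
        unfolding e1 e2 K_def using kk by (simp add: mult.assoc[symmetric])
      with nF[of x] have "norm (?F x) \<le> K powr (1 / s) * (\<integral>w. ?G w x \<partial>M) powr (1 / r)" by simp
      then have "norm (?F x) powr r \<le> (K powr (1 / s) * (\<integral>w. ?G w x \<partial>M) powr (1 / r)) powr r"
        using r by (intro powr_mono2) auto
      also have "\<dots> = K powr (r / s) * (\<integral>w. ?G w x \<partial>M)"
        using r K by (simp add: powr_mult powr_powr)
      also have "r / s = r - 1" using r by (simp add: s_def)
      finally show ?thesis .
    qed
    have Gs: "integrable lborel (\<lambda>x. \<integral>w. ?G w x \<partial>M)"
      using P.integrable_snd[OF Gi] by simp
    have Geq: "(\<integral>x. (\<integral>w. ?G w x \<partial>M) \<partial>lborel) = K * (\<integral>x. norm (\<phi> x) powr r \<partial>lborel)"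
      using P.Fubini_integral[OF Gi] by (simp add: shift K_def)
    have Fi: "integrable lborel (\<lambda>x. norm (?F x) powr r)"
      by (rule integrable_norm_bound[of _ "\<lambda>x. K powr (r - 1) * (\<integral>w. ?G w x \<partial>M)"])
         (use Gs pt mF in auto)
    have "(\<integral>x. norm (?F x) powr r \<partial>lborel) \<le> (\<integral>x. K powr (r - 1) * (\<integral>w. ?G w x \<partial>M) \<partial>lborel)"
      by (rule integral_mono) (use Fi Gs pt in auto)
    also have "\<dots> = K powr r * (\<integral>x. norm (\<phi> x) powr r \<partial>lborel)"
    proof (cases "K = 0")
      case False
      then have "K powr r = K powr (r - 1) * K" using K powr_add[of K "r - 1" 1] by simp
      then show ?thesis by (simp add: Geq)
    qed (use r in simp)
    finally have "(\<integral>x. norm (?F x) powr r \<partial>lborel) powr (1 / r)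
       \<le> (K powr r * (\<integral>x. norm (\<phi> x) powr r \<partial>lborel)) powr (1 / r)"
      using r by (intro powr_mono2) auto
    also have "\<dots> = K * (\<integral>x. norm (\<phi> x) powr r \<partial>lborel) powr (1 / r)"
      using K r by (simp add: powr_mult powr_powr)
    finally show ?thesis
      using Fi mF r by (simp add: Lp_ennreal Lp_norm_ennreal K_def)
  qed
  then show "?F \<in> Lp p" "Lp_norm p ?F \<le> (\<integral>w. norm (k w) \<partial>M) * Lp_norm p \<phi>" by auto
qed

section \<open>The predual and its strong dual\<close>

lemma finite_short_lists: "finite {\<alpha>::'n::finite list. length \<alpha> \<le> m}"
  using finite_lists_length_le[of "UNIV :: 'n set" m] by simp

lemma Lp_norm_le_D_L_seminorm:
  "length \<alpha> \<le> m \<Longrightarrow> Lp_norm p (partial_derivs \<alpha> \<phi>) \<le> D_L_seminorm p m \<phi>"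
  unfolding D_L_seminorm_def
  by (intro cSUP_upper bdd_above_finite finite_imageI finite_short_lists) simp

lemma D_L_seminorm_le:
  "(\<And>\<alpha>. length \<alpha> \<le> m \<Longrightarrow> Lp_norm p (partial_derivs \<alpha> \<phi>) \<le> C) \<Longrightarrow> D_L_seminorm p m \<phi> \<le> C"
  unfolding D_L_seminorm_def by (intro cSUP_least) (auto intro!: exI[of _ "[]"])

lemma D_L_seminorm_nonneg [simp]: "0 \<le> D_L_seminorm p m \<phi>"
  by (rule order_trans[OF Lp_norm_nonneg Lp_norm_le_D_L_seminorm[of "[]"]]) simp

lemma D_L_seminorm_mono: "m \<le> k \<Longrightarrow> D_L_seminorm p m \<phi> \<le> D_L_seminorm p k \<phi>"
  by (intro D_L_seminorm_le Lp_norm_le_D_L_seminorm) simp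

lemma D_L_seminorm_partial_derivs:
  "D_L_seminorm p m (partial_derivs \<beta> \<phi>) \<le> D_L_seminorm p (m + length \<beta>) \<phi>"
  by (intro D_L_seminorm_le) (auto simp flip: partial_derivs_append intro: Lp_norm_le_D_L_seminorm)

section \<open>The predual as a vector space closed under derivatives\<close>

context
  fixes q :: ennreal
  assumes q: "1 \<le> q" "q < \<infinity>"
begin

lemma predual_D_L: "\<phi> \<in> predual q \<Longrightarrow> \<phi> \<in> D_L (conj_exponent q)"
  by (auto simp: predual_def B_dot_def conj_exponent_def split: if_splits)

lemma predual_smooth: "\<phi> \<in> predual q \<Longrightarrow> smooth \<phi>"
  using predual_D_L by (auto simp: D_L_def)

lemma predual_Lp: "\<phi> \<in> predual q \<Longrightarrow> partial_derivs \<alpha> \<phi> \<in> Lp (conj_exponent q)"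
  using predual_D_L by (auto simp: D_L_def)

lemma predual_Lp_0: "\<phi> \<in> predual q \<Longrightarrow> \<phi> \<in> Lp (conj_exponent q)"
  using predual_Lp[of \<phi> "[]"] by simp

lemma predual_tendsto: "\<phi> \<in> predual q \<Longrightarrow> q = 1 \<Longrightarrow> (partial_derivs \<alpha> \<phi> \<longlongrightarrow> 0) at_infinity"
  by (auto simp: predual_def B_dot_def)

lemma predualI:
  assumes "smooth \<phi>" "\<And>\<alpha>. partial_derivs \<alpha> \<phi> \<in> Lp (conj_exponent q)"
    "\<And>\<alpha>. q = 1 \<Longrightarrow> (partial_derivs \<alpha> \<phi> \<longlongrightarrow> 0) at_infinity"
  shows "\<phi> \<in> predual q"
  using assms by (auto simp: predual_def B_dot_def D_L_def conj_exponent_def)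

lemma predual_partial_derivs: "\<phi> \<in> predual q \<Longrightarrow> partial_derivs \<alpha> \<phi> \<in> predual q"
  by (intro predualI)
     (auto intro: predual_smooth predual_Lp predual_tendsto simp flip: partial_derivs_append)

lemma predual_add:
  assumes "\<phi> \<in> predual q" "\<psi> \<in> predual q"
  shows "(\<lambda>x. \<phi> x + \<psi> x) \<in> predual q"
proof (rule predualI)
  note sm = predual_smooth[OF assms(1)] predual_smooth[OF assms(2)]
  show "smooth (\<lambda>x. \<phi> x + \<psi> x)" using sm by (rule smooth_add)
  fix \<alpha>
  show "partial_derivs \<alpha> (\<lambda>x. \<phi> x + \<psi> x) \<in> Lp (conj_exponent q)"
    unfolding partial_derivs_add[OF sm]
    by (intro Lp_add one_le_conj_exponent predual_Lp assms q)
  show "(partial_derivs \<alpha> (\<lambda>x. \<phi> x + \<psi> x) \<longlongrightarrow> 0) at_infinity" if "q = 1"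
    unfolding partial_derivs_add[OF sm]
    using tendsto_add[OF predual_tendsto[OF assms(1) that] predual_tendsto[OF assms(2) that]] by simp
qed

lemma Lp_norm_cmult_le:
  assumes "f \<in> Lp (conj_exponent q)" "continuous_on UNIV f"
  shows "Lp_norm (conj_exponent q) (\<lambda>x. c * f x) \<le> norm c * Lp_norm (conj_exponent q) f"
  by (rule Lp_norm_dominated[OF one_le_conj_exponent[OF q] assms])
     (use Lp_measurable[OF assms(1)] in \<open>auto simp: norm_mult\<close>)

lemma Lp_cmult:
  assumes "f \<in> Lp (conj_exponent q)" "continuous_on UNIV f"
  shows "(\<lambda>x. c * f x) \<in> Lp (conj_exponent q)"
  by (rule Lp_dominated[OF one_le_conj_exponent[OF q] assms, where C = "norm c"])
     (use Lp_measurable[OF assms(1)] in \<open>auto simp: norm_mult\<close>)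

lemma predual_cmult:
  assumes "\<phi> \<in> predual q"
  shows "(\<lambda>x. c * \<phi> x) \<in> predual q"
proof (rule predualI)
  note sm = predual_smooth[OF assms]
  show "smooth (\<lambda>x. c * \<phi> x)" using sm by (rule smooth_cmult)
  fix \<alpha>
  show "partial_derivs \<alpha> (\<lambda>x. c * \<phi> x) \<in> Lp (conj_exponent q)"
    unfolding partial_derivs_cmult[OF sm]
    by (intro Lp_cmult predual_Lp assms continuous_on_partial_derivs sm)
  show "(partial_derivs \<alpha> (\<lambda>x. c * \<phi> x) \<longlongrightarrow> 0) at_infinity" if "q = 1"
    unfolding partial_derivs_cmult[OF sm]
    using tendsto_mult_left[OF predual_tendsto[OF assms that], of c] by simp
qed

lemma predual_diff:
  "\<phi> \<in> predual q \<Longrightarrow> \<psi> \<in> predual q \<Longrightarrow> (\<lambda>x. \<phi> x - \<psi> x) \<in> predual q"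
  using predual_add[OF _ predual_cmult[of \<psi> "-1"]] by simp

lemma decaying_Lp: "decaying f \<Longrightarrow> partial_derivs \<alpha> f \<in> Lp (conj_exponent q)"
proof -
  assume f: "decaying f"
  obtain C where C: "C > 0" "\<And>x. norm (partial_derivs \<alpha> f x) \<le> C * weight x"
    using decaying_bound[OF f] by blast
  show ?thesis
    by (rule Lp_weight_bound[OF one_le_conj_exponent[OF q] _ _ C(2)])
       (use C f in \<open>auto intro: borel_measurable_partial_derivs decaying_smooth\<close>)
qed

lemma decaying_predual: "decaying f \<Longrightarrow> f \<in> predual q"
proof (rule predualI)
  assume f: "decaying f"
  fix \<alpha>
  obtain C where C: "C > 0" "\<And>x. norm (partial_derivs \<alpha> f x) \<le> C * weight x"
    using decaying_bound[OF f] by blast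
  show "(partial_derivs \<alpha> f \<longlongrightarrow> 0) at_infinity"
    by (rule Lim_null_comparison[OF _ tendsto_mult_right_zero[OF tendsto_weight, of C]])
       (simp add: C always_eventually)
qed (auto intro: decaying_smooth decaying_Lp)

lemma test_functions_predual: "\<phi> \<in> test_functions \<Longrightarrow> \<phi> \<in> predual q"
  by (intro decaying_predual test_functions_decaying)

lemma predual_zero: "(\<lambda>x. 0) \<in> predual q"
  using predual_cmult[OF decaying_predual[OF decaying_gauss], of 0] by simp

lemma D_L_seminorm_cmult:
  assumes "\<phi> \<in> predual q"
  shows "D_L_seminorm (conj_exponent q) m (\<lambda>x. c * \<phi> x) \<le> norm c * D_L_seminorm (conj_exponent q) m \<phi>"
proof (rule D_L_seminorm_le)
  fix \<alpha> :: "'a list" assume "length \<alpha> \<le> m"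
  then have "norm c * Lp_norm (conj_exponent q) (partial_derivs \<alpha> \<phi>) \<le> norm c * D_L_seminorm (conj_exponent q) m \<phi>"
    by (intro mult_left_mono Lp_norm_le_D_L_seminorm) auto
  then show "Lp_norm (conj_exponent q) (partial_derivs \<alpha> (\<lambda>x. c * \<phi> x)) \<le> norm c * D_L_seminorm (conj_exponent q) m \<phi>"
    unfolding partial_derivs_cmult[OF predual_smooth[OF assms]]
    using Lp_norm_cmult_le[OF predual_Lp[OF assms] continuous_on_partial_derivs[OF predual_smooth[OF assms]]]
      order_trans by blast
qed

section \<open>Continuous functionals and their seminorm bounds\<close>

lemma D'_L_outside: "S \<in> D'_L q \<Longrightarrow> \<phi> \<notin> predual q \<Longrightarrow> S \<phi> = 0"
  by (simp add: D'_L_def dual_space_def)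

lemma D'_L_add: "S \<in> D'_L q \<Longrightarrow> \<phi> \<in> predual q \<Longrightarrow> \<psi> \<in> predual q \<Longrightarrow> S (\<lambda>x. \<phi> x + \<psi> x) = S \<phi> + S \<psi>"
  by (simp add: D'_L_def dual_space_def linear_functional_def)

lemma D'_L_cmult: "S \<in> D'_L q \<Longrightarrow> \<phi> \<in> predual q \<Longrightarrow> S (\<lambda>x. c * \<phi> x) = c * S \<phi>"
  by (simp add: D'_L_def dual_space_def linear_functional_def)

lemma D'_L_zero: "S \<in> D'_L q \<Longrightarrow> S (\<lambda>x. 0) = 0"
  using D'_L_cmult[of S "\<lambda>x. 0" 0] predual_zero by simp

lemma D'_L_diff: "S \<in> D'_L q \<Longrightarrow> \<phi> \<in> predual q \<Longrightarrow> \<psi> \<in> predual q \<Longrightarrow> S (\<lambda>x. \<phi> x - \<psi> x) = S \<phi> - S \<psi>"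
  using D'_L_add[of S \<phi> "\<lambda>x. (-1) * \<psi> x"] D'_L_cmult[of S \<psi> "-1"] predual_cmult[of \<psi> "-1"] by simp

lemma predual_sum: "(\<And>i. i \<in> I \<Longrightarrow> f i \<in> predual q) \<Longrightarrow> (\<lambda>x. \<Sum>i\<in>I. f i x) \<in> predual q"
  by (induction I rule: infinite_finite_induct) (auto intro: predual_zero predual_add)

lemma D'_L_sum:
  assumes "S \<in> D'_L q"
  shows "(\<And>i. i \<in> I \<Longrightarrow> f i \<in> predual q) \<Longrightarrow> S (\<lambda>x. \<Sum>i\<in>I. f i x) = (\<Sum>i\<in>I. S (f i))"
  by (induction I rule: infinite_finite_induct)
     (auto simp: D'_L_zero[OF assms] D'_L_add[OF assms] predual_sum)

text \<open>A neighbourhood of 0 mapped into the unit disc involves finitely many seminorms. As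
  these increase with m, the largest index alone suffices, and homogeneity gives the bound.\<close>

lemma D'_L_bound:
  fixes S :: "(real^'n::finite \<Rightarrow> complex) \<Rightarrow> complex"
  assumes "S \<in> D'_L q"
  shows "\<exists>m. \<exists>c>0. \<forall>\<phi>\<in>predual q. norm (S \<phi>) \<le> c * D_L_seminorm (conj_exponent q) m \<phi>"
proof -
  let ?P = "D_L_seminorm (conj_exponent q) :: nat \<Rightarrow> (real^'n \<Rightarrow> complex) \<Rightarrow> real"
    and ?X = "predual q :: (real^'n \<Rightarrow> complex) set"
  have "continuous_map (seminorm_topology ?X (range ?P)) euclidean S"
    using assms by (simp add: D'_L_def dual_space_def)
  from openin_continuous_map_preimage[OF this, of "ball 0 1"]
  have op: "openin (seminorm_topology ?X (range ?P)) {\<phi>\<in>?X. S \<phi> \<in> ball 0 1}"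
    by simp
  have zero: "(\<lambda>x. 0) \<in> {\<phi>\<in>?X. S \<phi> \<in> ball 0 1}"
    using predual_zero D'_L_zero[OF assms] by simp
  obtain F \<epsilon> where F: "finite F" "F \<subseteq> range ?P" "\<epsilon> > 0"
    "{\<phi>\<in>?X. \<forall>p\<in>F. p (\<lambda>x. \<phi> x - 0) < \<epsilon>} \<subseteq> {\<phi>\<in>?X. S \<phi> \<in> ball 0 1}"
    using bspec[OF op[unfolded openin_seminorm_topology, THEN conjunct2] zero]
    by (elim exE conjE) (rule that)
  obtain I where I: "finite I" "F = ?P ` I"
    using F(1,2) finite_subset_image by metis
  define m where "m = Max (insert 0 I)"
  have m: "i \<le> m" if "i \<in> I" for i
    unfolding m_def using I(1) that by simp
  have unit: "norm (S \<phi>) < 1" if "\<phi> \<in> ?X" "?P m \<phi> < \<epsilon>" for \<phi>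
  proof -
    have "?P i \<phi> < \<epsilon>" if "i \<in> I" for i
      using D_L_seminorm_mono[OF m[OF that]] \<open>?P m \<phi> < \<epsilon>\<close> le_less_trans by blast
    then have "\<phi> \<in> {\<phi>\<in>?X. \<forall>p\<in>F. p (\<lambda>x. \<phi> x - 0) < \<epsilon>}" using I(2) that(1) by simp
    then have "\<phi> \<in> {\<phi>\<in>?X. S \<phi> \<in> ball 0 1}" using F(4) by blast
    then show ?thesis by simp
  qed
  have "norm (S \<phi>) \<le> (2 / \<epsilon>) * ?P m \<phi>" if \<phi>: "\<phi> \<in> ?X" for \<phi>
  proof -
    \<comment> \<open>Scaling by any t above the bound, and not by the seminorm itself, covers the
      case in which the seminorm of \<phi> vanishes.\<close>
    have *: "norm (S \<phi>) \<le> t" if "t > (2 / \<epsilon>) * ?P m \<phi>" for t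
    proof -
      have t: "t > 0" using that F(3) by (smt (verit) D_L_seminorm_nonneg divide_nonneg_pos mult_nonneg_nonneg)
      have "?P m (\<lambda>x. of_real (1 / t) * \<phi> x) \<le> (1 / t) * ?P m \<phi>"
        using D_L_seminorm_cmult[OF \<phi>, of m "of_real (1 / t)"] t by (simp del: of_real_divide)
      also have "\<dots> < \<epsilon>"
        using that t F(3) by (simp add: field_simps) (smt (verit) mult_pos_pos)
      finally have "norm (S (\<lambda>x. of_real (1 / t) * \<phi> x)) < 1"
        by (intro unit predual_cmult \<phi>)
      then have "norm (of_real (1 / t) * S \<phi>) < 1"
        by (simp only: D'_L_cmult[OF assms \<phi>])
      then show ?thesis
        using t by (simp add: norm_mult norm_divide field_simps)
    qed
    show ?thesis by (rule dense_ge) (rule *)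
  qed
  then show ?thesis using F(3) by (intro exI[of _ m] exI[of _ "2 / \<epsilon>"]) auto
qed

lemma D'_L_I:
  fixes S :: "(real^'n::finite \<Rightarrow> complex) \<Rightarrow> complex"
  assumes "\<And>\<phi>. \<phi> \<notin> predual q \<Longrightarrow> S \<phi> = 0"
    and add: "\<And>\<phi> \<psi>. \<phi> \<in> predual q \<Longrightarrow> \<psi> \<in> predual q \<Longrightarrow> S (\<lambda>x. \<phi> x + \<psi> x) = S \<phi> + S \<psi>"
    and cmult: "\<And>c \<phi>. \<phi> \<in> predual q \<Longrightarrow> S (\<lambda>x. c * \<phi> x) = c * S \<phi>"
    and bound: "\<And>\<phi>. \<phi> \<in> predual q \<Longrightarrow> norm (S \<phi>) \<le> c * D_L_seminorm (conj_exponent q) m \<phi>"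
  shows "S \<in> D'_L q"
proof -
  let ?P = "D_L_seminorm (conj_exponent q) :: nat \<Rightarrow> (real^'n \<Rightarrow> complex) \<Rightarrow> real"
    and ?X = "predual q :: (real^'n \<Rightarrow> complex) set"
  have diff: "S (\<lambda>x. \<phi> x - \<psi> x) = S \<phi> - S \<psi>" if "\<phi> \<in> ?X" "\<psi> \<in> ?X" for \<phi> \<psi>
    using add[OF that(1) predual_cmult[OF that(2), of "-1"]] cmult[OF that(2), of "-1"] by simp
  have "continuous_map (seminorm_topology ?X (range ?P)) euclidean S"
    unfolding continuous_map_def
  proof (intro conjI allI impI)
    fix U :: "complex set" assume "openin euclidean U"
    then have U: "open U" by simp
    show "openin (seminorm_topology ?X (range ?P)) {\<phi> \<in> topspace (seminorm_topology ?X (range ?P)). S \<phi> \<in> U}"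
      unfolding openin_seminorm_topology topspace_seminorm_topology
    proof (intro conjI ballI)
      fix \<phi> assume \<phi>: "\<phi> \<in> {\<phi> \<in> ?X. S \<phi> \<in> U}"
      then obtain e where e: "e > 0" "ball (S \<phi>) e \<subseteq> U" using U open_contains_ball by blast
      define \<epsilon> where "\<epsilon> = e / (\<bar>c\<bar> + 1)"
      have \<epsilon>: "\<epsilon> > 0" using e by (simp add: \<epsilon>_def)
      have "S \<psi> \<in> U" if "\<psi> \<in> ?X" "?P m (\<lambda>x. \<psi> x - \<phi> x) < \<epsilon>" for \<psi>
      proof -
        have "norm (S \<psi> - S \<phi>) \<le> c * ?P m (\<lambda>x. \<psi> x - \<phi> x)"
          using bound[OF predual_diff[OF that(1)], of \<phi>] diff[OF that(1)] \<phi> by simp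
        also have "\<dots> \<le> (\<bar>c\<bar> + 1) * ?P m (\<lambda>x. \<psi> x - \<phi> x)"
          by (intro mult_right_mono) auto
        also have "\<dots> < (\<bar>c\<bar> + 1) * \<epsilon>" using that by (intro mult_strict_left_mono) auto
        also have "\<dots> = e" by (simp add: \<epsilon>_def)
        finally show ?thesis using e(2) by (auto simp: dist_norm norm_minus_commute)
      qed
      then show "\<exists>F \<epsilon>. finite F \<and> F \<subseteq> range ?P \<and> \<epsilon> > 0 \<and>
          {\<psi> \<in> ?X. \<forall>p\<in>F. p (\<lambda>x. \<psi> x - \<phi> x) < \<epsilon>} \<subseteq> {\<phi> \<in> ?X. S \<phi> \<in> U}"
        using \<epsilon> by (intro exI[of _ "{?P m}"] exI[of _ \<epsilon>]) auto
    qed auto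
  qed auto
  then show ?thesis
    using assms(1) add cmult by (auto simp: D'_L_def dual_space_def linear_functional_def)
qed

lemma D'_L_diff_closed:
  fixes S T :: "(real^'n::finite \<Rightarrow> complex) \<Rightarrow> complex"
  assumes S: "S \<in> D'_L q" and T: "T \<in> D'_L q"
  shows "(\<lambda>\<phi>. S \<phi> - T \<phi>) \<in> D'_L q"
proof -
  let ?P = "D_L_seminorm (conj_exponent q) :: nat \<Rightarrow> (real^'n \<Rightarrow> complex) \<Rightarrow> real"
  obtain m c k d where c: "c > 0" "\<And>\<phi>. \<phi> \<in> predual q \<Longrightarrow> norm (S \<phi>) \<le> c * ?P m \<phi>"
    and d: "d > 0" "\<And>\<phi>. \<phi> \<in> predual q \<Longrightarrow> norm (T \<phi>) \<le> d * ?P k \<phi>"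
    using D'_L_bound[OF S] D'_L_bound[OF T] by metis
  show ?thesis
  proof (rule D'_L_I)
    fix \<phi> :: "real^'n \<Rightarrow> complex" assume \<phi>: "\<phi> \<in> predual q"
    have "norm (S \<phi> - T \<phi>) \<le> c * ?P m \<phi> + d * ?P k \<phi>"
      using c(2)[OF \<phi>] d(2)[OF \<phi>] norm_triangle_ineq4[of "S \<phi>" "T \<phi>"] by linarith
    also have "\<dots> \<le> c * ?P (max m k) \<phi> + d * ?P (max m k) \<phi>"
      using c(1) d(1) by (intro add_mono mult_left_mono D_L_seminorm_mono) auto
    finally show "norm (S \<phi> - T \<phi>) \<le> (c + d) * ?P (max m k) \<phi>" by (simp add: distrib_right)
  qed (use S T in \<open>auto simp: D'_L_outside D'_L_add D'_L_cmult algebra_simps\<close>)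
qed

section \<open>The strong topology: open balls and compact sets\<close>

definition dual_seminorm :: "(real^'n::finite \<Rightarrow> complex) set \<Rightarrow> ((real^'n \<Rightarrow> complex) \<Rightarrow> complex) \<Rightarrow> real" where
  "dual_seminorm B S = (SUP \<phi>\<in>B. norm (S \<phi>))"

abbreviation bounded_predual :: "(real^'n::finite \<Rightarrow> complex) set set" where
  "bounded_predual \<equiv> bounded_sets (predual q) (range (D_L_seminorm (conj_exponent q)))"

lemma norm_le_dual_seminorm:
  assumes B: "B \<in> bounded_predual" and S: "S \<in> D'_L q" and \<phi>: "\<phi> \<in> B"
  shows "norm (S \<phi>) \<le> dual_seminorm B S"
  unfolding dual_seminorm_def
proof (rule cSUP_upper[OF \<phi>])
  obtain m c where c: "c > 0" "\<And>\<phi>. \<phi> \<in> predual q \<Longrightarrow> norm (S \<phi>) \<le> c * D_L_seminorm (conj_exponent q) m \<phi>"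
    using D'_L_bound[OF S] by metis
  obtain K where K: "\<And>\<phi>. \<phi> \<in> B \<Longrightarrow> D_L_seminorm (conj_exponent q) m \<phi> \<le> K"
  proof -
    have "bdd_above (D_L_seminorm (conj_exponent q) m ` B)"
      using B by (auto simp: bounded_sets_def)
    then show thesis using that unfolding bdd_above_def by blast
  qed
  have "norm (S \<phi>) \<le> c * K" if "\<phi> \<in> B" for \<phi>
  proof -
    have "\<phi> \<in> predual q" using B that by (auto simp: bounded_sets_def)
    from c(2)[OF this] show ?thesis
      by (rule order_trans) (intro mult_left_mono K that less_imp_le c(1))
  qed
  then show "bdd_above ((\<lambda>\<phi>. norm (S \<phi>)) ` B)" by (rule bdd_aboveI2)
qed

lemma dual_seminorm_le:
  "B \<in> bounded_predual \<Longrightarrow> (\<And>\<phi>. \<phi> \<in> B \<Longrightarrow> norm (S \<phi>) \<le> C) \<Longrightarrow> dual_seminorm B S \<le> C"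
  unfolding dual_seminorm_def by (intro cSUP_least) (auto simp: bounded_sets_def)

lemma openin_D'_L_topology:
  "openin (D'_L_topology q) U \<longleftrightarrow> U \<subseteq> D'_L q \<and>
     (\<forall>S\<in>U. \<exists>F \<epsilon>. finite F \<and> F \<subseteq> dual_seminorm ` bounded_predual \<and> \<epsilon> > 0 \<and>
        {T\<in>D'_L q. \<forall>p\<in>F. p (\<lambda>\<phi>. T \<phi> - S \<phi>) < \<epsilon>} \<subseteq> U)"
  unfolding D'_L_topology_def strong_dual_topology_def openin_seminorm_topology D'_L_def[symmetric]
    dual_seminorm_def[abs_def] ..

lemma topspace_D'_L_topology [simp]: "topspace (D'_L_topology q) = D'_L q"
  unfolding D'_L_topology_def strong_dual_topology_def D'_L_def by simp

text \<open>The topology is given by neighbourhoods of each point, so openness of a ball rests on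
  the triangle inequality for \<open>dual_seminorm\<close>, valid because differences stay in
  \<open>D'_L q\<close> and are bounded on B.\<close>

lemma openin_dual_ball:
  assumes B: "B \<in> bounded_predual" and S0: "S0 \<in> D'_L q"
  shows "openin (D'_L_topology q) {S \<in> D'_L q. dual_seminorm B (\<lambda>\<phi>. S \<phi> - S0 \<phi>) < \<delta>}"
  unfolding openin_D'_L_topology
proof (intro conjI ballI)
  fix S assume S: "S \<in> {S \<in> D'_L q. dual_seminorm B (\<lambda>\<phi>. S \<phi> - S0 \<phi>) < \<delta>}"
  let ?\<epsilon> = "\<delta> - dual_seminorm B (\<lambda>\<phi>. S \<phi> - S0 \<phi>)"
  have "dual_seminorm B (\<lambda>\<phi>. T \<phi> - S0 \<phi>) < \<delta>" if T: "T \<in> D'_L q" "dual_seminorm B (\<lambda>\<phi>. T \<phi> - S \<phi>) < ?\<epsilon>" for T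
  proof -
    have "dual_seminorm B (\<lambda>\<phi>. T \<phi> - S0 \<phi>) \<le> dual_seminorm B (\<lambda>\<phi>. T \<phi> - S \<phi>) + dual_seminorm B (\<lambda>\<phi>. S \<phi> - S0 \<phi>)"
    proof (rule dual_seminorm_le[OF B])
      fix \<phi> assume \<phi>: "\<phi> \<in> B"
      have "norm (T \<phi> - S0 \<phi>) \<le> norm (T \<phi> - S \<phi>) + norm (S \<phi> - S0 \<phi>)"
        using norm_triangle_ineq[of "T \<phi> - S \<phi>" "S \<phi> - S0 \<phi>"] by simp
      also have "\<dots> \<le> dual_seminorm B (\<lambda>\<phi>. T \<phi> - S \<phi>) + dual_seminorm B (\<lambda>\<phi>. S \<phi> - S0 \<phi>)"
        using S T by (intro add_mono norm_le_dual_seminorm[OF B _ \<phi>] D'_L_diff_closed S0) auto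
      finally show "norm (T \<phi> - S0 \<phi>) \<le> dual_seminorm B (\<lambda>\<phi>. T \<phi> - S \<phi>) + dual_seminorm B (\<lambda>\<phi>. S \<phi> - S0 \<phi>)" .
    qed
    with that show ?thesis by simp
  qed
  then show "\<exists>F \<epsilon>. finite F \<and> F \<subseteq> dual_seminorm ` bounded_predual \<and> \<epsilon> > 0 \<and>
      {T\<in>D'_L q. \<forall>p\<in>F. p (\<lambda>\<phi>. T \<phi> - S \<phi>) < \<epsilon>} \<subseteq> {S \<in> D'_L q. dual_seminorm B (\<lambda>\<phi>. S \<phi> - S0 \<phi>) < \<delta>}"
    using S B by (intro exI[of _ "{dual_seminorm B}"] exI[of _ ?\<epsilon>]) auto
qed auto

lemma D'_L_zero_functional: "(\<lambda>\<phi>. 0) \<in> D'_L q"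
  by (rule D'_L_I[where c = 0]) auto

text \<open>The open balls about 0 of integer radius for the seminorm of B cover the whole dual, and
  finitely many of them cover C.\<close>

lemma compactin_imp_bounded_on:
  assumes C: "compactin (D'_L_topology q) C" and B: "B \<in> bounded_predual"
  shows "\<exists>M. \<forall>S\<in>C. \<forall>\<phi>\<in>B. norm (S \<phi>) \<le> M"
proof -
  define U where "U k = {S \<in> D'_L q. dual_seminorm B (\<lambda>\<phi>. S \<phi> - 0) < real k}" for k :: nat
  have sub: "C \<subseteq> D'_L q" using compactin_subset_topspace[OF C] by simp
  have "\<forall>V\<in>range U. openin (D'_L_topology q) V"
    unfolding U_def using openin_dual_ball[OF B D'_L_zero_functional] by auto
  moreover have "C \<subseteq> \<Union>(range U)"
    using sub reals_Archimedean2 unfolding U_def by fastforce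
  ultimately obtain F where F: "finite F" "F \<subseteq> range U" "C \<subseteq> \<Union>F"
    using C unfolding compactin_def by meson
  then obtain I where I: "finite I" "F = U ` I" by (metis finite_subset_image)
  have "norm (S \<phi>) \<le> real (Max (insert 0 I))" if S: "S \<in> C" and \<phi>: "\<phi> \<in> B" for S \<phi>
  proof -
    obtain k where k: "k \<in> I" "S \<in> U k" using F(3) I S by auto
    have "norm (S \<phi>) \<le> dual_seminorm B S"
      using sub S by (intro norm_le_dual_seminorm[OF B _ \<phi>]) auto
    also have "\<dots> \<le> real k" using k(2) by (simp add: U_def)
    also have "\<dots> \<le> real (Max (insert 0 I))" using I(1) k(1) by simp
    finally show ?thesis .
  qed
  then show ?thesis by blast
qed

text \<open>
  Otherwise there are \<open>S\<^sub>j \<in> C\<close> and \<open>\<psi>\<^sub>j\<close> with \<open>j\<close>-th seminorm at most 1 and \<open>\<bar>S\<^sub>j \<psi>\<^sub>j\<bar> = j + 1\<close>;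
  but the set of all \<open>\<psi>\<^sub>j\<close> is bounded, as the seminorms increase.
\<close>

lemma compactin_imp_equicontinuous:
  fixes C :: "((real^'n::finite \<Rightarrow> complex) \<Rightarrow> complex) set"
  assumes C: "compactin (D'_L_topology q) C"
  shows "\<exists>m. \<exists>c>0. \<forall>S\<in>C. \<forall>\<phi>\<in>predual q. norm (S \<phi>) \<le> c * D_L_seminorm (conj_exponent q) m \<phi>"
proof (rule ccontr)
  let ?P = "D_L_seminorm (conj_exponent q) :: nat \<Rightarrow> (real^'n \<Rightarrow> complex) \<Rightarrow> real"
  assume contra: "\<not> ?thesis"
  have sub: "C \<subseteq> D'_L q" using compactin_subset_topspace[OF C] by simp
  have "\<exists>S \<psi>. S \<in> C \<and> \<psi> \<in> predual q \<and> ?P j \<psi> \<le> 1 \<and> norm (S \<psi>) = real j + 1" for j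
  proof -
    have "real j + 1 > 0" by simp
    then obtain S \<phi> where S: "S \<in> C" "\<phi> \<in> predual q" "norm (S \<phi>) > (real j + 1) * ?P j \<phi>"
      using contra by (meson not_le)
    define t where "t = norm (S \<phi>)"
    have t: "t > 0" using S(3) unfolding t_def by (smt (verit) D_L_seminorm_nonneg mult_nonneg_nonneg of_nat_0_le_iff)
    let ?c = "complex_of_real ((real j + 1) / t)"
    have nc: "norm ?c = (real j + 1) / t" using t by (simp only: norm_of_real) simp
    have "?P j (\<lambda>x. ?c * \<phi> x) \<le> (real j + 1) / t * ?P j \<phi>"
      using D_L_seminorm_cmult[OF S(2), of j ?c] nc by simp
    also have "\<dots> \<le> 1" using S(3) t by (simp add: t_def field_simps)
    finally have "?P j (\<lambda>x. ?c * \<phi> x) \<le> 1" .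
    moreover have "norm (S (\<lambda>x. ?c * \<phi> x)) = real j + 1"
    proof -
      have "S (\<lambda>x. ?c * \<phi> x) = ?c * S \<phi>"
        using S sub by (intro D'_L_cmult) auto
      then have "norm (S (\<lambda>x. ?c * \<phi> x)) = (real j + 1) / t * t"
        by (simp only: norm_mult nc t_def[symmetric])
      then show ?thesis using t by simp
    qed
    ultimately show ?thesis using S predual_cmult by blast
  qed
  then obtain S \<psi> where *: "\<And>j. S j \<in> C" "\<And>j. \<psi> j \<in> predual q" "\<And>j. ?P j (\<psi> j) \<le> 1"
    "\<And>j. norm (S j (\<psi> j)) = real j + 1" by metis
  have "bdd_above (?P m ` range \<psi>)" for m
  proof (rule bdd_aboveI)
    fix y assume "y \<in> ?P m ` range \<psi>"
    then obtain j where y: "y = ?P m (\<psi> j)" by blast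
    show "y \<le> 1 + (\<Sum>j<m. ?P m (\<psi> j))"
    proof (cases "j < m")
      case True
      then have "?P m (\<psi> j) \<le> (\<Sum>j<m. ?P m (\<psi> j))" by (intro member_le_sum) auto
      with y show ?thesis by simp
    next
      case False
      then have "?P m (\<psi> j) \<le> 1" using D_L_seminorm_mono[of m j] *(3)[of j] order_trans by (metis not_less)
      with y show ?thesis by (simp add: sum_nonneg add_increasing2)
    qed
  qed
  then have "range \<psi> \<in> bounded_predual"
    using *(2) unfolding bounded_sets_def by auto
  from compactin_imp_bounded_on[OF C this] obtain M where M: "\<And>j. norm (S j (\<psi> j)) \<le> M"
    using *(1) by blast
  obtain j :: nat where "real j > M" using reals_Archimedean2 by blast
  with M[of j] *(4)[of j] show False by simp
qed

end

section \<open>Test functions in the predual, and the converse of Hoelder's inequality\<close>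

lemma norm_sum_list_bound:
  fixes F :: "'s \<Rightarrow> 'b::real_normed_vector"
  assumes "\<And>s. s \<in> set xs \<Longrightarrow> norm (F s) \<le> G s"
  shows "norm (\<Sum>s\<leftarrow>xs. F s) \<le> (\<Sum>s\<leftarrow>xs. G s)"
  using assms by (induction xs) (auto intro!: norm_triangle_mono)

lemma eventually_cutoff_close:
  fixes R :: real
  assumes "\<epsilon> > 0"
  shows "\<forall>\<^sub>F k in sequentially. \<forall>x::real^'n::finite. norm x \<le> R \<longrightarrow> 1 - cutoff ((1 / real (Suc k)) *\<^sub>R x) < \<epsilon>"
proof -
  have "isCont (cutoff :: real^'n \<Rightarrow> real) 0"
    using continuous_cutoff[of "UNIV :: (real^'n) set"] by (simp add: continuous_on_eq_continuous_at)
  then obtain d where d: "d > 0" "\<And>y::real^'n. norm y < d \<Longrightarrow> \<bar>cutoff y - 1\<bar> < \<epsilon>"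
    using assms unfolding continuous_at_eps_delta by (auto simp: dist_norm)
  have "(\<lambda>k. \<bar>R\<bar> * (1 / real (Suc k))) \<longlonglongrightarrow> \<bar>R\<bar> * 0"
    by (intro tendsto_mult_left LIMSEQ_Suc[OF lim_1_over_n])
  then have "\<forall>\<^sub>F k in sequentially. \<bar>R\<bar> * (1 / real (Suc k)) < d"
    using order_tendstoD(2)[of _ 0 sequentially d] d(1) by simp
  then show ?thesis
  proof eventually_elim
    case (elim k)
    show ?case
    proof (intro allI impI)
      fix x :: "real^'n" assume "norm x \<le> R"
      then have "norm ((1 / real (Suc k)) *\<^sub>R x) \<le> \<bar>R\<bar> * (1 / real (Suc k))"
        by (simp add: divide_right_mono)
      with elim have "norm ((1 / real (Suc k)) *\<^sub>R x) < d" by simp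
      from d(2)[OF this] show "1 - cutoff ((1 / real (Suc k)) *\<^sub>R x) < \<epsilon>" by linarith
    qed
  qed
qed

lemma tendsto_cutoff_scale: "(\<lambda>k. cutoff ((1 / real (Suc k)) *\<^sub>R x)) \<longlonglongrightarrow> 1"
proof (rule LIMSEQ_I)
  fix r :: real assume "r > 0"
  from eventually_cutoff_close[OF this, of "norm x"]
  have "\<forall>\<^sub>F k in sequentially. 1 - cutoff ((1 / real (Suc k)) *\<^sub>R x) < r"
    by (rule eventually_mono) blast
  then have "\<forall>\<^sub>F k in sequentially. norm (cutoff ((1 / real (Suc k)) *\<^sub>R x) - 1) < r"
  proof eventually_elim
    case (elim k)
    then show ?case
      using cutoff_le_1[of "(1 / real (Suc k)) *\<^sub>R x"] \<open>r > 0\<close>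
      unfolding real_norm_def abs_less_iff by (intro conjI) linarith+
  qed
  then show "\<exists>no. \<forall>n\<ge>no. norm (cutoff ((1 / real (Suc n)) *\<^sub>R x) - 1) < r"
    by (simp add: eventually_sequentially)
qed

context
  fixes q :: ennreal
  assumes q: "1 \<le> q" "q < \<infinity>"
begin

text \<open>The first term is small by its factor 1 / (k + 1), the second because the cutoffs tend
  to 1. For p = \<infinity> this convergence is uniform only on bounded sets, and
  \<open>vanish\<close> handles the outside; this is why the predual for q = 1 is
  \<open>B_dot\<close>. For finite p it is dominated convergence under |u| + |v|.\<close>

lemma Lp_norm_cutoff_tendsto:
  fixes u v :: "real^'n::finite \<Rightarrow> complex" and f :: "nat \<Rightarrow> real^'n \<Rightarrow> complex"
  assumes u: "u \<in> Lp (conj_exponent q)" "continuous_on UNIV u"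
    and v: "v \<in> Lp (conj_exponent q)" "continuous_on UNIV v"
    and vanish: "q = 1 \<Longrightarrow> (v \<longlongrightarrow> 0) at_infinity"
    and f: "\<And>k. f k \<in> borel_measurable borel"
    and le: "\<And>k x. norm (f k x) \<le> norm (u x) / real (Suc k) + (1 - cutoff ((1 / real (Suc k)) *\<^sub>R x)) * norm (v x)"
  shows "(\<lambda>k. Lp_norm (conj_exponent q) (f k)) \<longlonglongrightarrow> 0"
  using q
proof (cases rule: conj_exponent_cases)
  case 1
  show ?thesis
  proof (rule LIMSEQ_I)
    fix r :: real assume r: "r > 0"
    define U where "U = Lp_norm \<infinity> u"
    define V where "V = Lp_norm \<infinity> v"
    have UV: "U \<ge> 0" "V \<ge> 0" by (simp_all add: U_def V_def)
    have uU: "norm (u x) \<le> U" and vV: "norm (v x) \<le> V" for x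
      using norm_le_Lp_norm_infinity u v 1 unfolding U_def V_def by metis+
    have "\<forall>\<^sub>F x in at_infinity. norm (v x) < r / 3"
      using tendstoD[OF vanish[OF 1(1)], of "r / 3"] r by (simp add: dist_norm)
    then obtain R where R: "\<And>x. norm x \<ge> R \<Longrightarrow> norm (v x) < r / 3"
      unfolding eventually_at_infinity by blast
    have "\<forall>\<^sub>F k in sequentially. U * (1 / real (Suc k)) < r / 3"
      using order_tendstoD(2)[OF tendsto_mult_left[OF LIMSEQ_Suc[OF lim_1_over_n], of U], of "r / 3"] r by simp
    moreover have "\<forall>\<^sub>F k in sequentially. \<forall>x::real^'n. norm x \<le> R \<longrightarrow> 1 - cutoff ((1 / real (Suc k)) *\<^sub>R x) < r / (3 * (V + 1))"
      using r UV by (intro eventually_cutoff_close) simp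
    ultimately have "\<forall>\<^sub>F k in sequentially. norm (Lp_norm (conj_exponent q) (f k) - 0) < r"
    proof eventually_elim
      case (elim k)
      have "norm (f k x) \<le> r * (2 / 3)" for x
      proof -
        let ?c = "1 - cutoff ((1 / real (Suc k)) *\<^sub>R x)"
        have c: "0 \<le> ?c" "?c \<le> 1" using cutoff_le_1 cutoff_nonneg by (auto simp: algebra_simps)
        have "norm (u x) / real (Suc k) \<le> U * (1 / real (Suc k))"
          using divide_right_mono[OF uU, of "real (Suc k)" x] by simp
        then have 1: "norm (u x) / real (Suc k) \<le> r / 3" using elim(1) by linarith
        have 2: "?c * norm (v x) \<le> r / 3"
        proof (cases "norm x \<le> R")
          case True
          then have "?c * norm (v x) \<le> (r / (3 * (V + 1))) * (V + 1)"
            using elim(2) c vV[of x] UV r by (intro mult_mono) (auto intro: less_imp_le)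
          also have "\<dots> = r / 3" using UV by (simp add: field_simps)
          finally show ?thesis .
        next
          case False
          then have "norm (v x) \<le> r / 3" using R[of x] by simp
          then show ?thesis using c mult_mono[of ?c 1 "norm (v x)" "r / 3"] by simp
        qed
        show ?thesis using le[of k x] 1 2 by linarith
      qed
      then have "Lp_norm \<infinity> (f k) \<le> r * (2 / 3)"
        using Lp_norm_infinity_le[OF f] by blast
      then show ?case using 1 r by simp
    qed
    then show "\<exists>no. \<forall>n\<ge>no. norm (Lp_norm (conj_exponent q) (f n) - 0) < r"
      by (simp add: eventually_sequentially)
  qed
next
  case (2 r s)
  let ?g = "\<lambda>x. norm (u x) + norm (v x)"
  have nn: "(\<lambda>x. complex_of_real (norm (w x))) \<in> Lp (conj_exponent q)"
    if "w \<in> Lp (conj_exponent q)" "continuous_on UNIV w" for w :: "real^'n \<Rightarrow> complex"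
    by (rule Lp_dominated[OF one_le_conj_exponent[OF q] that, where C = 1])
       (use Lp_measurable[OF that(1)] in auto)
  have "(\<lambda>x. complex_of_real (norm (u x)) + complex_of_real (norm (v x))) \<in> Lp (conj_exponent q)"
    by (intro Lp_add one_le_conj_exponent q nn u v)
  then have "integrable lborel (\<lambda>x. norm (complex_of_real (norm (u x)) + complex_of_real (norm (v x))) powr s)"
    using 2 by (simp add: Lp_ennreal)
  moreover have "norm (complex_of_real (norm (u x)) + complex_of_real (norm (v x))) = ?g x" for x
    by (simp flip: of_real_add)
  ultimately have g: "integrable lborel (\<lambda>x. ?g x powr s)" by simp
  show ?thesis
  proof (rule Lp_norm_tendsto_zero[where g = ?g])
    show "integrable lborel (\<lambda>x. ?g x powr enn2real (conj_exponent q))" using g 2 by simp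
    fix k x
    have "norm (u x) / real (Suc k) \<le> norm (u x)" by (simp add: divide_le_eq algebra_simps)
    moreover have "(1 - cutoff ((1 / real (Suc k)) *\<^sub>R x)) * norm (v x) \<le> 1 * norm (v x)"
      using cutoff_nonneg by (intro mult_right_mono) auto
    ultimately show "norm (f k x) \<le> ?g x" using le[of k x] by simp
  next
    fix x
    have "(\<lambda>k. norm (u x) * (1 / real (Suc k)) + (1 - cutoff ((1 / real (Suc k)) *\<^sub>R x)) * norm (v x))
        \<longlonglongrightarrow> norm (u x) * 0 + (1 - 1) * norm (v x)"
      by (intro tendsto_intros LIMSEQ_Suc[OF lim_1_over_n] tendsto_cutoff_scale)
    then have lim: "(\<lambda>k. norm (u x) / real (Suc k) + (1 - cutoff ((1 / real (Suc k)) *\<^sub>R x)) * norm (v x)) \<longlonglongrightarrow> 0"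
      by simp
    show "(\<lambda>k. f k x) \<longlonglongrightarrow> 0"
      by (rule Lim_null_comparison[OF always_eventually lim]) (rule allI, rule le)
  qed (use 2 f one_le_conj_exponent[OF q] in auto)
qed

definition truncate :: "nat \<Rightarrow> (real^'n::finite \<Rightarrow> complex) \<Rightarrow> real^'n \<Rightarrow> complex" where
  "truncate k \<phi> x = complex_of_real (cutoff ((1 / real (Suc k)) *\<^sub>R x)) * \<phi> x"

lemma truncate_test: "smooth \<phi> \<Longrightarrow> truncate k \<phi> \<in> test_functions"
  unfolding truncate_def[abs_def]
  by (intro test_functions_mult cutoff_scale_test) auto

text \<open>In the Leibniz expansion every derivative falling on the dilated cutoff brings a factor
  1 / (k + 1). The one term without such a derivative is combined with the subtracted derivative of
  \<phi> into (cutoff - 1) times that derivative.\<close>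

lemma tendsto_Lp_norm_truncate:
  fixes \<phi> :: "real^'n::finite \<Rightarrow> complex"
  assumes \<phi>: "\<phi> \<in> predual q"
  shows "(\<lambda>k. Lp_norm (conj_exponent q) (partial_derivs \<alpha> (\<lambda>x. truncate k \<phi> x - \<phi> x))) \<longlonglongrightarrow> 0"
proof -
  let ?\<chi> = "\<lambda>x::real^'n. complex_of_real (cutoff x)"
  let ?\<chi>k = "\<lambda>k x::real^'n. complex_of_real (cutoff ((1 / real (Suc k)) *\<^sub>R x))"
  have sm: "smooth \<phi>" by (rule predual_smooth[OF q \<phi>])
  have s\<chi>: "smooth ?\<chi>" by (rule test_functions_smooth[OF cutoff_test])
  have s\<chi>k: "smooth (?\<chi>k k)" for k by (rule test_functions_smooth[OF cutoff_scale_test]) simp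
  have "\<forall>\<beta>. \<exists>B>0. \<forall>x. norm (partial_derivs \<beta> ?\<chi> x) \<le> B"
    by (intro allI decaying_bounded test_functions_decaying cutoff_test)
  then obtain B where B: "\<And>\<beta>. B \<beta> > 0" "\<And>\<beta> x. norm (partial_derivs \<beta> ?\<chi> x) \<le> B \<beta>" by metis
  have p\<chi>k: "partial_derivs \<beta> (?\<chi>k k) x = of_real (1 / real (Suc k)) ^ length \<beta> * partial_derivs \<beta> ?\<chi> ((1 / real (Suc k)) *\<^sub>R x)" for \<beta> k x
    using fun_cong[OF partial_derivs_affine[OF s\<chi>, of \<beta> "1 / real (Suc k)" 0], of x] by simp
  have b\<chi>k: "norm (partial_derivs \<beta> (?\<chi>k k) x) \<le> B \<beta> / real (Suc k)" if "\<beta> \<noteq> []" for \<beta> k x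
  proof -
    have "norm (of_real (1 / real (Suc k)) ^ length \<beta> :: complex) = (1 / real (Suc k)) ^ length \<beta>"
      by (simp only: norm_power norm_of_real) simp
    also have "\<dots> \<le> (1 / real (Suc k)) ^ 1"
      using that by (intro power_decreasing) (auto simp: Suc_le_eq)
    finally have "norm (partial_derivs \<beta> (?\<chi>k k) x) \<le> (1 / real (Suc k)) ^ 1 * B \<beta>"
      unfolding p\<chi>k norm_mult by (intro mult_mono B) auto
    then show ?thesis by simp
  qed
  obtain xs where xs: "splits \<alpha> = xs @ [([], \<alpha>)]" "\<forall>(\<beta>, \<gamma>)\<in>set xs. \<beta> \<noteq> []"
    using splits_Nil_fst by blast
  let ?U = "\<lambda>xs x. \<Sum>s\<leftarrow>xs. of_real (B (fst s)) * complex_of_real (norm (partial_derivs (snd s) \<phi> x))"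
  have U: "?U xs \<in> Lp (conj_exponent q) \<and> continuous_on UNIV (?U xs)" for xs :: "('n list \<times> 'n list) list"
  proof (induction xs)
    case Nil
    show ?case using predual_Lp_0[OF q predual_zero[OF q]] by simp
  next
    case (Cons s xs)
    let ?w = "\<lambda>x. of_real (B (fst s)) * complex_of_real (norm (partial_derivs (snd s) \<phi> x))"
    have w: "continuous_on UNIV ?w"
      by (intro continuous_intros continuous_on_partial_derivs sm)
    have w': "?w \<in> Lp (conj_exponent q)"
      by (rule Lp_dominated[OF one_le_conj_exponent[OF q] predual_Lp[OF q \<phi>, of "snd s"] continuous_on_partial_derivs[OF sm], where C = "B (fst s)"])
         (use w B(1)[of "fst s"] in \<open>auto simp: norm_mult intro: borel_measurable_continuous_onI less_imp_le\<close>)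
    then show ?case
      unfolding list.map sum_list.Cons
      by (intro conjI Lp_add one_le_conj_exponent q w' continuous_on_add w conjunct1[OF Cons] conjunct2[OF Cons])
  qed
  have ReU: "norm (?U xs x) = (\<Sum>s\<leftarrow>xs. B (fst s) * norm (partial_derivs (snd s) \<phi> x))" for x
  proof -
    have "?U xs x = complex_of_real (\<Sum>s\<leftarrow>xs. B (fst s) * norm (partial_derivs (snd s) \<phi> x))" for xs
      by (induction xs) auto
    moreover have "0 \<le> (\<Sum>s\<leftarrow>xs. B (fst s) * norm (partial_derivs (snd s) \<phi> x))"
      using less_imp_le[OF B(1)] by (intro sum_list_nonneg) auto
    ultimately show ?thesis by simp
  qed
  show ?thesis
  proof (rule Lp_norm_cutoff_tendsto[where u = "?U xs" and v = "partial_derivs \<alpha> \<phi>"])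
    show "partial_derivs \<alpha> (\<lambda>x. truncate k \<phi> x - \<phi> x) \<in> borel_measurable borel" for k
      by (intro borel_measurable_partial_derivs smooth_diff sm test_functions_smooth truncate_test)
    fix k x
    have "partial_derivs \<alpha> (\<lambda>x. truncate k \<phi> x - \<phi> x) x
       = (\<Sum>s\<leftarrow>splits \<alpha>. partial_derivs (fst s) (?\<chi>k k) x * partial_derivs (snd s) \<phi> x) - partial_derivs \<alpha> \<phi> x"
      using partial_derivs_diff[OF test_functions_smooth[OF truncate_test[OF sm]] sm, of \<alpha> k]
        Leibniz_partial_derivs[OF s\<chi>k sm, of \<alpha> k]
      by (simp add: truncate_def[abs_def])
    also have "\<dots> = (\<Sum>s\<leftarrow>xs. partial_derivs (fst s) (?\<chi>k k) x * partial_derivs (snd s) \<phi> x)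
        + (?\<chi>k k x - 1) * partial_derivs \<alpha> \<phi> x"
      unfolding xs(1) by (simp add: algebra_simps)
    finally have eq: "partial_derivs \<alpha> (\<lambda>x. truncate k \<phi> x - \<phi> x) x = \<dots>" .
    have 1: "norm (\<Sum>s\<leftarrow>xs. partial_derivs (fst s) (?\<chi>k k) x * partial_derivs (snd s) \<phi> x)
        \<le> (\<Sum>s\<leftarrow>xs. (B (fst s) * norm (partial_derivs (snd s) \<phi> x)) * (1 / real (Suc k)))"
    proof (rule norm_sum_list_bound)
      fix s assume "s \<in> set xs"
      then have "fst s \<noteq> []" using xs(2) by auto
      from mult_right_mono[OF b\<chi>k[OF this, of k x], of "norm (partial_derivs (snd s) \<phi> x)"]
      show "norm (partial_derivs (fst s) (?\<chi>k k) x * partial_derivs (snd s) \<phi> x) \<le> (B (fst s) * norm (partial_derivs (snd s) \<phi> x)) * (1 / real (Suc k))"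
        by (simp add: norm_mult)
    qed
    have "norm (?\<chi>k k x - 1) = norm (complex_of_real (cutoff ((1 / real (Suc k)) *\<^sub>R x) - 1))"
      by simp
    also have "\<dots> = 1 - cutoff ((1 / real (Suc k)) *\<^sub>R x)"
      unfolding norm_of_real using cutoff_le_1[of "(1 / real (Suc k)) *\<^sub>R x"] by simp
    finally have 2: "norm ((?\<chi>k k x - 1) * partial_derivs \<alpha> \<phi> x) = (1 - cutoff ((1 / real (Suc k)) *\<^sub>R x)) * norm (partial_derivs \<alpha> \<phi> x)"
      by (simp add: norm_mult)
    show "norm (partial_derivs \<alpha> (\<lambda>x. truncate k \<phi> x - \<phi> x) x)
      \<le> norm (?U xs x) / real (Suc k) + (1 - cutoff ((1 / real (Suc k)) *\<^sub>R x)) * norm (partial_derivs \<alpha> \<phi> x)"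
      unfolding eq ReU 2[symmetric]
      by (rule order_trans[OF norm_triangle_ineq])
         (use 1 in \<open>simp only: sum_list_mult_const add_le_cancel_right\<close>, simp)
  qed (use U predual_Lp[OF q \<phi>] continuous_on_partial_derivs[OF sm] predual_tendsto[OF q \<phi>] in auto)
qed

lemma tendsto_D_L_seminorm_truncate:
  fixes \<phi> :: "real^'n::finite \<Rightarrow> complex"
  assumes \<phi>: "\<phi> \<in> predual q"
  shows "(\<lambda>k. D_L_seminorm (conj_exponent q) m (\<lambda>x. truncate k \<phi> x - \<phi> x)) \<longlonglongrightarrow> 0"
proof (rule LIMSEQ_I)
  fix r :: real assume r: "r > 0"
  let ?N = "\<lambda>k \<alpha>. Lp_norm (conj_exponent q) (partial_derivs \<alpha> (\<lambda>x. truncate k \<phi> x - \<phi> x))"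
  have "\<forall>\<^sub>F k in sequentially. ?N k \<alpha> < r / 2" for \<alpha>
    using order_tendstoD(2)[OF tendsto_Lp_norm_truncate[OF \<phi>], of "r / 2"] r by simp
  then have "\<forall>\<^sub>F k in sequentially. \<forall>\<alpha>\<in>{\<alpha>. length \<alpha> \<le> m}. ?N k \<alpha> < r / 2"
    by (intro eventually_ball_finite finite_short_lists ballI)
  then have "\<forall>\<^sub>F k in sequentially. norm (D_L_seminorm (conj_exponent q) m (\<lambda>x. truncate k \<phi> x - \<phi> x) - 0) < r"
  proof eventually_elim
    case (elim k)
    then have "D_L_seminorm (conj_exponent q) m (\<lambda>x. truncate k \<phi> x - \<phi> x) \<le> r / 2"
      by (intro D_L_seminorm_le) (auto intro: less_imp_le)
    then show ?case using r by simp
  qed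
  then show "\<exists>no. \<forall>n\<ge>no. norm (D_L_seminorm (conj_exponent q) m (\<lambda>x. truncate n \<phi> x - \<phi> x) - 0) < r"
    by (simp add: eventually_sequentially)
qed

lemma truncate_predual: "\<phi> \<in> predual q \<Longrightarrow> truncate k \<phi> \<in> predual q"
  by (rule test_functions_predual[OF q], rule truncate_test, rule predual_smooth[OF q])

lemma tendsto_D'_L_truncate:
  fixes \<phi> :: "real^'n::finite \<Rightarrow> complex"
  assumes S: "S \<in> D'_L q" and \<phi>: "\<phi> \<in> predual q"
  shows "(\<lambda>k. S (truncate k \<phi>)) \<longlonglongrightarrow> S \<phi>"
proof -
  obtain m c where c: "\<And>\<phi>. \<phi> \<in> predual q \<Longrightarrow> norm (S \<phi>) \<le> c * D_L_seminorm (conj_exponent q) m \<phi>"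
    using D'_L_bound[OF q S] by blast
  have "(\<lambda>k. S (truncate k \<phi>) - S \<phi>) \<longlonglongrightarrow> 0"
  proof (rule Lim_null_comparison[OF always_eventually])
    show "\<forall>k. norm (S (truncate k \<phi>) - S \<phi>) \<le> c * D_L_seminorm (conj_exponent q) m (\<lambda>x. truncate k \<phi> x - \<phi> x)"
      using c[OF predual_diff[OF q truncate_predual[OF \<phi>] \<phi>]] D'_L_diff[OF q S truncate_predual[OF \<phi>] \<phi>] by simp
    show "(\<lambda>k. c * D_L_seminorm (conj_exponent q) m (\<lambda>x. truncate k \<phi> x - \<phi> x)) \<longlonglongrightarrow> 0"
      by (intro tendsto_mult_right_zero tendsto_D_L_seminorm_truncate \<phi>)
  qed
  then show ?thesis by (simp add: Lim_null[symmetric])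
qed

text \<open>Both functionals are limits of their values on truncations. This is what allows (1 -
  \<Delta>)^m to be shown inverse to the convolution by computing on test functions only.\<close>

lemma D'_L_eqI:
  fixes S T :: "(real^'n::finite \<Rightarrow> complex) \<Rightarrow> complex"
  assumes S: "S \<in> D'_L q" and T: "T \<in> D'_L q" and eq: "\<And>\<phi>. \<phi> \<in> test_functions \<Longrightarrow> S \<phi> = T \<phi>"
  shows "S = T"
proof
  fix \<phi>
  show "S \<phi> = T \<phi>"
  proof (cases "\<phi> \<in> predual q")
    case True
    have "S (truncate k \<phi>) = T (truncate k \<phi>)" for k
      by (intro eq truncate_test predual_smooth[OF q] True)
    then show ?thesis
      using tendsto_D'_L_truncate[OF S True] tendsto_D'_L_truncate[OF T True] LIMSEQ_unique by simp
  qed (simp add: D'_L_outside[OF q S] D'_L_outside[OF q T])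
qed

section \<open>The pairing of L^q with the predual\<close>

lemma predual_continuous_on: "\<phi> \<in> predual q \<Longrightarrow> continuous_on A \<phi>"
  by (intro smooth_continuous_on predual_smooth[OF q])

lemma pairing_diff:
  assumes g: "g \<in> Lp q" and \<phi>: "\<phi> \<in> predual q" and \<psi>: "\<psi> \<in> predual q"
  shows "pairing g (\<lambda>x. \<phi> x - \<psi> x) = pairing g \<phi> - pairing g \<psi>"
  unfolding pairing_def right_diff_distrib
  by (intro Bochner_Integration.integral_diff Hoelder_integrable[OF q g] predual_Lp_0[OF q]
      predual_continuous_on \<phi> \<psi>)

lemma pairing_add:
  assumes g: "g \<in> Lp q" and \<phi>: "\<phi> \<in> predual q" and \<psi>: "\<psi> \<in> predual q"
  shows "pairing g (\<lambda>x. \<phi> x + \<psi> x) = pairing g \<phi> + pairing g \<psi>"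
  unfolding pairing_def distrib_left
  by (intro Bochner_Integration.integral_add Hoelder_integrable[OF q g] predual_Lp_0[OF q]
      predual_continuous_on \<phi> \<psi>)

lemma pairing_cmult: "pairing g (\<lambda>x. c * \<phi> x) = c * pairing g \<phi>"
  unfolding pairing_def by (simp add: mult.left_commute)

lemma pairing_diff_left:
  assumes g: "g \<in> Lp q" and h: "h \<in> Lp q" and \<phi>: "\<phi> \<in> predual q"
  shows "pairing (\<lambda>x. g x - h x) \<phi> = pairing g \<phi> - pairing h \<phi>"
  unfolding pairing_def left_diff_distrib
  by (intro Bochner_Integration.integral_diff Hoelder_integrable[OF q] g h predual_Lp_0[OF q]
      predual_continuous_on \<phi>)

lemma norm_pairing_le:
  assumes g: "g \<in> Lp q" and \<phi>: "\<phi> \<in> predual q"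
  shows "norm (pairing g \<phi>) \<le> Lp_norm q g * Lp_norm (conj_exponent q) \<phi>"
  by (intro Hoelder[OF q g] predual_Lp_0[OF q] predual_continuous_on \<phi>)

lemma tendsto_pairing_truncate:
  fixes \<phi> :: "real^'n::finite \<Rightarrow> complex"
  assumes g: "g \<in> Lp q" and \<phi>: "\<phi> \<in> predual q"
  shows "(\<lambda>k. pairing g (truncate k \<phi>)) \<longlonglongrightarrow> pairing g \<phi>"
proof -
  have "(\<lambda>k. pairing g (truncate k \<phi>) - pairing g \<phi>) \<longlonglongrightarrow> 0"
  proof (rule Lim_null_comparison[OF always_eventually])
    show "\<forall>k. norm (pairing g (truncate k \<phi>) - pairing g \<phi>) \<le> Lp_norm q g * Lp_norm (conj_exponent q) (\<lambda>x. truncate k \<phi> x - \<phi> x)"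
      using norm_pairing_le[OF g predual_diff[OF q truncate_predual[OF \<phi>] \<phi>]] pairing_diff[OF g truncate_predual[OF \<phi>] \<phi>] by simp
    show "(\<lambda>k. Lp_norm q g * Lp_norm (conj_exponent q) (\<lambda>x. truncate k \<phi> x - \<phi> x)) \<longlonglongrightarrow> 0"
      using tendsto_mult_right_zero[OF tendsto_Lp_norm_truncate[OF \<phi>, of "[]"]] by simp
  qed
  then show ?thesis by (simp add: Lim_null[symmetric])
qed

text \<open>Truncation extends equality on test functions to the predual. It makes
  \<open>helmholtz_dist\<close> independent of the chosen representative, without an argument that g
  and h agree almost everywhere.\<close>

lemma pairing_eq:
  fixes g h :: "real^'n::finite \<Rightarrow> complex"
  assumes g: "g \<in> Lp q" and h: "h \<in> Lp q" and eq: "regular_distribution g = regular_distribution h"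
    and \<phi>: "\<phi> \<in> predual q"
  shows "pairing g \<phi> = pairing h \<phi>"
proof -
  have "pairing g (truncate k \<phi>) = pairing h (truncate k \<phi>)" for k
    using fun_cong[OF eq, of "truncate k \<phi>"] truncate_test[OF predual_smooth[OF q \<phi>]]
    by (simp add: regular_distribution_def)
  then show ?thesis
    using tendsto_pairing_truncate[OF g \<phi>] tendsto_pairing_truncate[OF h \<phi>] LIMSEQ_unique by simp
qed

end

section \<open>The converse of Hoelder's inequality for continuous functions\<close>

lemma polyfun_of_real_polynomial:
  fixes p :: "real^'n::finite \<Rightarrow> real"
  shows "real_polynomial_function p \<Longrightarrow> polyfun (\<lambda>x. complex_of_real (p x))"
proof (induction rule: real_polynomial_function.induct)
  case (linear f)
  have lin: "f x = (\<Sum>i\<in>UNIV. x $ i * f (axis i 1))" for x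
  proof -
    have "x = (\<Sum>i\<in>UNIV. x $ i *\<^sub>R axis i 1)"
      by (simp add: vec_eq_iff axis_def if_distrib cong: if_cong)
    then have "f x = f (\<Sum>i\<in>UNIV. x $ i *\<^sub>R axis i 1)" by simp
    also have "\<dots> = (\<Sum>i\<in>UNIV. x $ i * f (axis i 1))"
      using bounded_linear.linear[OF linear] by (simp add: linear_sum linear_cmul)
    finally show ?thesis .
  qed
  have "(\<lambda>x. complex_of_real (f x)) = (\<lambda>x. \<Sum>i\<in>UNIV. of_real (x $ i) * of_real (f (axis i 1)))"
    by (rule ext, subst lin) simp
  then show ?case by (simp add: polyfun_sum polyfun.mult polyfun.coord polyfun.const)
qed (auto intro: polyfun.intros)

text \<open>Divide \<psi> by a cutoff of radius 2 R, approximate the quotient on that ball by a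
  polynomial (Stone-Weierstrass), and multiply by the cutoff again. The product is a test function,
  and as the cutoff is at most 1 the error does not grow.\<close>

lemma approximate_by_test_function:
  fixes \<psi> :: "real^'n::finite \<Rightarrow> complex"
  assumes cont: "continuous_on UNIV \<psi>" and supp: "\<And>x. norm x > R \<Longrightarrow> \<psi> x = 0" and R: "R > 0" and \<epsilon>: "\<epsilon> > 0"
  shows "\<exists>\<phi>\<in>test_functions. (\<forall>x. norm (\<phi> x - \<psi> x) \<le> \<epsilon>) \<and> (\<forall>x. norm x > 2 * R \<longrightarrow> \<phi> x = 0)"
proof -
  define \<theta> where "\<theta> x = cutoff ((1 / (2 * R)) *\<^sub>R x)" for x :: "real^'n"
  have c\<theta>: "continuous_on A \<theta>" for A
    unfolding \<theta>_def by (intro continuous_on_compose2[OF continuous_cutoff[of UNIV]] continuous_intros) auto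
  have "\<exists>x0\<in>cball 0 R. \<forall>x\<in>cball 0 R. \<theta> x0 \<le> \<theta> x"
    by (intro continuous_attains_inf c\<theta>) (use R in auto)
  then obtain x0 where x0: "norm x0 \<le> R" "\<And>x. norm x \<le> R \<Longrightarrow> \<theta> x0 \<le> \<theta> x" by auto
  define c where "c = \<theta> x0"
  have c: "c > 0" unfolding c_def \<theta>_def by (rule cutoff_pos) (use x0 R in \<open>simp add: field_simps\<close>)
  \<comment> \<open>The cutoff is at least c on the ball of radius R, which contains the support of
    \<psi>; the maximum with c changes nothing there and makes the quotient continuous
    everywhere.\<close>
  define h where "h x = \<psi> x / of_real (max (\<theta> x) c)" for x
  have ch: "continuous_on A h" for A
  proof -
    have "complex_of_real (max (\<theta> x) c) \<noteq> 0" for x using c by (simp add: max_def)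
    then show ?thesis
      unfolding h_def by (intro continuous_intros c\<theta> continuous_on_subset[OF cont]) auto
  qed
  have \<psi>: "\<psi> x = of_real (\<theta> x) * h x" for x
  proof (cases "norm x > R")
    case False
    then have "max (\<theta> x) c = \<theta> x" "\<theta> x > 0" using x0(2)[of x] c unfolding c_def by auto
    then show ?thesis by (simp add: h_def)
  qed (simp add: supp h_def)
  let ?K = "cball (0::real^'n) (2 * R)"
  obtain p1 where p1: "real_polynomial_function p1" "\<And>x. x \<in> ?K \<Longrightarrow> \<bar>Re (h x) - p1 x\<bar> < \<epsilon> / 2"
    using Stone_Weierstrass_real_polynomial_function[OF compact_cball continuous_on_Re[OF ch], of "\<epsilon> / 2" "0::real^'n" "2 * R"] \<epsilon>
    by auto
  obtain p2 where p2: "real_polynomial_function p2" "\<And>x. x \<in> ?K \<Longrightarrow> \<bar>Im (h x) - p2 x\<bar> < \<epsilon> / 2"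
    using Stone_Weierstrass_real_polynomial_function[OF compact_cball continuous_on_Im[OF ch], of "\<epsilon> / 2" "0::real^'n" "2 * R"] \<epsilon>
    by auto
  define P where "P x = of_real (p1 x) + \<i> * of_real (p2 x)" for x
  have sP: "smooth P"
    unfolding P_def
    by (intro polyfun_smooth polyfun.add polyfun_cmult polyfun_of_real_polynomial p1 p2)
  have P: "norm (P x - h x) \<le> \<epsilon>" if "x \<in> ?K" for x
    using p1(2)[OF that] p2(2)[OF that] cmod_le[of "P x - h x"] by (simp add: P_def abs_minus_commute)
  let ?\<phi> = "\<lambda>x. complex_of_real (\<theta> x) * P x"
  have out: "\<theta> x = 0" if "norm x \<ge> 2 * R" for x
    unfolding \<theta>_def by (rule cutoff_outside) (use that R in \<open>simp add: field_simps\<close>)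
  have "?\<phi> \<in> test_functions"
    unfolding \<theta>_def by (intro test_functions_mult cutoff_scale_test sP) (use R in auto)
  moreover have "norm (?\<phi> x - \<psi> x) \<le> \<epsilon>" for x
  proof (cases "x \<in> ?K")
    case True
    have "norm (?\<phi> x - \<psi> x) = \<theta> x * norm (P x - h x)"
      unfolding \<psi> using cutoff_nonneg[of "(1 / (2 * R)) *\<^sub>R x"] by (simp add: right_diff_distrib[symmetric] norm_mult \<theta>_def)
    also have "\<dots> \<le> 1 * \<epsilon>"
      by (intro mult_mono P True) (use cutoff_le_1 in \<open>auto simp: \<theta>_def\<close>)
    finally show ?thesis by simp
  next
    case False
    then show ?thesis using out[of x] supp[of x] R \<epsilon> by simp
  qed
  moreover have "\<forall>x. norm x > 2 * R \<longrightarrow> ?\<phi> x = 0" using out by simp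
  ultimately show ?thesis by (intro bexI[of _ ?\<phi>] conjI allI) auto
qed

lemma integrable_compact_support:
  fixes f :: "real^'n::finite \<Rightarrow> 'b::{banach,second_countable_topology}"
  assumes "continuous_on UNIV f" "\<And>x. norm x > R \<Longrightarrow> f x = 0"
  shows "integrable lborel f"
proof -
  have "integrable lborel (\<lambda>x. indicator (cball 0 R) x *\<^sub>R f x)"
    by (rule borel_integrable_compact[OF compact_cball continuous_on_subset[OF assms(1)]]) auto
  moreover have "indicator (cball 0 R) x *\<^sub>R f x = f x" for x
    using assms(2)[of x] by (auto simp: indicator_def not_le)
  ultimately show ?thesis by simp
qed

text \<open>Fatou's lemma along the growing cutoffs. Integrability of h is part of the conclusion,
  derived from the uniform bound on the truncated integrals.\<close>

lemma
  fixes h :: "real^'n::finite \<Rightarrow> real"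
  assumes h: "continuous_on UNIV h" "\<And>x. 0 \<le> h x"
    and le: "\<And>k. (\<integral>x. cutoff ((1 / real (Suc k)) *\<^sub>R x) * h x \<partial>lborel) \<le> K"
  shows integrable_cutoff_limit: "integrable lborel h"
    and integral_cutoff_limit: "(\<integral>x. h x \<partial>lborel) \<le> K"
proof -
  let ?u = "\<lambda>k x. cutoff ((1 / real (Suc k)) *\<^sub>R x) * h x"
  have cc: "continuous_on UNIV (\<lambda>x::real^'n. cutoff ((1 / real (Suc k)) *\<^sub>R x))" for k
    by (intro continuous_on_compose2[OF continuous_cutoff[of UNIV]] continuous_intros) auto
  have out: "cutoff ((1 / real (Suc k)) *\<^sub>R x) = 0" if "norm x > real (Suc k)" for x :: "real^'n" and k
    by (rule cutoff_outside) (use that in \<open>simp add: field_simps\<close>)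
  have int: "integrable lborel (?u k)" for k
    by (rule integrable_compact_support[of _ "real (Suc k)"])
       (use out cc h in \<open>auto intro!: continuous_intros simp del: of_nat_Suc\<close>)
  have nn: "0 \<le> ?u k x" for k x using h(2)[of x] cutoff_nonneg[of "(1 / real (Suc k)) *\<^sub>R x"] by simp
  have mh: "h \<in> borel_measurable borel" by (rule borel_measurable_continuous_onI[OF h(1)])
  have K: "0 \<le> K"
    using order_trans[OF Bochner_Integration.integral_nonneg[of lborel "?u 0"] le[of 0]] nn by blast
  have "(\<integral>\<^sup>+x. ennreal (h x) \<partial>lborel) = (\<integral>\<^sup>+x. liminf (\<lambda>k. ennreal (?u k x)) \<partial>lborel)"
  proof (rule nn_integral_cong)
    fix x
    have "(\<lambda>k. ennreal (?u k x)) \<longlonglongrightarrow> ennreal (1 * h x)"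
      by (intro tendsto_ennrealI tendsto_mult tendsto_cutoff_scale tendsto_const)
    then show "ennreal (h x) = liminf (\<lambda>k. ennreal (?u k x))"
      by (simp add: lim_imp_Liminf)
  qed
  also have "\<dots> \<le> liminf (\<lambda>k. \<integral>\<^sup>+x. ennreal (?u k x) \<partial>lborel)"
    by (rule nn_integral_liminf) (use borel_measurable_integrable[OF int] in measurable)
  also have "\<dots> \<le> limsup (\<lambda>k. \<integral>\<^sup>+x. ennreal (?u k x) \<partial>lborel)"
    by (rule Liminf_le_Limsup) simp
  also have "\<dots> \<le> ennreal K"
  proof (rule Limsup_bounded[OF always_eventually], rule allI)
    fix k
    show "(\<integral>\<^sup>+x. ennreal (?u k x) \<partial>lborel) \<le> ennreal K"
      by (subst nn_integral_eq_integral[OF int]) (use nn le in \<open>auto intro: ennreal_leI\<close>)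
  qed
  finally have fin: "(\<integral>\<^sup>+x. ennreal (h x) \<partial>lborel) \<le> ennreal K" .
  show i: "integrable lborel h"
    by (rule integrableI_nonneg) (use mh h(2) le_less_trans[OF fin] in auto)
  show "(\<integral>x. h x \<partial>lborel) \<le> K"
    using fin K by (subst (asm) nn_integral_eq_integral[OF i]) (use h(2) in auto)
qed

context
  fixes q :: ennreal
  assumes q: "1 \<le> q" "q < \<infinity>"
begin

text \<open>Extends the hypothesis from test functions to continuous functions of compact support,
  as required by extremal functions that are merely continuous. The uniform approximants vanish
  outside one fixed ball, so pairings and norms pass to the limit.\<close>

lemma norm_pairing_le_continuous:
  fixes g \<psi> :: "real^'n::finite \<Rightarrow> complex"
  assumes g: "continuous_on UNIV g"
    and M: "0 \<le> M" "\<And>\<phi>. \<phi> \<in> test_functions \<Longrightarrow> norm (pairing g \<phi>) \<le> M * Lp_norm (conj_exponent q) \<phi>"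
    and \<psi>: "continuous_on UNIV \<psi>" "\<And>x. norm x > R \<Longrightarrow> \<psi> x = 0" and R: "R > 0"
  shows "norm (pairing g \<psi>) \<le> M * Lp_norm (conj_exponent q) \<psi>"
proof -
  have "\<forall>k. \<exists>\<phi>\<in>test_functions. (\<forall>x. norm (\<phi> x - \<psi> x) \<le> 1 / real (Suc k)) \<and> (\<forall>x. norm x > 2 * R \<longrightarrow> \<phi> x = 0)"
    by (intro allI approximate_by_test_function \<psi> R) simp_all
  then obtain \<phi> where \<phi>: "\<And>k. \<phi> k \<in> test_functions"
    "\<And>k x. norm (\<phi> k x - \<psi> x) \<le> 1 / real (Suc k)" "\<And>k x. norm x > 2 * R \<Longrightarrow> \<phi> k x = 0" by metis
  have lim: "(\<lambda>k. \<phi> k x) \<longlonglongrightarrow> \<psi> x" for x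
    by (rule LIM_zero_cancel, rule Lim_null_comparison[OF always_eventually LIMSEQ_Suc[OF lim_1_over_n]])
       (use \<phi>(2) in blast)
  have bd: "norm (\<phi> k x) \<le> norm (\<psi> x) + 1 / real (Suc k)" for k x
    using \<phi>(2)[of k x] norm_triangle_sub[of "\<phi> k x" "\<psi> x"] by linarith
  have bd1: "norm (\<phi> k x) \<le> norm (\<psi> x) + 1" for k x
  proof -
    have "1 / real (Suc k) \<le> 1" by simp
    with bd[of k x] show ?thesis by linarith
  qed
  have m\<phi>: "\<phi> k \<in> borel_measurable borel" for k
    using \<phi>(1) by (intro smooth_borel_measurable test_functions_smooth)
  have m\<psi>: "\<psi> \<in> borel_measurable borel" and mg: "g \<in> borel_measurable borel"
    using \<psi>(1) g by (auto intro: borel_measurable_continuous_onI)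
  have lim1: "(\<lambda>k. pairing g (\<phi> k)) \<longlonglongrightarrow> pairing g \<psi>"
    unfolding pairing_def
  proof (rule integral_dominated_convergence[where w = "\<lambda>x. indicator (cball 0 (2 * R)) x *\<^sub>R (norm (g x) * (norm (\<psi> x) + 1))"])
    show "integrable lborel (\<lambda>x. indicator (cball 0 (2 * R)) x *\<^sub>R (norm (g x) * (norm (\<psi> x) + 1)))"
      by (intro borel_integrable_compact compact_cball continuous_intros continuous_on_subset[OF g] continuous_on_subset[OF \<psi>(1)]) auto
    show "AE x in lborel. norm (g x * \<phi> k x) \<le> indicator (cball 0 (2 * R)) x *\<^sub>R (norm (g x) * (norm (\<psi> x) + 1))" for k
      by (rule AE_I2) (use \<phi>(3)[of _ k] bd1 in \<open>auto simp: indicator_def norm_mult not_le intro!: mult_left_mono\<close>)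
    show "AE x in lborel. (\<lambda>k. g x * \<phi> k x) \<longlonglongrightarrow> g x * \<psi> x"
      by (rule AE_I2) (intro tendsto_mult_left lim)
  qed (use m\<phi> m\<psi> mg in auto)
  \<comment> \<open>Upper bounds converging to the norm are enough. For p = \<infinity> they are the
    norm of \<psi> plus the error 1 / (k + 1); for finite p they are the norms of the
    approximants.\<close>
  have "\<exists>N. N \<longlonglongrightarrow> Lp_norm (conj_exponent q) \<psi> \<and> (\<forall>k. Lp_norm (conj_exponent q) (\<phi> k) \<le> N k)"
    using q
  proof (cases rule: conj_exponent_cases)
    case 1
    obtain C where C: "C > 0" "\<And>x. norm (\<psi> x) \<le> C * weight x"
      using compact_support_bound[OF \<psi>] by blast
    have \<psi>L: "\<psi> \<in> Lp \<infinity>"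
      by (rule Lp_weight_bound[OF _ m\<psi> less_imp_le[OF C(1)] C(2)]) simp
    have "Lp_norm \<infinity> (\<phi> k) \<le> Lp_norm \<infinity> \<psi> + 1 / real (Suc k)" for k
      by (rule Lp_norm_infinity_le[OF m\<phi>])
         (use norm_le_Lp_norm_infinity[OF \<psi>L \<psi>(1)] bd[of k] in \<open>smt (verit)\<close>)
    moreover have "(\<lambda>k. Lp_norm \<infinity> \<psi> + 1 / real (Suc k)) \<longlonglongrightarrow> Lp_norm \<infinity> \<psi> + 0"
      by (intro tendsto_add tendsto_const LIMSEQ_Suc[OF lim_1_over_n])
    ultimately show ?thesis unfolding 1(2) by (intro exI[of _ "\<lambda>k. Lp_norm \<infinity> \<psi> + 1 / real (Suc k)"]) auto
  next
    case (2 r s)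
    have "(\<lambda>k. \<integral>x. norm (\<phi> k x) powr s \<partial>lborel) \<longlonglongrightarrow> (\<integral>x. norm (\<psi> x) powr s \<partial>lborel)"
    proof (rule integral_dominated_convergence[where w = "\<lambda>x. indicator (cball 0 (2 * R)) x *\<^sub>R ((norm (\<psi> x) + 1) powr s)"])
      show "integrable lborel (\<lambda>x. indicator (cball 0 (2 * R)) x *\<^sub>R ((norm (\<psi> x) + 1) powr s))"
        by (intro borel_integrable_compact compact_cball continuous_intros continuous_on_subset[OF \<psi>(1)])
           (use 2 in \<open>auto simp: add_nonneg_eq_0_iff\<close>)
      show "AE x in lborel. norm (norm (\<phi> k x) powr s) \<le> indicator (cball 0 (2 * R)) x *\<^sub>R ((norm (\<psi> x) + 1) powr s)" for k
        by (rule AE_I2) (use \<phi>(3)[of _ k] bd1 2 in \<open>auto simp: indicator_def not_le intro!: powr_mono2\<close>)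
      show "AE x in lborel. (\<lambda>k. norm (\<phi> k x) powr s) \<longlonglongrightarrow> norm (\<psi> x) powr s"
        by (rule AE_I2, rule tendsto_powr'[OF tendsto_norm[OF lim] tendsto_const]) (use 2 in auto)
    qed (use m\<phi> m\<psi> in auto)
    then have "(\<lambda>k. (\<integral>x. norm (\<phi> k x) powr s \<partial>lborel) powr (1 / s)) \<longlonglongrightarrow> (\<integral>x. norm (\<psi> x) powr s \<partial>lborel) powr (1 / s)"
      by (rule tendsto_powr'[OF _ tendsto_const]) (use 2 in \<open>auto intro!: always_eventually\<close>)
    then have "(\<lambda>k. Lp_norm (conj_exponent q) (\<phi> k)) \<longlonglongrightarrow> Lp_norm (conj_exponent q) \<psi>"
      using 2 by (simp add: Lp_norm_ennreal)
    then show ?thesis by blast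
  qed
  then obtain N where N: "N \<longlonglongrightarrow> Lp_norm (conj_exponent q) \<psi>" "\<And>k. Lp_norm (conj_exponent q) (\<phi> k) \<le> N k" by blast
  have "norm (pairing g (\<phi> k)) \<le> M * N k" for k
    using M(2)[OF \<phi>(1)[of k]] mult_left_mono[OF N(2)[of k] M(1)] by linarith
  then show ?thesis
    by (intro LIMSEQ_le[OF tendsto_norm[OF lim1] tendsto_mult_left[OF N(1)]]) auto
qed

text \<open>The cut-off extremal functions of Hoelder's inequality are inserted: a regularised cnj g
  / |g| for q = 1, and cnj g |g|^(r-2) otherwise. They are continuous because g is. The resulting
  bounds on the truncated integrals do not depend on the cutoff, so Fatou's lemma concludes.\<close>

lemma
  fixes g :: "real^'n::finite \<Rightarrow> complex"
  assumes g: "continuous_on UNIV g"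
    and M: "0 \<le> M" "\<And>\<phi>. \<phi> \<in> test_functions \<Longrightarrow> norm (pairing g \<phi>) \<le> M * Lp_norm (conj_exponent q) \<phi>"
  shows converse_Hoelder_Lp: "g \<in> Lp q" and converse_Hoelder: "Lp_norm q g \<le> M"
proof -
  have mg: "g \<in> borel_measurable borel"
    using g by (rule borel_measurable_continuous_onI)
  let ?c = "\<lambda>k x::real^'n. cutoff ((1 / real (Suc k)) *\<^sub>R x)"
  have cc: "continuous_on UNIV (?c k)" for k
    by (intro continuous_on_compose2[OF continuous_cutoff[of UNIV]] continuous_intros) auto
  have out: "?c k x = 0" if "norm x > real (Suc k)" for x k
    by (rule cutoff_outside) (use that in \<open>simp add: field_simps\<close>)
  have c0: "0 \<le> ?c k x" and c1: "?c k x \<le> 1" for k x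
    by (rule cutoff_nonneg, rule cutoff_le_1)
  have int: "integrable lborel (\<lambda>x. ?c k x * h x)" if "continuous_on UNIV h" for k and h :: "real^'n \<Rightarrow> real"
    by (rule integrable_compact_support[of _ "real (Suc k)"])
       (use out cc that in \<open>auto intro!: continuous_intros simp del: of_nat_Suc\<close>)
  have "g \<in> Lp q \<and> Lp_norm q g \<le> M"
    using q
  proof (cases rule: conj_exponent_cases)
    case 1
    have "(\<integral>x. ?c k x * norm (g x) \<partial>lborel) \<le> M" for k
    proof -
      define I where "I = (\<integral>x. ?c k x * 1 \<partial>lborel)"
      have I: "I \<ge> 0" unfolding I_def using c0 by (intro Bochner_Integration.integral_nonneg) simp
      \<comment> \<open>The phase cnj g / |g| is discontinuous at zeros of g; adding \<delta> to the
        denominator makes it continuous at a cost of at most \<delta> times the mass I of the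
        cutoff.\<close>
      have *: "(\<integral>x. ?c k x * norm (g x) \<partial>lborel) \<le> M + \<delta> * I" if \<delta>: "\<delta> > 0" for \<delta>
      proof -
        have nz: "complex_of_real (norm (g x) + \<delta>) \<noteq> 0" "norm (g x) + \<delta> > 0" "norm (g x) + \<delta> \<noteq> 0" for x
        proof -
          show "norm (g x) + \<delta> > 0" using \<delta> by (simp add: add_nonneg_pos)
          then show "norm (g x) + \<delta> \<noteq> 0" by simp
          then show "complex_of_real (norm (g x) + \<delta>) \<noteq> 0" by (simp only: of_real_eq_0_iff not_False_eq_True)
        qed
        define \<psi> where "\<psi> x = of_real (?c k x) * (cnj (g x) / of_real (norm (g x) + \<delta>))" for x
        have c\<psi>: "continuous_on UNIV \<psi>"
          unfolding \<psi>_def using nz by (intro continuous_intros cc g) simp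
        have \<psi>0: "\<psi> x = 0" if "norm x > real (Suc k)" for x
          unfolding \<psi>_def using out[OF that] by simp
        have "norm (\<psi> x) \<le> 1" for x
        proof -
          have "norm (\<psi> x) = ?c k x * (norm (g x) / (norm (g x) + \<delta>))"
            unfolding \<psi>_def norm_mult norm_divide norm_of_real complex_mod_cnj
            using c0[of k x] nz(2)[of x] by simp
          also have "\<dots> \<le> 1 * 1"
            by (intro mult_mono c1 c0) (use nz(2)[of x] \<delta> in \<open>auto simp: divide_le_eq\<close>)
          finally show ?thesis by simp
        qed
        then have N1: "Lp_norm \<infinity> \<psi> \<le> 1"
          by (intro Lp_norm_infinity_le borel_measurable_continuous_onI c\<psi>)
        have g\<psi>: "g x * \<psi> x = of_real (?c k x * ((norm (g x))\<^sup>2 / (norm (g x) + \<delta>)))" for x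
          unfolding \<psi>_def using complex_norm_square[of "g x"] nz(1)[of x] by (simp add: mult.left_commute)
        have cont2: "continuous_on UNIV (\<lambda>x. (norm (g x))\<^sup>2 / (norm (g x) + \<delta>))"
          using nz(3) by (intro continuous_intros g) simp
        have "pairing g \<psi> = of_real (\<integral>x. ?c k x * ((norm (g x))\<^sup>2 / (norm (g x) + \<delta>)) \<partial>lborel)"
          unfolding pairing_def g\<psi> by (rule integral_complex_of_real)
        moreover have "norm (pairing g \<psi>) \<le> M * Lp_norm (conj_exponent q) \<psi>"
        proof (rule norm_pairing_le_continuous[OF g M c\<psi>])
          show "\<psi> x = 0" if "norm x > real (Suc k)" for x using that by (rule \<psi>0)
          show "0 < real (Suc k)" by simp
        qed
        then have "norm (pairing g \<psi>) \<le> M * 1"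
          using mult_left_mono[OF N1 M(1)] unfolding 1(2) by linarith
        ultimately have P: "(\<integral>x. ?c k x * ((norm (g x))\<^sup>2 / (norm (g x) + \<delta>)) \<partial>lborel) \<le> M"
          by simp
        have "(\<integral>x. ?c k x * norm (g x) \<partial>lborel)
            \<le> (\<integral>x. ?c k x * ((norm (g x))\<^sup>2 / (norm (g x) + \<delta>)) + \<delta> * (?c k x * 1) \<partial>lborel)"
        proof (rule integral_mono)
          show "integrable lborel (\<lambda>x. ?c k x * norm (g x))" by (intro int continuous_intros g)
          show "integrable lborel (\<lambda>x. ?c k x * ((norm (g x))\<^sup>2 / (norm (g x) + \<delta>)) + \<delta> * (?c k x * 1))"
            by (intro Bochner_Integration.integrable_add int cont2 integrable_mult_right continuous_intros)
          fix x
          have "norm (g x) \<le> (norm (g x))\<^sup>2 / (norm (g x) + \<delta>) + \<delta>"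
            using nz(2)[of x] \<delta> by (simp add: field_simps power2_eq_square)
          from mult_left_mono[OF this c0[of k x]]
          show "?c k x * norm (g x) \<le> ?c k x * ((norm (g x))\<^sup>2 / (norm (g x) + \<delta>)) + \<delta> * (?c k x * 1)"
            by (simp only: distrib_left mult.commute mult_1_left)
        qed
        also have "\<dots> = (\<integral>x. ?c k x * ((norm (g x))\<^sup>2 / (norm (g x) + \<delta>)) \<partial>lborel) + \<delta> * I"
          unfolding I_def
          by (subst Bochner_Integration.integral_add)
             (intro int cont2 integrable_mult_right continuous_intros | simp)+
        finally show ?thesis using P by linarith
      qed
      show ?thesis
      proof (rule field_le_epsilon)
        fix e :: real assume e: "e > 0"
        have "e / (I + 1) * I \<le> e" using e I by (simp add: field_simps)
        with *[of "e / (I + 1)"] e I show "(\<integral>x. ?c k x * norm (g x) \<partial>lborel) \<le> M + e" by simp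
      qed
    qed
    then have "integrable lborel (\<lambda>x. norm (g x))" "(\<integral>x. norm (g x) \<partial>lborel) \<le> M"
      using integrable_cutoff_limit[of "\<lambda>x. norm (g x)" M] integral_cutoff_limit[of "\<lambda>x. norm (g x)" M] g
      by (simp_all add: continuous_on_norm)
    then show ?thesis
      using 1 mg Lp_ennreal[of 1 g] Lp_norm_ennreal[of 1 g] by simp
  next
    case (2 r s)
    then have rs: "r > 1" "s > 1" "1 / r + 1 / s = 1" by auto
    have rs': "(r - 1) * s = r" using rs by (simp add: field_simps)
    \<comment> \<open>The equality case of Hoelder's inequality: z F(z) = |z|^r and |F(z)|^s =
      |z|^r, since (r - 1) s = r.\<close>
    define F where "F z = cnj z * of_real (norm z powr (r - 2))" for z
    have nF: "norm (F z) = norm z powr (r - 1)" for z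
    proof (cases "z = 0")
      case False
      then have "norm (F z) = norm z powr 1 * norm z powr (r - 2)" by (simp add: F_def norm_mult)
      also have "\<dots> = norm z powr (r - 1)" by (simp only: powr_add[symmetric]) simp
      finally show ?thesis .
    qed (simp add: F_def)
    have zF: "z * F z = of_real (norm z powr r)" for z
    proof (cases "z = 0")
      case False
      have "z * F z = of_real ((norm z)\<^sup>2 * norm z powr (r - 2))"
        using complex_norm_square[of z] by (simp add: F_def)
      also have "(norm z)\<^sup>2 * norm z powr (r - 2) = norm z powr 2 * norm z powr (r - 2)"
        using False by (simp add: powr_numeral)
      also have "\<dots> = norm z powr r" by (simp only: powr_add[symmetric]) simp
      finally show ?thesis .
    qed simp
    \<comment> \<open>For r < 2 the factor |z|^(r-2) is unbounded near 0, but |F(z)| = |z|^(r-1)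
      still tends to 0.\<close>
    have cF: "continuous_on UNIV F"
    proof (rule continuous_at_imp_continuous_on, rule ballI)
      fix z
      show "isCont F z"
      proof (cases "z = 0")
        case True
        have "((\<lambda>z::complex. norm z powr (r - 1)) \<longlongrightarrow> 0) (at 0)"
          by (rule tendsto_zero_powrI[OF tendsto_norm_zero[OF tendsto_ident_at] tendsto_const]) (use rs in auto)
        then have "(F \<longlongrightarrow> 0) (at 0)"
          by (rule Lim_null_comparison[rotated]) (simp add: nF)
        then show ?thesis using True by (simp add: isCont_def F_def)
      next
        case False
        then show ?thesis unfolding F_def isCont_def
          by (intro tendsto_intros) auto
      qed
    qed
    have "(\<integral>x. ?c k x * norm (g x) powr r \<partial>lborel) \<le> M powr r" for k
    proof -
      define I where "I = (\<integral>x. ?c k x * norm (g x) powr r \<partial>lborel)"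
      have cr: "continuous_on UNIV (\<lambda>x. norm (g x) powr r)"
        using rs by (intro continuous_on_powr' continuous_intros g) auto
      have I: "I \<ge> 0" unfolding I_def using c0 by (intro Bochner_Integration.integral_nonneg) simp
      define \<psi> where "\<psi> x = of_real (?c k x) * F (g x)" for x
      have c\<psi>: "continuous_on UNIV \<psi>"
        unfolding \<psi>_def by (intro continuous_intros cc continuous_on_compose2[OF cF g]) auto
      have \<psi>0: "\<psi> x = 0" if "norm x > real (Suc k)" for x
        unfolding \<psi>_def using out[OF that] by simp
      have g\<psi>: "g x * \<psi> x = of_real (?c k x * norm (g x) powr r)" for x
        unfolding \<psi>_def using zF[of "g x"] by (simp add: mult.left_commute)
      have "pairing g \<psi> = of_real I"
        unfolding pairing_def g\<psi> I_def by (rule integral_complex_of_real)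
      moreover have "norm (pairing g \<psi>) \<le> M * Lp_norm (conj_exponent q) \<psi>"
      proof (rule norm_pairing_le_continuous[OF g M c\<psi>])
        show "\<psi> x = 0" if "norm x > real (Suc k)" for x using that by (rule \<psi>0)
        show "0 < real (Suc k)" by simp
      qed
      ultimately have 1: "I \<le> M * Lp_norm (conj_exponent q) \<psi>" using I by simp
      have \<psi>s: "norm (\<psi> x) powr s \<le> ?c k x * norm (g x) powr r" for x
      proof -
        have "norm (\<psi> x) powr s = ?c k x powr s * norm (g x) powr r"
          unfolding \<psi>_def using c0[of k x] rs' by (simp add: norm_mult nF powr_mult powr_powr)
        also have "\<dots> \<le> ?c k x powr 1 * norm (g x) powr r"
          by (intro mult_right_mono powr_mono' c0 c1) (use rs in auto)
        finally show ?thesis using c0[of k x] by simp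
      qed
      have "(\<integral>x. norm (\<psi> x) powr s \<partial>lborel) \<le> I"
        unfolding I_def
      proof (rule integral_mono[OF _ int[OF cr] \<psi>s])
        show "integrable lborel (\<lambda>x. norm (\<psi> x) powr s)"
          by (rule integrable_norm_bound[OF int[OF cr, of k]])
             (use \<psi>s borel_measurable_continuous_onI[OF c\<psi>] in auto)
      qed
      then have "Lp_norm (conj_exponent q) \<psi> \<le> I powr (1 / s)"
        using 2 by (simp add: Lp_norm_ennreal powr_mono2)
      with 1 have IM: "I \<le> M * I powr (1 / s)"
        using M(1) by (meson mult_left_mono order_trans)
      \<comment> \<open>Dividing by I^(1/s) is legitimate because the cutoff has made I a genuine
        finite integral.\<close>
      show "I \<le> M powr r"
      proof (cases "I = 0")
        case False
        with I have I0: "I > 0" by simp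
        have "1 / r = 1 - 1 / s" using rs by linarith
        then have "I powr (1 / r) * I powr (1 / s) = I"
          using I0 by (simp only: powr_add[symmetric]) simp
        with IM have "I powr (1 / r) * I powr (1 / s) \<le> M * I powr (1 / s)" by simp
        then have "I powr (1 / r) \<le> M" using I0 by simp
        then have "(I powr (1 / r)) powr r \<le> M powr r" using rs by (intro powr_mono2) auto
        then show ?thesis using rs I0 by (simp add: powr_powr)
      qed simp
    qed
    moreover have "continuous_on UNIV (\<lambda>x. norm (g x) powr r)"
      using rs by (intro continuous_on_powr' continuous_intros g) auto
    ultimately have i: "integrable lborel (\<lambda>x. norm (g x) powr r)" "(\<integral>x. norm (g x) powr r \<partial>lborel) \<le> M powr r"
      using integrable_cutoff_limit[of "\<lambda>x. norm (g x) powr r" "M powr r"]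
        integral_cutoff_limit[of "\<lambda>x. norm (g x) powr r" "M powr r"] by simp_all
    have "(\<integral>x. norm (g x) powr r \<partial>lborel) powr (1 / r) \<le> (M powr r) powr (1 / r)"
      using i(2) rs by (intro powr_mono2) auto
    also have "\<dots> = M" using rs M(1) by (simp add: powr_powr)
    finally show ?thesis
      using 2 mg i by (simp add: Lp_ennreal Lp_norm_ennreal)
  qed
  then show "g \<in> Lp q" "Lp_norm q g \<le> M" by auto
qed

end

section \<open>Fourier inversion and the Bessel kernels\<close>

text \<open>The operator 1 - \<Delta>.\<close>

definition helmholtz :: "(real^'n::finite \<Rightarrow> complex) \<Rightarrow> real^'n \<Rightarrow> complex" where
  "helmholtz \<phi> = (\<lambda>x. \<phi> x - (\<Sum>i\<in>UNIV. partial_derivs [i, i] \<phi> x))"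

lemma smooth_helmholtz: "smooth \<phi> \<Longrightarrow> smooth (helmholtz \<phi>)"
  unfolding helmholtz_def by (intro smooth_diff smooth_sum smooth_partial_derivs)

lemma smooth_helmholtz_power: "smooth \<phi> \<Longrightarrow> smooth ((helmholtz ^^ m) \<phi>)"
  by (induction m) (auto intro: smooth_helmholtz)

lemma test_functions_diff:
  "\<phi> \<in> test_functions \<Longrightarrow> \<psi> \<in> test_functions \<Longrightarrow> (\<lambda>x. \<phi> x - \<psi> x) \<in> test_functions"
  using test_functions_add[OF _ test_functions_cmult[of \<psi> "-1"]] by simp

lemma test_functions_zero: "(\<lambda>x. 0) \<in> test_functions"
  by (simp add: test_functions_iff)

lemma test_functions_sum:
  "(\<And>i. i \<in> I \<Longrightarrow> f i \<in> test_functions) \<Longrightarrow> (\<lambda>x. \<Sum>i\<in>I. f i x) \<in> test_functions"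
  by (induction I rule: infinite_finite_induct) (auto intro: test_functions_add test_functions_zero)

lemma test_functions_helmholtz: "\<phi> \<in> test_functions \<Longrightarrow> helmholtz \<phi> \<in> test_functions"
  unfolding helmholtz_def
  by (intro test_functions_diff test_functions_sum test_functions_partial_derivs)

lemma test_functions_helmholtz_power:
  "\<phi> \<in> test_functions \<Longrightarrow> (helmholtz ^^ m) \<phi> \<in> test_functions"
  by (induction m) (auto intro: test_functions_helmholtz)

lemma helmholtz_translate:
  assumes "smooth \<phi>"
  shows "helmholtz (\<lambda>x. \<phi> (x + a)) = (\<lambda>x. helmholtz \<phi> (x + a))"
  unfolding helmholtz_def by (simp only: partial_derivs_translate[OF assms])

lemma helmholtz_power_translate:
  assumes "smooth \<phi>"
  shows "(helmholtz ^^ m) (\<lambda>x. \<phi> (x + a)) = (\<lambda>x. (helmholtz ^^ m) \<phi> (x + a))"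
  by (induction m) (simp_all add: helmholtz_translate smooth_helmholtz_power assms)

section \<open>The inverse Fourier transform of test functions\<close>

lemma inverse_fourier_eq:
  "inverse_fourier \<psi> (\<xi>::real^'n::finite) =
   (\<integral>x. exp (\<i> * of_real (\<xi> \<bullet> x)) * \<psi> x \<partial>lborel) / of_real ((2 * pi) ^ CARD('n))"
  by (simp add: inverse_fourier_def fourier_def)

lemma smooth_exp_inner:
  fixes \<xi> :: "real^'n::finite"
  shows "smooth (\<lambda>x. exp (\<i> * of_real (\<xi> \<bullet> x)))"
    and "partial_deriv i (\<lambda>x. exp (\<i> * of_real (\<xi> \<bullet> x))) x = \<i> * of_real (\<xi> $ i) * exp (\<i> * of_real (\<xi> \<bullet> x))"
proof -
  let ?e = "\<lambda>x. exp (\<i> * complex_of_real (\<xi> \<bullet> x))"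
  have d: "(?e has_derivative (\<lambda>v. \<i> * of_real (\<xi> \<bullet> v) * ?e x)) (at x)" for x
  proof -
    have "((\<lambda>x. \<i> * complex_of_real (\<xi> \<bullet> x)) has_derivative (\<lambda>v. \<i> * of_real (\<xi> \<bullet> v))) (at x)"
      by (auto intro!: derivative_eq_intros)
    moreover have "(exp has_derivative (\<lambda>v. v * ?e x)) (at (\<i> * complex_of_real (\<xi> \<bullet> x)))"
      using DERIV_exp[of "\<i> * complex_of_real (\<xi> \<bullet> x)"] unfolding has_field_derivative_def
      by (rule has_derivative_eq_rhs) (simp add: fun_eq_iff)
    ultimately show ?thesis by (rule has_derivative_compose)
  qed
  have p: "partial_deriv i ?e x = \<i> * of_real (\<xi> $ i) * ?e x" for i x
    by (subst partial_derivI[OF d]) (simp add: cart_eq_inner_axis)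
  then show "partial_deriv i ?e x = \<i> * of_real (\<xi> $ i) * ?e x" .
  have dd: "?e differentiable (at x)" for x using d differentiable_def by blast
  show "smooth ?e"
  proof (rule smooth_coinduct[of _ "{\<lambda>x. c * ?e x | c. True}"])
    show "?e \<in> {\<lambda>x. c * ?e x | c. True}" by (auto intro!: exI[of _ 1])
    fix g i x assume "g \<in> {\<lambda>x. c * ?e x | c. True}"
    then obtain c where g: "g = (\<lambda>x. c * ?e x)" by blast
    show "g differentiable at x" unfolding g by (intro differentiable_mult differentiable_const dd)
    have "partial_deriv i g = (\<lambda>x. (c * (\<i> * of_real (\<xi> $ i))) * ?e x)"
      unfolding g by (rule ext) (simp add: partial_deriv_cmult[OF dd] p)
    then show "partial_deriv i g \<in> {\<lambda>x. c * ?e x | c. True}" by blast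
  qed
qed

lemma norm_exp_i_times [simp]: "norm (exp (\<i> * complex_of_real r)) = 1"
  by simp

lemma test_functions_exp_mult_integrable:
  "\<psi> \<in> test_functions \<Longrightarrow> integrable lborel (\<lambda>x. exp (\<i> * of_real (\<xi> \<bullet> x)) * \<psi> x)"
  using decaying_integrable[OF test_functions_decaying[OF test_functions_mult[OF _ smooth_exp_inner(1)]]]
  by (simp add: mult.commute)

lemma inverse_fourier_partial_deriv:
  assumes \<psi>: "\<psi> \<in> test_functions"
  shows "inverse_fourier (partial_deriv i \<psi>) \<xi> = - (\<i> * of_real (\<xi> $ i)) * inverse_fourier \<psi> \<xi>"
proof -
  let ?e = "\<lambda>x. exp (\<i> * complex_of_real (\<xi> \<bullet> x))"
  have p\<psi>: "partial_deriv i \<psi> \<in> test_functions"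
    using test_functions_partial_derivs[OF \<psi>, of "[i]"] by simp
  have "0 = (\<integral>x. partial_deriv i (\<lambda>x. \<psi> x * ?e x) x \<partial>lborel)"
    by (simp add: integral_partial_deriv test_functions_decaying test_functions_mult \<psi> smooth_exp_inner)
  also have "\<dots> = (\<integral>x. ?e x * partial_deriv i \<psi> x + (\<i> * of_real (\<xi> $ i)) * (?e x * \<psi> x) \<partial>lborel)"
    by (intro Bochner_Integration.integral_cong refl)
       (simp add: partial_deriv_mult smooth_differentiable test_functions_smooth \<psi> smooth_exp_inner)
  also have "\<dots> = (\<integral>x. ?e x * partial_deriv i \<psi> x \<partial>lborel) + (\<integral>x. (\<i> * of_real (\<xi> $ i)) * (?e x * \<psi> x) \<partial>lborel)"
    by (intro Bochner_Integration.integral_add integrable_mult_right test_functions_exp_mult_integrable p\<psi> \<psi>)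
  finally have "(\<integral>x. ?e x * partial_deriv i \<psi> x \<partial>lborel) = - (\<i> * of_real (\<xi> $ i)) * (\<integral>x. ?e x * \<psi> x \<partial>lborel)"
    by (simp add: eq_neg_iff_add_eq_0)
  then show ?thesis by (simp add: inverse_fourier_eq)
qed

lemma inverse_fourier_helmholtz:
  fixes \<psi> :: "real^'n::finite \<Rightarrow> complex"
  assumes \<psi>: "\<psi> \<in> test_functions"
  shows "inverse_fourier (helmholtz \<psi>) \<xi> = of_real (1 + (norm \<xi>)\<^sup>2) * inverse_fourier \<psi> \<xi>"
proof -
  have p\<psi>: "partial_deriv i \<psi> \<in> test_functions" for i
    using test_functions_partial_derivs[OF \<psi>, of "[i]"] by simp
  have pp\<psi>: "partial_deriv i (partial_deriv i \<psi>) \<in> test_functions" for i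
    using test_functions_partial_derivs[OF \<psi>, of "[i, i]"] by simp
  let ?e = "\<lambda>x. exp (\<i> * complex_of_real (\<xi> \<bullet> x))"
  have "(\<integral>x. ?e x * helmholtz \<psi> x \<partial>lborel) = (\<integral>x. ?e x * \<psi> x - (\<Sum>i\<in>UNIV. ?e x * partial_deriv i (partial_deriv i \<psi>) x) \<partial>lborel)"
    by (simp add: helmholtz_def right_diff_distrib sum_distrib_left)
  also have "\<dots> = (\<integral>x. ?e x * \<psi> x \<partial>lborel) - (\<Sum>i\<in>UNIV. \<integral>x. ?e x * partial_deriv i (partial_deriv i \<psi>) x \<partial>lborel)"
    by (simp only: Bochner_Integration.integral_diff Bochner_Integration.integral_sum
        test_functions_exp_mult_integrable \<psi> pp\<psi> Bochner_Integration.integrable_sum)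
  finally have "inverse_fourier (helmholtz \<psi>) \<xi> = inverse_fourier \<psi> \<xi> - (\<Sum>i\<in>UNIV. inverse_fourier (partial_deriv i (partial_deriv i \<psi>)) \<xi>)"
    by (simp add: inverse_fourier_eq diff_divide_distrib sum_divide_distrib)
  also have "\<dots> = inverse_fourier \<psi> \<xi> - (\<Sum>i\<in>UNIV. (- (\<i> * of_real (\<xi> $ i)) * - (\<i> * of_real (\<xi> $ i))) * inverse_fourier \<psi> \<xi>)"
    by (simp only: inverse_fourier_partial_deriv p\<psi> \<psi> mult.assoc)
  also have "\<dots> = (1 + (\<Sum>i\<in>UNIV. complex_of_real ((\<xi> $ i)\<^sup>2))) * inverse_fourier \<psi> \<xi>"
    by (simp add: power2_eq_square algebra_simps sum_distrib_left sum_negf)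
  finally show ?thesis by (simp add: norm_vec_sq)
qed

lemma inverse_fourier_helmholtz_power:
  "\<psi> \<in> test_functions \<Longrightarrow>
   inverse_fourier ((helmholtz ^^ m) \<psi>) \<xi> = of_real ((1 + (norm \<xi>)\<^sup>2) ^ m) * inverse_fourier \<psi> \<xi>"
  by (induction m) (simp_all add: inverse_fourier_helmholtz test_functions_helmholtz_power)

lemma borel_measurable_inverse_fourier:
  fixes \<psi> :: "real^'n::finite \<Rightarrow> complex"
  assumes "\<psi> \<in> borel_measurable borel"
  shows "inverse_fourier \<psi> \<in> borel_measurable borel"
proof -
  have "(\<lambda>(\<xi>, x). exp (\<i> * of_real (\<xi> \<bullet> x)) * \<psi> x) \<in> borel_measurable (borel \<Otimes>\<^sub>M (lborel :: (real^'n) measure))"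
    using assms by measurable
  then have "(\<lambda>\<xi>. \<integral>x. exp (\<i> * of_real (\<xi> \<bullet> x)) * \<psi> x \<partial>lborel) \<in> borel_measurable borel"
    by (rule lborel.borel_measurable_lebesgue_integral)
  then show ?thesis
    unfolding inverse_fourier_eq[abs_def] by measurable
qed

text \<open>Applying (1 - \<Delta>)^n to \<psi> multiplies the transform by (1 + |\<xi>|^2)^n, which
  is the reciprocal of \<open>weight\<close>; and the transform of an integrable function is
  bounded.\<close>

lemma inverse_fourier_bound:
  fixes \<psi> :: "real^'n::finite \<Rightarrow> complex"
  assumes \<psi>: "\<psi> \<in> test_functions"
  shows "\<exists>C. \<forall>\<xi>. norm (inverse_fourier \<psi> \<xi>) \<le> C * weight \<xi>"
proof -
  let ?\<psi> = "(helmholtz ^^ CARD('n)) \<psi>"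
  define C where "C = (\<integral>x. norm (?\<psi> x) \<partial>lborel) / (2 * pi) ^ CARD('n)"
  have "norm (inverse_fourier \<psi> \<xi>) \<le> C * weight \<xi>" for \<xi>
  proof -
    have "norm (\<integral>x. exp (\<i> * complex_of_real (\<xi> \<bullet> x)) * ?\<psi> x \<partial>lborel) \<le> (\<integral>x. norm (exp (\<i> * complex_of_real (\<xi> \<bullet> x)) * ?\<psi> x) \<partial>lborel)"
      by (rule integral_norm_bound)
    also have "\<dots> = (\<integral>x. norm (?\<psi> x) \<partial>lborel)" by (simp only: norm_mult norm_exp_i_times mult_1_left)
    finally have "norm (inverse_fourier ?\<psi> \<xi>) \<le> C"
    proof -
      assume le: "norm (\<integral>x. exp (\<i> * complex_of_real (\<xi> \<bullet> x)) * ?\<psi> x \<partial>lborel) \<le> (\<integral>x. norm (?\<psi> x) \<partial>lborel)"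
      have "norm (complex_of_real ((2 * pi) ^ CARD('n))) = (2 * pi) ^ CARD('n)"
        by (simp only: norm_of_real) simp
      then show ?thesis
        unfolding inverse_fourier_eq C_def norm_divide using le by (simp add: divide_right_mono)
    qed
    then have "(1 + (norm \<xi>)\<^sup>2) ^ CARD('n) * norm (inverse_fourier \<psi> \<xi>) \<le> C"
      unfolding inverse_fourier_helmholtz_power[OF \<psi>] by (simp only: norm_mult norm_of_real) simp
    moreover have "0 < (1 + (norm \<xi>)\<^sup>2) ^ CARD('n)" by (simp add: add_pos_nonneg)
    ultimately show ?thesis
      unfolding weight_def divide_inverse[symmetric] by (simp only: pos_le_divide_eq mult.commute)
  qed
  then show ?thesis by blast
qed

lemma inverse_fourier_integrable:
  assumes \<psi>: "\<psi> \<in> test_functions"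
  shows "integrable lborel (inverse_fourier \<psi>)"
  using inverse_fourier_bound[OF \<psi>]
    integrable_weight_bound[OF borel_measurable_inverse_fourier[OF smooth_borel_measurable[OF test_functions_smooth[OF \<psi>]]]]
  by blast

section \<open>Heat kernels and Fourier inversion\<close>

lemma exp_neg_norm_sq_gauss:
  assumes "t \<ge> 0"
  shows "complex_of_real (exp (- t * (norm (\<xi>::real^'n::finite))\<^sup>2)) = of_real (sqrt (2 * pi) ^ CARD('n)) * gauss (sqrt (2 * t) *\<^sub>R \<xi>)"
  using assms by (simp add: gauss_def power_mult_distrib)

lemma integral_exp_gauss_scaled:
  fixes y :: "real^'n::finite"
  assumes c: "c > 0"
  shows "(\<integral>\<xi>. exp (\<i> * of_real (\<xi> \<bullet> y)) * gauss (c *\<^sub>R \<xi>) \<partial>lborel) = of_real (sqrt (2 * pi) ^ CARD('n) / c ^ CARD('n)) * gauss ((1 / c) *\<^sub>R y)"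
proof -
  have "(\<integral>\<eta>. exp (\<i> * of_real (((1 / c) *\<^sub>R y) \<bullet> \<eta>)) * gauss \<eta> \<partial>lborel)
    = \<bar>c\<bar> ^ CARD('n) *\<^sub>R (\<integral>\<xi>. exp (\<i> * of_real (((1 / c) *\<^sub>R y) \<bullet> (c *\<^sub>R \<xi> + 0))) * gauss (c *\<^sub>R \<xi> + 0) \<partial>lborel)"
    by (rule integral_affine) (use c in simp)
  also have "\<dots> = c ^ CARD('n) *\<^sub>R (\<integral>\<xi>. exp (\<i> * of_real (\<xi> \<bullet> y)) * gauss (c *\<^sub>R \<xi>) \<partial>lborel)"
    using c by (simp add: inner_commute)
  finally have "of_real (c ^ CARD('n)) * (\<integral>\<xi>. exp (\<i> * of_real (\<xi> \<bullet> y)) * gauss (c *\<^sub>R \<xi>) \<partial>lborel) = of_real (exp (- (norm ((1 / c) *\<^sub>R y))\<^sup>2 / 2))"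
    unfolding integral_exp_gauss by (simp add: scaleR_conv_of_real)
  also have "\<dots> = of_real (sqrt (2 * pi) ^ CARD('n)) * gauss ((1 / c) *\<^sub>R y)"
    unfolding gauss_def by (simp flip: of_real_mult)
  finally show ?thesis using c by (simp add: field_simps)
qed

text \<open>The multiplication formula: Fubini moves the transform from \<psi> to the function exp
  (- t |\<xi>|^2), whose transform is the heat kernel at time t. Rescaling by sqrt (2 * t) gives the
  form with a fixed Gaussian.\<close>

lemma integral_gauss_inverse_fourier:
  fixes \<psi> :: "real^'n::finite \<Rightarrow> complex"
  assumes \<psi>: "\<psi> \<in> test_functions" and t: "t > 0"
  shows "(\<integral>\<xi>. of_real (exp (- t * (norm \<xi>)\<^sup>2)) * inverse_fourier \<psi> \<xi> \<partial>lborel)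
       = (\<integral>z. gauss z * \<psi> (sqrt (2 * t) *\<^sub>R z) \<partial>lborel)"
proof -
  define c where "c = sqrt (2 * t)"
  have c: "c > 0" using t by (simp add: c_def)
  \<comment> \<open>The Gaussian in \<xi> equals a times \<open>gauss\<close> of c \<xi>, and a^2 =
    (2 pi)^n is the normalisation of the inverse transform, so a factor 1/a remains to cancel
    against the transform of \<open>gauss\<close>.\<close>
  define a where "a = complex_of_real (sqrt (2 * pi) ^ CARD('n))"
  have "sqrt (2 * pi) ^ CARD('n) * sqrt (2 * pi) ^ CARD('n) = (2 * pi) ^ CARD('n)"
    by (simp only: power_mult_distrib[symmetric] real_sqrt_mult_self) simp
  then have a: "a \<noteq> 0" "a * a = of_real ((2 * pi) ^ CARD('n))"
    unfolding a_def of_real_mult[symmetric] by (simp_all only: of_real_eq_0_iff) simp_all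
  have m\<psi>: "\<psi> \<in> borel_measurable borel" by (rule smooth_borel_measurable[OF test_functions_smooth[OF \<psi>]])
  have mg: "gauss \<in> borel_measurable borel" by (rule smooth_borel_measurable[OF smooth_gauss])
  have i\<psi>: "integrable lborel \<psi>" by (rule decaying_integrable[OF test_functions_decaying[OF \<psi>]])
  have ig: "integrable lborel (\<lambda>\<xi>::real^'n. gauss (c *\<^sub>R \<xi>))"
    using integrable_affine_iff[of c "gauss :: real^'n \<Rightarrow> complex" 0] integrable_gauss c by simp
  let ?f = "\<lambda>\<xi> y. gauss (c *\<^sub>R \<xi>) * (exp (\<i> * of_real (\<xi> \<bullet> y)) * \<psi> y)"
  have nf: "norm (?f \<xi> y) = norm (gauss (c *\<^sub>R \<xi>)) * norm (\<psi> y)" for \<xi> y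
    by (simp only: norm_mult norm_exp_i_times mult_1_left)
  have F: "integrable (lborel \<Otimes>\<^sub>M lborel) (\<lambda>(\<xi>, y). ?f \<xi> y)"
  proof (rule lborel_pair.Fubini_integrable)
    show "(\<lambda>(\<xi>, y). ?f \<xi> y) \<in> borel_measurable (lborel \<Otimes>\<^sub>M lborel)"
      using m\<psi> mg by measurable
    show "integrable lborel (\<lambda>\<xi>. \<integral>y. norm (case (\<xi>, y) of (\<xi>, y) \<Rightarrow> ?f \<xi> y) \<partial>lborel)"
      using ig by (simp only: prod.case nf) simp
    show "AE \<xi> in lborel. integrable lborel (\<lambda>y. case (\<xi>, y) of (\<xi>, y) \<Rightarrow> ?f \<xi> y)"
      by (rule AE_I2) (simp only: prod.case integrable_mult_right test_functions_exp_mult_integrable \<psi>)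
  qed
  have "(\<integral>\<xi>. of_real (exp (- t * (norm \<xi>)\<^sup>2)) * inverse_fourier \<psi> \<xi> \<partial>lborel)
      = (\<integral>\<xi>. (1 / a) * (\<integral>y. ?f \<xi> y \<partial>lborel) \<partial>lborel)"
  proof (intro Bochner_Integration.integral_cong refl)
    fix \<xi> :: "real^'n"
    let ?I = "\<integral>x. exp (\<i> * of_real (\<xi> \<bullet> x)) * \<psi> x \<partial>lborel"
    have "(\<integral>y. ?f \<xi> y \<partial>lborel) = gauss (c *\<^sub>R \<xi>) * ?I"
      by (simp only: integral_mult_right_zero)
    then show "of_real (exp (- t * (norm \<xi>)\<^sup>2)) * inverse_fourier \<psi> \<xi> = (1 / a) * (\<integral>y. ?f \<xi> y \<partial>lborel)"
      unfolding exp_neg_norm_sq_gauss[OF less_imp_le[OF t]] inverse_fourier_eq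
        c_def[symmetric] a_def[symmetric] a(2)[symmetric]
      using a(1) by simp
  qed
  also have "\<dots> = (1 / a) * (\<integral>\<xi>. (\<integral>y. ?f \<xi> y \<partial>lborel) \<partial>lborel)" by simp
  also have "(\<integral>\<xi>. (\<integral>y. ?f \<xi> y \<partial>lborel) \<partial>lborel) = (\<integral>y. (\<integral>\<xi>. ?f \<xi> y \<partial>lborel) \<partial>lborel)"
    using lborel_pair.Fubini_integral[OF F] by simp
  also have "\<dots> = (\<integral>y. (a / of_real (c ^ CARD('n))) * (gauss ((1 / c) *\<^sub>R y) * \<psi> y) \<partial>lborel)"
  proof (intro Bochner_Integration.integral_cong refl)
    fix y :: "real^'n"
    have "(\<integral>\<xi>. ?f \<xi> y \<partial>lborel) = (\<integral>\<xi>. (exp (\<i> * of_real (\<xi> \<bullet> y)) * gauss (c *\<^sub>R \<xi>)) * \<psi> y \<partial>lborel)"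
      by (intro Bochner_Integration.integral_cong refl) (simp add: ac_simps)
    also have "\<dots> = (\<integral>\<xi>. (exp (\<i> * of_real (\<xi> \<bullet> y)) * gauss (c *\<^sub>R \<xi>)) \<partial>lborel) * \<psi> y" by simp
    also have "\<dots> = (a / of_real (c ^ CARD('n))) * (gauss ((1 / c) *\<^sub>R y) * \<psi> y)"
      unfolding integral_exp_gauss_scaled[OF c] a_def by simp
    finally show "(\<integral>\<xi>. ?f \<xi> y \<partial>lborel) = (a / of_real (c ^ CARD('n))) * (gauss ((1 / c) *\<^sub>R y) * \<psi> y)" .
  qed
  also have "\<dots> = (a / of_real (c ^ CARD('n))) * (\<integral>y. gauss ((1 / c) *\<^sub>R y) * \<psi> y \<partial>lborel)" by simp
  also have "(\<integral>y. gauss ((1 / c) *\<^sub>R y) * \<psi> y \<partial>lborel)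
     = \<bar>c\<bar> ^ CARD('n) *\<^sub>R (\<integral>z. gauss ((1 / c) *\<^sub>R (c *\<^sub>R z + 0)) * \<psi> (c *\<^sub>R z + 0) \<partial>lborel)"
    by (rule integral_affine) (use c in simp)
  also have "\<dots> = \<bar>c\<bar> ^ CARD('n) *\<^sub>R (\<integral>z. gauss z * \<psi> (c *\<^sub>R z) \<partial>lborel)"
    using c by simp
  also have "\<dots> = of_real (c ^ CARD('n)) * (\<integral>z. gauss z * \<psi> (c *\<^sub>R z) \<partial>lborel)"
    using c by (simp only: scaleR_conv_of_real abs_of_pos)
  finally show ?thesis
    using c a(1) by (simp add: c_def[symmetric])
qed

lemma test_functions_bounded:
  "\<phi> \<in> test_functions \<Longrightarrow> \<exists>B>0. \<forall>x. norm (partial_derivs \<alpha> \<phi> x) \<le> B"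
  by (intro decaying_bounded test_functions_decaying)

text \<open>Let t tend to 0 in the multiplication formula; the Gaussian has mass 1. Inversion at the
  origin is the case used for the Bessel kernels, and translations carry it to other points.\<close>

lemma Fourier_inversion:
  fixes \<psi> :: "real^'n::finite \<Rightarrow> complex"
  assumes \<psi>: "\<psi> \<in> test_functions"
  shows "(\<integral>\<xi>. inverse_fourier \<psi> \<xi> \<partial>lborel) = \<psi> 0"
proof -
  let ?t = "\<lambda>k. 1 / real (Suc k)"
  have t0: "?t \<longlonglongrightarrow> 0" by (rule LIMSEQ_Suc[OF lim_1_over_n])
  have m\<psi>[measurable]: "\<psi> \<in> borel_measurable borel" by (rule smooth_borel_measurable[OF test_functions_smooth[OF \<psi>]])
  have mg[measurable]: "gauss \<in> borel_measurable borel" by (rule smooth_borel_measurable[OF smooth_gauss])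
  have mi[measurable]: "inverse_fourier \<psi> \<in> borel_measurable borel" by (rule borel_measurable_inverse_fourier[OF m\<psi>])
  obtain B where B: "B > 0" "\<And>x. norm (\<psi> x) \<le> B"
    using test_functions_bounded[OF \<psi>, of "[]"] by auto
  have lim1: "(\<lambda>k. \<integral>\<xi>. of_real (exp (- ?t k * (norm \<xi>)\<^sup>2)) * inverse_fourier \<psi> \<xi> \<partial>lborel) \<longlonglongrightarrow> (\<integral>\<xi>. inverse_fourier \<psi> \<xi> \<partial>lborel)"
  proof (rule integral_dominated_convergence[where w = "\<lambda>\<xi>. norm (inverse_fourier \<psi> \<xi>)"])
    show "AE \<xi> in lborel. (\<lambda>k. of_real (exp (- ?t k * (norm \<xi>)\<^sup>2)) * inverse_fourier \<psi> \<xi>) \<longlonglongrightarrow> inverse_fourier \<psi> \<xi>"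
    proof (rule AE_I2)
      fix \<xi> :: "real^'n"
      have "(\<lambda>k. of_real (exp (- ?t k * (norm \<xi>)\<^sup>2)) * inverse_fourier \<psi> \<xi>) \<longlonglongrightarrow> of_real (exp (- 0 * (norm \<xi>)\<^sup>2)) * inverse_fourier \<psi> \<xi>"
        by (intro tendsto_intros t0)
      then show "(\<lambda>k. of_real (exp (- ?t k * (norm \<xi>)\<^sup>2)) * inverse_fourier \<psi> \<xi>) \<longlonglongrightarrow> inverse_fourier \<psi> \<xi>" by simp
    qed
    show "AE \<xi> in lborel. norm (of_real (exp (- ?t k * (norm \<xi>)\<^sup>2)) * inverse_fourier \<psi> \<xi>) \<le> norm (inverse_fourier \<psi> \<xi>)" for k
    proof (rule AE_I2)
      fix \<xi> :: "real^'n"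
      have "exp (- ?t k * (norm \<xi>)\<^sup>2) \<le> 1" by simp
      then show "norm (of_real (exp (- ?t k * (norm \<xi>)\<^sup>2)) * inverse_fourier \<psi> \<xi>) \<le> norm (inverse_fourier \<psi> \<xi>)"
        unfolding norm_mult norm_of_real by (intro mult_left_le_one_le) auto
    qed
  qed (use mi inverse_fourier_integrable[OF \<psi>] in auto)
  have lim2: "(\<lambda>k. \<integral>z. gauss z * \<psi> (sqrt (2 * ?t k) *\<^sub>R z) \<partial>lborel) \<longlonglongrightarrow> (\<integral>z. gauss z * \<psi> (0 *\<^sub>R z) \<partial>lborel)"
  proof (rule integral_dominated_convergence[where w = "\<lambda>z. norm (gauss z) * B"])
    show "AE z in lborel. (\<lambda>k. gauss z * \<psi> (sqrt (2 * ?t k) *\<^sub>R z)) \<longlonglongrightarrow> gauss z * \<psi> (0 *\<^sub>R z)"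
    proof (rule AE_I2, rule tendsto_mult_left)
      fix z :: "real^'n"
      have "(\<lambda>k. sqrt (2 * ?t k) *\<^sub>R z) \<longlonglongrightarrow> sqrt (2 * 0) *\<^sub>R z"
        by (intro tendsto_intros t0)
      then show "(\<lambda>k. \<psi> (sqrt (2 * ?t k) *\<^sub>R z)) \<longlonglongrightarrow> \<psi> (0 *\<^sub>R z)"
        by (intro isCont_tendsto_compose[OF smooth_isCont[OF test_functions_smooth[OF \<psi>]]]) simp
    qed
    show "AE z in lborel. norm (gauss z * \<psi> (sqrt (2 * ?t k) *\<^sub>R z)) \<le> norm (gauss z) * B" for k
      by (rule AE_I2) (use B in \<open>auto simp: norm_mult intro!: mult_left_mono\<close>)
  qed (use integrable_norm[OF integrable_gauss[where 'a = 'n]] in \<open>simp_all, measurable\<close>)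
  have "(\<lambda>k. \<integral>\<xi>. of_real (exp (- ?t k * (norm \<xi>)\<^sup>2)) * inverse_fourier \<psi> \<xi> \<partial>lborel)
      = (\<lambda>k. \<integral>z. gauss z * \<psi> (sqrt (2 * ?t k) *\<^sub>R z) \<partial>lborel)"
    by (rule ext, rule integral_gauss_inverse_fourier[OF \<psi>]) simp
  then have "(\<integral>\<xi>. inverse_fourier \<psi> \<xi> \<partial>lborel) = (\<integral>z. gauss z * \<psi> (0 *\<^sub>R (z::real^'n)) \<partial>lborel)"
    using LIMSEQ_unique[OF lim1] lim2 by simp
  also have "\<dots> = \<psi> 0" by (simp add: integral_gauss)
  finally show ?thesis .
qed

section \<open>Bessel kernels as fundamental solutions and as superpositions of heat kernels\<close>

lemma bessel_kernel_eq:
  "bessel_kernel (2 * real m) \<psi> = (\<integral>\<xi>. of_real (inverse ((1 + (norm (\<xi>::real^'n::finite))\<^sup>2) ^ m)) * inverse_fourier \<psi> \<xi> \<partial>lborel)"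
proof -
  have "(1 + (norm \<xi>)\<^sup>2) powr (- (2 * real m) / 2) = inverse ((1 + (norm \<xi>)\<^sup>2) ^ m)" for \<xi> :: "real^'n"
  proof -
    have "0 < 1 + (norm \<xi>)\<^sup>2" by (simp add: add_pos_nonneg)
    then show ?thesis by (simp add: powr_minus powr_realpow)
  qed
  then show ?thesis
    by (simp add: bessel_kernel_def inverse_fourier_dist_def pairing_def)
qed

text \<open>Under the inverse transform (1 - \<Delta>)^m multiplies by (1 + |\<xi>|^2)^m, cancelling
  the symbol of the kernel; what remains is Fourier inversion at 0. Since 1 - \<Delta> is its own
  transpose, this says that the kernel is a fundamental solution.\<close>

lemma bessel_kernel_helmholtz_power:
  fixes \<psi> :: "real^'n::finite \<Rightarrow> complex"
  assumes \<psi>: "\<psi> \<in> test_functions"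
  shows "bessel_kernel (2 * real m) ((helmholtz ^^ m) \<psi>) = \<psi> 0"
proof -
  have "bessel_kernel (2 * real m) ((helmholtz ^^ m) \<psi>) = (\<integral>\<xi>. inverse_fourier \<psi> \<xi> \<partial>lborel)"
    unfolding bessel_kernel_eq inverse_fourier_helmholtz_power[OF \<psi>]
  proof (intro Bochner_Integration.integral_cong refl)
    fix \<xi> :: "real^'n"
    have nz: "(1 + (norm \<xi>)\<^sup>2) ^ m \<noteq> 0"
      using add_pos_nonneg[of 1 "(norm \<xi>)\<^sup>2"] by simp
    have "of_real (inverse ((1 + (norm \<xi>)\<^sup>2) ^ m)) * complex_of_real ((1 + (norm \<xi>)\<^sup>2) ^ m) = 1"
      by (simp only: of_real_mult[symmetric] left_inverse[OF nz] of_real_1)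
    then show "of_real (inverse ((1 + (norm \<xi>)\<^sup>2) ^ m)) * (of_real ((1 + (norm \<xi>)\<^sup>2) ^ m) * inverse_fourier \<psi> \<xi>) = inverse_fourier \<psi> \<xi>"
      by (simp only: mult.assoc[symmetric] mult_1_left)
  qed
  then show ?thesis by (simp add: Fourier_inversion[OF \<psi>])
qed

text \<open>Beware of the shift: the index k belongs to the kernel of order 2m with m = k +
  1.\<close>

abbreviation erlang :: "nat \<Rightarrow> real \<Rightarrow> real" where
  "erlang k \<equiv> erlang_density k 1"

text \<open>Multiplying by exp (- t r) changes the rate from 1 to 1 + r: up to the factor (1 +
  r)^(-(k+1)) the integrand is the Erlang density of that rate, which has mass 1.\<close>

lemma integral_erlang_exp:
  assumes r: "r \<ge> 0"
  shows "integrable lborel (\<lambda>t. erlang k t * exp (- t * r))"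
    and "(\<integral>t. erlang k t * exp (- t * r) \<partial>lborel) = inverse ((1 + r) ^ Suc k)"
proof -
  have eq: "erlang k t * exp (- t * r) = inverse ((1 + r) ^ Suc k) * erlang_density k (1 + r) t" for t
  proof -
    have E: "exp (- (1 + r) * t) = exp (- t) * exp (- t * r)"
      by (simp add: exp_add[symmetric] algebra_simps)
    have "(1 + r) ^ Suc k \<noteq> 0" using r by simp
    then show ?thesis unfolding erlang_density_def E by (simp del: power_Suc)
  qed
  have "emeasure (density lborel (erlang_density k (1 + r))) (space (density lborel (erlang_density k (1 + r)))) = 1"
    using r by (intro prob_space.emeasure_space_1 prob_space_erlang_density) simp
  then have nn: "(\<integral>\<^sup>+t. ennreal (erlang_density k (1 + r) t) \<partial>lborel) = 1"
    by (simp add: emeasure_density)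
  have int: "integrable lborel (erlang_density k (1 + r))"
    by (rule integrableI_nonneg) (use nn r in auto)
  have "(\<integral>t. erlang_density k (1 + r) t \<partial>lborel) = 1"
    using nn r by (subst (asm) nn_integral_eq_integral[OF int]) auto
  then show "integrable lborel (\<lambda>t. erlang k t * exp (- t * r))"
    "(\<integral>t. erlang k t * exp (- t * r) \<partial>lborel) = inverse ((1 + r) ^ Suc k)"
    unfolding eq using int by simp_all
qed

lemma integrable_erlang: "integrable lborel (erlang k)"
  using integral_erlang_exp(1)[of 0 k] by simp

text \<open>The Erlang integral with r = |\<xi>|^2 represents the symbol (1 + |\<xi>|^2)^(-m). After
  exchanging the integrals, the integral over \<xi> is the multiplication formula at time t.\<close>

lemma bessel_kernel_heat:
  fixes \<psi> :: "real^'n::finite \<Rightarrow> complex"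
  assumes \<psi>: "\<psi> \<in> test_functions"
  shows "bessel_kernel (2 * real (Suc k)) \<psi> =
    (\<integral>t. of_real (erlang k t) * (\<integral>z. gauss z * \<psi> (sqrt (2 * t) *\<^sub>R z) \<partial>lborel) \<partial>lborel)"
proof -
  let ?f = "\<lambda>\<xi> t. complex_of_real (erlang k t * exp (- t * (norm (\<xi>::real^'n))\<^sup>2)) * inverse_fourier \<psi> \<xi>"
  have m\<psi>: "\<psi> \<in> borel_measurable borel" by (rule smooth_borel_measurable[OF test_functions_smooth[OF \<psi>]])
  have mi[measurable]: "inverse_fourier \<psi> \<in> borel_measurable borel" by (rule borel_measurable_inverse_fourier[OF m\<psi>])
  have nf: "norm (?f \<xi> t) = (erlang k t * exp (- t * (norm \<xi>)\<^sup>2)) * norm (inverse_fourier \<psi> \<xi>)" for \<xi> t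
    unfolding norm_mult norm_of_real by simp
  have F: "integrable (lborel \<Otimes>\<^sub>M lborel) (\<lambda>(\<xi>, t). ?f \<xi> t)"
  proof (rule lborel_pair.Fubini_integrable)
    show "(\<lambda>(\<xi>, t). ?f \<xi> t) \<in> borel_measurable (lborel \<Otimes>\<^sub>M lborel)" by measurable
    have "integrable lborel (\<lambda>\<xi>. inverse ((1 + (norm \<xi>)\<^sup>2) ^ Suc k) * norm (inverse_fourier \<psi> \<xi>))"
    proof (rule integrable_norm_bound[OF integrable_norm[OF inverse_fourier_integrable[OF \<psi>]]])
      fix \<xi> :: "real^'n"
      have "1 \<le> (1 + (norm \<xi>)\<^sup>2) ^ Suc k" by (intro one_le_power) simp
      then have "inverse ((1 + (norm \<xi>)\<^sup>2) ^ Suc k) \<le> 1" by (rule le_imp_inverse_le[of 1, simplified])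
      then show "norm (inverse ((1 + (norm \<xi>)\<^sup>2) ^ Suc k) * norm (inverse_fourier \<psi> \<xi>)) \<le> norm (inverse_fourier \<psi> \<xi>)"
        by (simp add: abs_mult mult_left_le_one_le del: power_Suc)
    qed measurable
    then show "integrable lborel (\<lambda>\<xi>. \<integral>t. norm (case (\<xi>, t) of (\<xi>, t) \<Rightarrow> ?f \<xi> t) \<partial>lborel)"
      by (simp only: prod.case nf integral_mult_left_zero integral_erlang_exp(2) zero_le_power2)
    show "AE \<xi> in lborel. integrable lborel (\<lambda>t. case (\<xi>, t) of (\<xi>, t) \<Rightarrow> ?f \<xi> t)"
      by (rule AE_I2) (simp only: prod.case integrable_mult_left integrable_of_real integral_erlang_exp(1) zero_le_power2)
  qed
  have "bessel_kernel (2 * real (Suc k)) \<psi> = (\<integral>\<xi>. (\<integral>t. ?f \<xi> t \<partial>lborel) \<partial>lborel)"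
    unfolding bessel_kernel_eq
    by (simp only: integral_mult_left_zero integral_complex_of_real integral_erlang_exp(2) zero_le_power2)
  also have "\<dots> = (\<integral>t. (\<integral>\<xi>. ?f \<xi> t \<partial>lborel) \<partial>lborel)"
    using lborel_pair.Fubini_integral[OF F] by simp
  also have "\<dots> = (\<integral>t. of_real (erlang k t) * (\<integral>z. gauss z * \<psi> (sqrt (2 * t) *\<^sub>R z) \<partial>lborel) \<partial>lborel)"
  proof (rule integral_cong_AE)
    have "AE t::real in lborel. t \<noteq> 0" by (rule AE_lborel_singleton)
    then show "AE t in lborel. (\<integral>\<xi>. ?f \<xi> t \<partial>lborel) = of_real (erlang k t) * (\<integral>z. gauss z * \<psi> (sqrt (2 * t) *\<^sub>R z) \<partial>lborel)"
    proof eventually_elim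
      case (elim t)
      show ?case
      proof (cases "t > 0")
        case True
        have "(\<integral>\<xi>. ?f \<xi> t \<partial>lborel) = of_real (erlang k t) * (\<integral>\<xi>. of_real (exp (- t * (norm \<xi>)\<^sup>2)) * inverse_fourier \<psi> \<xi> \<partial>lborel)"
          by (simp only: of_real_mult mult.assoc integral_mult_right_zero)
        then show ?thesis by (simp only: integral_gauss_inverse_fourier[OF \<psi> True])
      next
        case False
        with elim have "erlang k t = 0" by (simp add: erlang_density_def)
        then show ?thesis by simp
      qed
    qed
    have [measurable]: "\<psi> \<in> borel_measurable borel" "gauss \<in> borel_measurable (borel :: (real^'n) measure)"
      using m\<psi> smooth_borel_measurable[OF smooth_gauss] by auto
    show "(\<lambda>t. \<integral>\<xi>. ?f \<xi> t \<partial>lborel) \<in> borel_measurable lborel" by measurable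
    show "(\<lambda>t. of_real (erlang k t) * (\<integral>z. gauss z * \<psi> (sqrt (2 * t) *\<^sub>R z) \<partial>lborel)) \<in> borel_measurable lborel" by measurable
  qed
  finally show ?thesis .
qed

section \<open>Heat averages\<close>

text \<open>A is the range of times that is kept. The power j of 1 / sqrt (2 * t) counts the
  derivatives moved onto a Gaussian of width sqrt (2 * t), together with the n factors of its
  normalisation when the kernel is written as a function.\<close>

definition heat_weight :: "nat \<Rightarrow> real set \<Rightarrow> nat \<Rightarrow> real \<Rightarrow> real" where
  "heat_weight k A j t = indicator A t * erlang k t / sqrt (2 * t) ^ j"

lemma borel_measurable_heat_weight [measurable]:
  assumes [measurable]: "A \<in> sets borel"
  shows "heat_weight k A j \<in> borel_measurable borel"
  unfolding heat_weight_def[abs_def] by measurable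

lemma heat_weight_nonneg: "A \<subseteq> {0<..} \<Longrightarrow> 0 \<le> heat_weight k A j t"
  by (auto simp: heat_weight_def indicator_def intro!: divide_nonneg_nonneg)

lemma heat_weight_outside: "t \<notin> A \<Longrightarrow> heat_weight k A j t = 0"
  by (simp add: heat_weight_def)

lemma heat_weight_Suc: "heat_weight k A (Suc j) t = heat_weight k A j t / sqrt (2 * t)"
  by (simp add: heat_weight_def)

lemma heat_weight_add: "heat_weight k A (i + j) t = heat_weight k A i t * (1 / sqrt (2 * t)) ^ j"
  by (simp add: heat_weight_def power_add power_divide)

lemma heat_weight_Un:
  "A \<inter> B = {} \<Longrightarrow> heat_weight k (A \<union> B) j t = heat_weight k A j t + heat_weight k B j t"
  by (auto simp: heat_weight_def indicator_def)

text \<open>t^k / k! is a single term of the exponential series.\<close>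

lemma erlang_le_1: "erlang k t \<le> 1"
proof (cases "t < 0")
  case False
  have "t ^ k / fact k \<le> exp t"
  proof -
    have exp: "(\<lambda>n. t ^ n /\<^sub>R fact n) sums exp t" by (rule exp_converges)
    have "(\<Sum>n\<in>{k}. t ^ n /\<^sub>R fact n) \<le> (\<Sum>n. t ^ n /\<^sub>R fact n)"
      using False by (intro sum_le_suminf sums_summable[OF exp]) auto
    then have "(\<Sum>n\<in>{k}. t ^ n /\<^sub>R fact n) \<le> exp t"
      by (simp only: sums_unique[OF exp, symmetric])
    then show ?thesis by (simp add: divide_inverse mult.commute)
  qed
  then show ?thesis using False by (simp add: erlang_density_def exp_minus field_simps)
qed (simp add: erlang_density_def)

text \<open>Near \<open>t = 0\<close> the factor \<open>t\<^sup>k\<close> of the Erlang density absorbs the negative powers of \<open>\<surd>t\<close>.\<close>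

lemma heat_weight_le:
  assumes A: "A \<subseteq> {0<..}" and kj: "j \<le> k"
  shows "heat_weight k A j t \<le> erlang k t + erlang (k - j) t"
proof (cases "t \<in> A")
  case True
  then have t: "t > 0" using A by auto
  have e0: "0 \<le> erlang k t" "0 \<le> erlang (k - j) t" by simp_all
  have hw: "heat_weight k A j t = erlang k t / sqrt (2 * t) ^ j"
    using True by (simp add: heat_weight_def)
  show ?thesis
  proof (cases "t \<ge> 1")
    case True
    then have ge: "1 \<le> sqrt (2 * t) ^ j" by (intro one_le_power) simp
    from mult_left_mono[OF ge e0(1)] have "erlang k t / sqrt (2 * t) ^ j \<le> erlang k t"
      using t by (simp add: divide_le_eq)
    then show ?thesis using hw e0 by linarith
  next
    case False
    have "t * t \<le> 2 * t" using False t by (intro mult_right_mono) auto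
    then have "t \<le> sqrt (2 * t)" using t by (intro real_le_rsqrt) (simp add: power2_eq_square)
    then have "t ^ j \<le> sqrt (2 * t) ^ j" using t by (intro power_mono) auto
    then have "erlang k t / sqrt (2 * t) ^ j \<le> erlang k t / t ^ j"
      using t e0 by (intro divide_left_mono) auto
    also have "\<dots> = t ^ (k - j) * exp (- t) / fact k"
      using t kj by (simp add: erlang_density_def power_diff)
    also have "\<dots> \<le> t ^ (k - j) * exp (- t) / fact (k - j)"
      using t by (intro divide_left_mono fact_mono) auto
    also have "\<dots> = erlang (k - j) t" using t by (simp add: erlang_density_def)
    finally show ?thesis using hw e0 by linarith
  qed
qed (simp add: heat_weight_outside)

lemma integrable_heat_weight:
  assumes A: "A \<in> sets borel" "A \<subseteq> {0<..}" and kj: "j \<le> k"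
  shows "integrable lborel (heat_weight k A j)"
  by (rule integrable_norm_bound[of _ "\<lambda>t. erlang k t + erlang (k - j) t"])
     (use A heat_weight_le[OF A(2) kj] heat_weight_nonneg[OF A(2)] integrable_erlang in auto)

text \<open>Both densities bounding the weight in \<open>heat_weight_le\<close> are at most 1, and A
  lies in an interval of length e. This linear rate is the source of all smallness at small
  times.\<close>

lemma integral_heat_weight_small:
  assumes A: "A \<in> sets borel" "A \<subseteq> {0<..e}" and kj: "j \<le> k" and e: "e > 0"
  shows "(\<integral>t. heat_weight k A j t \<partial>lborel) \<le> 2 * e"
proof -
  have A0: "A \<subseteq> {0<..}" using A by auto
  have "(\<integral>t. heat_weight k A j t \<partial>lborel) \<le> (\<integral>t. 2 * indicator {0<..e} t \<partial>lborel)"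
  proof (rule integral_mono[OF integrable_heat_weight[OF A(1) A0 kj]])
    show "integrable lborel (\<lambda>t. 2 * indicator {0<..e} t :: real)"
      using e by (intro integrable_mult_right integrable_real_indicator) auto
    fix t
    show "heat_weight k A j t \<le> 2 * indicator {0<..e} t"
    proof (cases "t \<in> A")
      case True
      then show ?thesis
        using heat_weight_le[OF A0 kj, of t] erlang_le_1[of k t] erlang_le_1[of "k - j" t] A by auto
    qed (simp add: heat_weight_outside)
  qed
  also have "\<dots> = 2 * e" using e by simp
  finally show ?thesis .
qed

lemma heat_weight_away:
  assumes A: "A \<subseteq> {e<..}" and e: "e > 0"
  shows "heat_weight k A j t \<le> (1 / sqrt (2 * e)) ^ j * erlang k t"
proof (cases "t \<in> A")
  case True
  then have t: "t > e" using A by auto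
  have "(1 / sqrt (2 * t)) ^ j \<le> (1 / sqrt (2 * e)) ^ j"
    using t e by (intro power_mono divide_left_mono) auto
  from mult_right_mono[OF this, of "erlang k t"] True show ?thesis
    by (simp add: heat_weight_def power_divide)
qed (use e in \<open>simp add: heat_weight_outside\<close>)

text \<open>The polynomial factor is the one that \<open>weight_affine\<close> yields for c = 1 /
  sqrt (2 * t). With r = (1 + 2 t) / 4 it equals 8^N r^N, and exp (- t) = exp (1/4) exp (- r) exp (-
  t/2): the middle factor absorbs r^N and the last leaves an Erlang density of rate 1/2.\<close>

lemma integrable_heat_weight_away:
  assumes A: "A \<in> sets borel" "A \<subseteq> {e<..}" and e: "e > 0"
  shows "integrable lborel (\<lambda>t. heat_weight k A j t * (2 * (1 + 2 * t)) ^ N)"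
proof -
  have A0: "A \<subseteq> {0<..}" using A(2) e by auto
  obtain K where K: "K > 0" "\<And>r. r \<ge> 0 \<Longrightarrow> r ^ N * exp (- r :: real) \<le> K"
    using power_times_exp_bounded by metis
  define D where "D = (1 / sqrt (2 * e)) ^ j * (8 ^ N * exp (1/4) * K) * 2 ^ Suc k"
  have half: "integrable lborel (erlang_density k (1/2))"
  proof -
    have "emeasure (density lborel (erlang_density k (1/2))) (space (density lborel (erlang_density k (1/2)))) = 1"
      by (intro prob_space.emeasure_space_1 prob_space_erlang_density) simp
    then have "(\<integral>\<^sup>+t. ennreal (erlang_density k (1/2) t) \<partial>lborel) = 1"
      by (simp add: emeasure_density)
    then show ?thesis by (intro integrableI_nonneg) auto
  qed
  show ?thesis
  proof (rule integrable_norm_bound[of _ "\<lambda>t. D * erlang_density k (1/2) t"])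
    show "integrable lborel (\<lambda>t. D * erlang_density k (1/2) t)" using half by simp
    show "(\<lambda>t. heat_weight k A j t * (2 * (1 + 2 * t)) ^ N) \<in> borel_measurable lborel"
      using A by measurable
    fix t
    show "norm (heat_weight k A j t * (2 * (1 + 2 * t)) ^ N) \<le> D * erlang_density k (1/2) t"
    proof (cases "t \<in> A")
      case True
      then have t: "t > 0" using A0 by auto
      let ?r = "(1 + 2 * t) / 4"
      have "(2 * (1 + 2 * t)) ^ N = 8 ^ N * ?r ^ N" 
      proof -
        have "2 * (1 + 2 * t) = 8 * ?r" by (simp add: field_simps)
        then show ?thesis by (simp only: power_mult_distrib)
      qed
      moreover have "exp (- t) = exp (1/4) * exp (- ?r) * exp (- t / 2)"
        by (simp add: exp_add[symmetric] field_simps)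
      ultimately have "exp (- t) * (2 * (1 + 2 * t)) ^ N = 8 ^ N * exp (1/4) * (?r ^ N * exp (- ?r)) * exp (- t / 2)"
        by (simp only: ac_simps)
      also have "\<dots> \<le> 8 ^ N * exp (1/4) * K * exp (- t / 2)"
        using K(2)[of ?r] t by (intro mult_right_mono mult_left_mono) auto
      finally have *: "exp (- t) * (2 * (1 + 2 * t)) ^ N \<le> 8 ^ N * exp (1/4) * K * exp (- t / 2)" .
      have "erlang k t * (2 * (1 + 2 * t)) ^ N = t ^ k / fact k * (exp (- t) * (2 * (1 + 2 * t)) ^ N)"
        using t by (simp add: erlang_density_def)
      also have "\<dots> \<le> t ^ k / fact k * (8 ^ N * exp (1/4) * K * exp (- t / 2))"
        using t by (intro mult_left_mono *) auto
      also have "\<dots> = (8 ^ N * exp (1/4) * K) * 2 ^ Suc k * erlang_density k (1/2) t"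
        using t by (simp add: erlang_density_def power_divide)
      finally have E: "erlang k t * (2 * (1 + 2 * t)) ^ N \<le> (8 ^ N * exp (1/4) * K) * 2 ^ Suc k * erlang_density k (1/2) t" .
      have "heat_weight k A j t * (2 * (1 + 2 * t)) ^ N \<le> (1 / sqrt (2 * e)) ^ j * erlang k t * (2 * (1 + 2 * t)) ^ N"
        using t by (intro mult_right_mono heat_weight_away A e) auto
      also have "\<dots> = (1 / sqrt (2 * e)) ^ j * (erlang k t * (2 * (1 + 2 * t)) ^ N)" by simp
      also have "\<dots> \<le> (1 / sqrt (2 * e)) ^ j * ((8 ^ N * exp (1/4) * K) * 2 ^ Suc k * erlang_density k (1/2) t)"
        using e by (intro mult_left_mono E) auto
      also have "\<dots> = D * erlang_density k (1/2) t" by (simp add: D_def)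
      finally show ?thesis using heat_weight_nonneg[OF A0, of k j t] t by (simp add: abs_mult)
    next
      case False
      have "0 \<le> D" using e K(1) by (simp add: D_def)
      then show ?thesis using False by (simp add: heat_weight_outside)
    qed
  qed
qed

lemma integrable_heat_weight_away_0:
  assumes "A \<in> sets borel" "A \<subseteq> {e<..}" "e > 0"
  shows "integrable lborel (heat_weight k A j)"
  using integrable_heat_weight_away[OF assms, of k j 0] by simp

section \<open>Averages over heat kernels, with derivatives on the Gaussian\<close>

definition heat_kernel :: "nat \<Rightarrow> real set \<Rightarrow> 'n::finite list \<Rightarrow> real \<times> (real^'n) \<Rightarrow> complex" where
  "heat_kernel k A \<beta> = (\<lambda>(t, z). of_real (heat_weight k A (length \<beta>) t) * partial_derivs \<beta> gauss z)"

text \<open>Convolution with the part of the Bessel kernel of order 2 (k + 1) that comes from the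
  times in A, if \<beta> is empty. The space variable is rescaled so that the Gaussian does not
  depend on t, and the integral is over the product measure so that \<open>Lp_average\<close>
  applies directly.\<close>

definition heat_average :: "nat \<Rightarrow> real set \<Rightarrow> 'n::finite list \<Rightarrow> (real^'n \<Rightarrow> complex) \<Rightarrow> real^'n \<Rightarrow> complex" where
  "heat_average k A \<beta> \<phi> x =
     (\<integral>w. heat_kernel k A \<beta> w * \<phi> (x + sqrt (2 * fst w) *\<^sub>R snd w) \<partial>(lborel \<Otimes>\<^sub>M lborel))"

lemma sigma_finite_pair: "sigma_finite_measure (lborel \<Otimes>\<^sub>M lborel :: (real \<times> (real^'n::finite)) measure)"
  unfolding lborel_prod by (rule sigma_finite_lborel)

lemma borel_measurable_partial_derivs_gauss [measurable]: "partial_derivs \<beta> gauss \<in> borel_measurable borel"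
  by (intro borel_measurable_partial_derivs smooth_gauss)

lemma integrable_partial_derivs_gauss: "integrable lborel (partial_derivs \<beta> gauss)"
  by (intro decaying_integrable decaying_partial_derivs decaying_gauss)

lemma borel_measurable_heat_kernel [measurable]:
  fixes \<beta> :: "'n::finite list"
  assumes [measurable]: "A \<in> sets borel"
  shows "heat_kernel k A \<beta> \<in> borel_measurable (lborel \<Otimes>\<^sub>M lborel)"
  unfolding heat_kernel_def by measurable

lemma
  fixes \<beta> :: "'n::finite list"
  assumes A: "A \<in> sets borel" "A \<subseteq> {0<..}" and int: "integrable lborel (heat_weight k A (length \<beta>))"
  shows integrable_heat_kernel: "integrable (lborel \<Otimes>\<^sub>M lborel) (heat_kernel k A \<beta>)"
    and integral_norm_heat_kernel: "(\<integral>w. norm (heat_kernel k A \<beta> w) \<partial>(lborel \<Otimes>\<^sub>M lborel))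
      = (\<integral>t. heat_weight k A (length \<beta>) t \<partial>lborel) * (\<integral>z. norm (partial_derivs \<beta> gauss z) \<partial>lborel)"
proof -
  note [measurable] = A(1)
  let ?I = "\<integral>z. norm (partial_derivs \<beta> gauss z) \<partial>lborel"
  have n: "norm (heat_kernel k A \<beta> (t, z)) = heat_weight k A (length \<beta>) t * norm (partial_derivs \<beta> gauss z)" for t z
    using heat_weight_nonneg[OF A(2), of k "length \<beta>" t] by (simp add: heat_kernel_def norm_mult)
  show i: "integrable (lborel \<Otimes>\<^sub>M lborel) (heat_kernel k A \<beta>)"
  proof (rule lborel_pair.Fubini_integrable)
    show "integrable lborel (\<lambda>t. \<integral>z. norm (heat_kernel k A \<beta> (t, z)) \<partial>lborel)"
      unfolding n using int by simp
    show "AE t in lborel. integrable lborel (\<lambda>z. heat_kernel k A \<beta> (t, z))"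
      unfolding heat_kernel_def using integrable_partial_derivs_gauss[of \<beta>] by simp
  qed measurable
  have "(\<integral>w. norm (heat_kernel k A \<beta> w) \<partial>(lborel \<Otimes>\<^sub>M lborel)) = (\<integral>t. (\<integral>z. norm (heat_kernel k A \<beta> (t, z)) \<partial>lborel) \<partial>lborel)"
    using lborel_pair.integral_fst'[OF integrable_norm[OF i]] by simp
  then show "(\<integral>w. norm (heat_kernel k A \<beta> w) \<partial>(lborel \<Otimes>\<^sub>M lborel)) = (\<integral>t. heat_weight k A (length \<beta>) t \<partial>lborel) * ?I"
    unfolding n by simp
qed

lemma borel_measurable_shift [measurable]:
  "(\<lambda>w. sqrt (2 * fst w) *\<^sub>R snd w) \<in> (lborel \<Otimes>\<^sub>M lborel) \<rightarrow>\<^sub>M (borel :: (real^'n::finite) measure)"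
  by measurable

context
  fixes k :: nat and A :: "real set" and \<beta> :: "'n::finite list" and \<phi> :: "real^'n \<Rightarrow> complex"
  assumes A: "A \<in> sets borel" "A \<subseteq> {0<..}"
    and int: "integrable lborel (heat_weight k A (length \<beta>))"
    and \<phi>: "\<phi> \<in> test_functions"
begin

lemma integrable_heat_average:
  "integrable (lborel \<Otimes>\<^sub>M lborel) (\<lambda>w. heat_kernel k A \<beta> w * \<phi> (x + sqrt (2 * fst w) *\<^sub>R snd w))"
proof -
  note [measurable] = A(1) smooth_borel_measurable[OF test_functions_smooth[OF \<phi>]]
  obtain B where B: "B > 0" "\<And>x. norm (\<phi> x) \<le> B" using test_functions_bounded[OF \<phi>, of "[]"] by auto
  show ?thesis
    by (rule integrable_norm_bound[of _ "\<lambda>w. norm (heat_kernel k A \<beta> w) * B"])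
       (use integrable_heat_kernel[OF A int] B in \<open>auto simp: norm_mult intro!: mult_left_mono\<close>)
qed

lemma heat_average_iterated:
  "heat_average k A \<beta> \<phi> x = (\<integral>t. of_real (heat_weight k A (length \<beta>) t) *
     (\<integral>z. partial_derivs \<beta> gauss z * \<phi> (x + sqrt (2 * t) *\<^sub>R z) \<partial>lborel) \<partial>lborel)"
proof -
  have "heat_average k A \<beta> \<phi> x = (\<integral>t. (\<integral>z. heat_kernel k A \<beta> (t, z) * \<phi> (x + sqrt (2 * t) *\<^sub>R z) \<partial>lborel) \<partial>lborel)"
    unfolding heat_average_def
    using lborel_pair.integral_fst'[OF integrable_heat_average[of x]] by simp
  also have "\<dots> = (\<integral>t. of_real (heat_weight k A (length \<beta>) t) *
     (\<integral>z. partial_derivs \<beta> gauss z * \<phi> (x + sqrt (2 * t) *\<^sub>R z) \<partial>lborel) \<partial>lborel)"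
    by (intro Bochner_Integration.integral_cong refl)
       (simp only: heat_kernel_def prod.case mult.assoc integral_mult_right_zero)
  finally show ?thesis .
qed

lemma
  shows smooth_heat_average: "smooth (heat_average k A \<beta> \<phi>)"
    and partial_derivs_heat_average: "partial_derivs \<alpha> (heat_average k A \<beta> \<phi>) = heat_average k A \<beta> (partial_derivs \<alpha> \<phi>)"
proof -
  let ?M = "lborel \<Otimes>\<^sub>M lborel :: (real \<times> (real^'n)) measure"
  let ?f = "\<lambda>x w. heat_kernel k A \<beta> w * \<phi> (x + sqrt (2 * fst w) *\<^sub>R snd w)"
  have sm: "smooth \<phi>" by (rule test_functions_smooth[OF \<phi>])
  note [measurable] = A(1) borel_measurable_partial_derivs[OF sm]
  have d: "partial_derivs \<alpha> (\<lambda>x. ?f x w) = (\<lambda>x. heat_kernel k A \<beta> w * partial_derivs \<alpha> \<phi> (x + sqrt (2 * fst w) *\<^sub>R snd w))" for \<alpha> w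
    by (simp add: partial_derivs_cmult partial_derivs_translate smooth_translate sm)
  have 1: "smooth (\<lambda>x. ?f x w)" for w by (intro smooth_cmult smooth_translate sm)
  have 2: "(\<lambda>w. partial_derivs \<alpha> (\<lambda>x. ?f x w) x) \<in> borel_measurable ?M" for \<alpha> x
    unfolding d by measurable
  have 3: "\<exists>B. integrable ?M B \<and> (\<forall>w\<in>space ?M. \<forall>x. norm (partial_derivs \<alpha> (\<lambda>x. ?f x w) x) \<le> B w)" for \<alpha>
  proof -
    obtain B where B: "B > 0" "\<And>x. norm (partial_derivs \<alpha> \<phi> x) \<le> B" using test_functions_bounded[OF \<phi>] by blast
    show ?thesis
      by (rule exI[of _ "\<lambda>w. norm (heat_kernel k A \<beta> w) * B"])
         (use integrable_heat_kernel[OF A int] B in \<open>auto simp: d norm_mult intro!: mult_left_mono\<close>)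
  qed
  show "smooth (heat_average k A \<beta> \<phi>)"
    unfolding heat_average_def[abs_def] by (rule smooth_integral[OF 1 2 3])
  show "partial_derivs \<alpha> (heat_average k A \<beta> \<phi>) = heat_average k A \<beta> (partial_derivs \<alpha> \<phi>)"
    unfolding heat_average_def[abs_def] partial_derivs_integral[OF 1 2 3] d ..
qed

text \<open>Along any sequence of points tending to infinity the integrand is eventually 0 at each
  fixed (t, z), as \<phi> has compact support; dominated convergence applies.\<close>

lemma tendsto_heat_average: "(heat_average k A \<beta> \<phi> \<longlongrightarrow> 0) at_infinity"
proof (rule ccontr)
  assume "\<not> (heat_average k A \<beta> \<phi> \<longlongrightarrow> 0) at_infinity"
  then obtain e where e: "e > 0" "\<And>b. \<exists>x. norm x \<ge> b \<and> norm (heat_average k A \<beta> \<phi> x) \<ge> e"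
    unfolding tendsto_iff eventually_at_infinity by (auto simp: not_less)
  have "\<forall>j::nat. \<exists>x. norm x \<ge> real j \<and> norm (heat_average k A \<beta> \<phi> x) \<ge> e"
    using e(2) by blast
  then obtain X where X: "\<And>j::nat. norm (X j) \<ge> real j" "\<And>j. norm (heat_average k A \<beta> \<phi> (X j)) \<ge> e"
    by metis
  note [measurable] = A(1) smooth_borel_measurable[OF test_functions_smooth[OF \<phi>]]
  obtain B where B: "B > 0" "\<And>x. norm (\<phi> x) \<le> B" using test_functions_bounded[OF \<phi>, of "[]"] by auto
  obtain R where R: "\<And>x. norm x > R \<Longrightarrow> \<phi> x = 0" using \<phi> by (auto simp: test_functions_iff)
  let ?M = "lborel \<Otimes>\<^sub>M lborel :: (real \<times> (real^'n)) measure"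
  have "(\<lambda>j. heat_average k A \<beta> \<phi> (X j)) \<longlonglongrightarrow> (\<integral>w. 0 \<partial>?M)"
    unfolding heat_average_def
  proof (rule integral_dominated_convergence[where w = "\<lambda>w. norm (heat_kernel k A \<beta> w) * B"])
    show "AE w in ?M. (\<lambda>j. heat_kernel k A \<beta> w * \<phi> (X j + sqrt (2 * fst w) *\<^sub>R snd w)) \<longlonglongrightarrow> 0"
    proof (rule AE_I2)
      fix w :: "real \<times> (real^'n)"
      let ?b = "sqrt (2 * fst w) *\<^sub>R snd w"
      obtain N :: nat where N: "real N > R + norm ?b" using reals_Archimedean2 by blast
      have "heat_kernel k A \<beta> w * \<phi> (X j + ?b) = 0" if "j \<ge> N" for j
      proof -
        have "real N \<le> norm (X j)" using X(1)[of j] that by linarith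
        also have "\<dots> \<le> norm (X j + ?b) + norm ?b"
          using norm_triangle_ineq4[of "X j + ?b" ?b] by simp
        finally show ?thesis using R[of "X j + ?b"] N by simp
      qed
      then show "(\<lambda>j. heat_kernel k A \<beta> w * \<phi> (X j + ?b)) \<longlonglongrightarrow> 0"
        by (intro tendsto_eventually) (auto simp: eventually_sequentially)
    qed
    show "AE w in ?M. norm (heat_kernel k A \<beta> w * \<phi> (X j + sqrt (2 * fst w) *\<^sub>R snd w)) \<le> norm (heat_kernel k A \<beta> w) * B" for j
      by (rule AE_I2) (use B in \<open>auto simp: norm_mult intro!: mult_left_mono\<close>)
  qed (use integrable_heat_kernel[OF A int] in auto)
  then have "(\<lambda>j. norm (heat_average k A \<beta> \<phi> (X j))) \<longlonglongrightarrow> 0"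
    by (simp add: tendsto_norm_zero)
  then have "e \<le> 0"
    by (rule LIMSEQ_le_const) (use X(2) in blast)
  with e(1) show False by simp
qed

lemma
  assumes q: "1 \<le> q" "q < \<infinity>"
  shows heat_average_Lp: "heat_average k A \<beta> \<phi> \<in> Lp (conj_exponent q)"
    and Lp_norm_heat_average: "Lp_norm (conj_exponent q) (heat_average k A \<beta> \<phi>)
      \<le> (\<integral>t. heat_weight k A (length \<beta>) t \<partial>lborel) * (\<integral>z. norm (partial_derivs \<beta> gauss z) \<partial>lborel)
        * Lp_norm (conj_exponent q) \<phi>"
proof -
  obtain B where B: "B > 0" "\<And>x. norm (\<phi> x) \<le> B" using test_functions_bounded[OF \<phi>, of "[]"] by auto
  have p: "conj_exponent q = \<infinity> \<or> (\<exists>r>1. conj_exponent q = ennreal r)"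
    using q by (cases rule: conj_exponent_cases) auto
  note avg = sigma_finite_pair integrable_heat_kernel[OF A int] borel_measurable_shift
    smooth_continuous_on[OF test_functions_smooth[OF \<phi>]] B(2)
    predual_Lp_0[OF q test_functions_predual[OF q \<phi>]] p
  show "heat_average k A \<beta> \<phi> \<in> Lp (conj_exponent q)"
    unfolding heat_average_def[abs_def] by (rule Lp_average[OF avg])
  show "Lp_norm (conj_exponent q) (heat_average k A \<beta> \<phi>)
      \<le> (\<integral>t. heat_weight k A (length \<beta>) t \<partial>lborel) * (\<integral>z. norm (partial_derivs \<beta> gauss z) \<partial>lborel)
        * Lp_norm (conj_exponent q) \<phi>"
    unfolding heat_average_def[abs_def] integral_norm_heat_kernel[OF A int, symmetric]
    by (rule Lp_norm_average[OF avg])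
qed

end

text \<open>The z-derivative of \<phi> (x + sqrt (2 * t) z) carries a factor sqrt (2 * t), so
  integrating by parts costs one power of 1 / sqrt (2 * t) and a sign for each derivative. They
  reach the Gaussian one at a time from the head of \<alpha>, which reverses their order.\<close>

lemma heat_average_by_parts:
  fixes \<phi> :: "real^'n::finite \<Rightarrow> complex"
  assumes A: "A \<in> sets borel" "A \<subseteq> {0<..}"
    and int: "\<And>j. j \<le> length \<alpha> + length \<beta> \<Longrightarrow> integrable lborel (heat_weight k A j)"
    and \<phi>: "\<phi> \<in> test_functions"
  shows "heat_average k A \<beta> (partial_derivs \<alpha> \<phi>) x = (-1) ^ length \<alpha> * heat_average k A (rev \<alpha> @ \<beta>) \<phi> x"
  using int
proof (induction \<alpha> arbitrary: \<beta>)
  case (Cons i \<alpha>)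
  let ?\<psi> = "partial_derivs \<alpha> \<phi>"
  have \<psi>: "?\<psi> \<in> test_functions" "partial_deriv i ?\<psi> \<in> test_functions"
    using test_functions_partial_derivs[OF \<phi>, of \<alpha>] test_functions_partial_derivs[OF \<phi>, of "i # \<alpha>"] by simp_all
  have i1: "integrable lborel (heat_weight k A (length \<beta>))" "integrable lborel (heat_weight k A (length (i # \<beta>)))"
    by (rule Cons.prems, simp)+
  have "heat_average k A \<beta> (partial_deriv i ?\<psi>) x = (\<integral>t. of_real (heat_weight k A (length \<beta>) t) *
     (\<integral>z. partial_derivs \<beta> gauss z * partial_deriv i ?\<psi> (x + sqrt (2 * t) *\<^sub>R z) \<partial>lborel) \<partial>lborel)"
    by (rule heat_average_iterated[OF A i1(1) \<psi>(2)])
  also have "\<dots> = (\<integral>t. - (of_real (heat_weight k A (length (i # \<beta>)) t) *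
     (\<integral>z. partial_derivs (i # \<beta>) gauss z * ?\<psi> (x + sqrt (2 * t) *\<^sub>R z) \<partial>lborel)) \<partial>lborel)"
  proof (intro Bochner_Integration.integral_cong refl)
    fix t
    show "of_real (heat_weight k A (length \<beta>) t) * (\<integral>z. partial_derivs \<beta> gauss z * partial_deriv i ?\<psi> (x + sqrt (2 * t) *\<^sub>R z) \<partial>lborel)
      = - (of_real (heat_weight k A (length (i # \<beta>)) t) * (\<integral>z. partial_derivs (i # \<beta>) gauss z * ?\<psi> (x + sqrt (2 * t) *\<^sub>R z) \<partial>lborel))"
    proof (cases "t \<in> A")
      case True
      then have t: "t > 0" using A by auto
      define c where "c = sqrt (2 * t)"
      have c: "c > 0" using t by (simp add: c_def)
      have dec: "decaying (\<lambda>z. ?\<psi> (c *\<^sub>R z + x))"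
        using c by (intro decaying_affine test_functions_decaying \<psi>) simp
      have "(\<integral>z. partial_derivs (i # \<beta>) gauss z * ?\<psi> (c *\<^sub>R z + x) \<partial>lborel)
         = - (\<integral>z. partial_derivs \<beta> gauss z * partial_deriv i (\<lambda>z. ?\<psi> (c *\<^sub>R z + x)) z \<partial>lborel)"
        using integral_by_parts[OF decaying_partial_derivs[OF decaying_gauss, of \<beta>] dec, of i] by simp
      also have "\<dots> = - (\<integral>z. of_real c * (partial_derivs \<beta> gauss z * partial_deriv i ?\<psi> (c *\<^sub>R z + x)) \<partial>lborel)"
        by (simp add: partial_deriv_affine smooth_differentiable test_functions_smooth \<psi> mult.left_commute)
      also have "\<dots> = - (of_real c * (\<integral>z. partial_derivs \<beta> gauss z * partial_deriv i ?\<psi> (c *\<^sub>R z + x) \<partial>lborel))" by simp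
      finally have "(\<integral>z. partial_derivs (i # \<beta>) gauss z * ?\<psi> (x + c *\<^sub>R z) \<partial>lborel)
         = - (of_real c * (\<integral>z. partial_derivs \<beta> gauss z * partial_deriv i ?\<psi> (x + c *\<^sub>R z) \<partial>lborel))"
        by (simp only: add.commute)
      then show ?thesis using c by (simp add: heat_weight_Suc c_def[symmetric])
    qed (simp add: heat_weight_outside)
  qed
  also have "\<dots> = - heat_average k A (i # \<beta>) ?\<psi> x"
    by (subst heat_average_iterated[OF A i1(2) \<psi>(1)]) simp
  also have "heat_average k A (i # \<beta>) ?\<psi> x = (-1) ^ length \<alpha> * heat_average k A (rev \<alpha> @ (i # \<beta>)) \<phi> x"
    by (rule Cons.IH) (use Cons.prems in simp)
  finally show ?case by simp
qed simp

context
  fixes q :: ennreal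
  assumes q: "1 \<le> q" "q < \<infinity>"
begin

text \<open>Here the derivatives are left on \<phi>, so no negative power of sqrt (2 * t) arises and
  the weight with j = 0 governs all of them.\<close>

lemma heat_average_predual:
  fixes \<phi> :: "real^'n::finite \<Rightarrow> complex"
  assumes A: "A \<in> sets borel" "A \<subseteq> {0<..}" and int: "integrable lborel (heat_weight k A 0)"
    and \<phi>: "\<phi> \<in> test_functions"
  shows "heat_average k A [] \<phi> \<in> predual q"
proof (rule predualI[OF q])
  have int': "integrable lborel (heat_weight k A (length ([] :: 'n list)))" using int by simp
  note \<phi>' = test_functions_partial_derivs[OF \<phi>]
  show "smooth (heat_average k A [] \<phi>)" by (rule smooth_heat_average[OF A int' \<phi>])
  fix \<alpha>
  show "partial_derivs \<alpha> (heat_average k A [] \<phi>) \<in> Lp (conj_exponent q)"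
    unfolding partial_derivs_heat_average[OF A int' \<phi>] by (rule heat_average_Lp[OF A int' \<phi>' q])
  show "(partial_derivs \<alpha> (heat_average k A [] \<phi>) \<longlongrightarrow> 0) at_infinity"
    unfolding partial_derivs_heat_average[OF A int' \<phi>] by (rule tendsto_heat_average[OF A int' \<phi>'])
qed

text \<open>A common bound for the L^1 norms of the derivatives of the Gaussian up to order K; the
  lists are reversed to match \<open>heat_average_by_parts\<close>.\<close>

definition gauss_mass :: "'n::finite itself \<Rightarrow> nat \<Rightarrow> real" where
  "gauss_mass _ K = (\<Sum>\<alpha>\<in>{\<alpha>::'n list. length \<alpha> \<le> K}. \<integral>z. norm (partial_derivs (rev \<alpha>) gauss z) \<partial>lborel)"

lemma gauss_mass_nonneg: "0 \<le> gauss_mass TYPE('n::finite) K"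
  unfolding gauss_mass_def by (intro sum_nonneg) simp

text \<open>All derivatives are moved onto the Gaussian, so only the norm of \<open>\<phi>\<close> itself enters.\<close>

lemma D_L_seminorm_heat_average:
  fixes \<phi> :: "real^'n::finite \<Rightarrow> complex"
  assumes A: "A \<in> sets borel" "A \<subseteq> {0<..}"
    and int: "\<And>j. j \<le> K \<Longrightarrow> integrable lborel (heat_weight k A j)"
    and T: "\<And>j. j \<le> K \<Longrightarrow> (\<integral>t. heat_weight k A j t \<partial>lborel) \<le> T"
    and \<phi>: "\<phi> \<in> test_functions"
  shows "D_L_seminorm (conj_exponent q) K (heat_average k A [] \<phi>) \<le> T * gauss_mass TYPE('n) K * Lp_norm (conj_exponent q) \<phi>"
proof (rule D_L_seminorm_le)
  fix \<alpha> :: "'n list" assume \<alpha>: "length \<alpha> \<le> K"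
  have int': "integrable lborel (heat_weight k A (length ([] :: 'n list)))" using int by simp
  have intr: "integrable lborel (heat_weight k A (length (rev \<alpha>)))" using int \<alpha> by simp
  let ?I = "\<lambda>\<alpha>::'n list. \<integral>z. norm (partial_derivs (rev \<alpha>) gauss z) \<partial>lborel"
  have hw0: "0 \<le> (\<integral>t. heat_weight k A (length \<alpha>) t \<partial>lborel)"
    by (intro Bochner_Integration.integral_nonneg heat_weight_nonneg A)
  have "partial_derivs \<alpha> (heat_average k A [] \<phi>) = (\<lambda>x. (-1) ^ length \<alpha> * heat_average k A (rev \<alpha>) \<phi> x)"
  proof
    fix x
    show "partial_derivs \<alpha> (heat_average k A [] \<phi>) x = (-1) ^ length \<alpha> * heat_average k A (rev \<alpha>) \<phi> x"
      unfolding partial_derivs_heat_average[OF A int' \<phi>]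
      using heat_average_by_parts[OF A _ \<phi>, of \<alpha> "[]" k x] int \<alpha> by simp
  qed
  then have "Lp_norm (conj_exponent q) (partial_derivs \<alpha> (heat_average k A [] \<phi>))
      \<le> norm ((-1) ^ length \<alpha> :: complex) * Lp_norm (conj_exponent q) (heat_average k A (rev \<alpha>) \<phi>)"
    using Lp_norm_cmult_le[OF q heat_average_Lp[OF A intr \<phi> q] smooth_continuous_on[OF smooth_heat_average[OF A intr \<phi>]]]
    by metis
  also have "\<dots> = Lp_norm (conj_exponent q) (heat_average k A (rev \<alpha>) \<phi>)" by (simp add: norm_power)
  also have "\<dots> \<le> (\<integral>t. heat_weight k A (length \<alpha>) t \<partial>lborel) * ?I \<alpha> * Lp_norm (conj_exponent q) \<phi>"
    using Lp_norm_heat_average[OF A intr \<phi> q] by simp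
  also have "\<dots> \<le> T * gauss_mass TYPE('n) K * Lp_norm (conj_exponent q) \<phi>"
  proof (intro mult_right_mono mult_mono)
    show "(\<integral>t. heat_weight k A (length \<alpha>) t \<partial>lborel) \<le> T" using T \<alpha> by simp
    then show "0 \<le> T" using hw0 by linarith
    show "?I \<alpha> \<le> gauss_mass TYPE('n) K"
      unfolding gauss_mass_def using \<alpha> by (intro member_le_sum finite_short_lists) auto
  qed auto
  finally show "Lp_norm (conj_exponent q) (partial_derivs \<alpha> (heat_average k A [] \<phi>))
      \<le> T * gauss_mass TYPE('n) K * Lp_norm (conj_exponent q) \<phi>" .
qed

lemma D_L_seminorm_weight_le:
  fixes f :: "real^'n::finite \<Rightarrow> complex"
  assumes "smooth f" "0 \<le> T" "\<And>\<alpha> x. length \<alpha> \<le> K \<Longrightarrow> norm (partial_derivs \<alpha> f x) \<le> T * weight x"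
  shows "D_L_seminorm (conj_exponent q) K f \<le> T * Lp_norm (conj_exponent q) (\<lambda>x::real^'n. complex_of_real (weight x))"
  by (intro D_L_seminorm_le Lp_norm_weight_bound[OF one_le_conj_exponent[OF q]] borel_measurable_partial_derivs assms)

end

section \<open>The truncated Bessel kernel as a smooth decaying function\<close>

definition heat_potential :: "nat \<Rightarrow> real set \<Rightarrow> real^'n::finite \<Rightarrow> complex" where
  "heat_potential k A x = (\<integral>t. of_real (heat_weight k A CARD('n) t) * gauss ((1 / sqrt (2 * t)) *\<^sub>R x) \<partial>lborel)"

lemma bounded_partial_derivs_gauss: "\<exists>B>0. \<forall>x. norm (partial_derivs \<alpha> gauss x) \<le> B * weight x"
  by (rule decaying_bound[OF decaying_gauss])

context
  fixes k :: nat and A :: "real set" and e :: real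
  assumes A: "A \<in> sets borel" "A \<subseteq> {e<..}" and e: "e > 0"
begin

lemma
  shows smooth_heat_potential: "smooth (heat_potential k A :: real^'n::finite \<Rightarrow> complex)"
    and partial_derivs_heat_potential: "partial_derivs \<alpha> (heat_potential k A) =
      (\<lambda>x::real^'n. \<integral>t. of_real (heat_weight k A (CARD('n) + length \<alpha>) t) * partial_derivs \<alpha> gauss ((1 / sqrt (2 * t)) *\<^sub>R x) \<partial>lborel)"
proof -
  note [measurable] = A(1)
  let ?f = "\<lambda>(x::real^'n) t. complex_of_real (heat_weight k A CARD('n) t) * gauss ((1 / sqrt (2 * t)) *\<^sub>R x)"
  let ?g = "\<lambda>\<alpha> (x::real^'n) t. complex_of_real (heat_weight k A (CARD('n) + length \<alpha>) t) * partial_derivs \<alpha> gauss ((1 / sqrt (2 * t)) *\<^sub>R x)"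
  have sa: "smooth (\<lambda>x::real^'n. gauss (c *\<^sub>R x))" for c
    using smooth_affine[OF smooth_gauss, of c 0] by simp
  have d: "partial_derivs \<alpha> (\<lambda>x. ?f x t) x = ?g \<alpha> x t" for \<alpha> t x
  proof -
    have "partial_derivs \<alpha> (\<lambda>x. ?f x t) x = of_real (heat_weight k A CARD('n) t) * partial_derivs \<alpha> (\<lambda>x. gauss ((1 / sqrt (2 * t)) *\<^sub>R x)) x"
      by (simp only: partial_derivs_cmult[OF sa])
    also have "partial_derivs \<alpha> (\<lambda>x::real^'n. gauss ((1 / sqrt (2 * t)) *\<^sub>R x)) x
        = of_real (1 / sqrt (2 * t)) ^ length \<alpha> * partial_derivs \<alpha> gauss ((1 / sqrt (2 * t)) *\<^sub>R x)"
      using fun_cong[OF partial_derivs_affine[OF smooth_gauss, of \<alpha> "1 / sqrt (2 * t)" 0], of x] by simp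
    finally show ?thesis by (simp only: heat_weight_add of_real_mult of_real_power mult.assoc)
  qed
  have 1: "smooth (\<lambda>x. ?f x t)" for t by (intro smooth_cmult sa)
  have 2: "(\<lambda>t. partial_derivs \<alpha> (\<lambda>x. ?f x t) x) \<in> borel_measurable lborel" for \<alpha> x
    unfolding d by measurable
  have 3: "\<exists>B. integrable lborel B \<and> (\<forall>t\<in>space lborel. \<forall>x. norm (partial_derivs \<alpha> (\<lambda>x. ?f x t) x) \<le> B t)" for \<alpha>
  proof -
    obtain B where B': "\<And>x::real^'n. norm (partial_derivs \<alpha> gauss x) \<le> B"
      using decaying_bounded[OF decaying_gauss] by blast
    have hw: "0 \<le> heat_weight k A j t" for j t using A(2) e by (intro heat_weight_nonneg) auto
    show ?thesis
      by (rule exI[of _ "\<lambda>t. heat_weight k A (CARD('n) + length \<alpha>) t * B"])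
         (use integrable_heat_weight_away_0[OF A e] B' hw in \<open>auto simp: d norm_mult intro!: mult_left_mono\<close>)
  qed
  show "smooth (heat_potential k A :: real^'n \<Rightarrow> complex)"
    unfolding heat_potential_def[abs_def] by (rule smooth_integral[OF 1 2 3])
  show "partial_derivs \<alpha> (heat_potential k A) = (\<lambda>x::real^'n. \<integral>t. ?g \<alpha> x t \<partial>lborel)"
    unfolding heat_potential_def[abs_def] partial_derivs_integral[OF 1 2 3] d ..
qed

text \<open>The bound on the derivative of the Gaussian is rescaled with
  \<open>weight_affine\<close> for c = 1 / sqrt (2 * t) and integrated over t. In the second form
  the constant C depends only on the Gaussian and not on A, so that kernels for different time
  ranges can be compared.\<close>

lemma heat_potential_bound:
  "\<exists>C>0. \<forall>x. norm (partial_derivs \<alpha> (heat_potential k A) (x::real^'n::finite))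
     \<le> C * (\<integral>t. heat_weight k A (CARD('n) + length \<alpha>) t * (2 * (1 + 2 * t)) ^ CARD('n) \<partial>lborel) * weight x"
  (is "\<exists>C>0. \<forall>x. _ \<le> C * ?T * weight x")
  and heat_potential_bound_uniform:
  "(\<And>x. norm (partial_derivs \<alpha> gauss (x::real^'n::finite)) \<le> C * weight x) \<Longrightarrow> C > 0 \<Longrightarrow>
     norm (partial_derivs \<alpha> (heat_potential k A) (x::real^'n::finite))
     \<le> C * (\<integral>t. heat_weight k A (CARD('n) + length \<alpha>) t * (2 * (1 + 2 * t)) ^ CARD('n) \<partial>lborel) * weight x"
proof -
  let ?h = "\<lambda>t. heat_weight k A (CARD('n) + length \<alpha>) t"
  show *: "norm (partial_derivs \<alpha> (heat_potential k A) x)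
     \<le> C * (\<integral>t. ?h t * (2 * (1 + 2 * t)) ^ CARD('n) \<partial>lborel) * weight x"
    if C: "\<And>x. norm (partial_derivs \<alpha> gauss (x::real^'n)) \<le> C * weight x" "C > 0" for C and x :: "real^'n"
  proof -
    note [measurable] = A(1)
    have hw: "0 \<le> ?h t" for t using A(2) e by (intro heat_weight_nonneg) auto
    let ?g = "\<lambda>t. complex_of_real (?h t) * partial_derivs \<alpha> gauss ((1 / sqrt (2 * t)) *\<^sub>R x)"
    let ?b = "\<lambda>t. (?h t * (2 * (1 + 2 * t)) ^ CARD('n)) * (C * weight x)"
    have le: "norm (?g t) \<le> ?b t" for t
    proof (cases "t \<in> A")
      case True
      then have t: "t > 0" using A(2) e by auto
      have "weight ((1 / sqrt (2 * t)) *\<^sub>R x) \<le> (2 * (1 + 2 * t)) ^ CARD('n) * weight x"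
        using weight_affine[of "1 / sqrt (2 * t)" x 0] t by (simp add: power_divide)
      then have "norm (partial_derivs \<alpha> gauss ((1 / sqrt (2 * t)) *\<^sub>R x)) \<le> C * ((2 * (1 + 2 * t)) ^ CARD('n) * weight x)"
        using C(1)[of "(1 / sqrt (2 * t)) *\<^sub>R x"] C(2) by (meson less_imp_le mult_left_mono order_trans)
      from mult_left_mono[OF this hw[of t]] show ?thesis
        using hw[of t] by (simp add: norm_mult ac_simps)
    qed (simp add: heat_weight_outside)
    have ib: "integrable lborel ?b"
      by (intro integrable_mult_left integrable_heat_weight_away[OF A e])
    have ig: "integrable lborel ?g"
      by (rule integrable_norm_bound[OF ib _ le]) measurable
    have "norm (\<integral>t. ?g t \<partial>lborel) \<le> (\<integral>t. norm (?g t) \<partial>lborel)" by (rule integral_norm_bound)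
    also have "\<dots> \<le> (\<integral>t. ?b t \<partial>lborel)" by (rule integral_mono[OF integrable_norm[OF ig] ib le])
    also have "\<dots> = C * (\<integral>t. ?h t * (2 * (1 + 2 * t)) ^ CARD('n) \<partial>lborel) * weight x" by simp
    finally show ?thesis unfolding partial_derivs_heat_potential .
  qed
  obtain C where "C > 0" "\<And>x::real^'n. norm (partial_derivs \<alpha> gauss x) \<le> C * weight x"
    using bounded_partial_derivs_gauss by blast
  with * show "\<exists>C>0. \<forall>x::real^'n. norm (partial_derivs \<alpha> (heat_potential k A) x)
     \<le> C * (\<integral>t. ?h t * (2 * (1 + 2 * t)) ^ CARD('n) \<partial>lborel) * weight x" by blast
qed

lemma decaying_heat_potential: "decaying (heat_potential k A :: real^'n::finite \<Rightarrow> complex)"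
  unfolding decaying_def using smooth_heat_potential heat_potential_bound by blast

text \<open>Substituting y = x + sqrt (2 * t) z and exchanging the integrals. The Jacobian supplies
  the n extra powers of 1 / sqrt (2 * t) in \<open>heat_potential\<close>, and the Gaussian is
  even.\<close>

lemma heat_average_potential:
  fixes \<phi> :: "real^'n::finite \<Rightarrow> complex"
  assumes \<phi>: "\<phi> \<in> test_functions"
  shows "heat_average k A [] \<phi> x = (\<integral>y. heat_potential k A (x - y) * \<phi> y \<partial>lborel)"
proof -
  note [measurable] = A(1) smooth_borel_measurable[OF test_functions_smooth[OF \<phi>]] smooth_borel_measurable[OF smooth_gauss]
  have A0: "A \<subseteq> {0<..}" using A(2) e by auto
  have int': "integrable lborel (heat_weight k A (length ([] :: 'n list)))"
    using integrable_heat_weight_away_0[OF A e, of k 0] by simp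
  let ?n = "CARD('n)"
  let ?f = "\<lambda>t y. complex_of_real (heat_weight k A ?n t) * gauss ((1 / sqrt (2 * t)) *\<^sub>R (x - y)) * \<phi> y"
  obtain B where B': "\<And>x::real^'n. norm (gauss x) \<le> B"
    using decaying_bounded[OF decaying_gauss, of "[]"] by auto
  have hw: "0 \<le> heat_weight k A j t" for j t using A0 by (rule heat_weight_nonneg)
  have nphi: "integrable lborel (\<lambda>y. norm (\<phi> y))"
    by (intro integrable_norm decaying_integrable test_functions_decaying \<phi>)
  have nf: "norm (?f t y) \<le> heat_weight k A ?n t * B * norm (\<phi> y)" for t y
    unfolding norm_mult norm_of_real using hw[of ?n t] B' by (intro mult_right_mono mult_mono) auto
  have i1: "integrable lborel (\<lambda>y. ?f t y)" for t
    by (rule integrable_norm_bound[OF _ _ nf]) (use nphi in auto)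
  have F: "integrable (lborel \<Otimes>\<^sub>M lborel) (\<lambda>(t, y). ?f t y)"
  proof (rule lborel_pair.Fubini_integrable)
    show "(\<lambda>(t, y). ?f t y) \<in> borel_measurable (lborel \<Otimes>\<^sub>M lborel)" by measurable
    show "AE t in lborel. integrable lborel (\<lambda>y. case (t, y) of (t, y) \<Rightarrow> ?f t y)" using i1 by simp
    show "integrable lborel (\<lambda>t. \<integral>y. norm (case (t, y) of (t, y) \<Rightarrow> ?f t y) \<partial>lborel)"
    proof (rule integrable_norm_bound[of _ "\<lambda>t. heat_weight k A ?n t * B * (\<integral>y. norm (\<phi> y) \<partial>lborel)"])
      show "integrable lborel (\<lambda>t. heat_weight k A ?n t * B * (\<integral>y. norm (\<phi> y) \<partial>lborel))"
        using integrable_heat_weight_away_0[OF A e, of k ?n] by simp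
      show "(\<lambda>t. \<integral>y. norm (case (t, y) of (t, y) \<Rightarrow> ?f t y) \<partial>lborel) \<in> borel_measurable lborel" by measurable
      fix t
      have "(\<integral>y. norm (?f t y) \<partial>lborel) \<le> (\<integral>y. heat_weight k A ?n t * B * norm (\<phi> y) \<partial>lborel)"
        by (rule integral_mono[OF integrable_norm[OF i1] _ nf]) (use nphi in auto)
      then show "norm (\<integral>y. norm (case (t, y) of (t, y) \<Rightarrow> ?f t y) \<partial>lborel) \<le> heat_weight k A ?n t * B * (\<integral>y. norm (\<phi> y) \<partial>lborel)"
        by simp
    qed
  qed
  have "heat_average k A [] \<phi> x = (\<integral>t. of_real (heat_weight k A 0 t) * (\<integral>z. gauss z * \<phi> (x + sqrt (2 * t) *\<^sub>R z) \<partial>lborel) \<partial>lborel)"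
    using heat_average_iterated[OF A(1) A0 int' \<phi>, of x] by simp
  also have "\<dots> = (\<integral>t. (\<integral>y. ?f t y \<partial>lborel) \<partial>lborel)"
  proof (intro Bochner_Integration.integral_cong refl)
    fix t
    show "of_real (heat_weight k A 0 t) * (\<integral>z. gauss z * \<phi> (x + sqrt (2 * t) *\<^sub>R z) \<partial>lborel) = (\<integral>y. ?f t y \<partial>lborel)"
    proof (cases "t \<in> A")
      case True
      then have t: "t > 0" using A0 by auto
      define c where "c = sqrt (2 * t)"
      have c: "c > 0" using t by (simp add: c_def)
      have "(\<integral>y. gauss ((1 / c) *\<^sub>R (x - y)) * \<phi> y \<partial>lborel)
        = \<bar>c\<bar> ^ ?n *\<^sub>R (\<integral>z. gauss ((1 / c) *\<^sub>R (x - (c *\<^sub>R z + x))) * \<phi> (c *\<^sub>R z + x) \<partial>lborel)"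
        by (rule integral_affine) (use c in simp)
      also have "\<dots> = c ^ ?n *\<^sub>R (\<integral>z. gauss z * \<phi> (x + c *\<^sub>R z) \<partial>lborel)"
        using c by (simp add: gauss_minus add.commute)
      also have "\<dots> = of_real (c ^ ?n) * (\<integral>z. gauss z * \<phi> (x + c *\<^sub>R z) \<partial>lborel)"
        by (rule scaleR_conv_of_real)
      finally have inner: "(\<integral>y. gauss ((1 / c) *\<^sub>R (x - y)) * \<phi> y \<partial>lborel) = of_real (c ^ ?n) * (\<integral>z. gauss z * \<phi> (x + c *\<^sub>R z) \<partial>lborel)" .
      have "(\<integral>y. ?f t y \<partial>lborel) = of_real (heat_weight k A ?n t) * (\<integral>y. gauss ((1 / c) *\<^sub>R (x - y)) * \<phi> y \<partial>lborel)"
        by (simp only: c_def mult.assoc integral_mult_right_zero)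
      also have "\<dots> = of_real (heat_weight k A ?n t * c ^ ?n) * (\<integral>z. gauss z * \<phi> (x + c *\<^sub>R z) \<partial>lborel)"
        by (simp only: inner of_real_mult mult.assoc)
      also have "heat_weight k A ?n t * c ^ ?n = heat_weight k A 0 t"
        using c by (simp add: heat_weight_def c_def[symmetric])
      finally show ?thesis by (simp only: c_def)
    qed (simp add: heat_weight_outside)
  qed
  also have "\<dots> = (\<integral>y. (\<integral>t. ?f t y \<partial>lborel) \<partial>lborel)"
    using lborel_pair.Fubini_integral[OF F] by simp
  also have "\<dots> = (\<integral>y. heat_potential k A (x - y) * \<phi> y \<partial>lborel)"
    by (simp only: heat_potential_def integral_mult_left_zero)
  finally show ?thesis .
qed

end

lemma heat_potential_diff:
  fixes x :: "real^'n::finite"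
  assumes A: "A \<in> sets borel" "A \<subseteq> {e<..}" and e: "e > 0" and B: "B \<in> sets borel" "B \<subseteq> A"
  shows "heat_potential k A x - heat_potential k B x = heat_potential k (A - B) x"
proof -
  note [measurable] = A(1) B(1)
  have AB: "A - B \<in> sets borel" "A - B \<subseteq> {e<..}" using A B by auto
  have Be: "B \<subseteq> {e<..}" using A B by auto
  have int: "integrable lborel (\<lambda>t. complex_of_real (heat_weight k D CARD('n) t) * gauss ((1 / sqrt (2 * t)) *\<^sub>R x))"
    if D: "D \<in> sets borel" "D \<subseteq> {e<..}" for D
  proof -
    note [measurable] = D(1)
    obtain B where B': "\<And>x::real^'n. norm (gauss x) \<le> B"
      using decaying_bounded[OF decaying_gauss, of "[]"] by auto
    have hw: "0 \<le> heat_weight k D j t" for j t using D e by (intro heat_weight_nonneg) auto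
    have [measurable]: "gauss \<in> borel_measurable (borel :: (real^'n) measure)"
      by (rule smooth_borel_measurable[OF smooth_gauss])
    show ?thesis
      by (rule integrable_norm_bound[of _ "\<lambda>t. heat_weight k D CARD('n) t * B"])
         (use integrable_heat_weight_away_0[OF D e] B' hw in \<open>auto simp: norm_mult intro!: mult_left_mono\<close>)
  qed
  have "heat_weight k A CARD('n) t = heat_weight k B CARD('n) t + heat_weight k (A - B) CARD('n) t" for t
    using heat_weight_Un[of B "A - B"] B by (simp add: Un_absorb1)
  then have "heat_potential k A x = heat_potential k B x + heat_potential k (A - B) x"
    unfolding heat_potential_def
    by (simp add: distrib_right Bochner_Integration.integral_add int B AB Be)
  then show ?thesis by simp
qed

section \<open>Functionals applied to convolutions\<close>

text \<open>Takes only finitely many values on a bounded set, so that finite additivity alone lets a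
  functional pass inside an integral over the grid points.\<close>

definition grid :: "nat \<Rightarrow> real^'n::finite \<Rightarrow> real^'n" where
  "grid j x = (\<chi> i. of_int \<lfloor>x $ i * real (Suc j)\<rfloor> / real (Suc j))"

lemma borel_measurable_grid [measurable]: "grid j \<in> borel_measurable (borel :: (real^'n::finite) measure)"
proof -
  have "(\<lambda>x::real^'n. grid j x $ i) \<in> borel_measurable borel" for i
    unfolding grid_def by simp
  then show ?thesis
    by (subst borel_measurable_euclidean_space) (auto simp: Basis_vec_def simp flip: cart_eq_inner_axis)
qed

lemma norm_grid_diff: "norm (grid j x - (x::real^'n::finite)) \<le> real CARD('n) / real (Suc j)"
proof -
  have "\<bar>(grid j x - x) $ i\<bar> \<le> 1 / real (Suc j)" for i
  proof -
    have "(grid j x - x) $ i = (of_int \<lfloor>x $ i * real (Suc j)\<rfloor> - x $ i * real (Suc j)) / real (Suc j)"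
      by (simp add: grid_def diff_divide_distrib del: of_nat_Suc)
    moreover have "\<bar>of_int \<lfloor>x $ i * real (Suc j)\<rfloor> - x $ i * real (Suc j)\<bar> \<le> 1" by linarith
    ultimately show ?thesis by (simp add: abs_divide divide_right_mono del: of_nat_Suc)
  qed
  then have "(\<Sum>i\<in>UNIV. \<bar>(grid j x - x) $ i\<bar>) \<le> (\<Sum>i\<in>(UNIV::'n set). 1 / real (Suc j))"
    by (intro sum_mono)
  then show ?thesis using norm_le_l1_cart[of "grid j x - x"] by simp
qed

lemma norm_grid_diff_le: "norm (grid j x - (x::real^'n::finite)) \<le> real CARD('n)"
proof -
  have "real CARD('n) / real (Suc j) \<le> real CARD('n)" by (simp add: divide_le_eq algebra_simps)
  with norm_grid_diff[of j x] show ?thesis by linarith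
qed

lemma finite_grid: "finite (grid j ` {x::real^'n::finite. norm x \<le> R})"
proof -
  define N where "N = \<lceil>\<bar>R\<bar> * real (Suc j)\<rceil> + 1"
  let ?F = "{f. \<forall>i::'n. f i \<in> {-N..N}}"
  have "?F = PiE UNIV (\<lambda>_. {-N..N})" by auto
  then have "finite ?F" by (simp add: finite_PiE)
  then have "finite ((\<lambda>f. \<chi> i. of_int (f i) / real (Suc j)) ` ?F :: (real^'n) set)" by (rule finite_imageI)
  moreover have "grid j ` {x::real^'n. norm x \<le> R} \<subseteq> (\<lambda>f. \<chi> i. of_int (f i) / real (Suc j)) ` ?F"
  proof clarify
    fix x :: "real^'n" assume x: "norm x \<le> R"
    have "\<lfloor>x $ i * real (Suc j)\<rfloor> \<in> {-N..N}" for i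
    proof -
      have "\<bar>x $ i * real (Suc j)\<bar> \<le> \<bar>R\<bar> * real (Suc j)"
        unfolding abs_mult using component_le_norm_cart[of x i] x by (intro mult_mono) auto
      then show ?thesis unfolding N_def atLeastAtMost_iff by linarith
    qed
    then show "grid j x \<in> (\<lambda>f. \<chi> i. of_int (f i) / real (Suc j)) ` ?F"
      by (intro image_eqI[where x = "\<lambda>i. \<lfloor>x $ i * real (Suc j)\<rfloor>"]) (auto simp: grid_def)
  qed
  ultimately show ?thesis using finite_subset by blast
qed

text \<open>\<open>convolve h \<phi> \<sigma>\<close> is the Riemann sum of the convolution of \<open>h\<close> and \<open>\<phi>\<close> when \<open>\<sigma>\<close> rounds to a grid,
  and the convolution itself when \<open>\<sigma>\<close> is the identity.\<close>

definition convolve :: "(real^'n::finite \<Rightarrow> complex) \<Rightarrow> (real^'n \<Rightarrow> complex) \<Rightarrow> (real^'n \<Rightarrow> real^'n) \<Rightarrow> real^'n \<Rightarrow> complex" where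
  "convolve h \<phi> \<sigma> y = (\<integral>x. \<phi> x * h (y - \<sigma> x) \<partial>lborel)"

lemma partial_derivs_shift:
  "smooth h \<Longrightarrow> partial_derivs \<alpha> (\<lambda>y. h (y - a)) = (\<lambda>y. partial_derivs \<alpha> h (y - a))"
  using partial_derivs_translate[of h \<alpha> "- a"] by simp

lemma decaying_shift: "decaying h \<Longrightarrow> decaying (\<lambda>y. h (y - a))"
  using decaying_translate[of h "- a"] by simp

text \<open>The mean value inequality between y - b and y - a, with \<open>weight\<close> at the
  points of the segment compared to \<open>weight y\<close> at distance at most R. In effect,
  translation is locally Lipschitz into the predual for each seminorm.\<close>

lemma shift_difference_bound:
  fixes h :: "real^'n::finite \<Rightarrow> complex"
  assumes h: "decaying h"
  shows "\<exists>D\<ge>0. \<forall>\<alpha> a b y. length \<alpha> \<le> K \<longrightarrow> norm a \<le> R \<longrightarrow> norm b \<le> R \<longrightarrow>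
     norm (partial_derivs \<alpha> h (y - a) - partial_derivs \<alpha> h (y - b)) \<le> D * norm (a - b) * weight y"
proof -
  have "\<forall>\<alpha>. \<exists>C>0. \<forall>x. norm (partial_derivs \<alpha> h x) \<le> C * weight x"
    using decaying_bound[OF h] by blast
  then obtain C where C: "\<And>\<alpha>. C \<alpha> > 0" "\<And>\<alpha> x. norm (partial_derivs \<alpha> h x) \<le> C \<alpha> * weight x" by metis
  define E where "E = (\<Sum>\<alpha>\<in>{\<alpha>. length \<alpha> \<le> Suc K}. C \<alpha>)"
  have E: "C \<alpha> \<le> E" if "length \<alpha> \<le> Suc K" for \<alpha>
    unfolding E_def using that C(1) by (intro member_le_sum finite_short_lists) (auto intro: less_imp_le)
  have E0: "E \<ge> 0" unfolding E_def using C(1) by (intro sum_nonneg) (auto intro: less_imp_le)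
  define W where "W = (4 * (1 + R\<^sup>2)) ^ CARD('n)"
  have W0: "W \<ge> 0" by (simp add: W_def)
  define D where "D = real CARD('n) * (E * W)"
  have "norm (partial_derivs \<alpha> h (y - a) - partial_derivs \<alpha> h (y - b)) \<le> D * norm (a - b) * weight y"
    if \<alpha>: "length \<alpha> \<le> K" and a: "norm a \<le> R" and b: "norm b \<le> R" for \<alpha> a b y
  proof -
    have "norm (partial_derivs \<alpha> h (y - a) - partial_derivs \<alpha> h (y - b))
        \<le> real CARD('n) * (E * (W * weight y)) * norm (y - a - (y - b))"
    proof (rule norm_diff_le_partial_deriv)
      fix z assume z: "z \<in> closed_segment (y - b) (y - a)"
      show "partial_derivs \<alpha> h differentiable at z"
        by (intro smooth_differentiable smooth_partial_derivs decaying_smooth h)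
      have "y - b \<in> cball y R" "y - a \<in> cball y R" using a b by (simp_all add: dist_norm)
      then have "closed_segment (y - b) (y - a) \<subseteq> cball y R"
        by (intro closed_segment_subset convex_cball)
      with z have "norm (z - y) \<le> R" by (auto simp: dist_norm norm_minus_commute)
      then have "(norm (z - y))\<^sup>2 \<le> R\<^sup>2" by (intro power_mono) auto
      then have "(4 * (1 + (norm (z - y))\<^sup>2)) ^ CARD('n) * weight y \<le> W * weight y"
        unfolding W_def by (intro mult_right_mono power_mono) auto
      then have "weight (y + (z - y)) \<le> W * weight y" by (rule order_trans[OF weight_translate])
      then have w: "weight z \<le> W * weight y" by simp
      fix i
      have "norm (partial_derivs (i # \<alpha>) h z) \<le> C (i # \<alpha>) * weight z" by (rule C(2))
      also have "\<dots> \<le> E * (W * weight y)"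
        using E[of "i # \<alpha>"] \<alpha> E0 by (intro mult_mono w) auto
      finally show "norm (partial_deriv i (partial_derivs \<alpha> h) z) \<le> E * (W * weight y)" by simp
    qed
    also have "\<dots> = D * norm (a - b) * weight y" by (simp add: D_def norm_minus_commute)
    finally show ?thesis .
  qed
  moreover have "D \<ge> 0" using E0 W0 by (simp add: D_def)
  ultimately show ?thesis by blast
qed

context
  fixes h \<phi> :: "real^'n::finite \<Rightarrow> complex" and R :: real
  assumes h: "decaying h" and \<phi>: "integrable lborel \<phi>"
begin

lemma
  fixes \<sigma> :: "real^'n \<Rightarrow> real^'n"
  assumes \<sigma>: "\<sigma> \<in> borel_measurable borel"
  shows integrable_convolve: "integrable lborel (\<lambda>x. \<phi> x * partial_derivs \<alpha> h (y - \<sigma> x))"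
    and smooth_convolve: "smooth (convolve h \<phi> \<sigma>)"
    and partial_derivs_convolve: "partial_derivs \<alpha> (convolve h \<phi> \<sigma>) y = (\<integral>x. \<phi> x * partial_derivs \<alpha> h (y - \<sigma> x) \<partial>lborel)"
proof -
  have sm: "smooth h" by (rule decaying_smooth[OF h])
  have [measurable]: "\<phi> \<in> borel_measurable borel" using \<phi> by (auto dest: borel_measurable_integrable)
  note [measurable] = \<sigma> borel_measurable_partial_derivs[OF sm]
  note bd = decaying_bounded[OF h]
  have d: "partial_derivs \<alpha> (\<lambda>y. \<phi> x * h (y - \<sigma> x)) = (\<lambda>y. \<phi> x * partial_derivs \<alpha> h (y - \<sigma> x))" for \<alpha> x
    using smooth_translate[OF sm, of "- \<sigma> x"] by (simp add: partial_derivs_cmult partial_derivs_shift[OF sm])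
  have 1: "smooth (\<lambda>y. \<phi> x * h (y - \<sigma> x))" for x
    using smooth_cmult[OF smooth_translate[OF sm, of "- \<sigma> x"], of "\<phi> x"] by simp
  have 2: "(\<lambda>x. partial_derivs \<alpha> (\<lambda>y. \<phi> x * h (y - \<sigma> x)) y) \<in> borel_measurable lborel" for \<alpha> y
    unfolding d by measurable
  have 3: "\<exists>B. integrable lborel B \<and> (\<forall>x\<in>space lborel. \<forall>y. norm (partial_derivs \<alpha> (\<lambda>y. \<phi> x * h (y - \<sigma> x)) y) \<le> B x)" for \<alpha>
  proof -
    obtain B where B: "B > 0" "\<And>x. norm (partial_derivs \<alpha> h x) \<le> B" using bd by blast
    show ?thesis
      by (rule exI[of _ "\<lambda>x. norm (\<phi> x) * B"]) (use \<phi> B in \<open>auto simp: d norm_mult intro!: mult_left_mono\<close>)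
  qed
  show "smooth (convolve h \<phi> \<sigma>)"
    unfolding convolve_def[abs_def] by (rule smooth_integral[OF 1 2 3])
  show "partial_derivs \<alpha> (convolve h \<phi> \<sigma>) y = (\<integral>x. \<phi> x * partial_derivs \<alpha> h (y - \<sigma> x) \<partial>lborel)"
    unfolding convolve_def[abs_def] partial_derivs_integral[OF 1 2 3] d ..
  obtain B where B: "B > 0" "\<And>x. norm (partial_derivs \<alpha> h x) \<le> B" using bd by blast
  show "integrable lborel (\<lambda>x. \<phi> x * partial_derivs \<alpha> h (y - \<sigma> x))"
    by (rule integrable_norm_bound[of _ "\<lambda>x. norm (\<phi> x) * B"])
       (use \<phi> B in \<open>auto simp: norm_mult intro!: mult_left_mono\<close>)
qed

lemma decaying_convolve:
  fixes \<sigma> :: "real^'n \<Rightarrow> real^'n"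
  assumes \<sigma>: "\<sigma> \<in> borel_measurable borel" and R: "\<And>x. \<phi> x \<noteq> 0 \<Longrightarrow> norm (\<sigma> x) \<le> R"
  shows "decaying (convolve h \<phi> \<sigma>)"
  unfolding decaying_def
proof (intro conjI allI smooth_convolve[OF \<sigma>])
  fix \<alpha>
  obtain C where C: "C > 0" "\<And>x. norm (partial_derivs \<alpha> h x) \<le> C * weight x"
    using decaying_bound[OF h] by blast
  let ?W = "(4 * (1 + R\<^sup>2)) ^ CARD('n)"
  have "norm (partial_derivs \<alpha> (convolve h \<phi> \<sigma>) y) \<le> ((\<integral>x. norm (\<phi> x) \<partial>lborel) * (C * ?W)) * weight y" for y
  proof -
    have le: "norm (\<phi> x * partial_derivs \<alpha> h (y - \<sigma> x)) \<le> norm (\<phi> x) * (C * (?W * weight y))" for x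
    proof (cases "\<phi> x = 0")
      case False
      then have "norm (\<sigma> x) \<le> R" by (rule R)
      then have "(norm (- \<sigma> x))\<^sup>2 \<le> R\<^sup>2" unfolding norm_minus_cancel by (intro power_mono) auto
      then have "(4 * (1 + (norm (- \<sigma> x))\<^sup>2)) ^ CARD('n) * weight y \<le> ?W * weight y"
        by (intro mult_right_mono power_mono) auto
      then have "weight (y + - \<sigma> x) \<le> ?W * weight y" by (rule order_trans[OF weight_translate])
      then have "weight (y - \<sigma> x) \<le> ?W * weight y" by simp
      then have "norm (partial_derivs \<alpha> h (y - \<sigma> x)) \<le> C * (?W * weight y)"
        using C(2)[of "y - \<sigma> x"] C(1) by (meson less_imp_le mult_left_mono order_trans)
      then show ?thesis unfolding norm_mult by (rule mult_left_mono) simp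
    qed simp
    have "norm (partial_derivs \<alpha> (convolve h \<phi> \<sigma>) y) \<le> (\<integral>x. norm (\<phi> x * partial_derivs \<alpha> h (y - \<sigma> x)) \<partial>lborel)"
      unfolding partial_derivs_convolve[OF \<sigma>] by (rule integral_norm_bound)
    also have "\<dots> \<le> (\<integral>x. norm (\<phi> x) * (C * (?W * weight y)) \<partial>lborel)"
      by (rule integral_mono[OF integrable_norm[OF integrable_convolve[OF \<sigma>]] _ le]) (use \<phi> in simp)
    also have "\<dots> = ((\<integral>x. norm (\<phi> x) \<partial>lborel) * (C * ?W)) * weight y" by simp
    finally show ?thesis .
  qed
  then show "\<exists>C. \<forall>x. norm (partial_derivs \<alpha> (convolve h \<phi> \<sigma>) x) \<le> C * weight x" by blast
qed

end

section \<open>Taking a functional inside a convolution integral\<close>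

context
  fixes q :: ennreal and S :: "(real^'n::finite \<Rightarrow> complex) \<Rightarrow> complex"
  assumes q: "1 \<le> q" "q < \<infinity>" and S: "S \<in> D'_L q"
begin

lemma continuous_on_shifts:
  assumes h: "decaying h"
  shows "continuous_on UNIV (\<lambda>a. S (\<lambda>y. h (y - a)))"
proof (rule continuous_at_imp_continuous_on, rule ballI)
  fix a :: "real^'n"
  obtain m c where c: "c > 0" "\<And>\<phi>. \<phi> \<in> predual q \<Longrightarrow> norm (S \<phi>) \<le> c * D_L_seminorm (conj_exponent q) m \<phi>"
    using D'_L_bound[OF q S] by blast
  let ?R = "norm a + 1"
  obtain D where D: "D \<ge> 0" "\<And>\<alpha> a b y. length \<alpha> \<le> m \<Longrightarrow> norm a \<le> ?R \<Longrightarrow> norm b \<le> ?R \<Longrightarrow>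
     norm (partial_derivs \<alpha> h (y - a) - partial_derivs \<alpha> h (y - b)) \<le> D * norm (a - b) * weight y"
    using shift_difference_bound[OF h] by meson
  let ?w = "Lp_norm (conj_exponent q) (\<lambda>x::real^'n. complex_of_real (weight x))"
  let ?G = "\<lambda>a. S (\<lambda>y. h (y - a))"
  have X: "(\<lambda>y. h (y - b)) \<in> predual q" for b by (intro decaying_predual[OF q] decaying_shift h)
  have sm: "smooth (\<lambda>y. h (y - b))" for b by (intro decaying_smooth decaying_shift h)
  have le: "norm (?G b - ?G a) \<le> c * (D * norm (b - a) * ?w)" if b: "norm (b - a) \<le> 1" for b
  proof -
    have nb: "norm b \<le> ?R" using b norm_triangle_sub[of b a] by simp
    have "D_L_seminorm (conj_exponent q) m (\<lambda>y. h (y - b) - h (y - a)) \<le> D * norm (b - a) * ?w"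
    proof (rule D_L_seminorm_weight_le[OF q])
      show "smooth (\<lambda>y. h (y - b) - h (y - a))" by (intro smooth_diff sm)
      show "0 \<le> D * norm (b - a)" using D(1) by simp
      show "norm (partial_derivs \<alpha> (\<lambda>y. h (y - b) - h (y - a)) x) \<le> D * norm (b - a) * weight x" if "length \<alpha> \<le> m" for \<alpha> x
        unfolding partial_derivs_diff[OF sm sm] partial_derivs_shift[OF decaying_smooth[OF h]]
        by (rule D(2)[OF that nb]) simp
    qed
    then have "c * D_L_seminorm (conj_exponent q) m (\<lambda>y. h (y - b) - h (y - a)) \<le> c * (D * norm (b - a) * ?w)"
      using c(1) by (intro mult_left_mono) auto
    then show ?thesis
      using c(2)[OF predual_diff[OF q X[of b] X[of a]]] D'_L_diff[OF q S X[of b] X[of a]] by simp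
  qed
  show "isCont ?G a"
    unfolding isCont_def
  proof (rule LIM_zero_cancel, rule Lim_null_comparison)
    show "\<forall>\<^sub>F b in at a. norm (?G b - ?G a) \<le> c * (D * norm (b - a) * ?w)"
      unfolding eventually_at by (rule exI[of _ 1]) (use le in \<open>auto simp: dist_norm\<close>)
    have "((\<lambda>b. c * (D * norm (b - a) * ?w)) \<longlongrightarrow> c * (D * norm (a - a) * ?w)) (at a)"
      by (intro tendsto_intros)
    then show "((\<lambda>b. c * (D * norm (b - a) * ?w)) \<longlongrightarrow> 0) (at a)" by simp
  qed
qed

lemma functional_convolve_finite:
  assumes h: "decaying h" and \<phi>: "integrable lborel \<phi>"
    and \<sigma>: "\<sigma> \<in> borel_measurable borel" and V: "finite V" "\<And>x. \<phi> x \<noteq> 0 \<Longrightarrow> \<sigma> x \<in> V"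
  shows "S (convolve h \<phi> \<sigma>) = (\<integral>x. \<phi> x * S (\<lambda>y. h (y - \<sigma> x)) \<partial>lborel)"
proof -
  have [measurable]: "\<phi> \<in> borel_measurable borel" using \<phi> by (auto dest: borel_measurable_integrable)
  note [measurable] = \<sigma>
  let ?c = "\<lambda>v. \<integral>x. \<phi> x * indicator {v} (\<sigma> x) \<partial>lborel"
  have i: "integrable lborel (\<lambda>x. \<phi> x * indicator {v} (\<sigma> x))" for v
    by (rule integrable_norm_bound[OF integrable_norm[OF \<phi>]]) (auto simp: indicator_def norm_mult)
  have eq: "\<phi> x * F (\<sigma> x) = (\<Sum>v\<in>V. \<phi> x * indicator {v} (\<sigma> x) * F v)" for x and F :: "real^'n \<Rightarrow> complex"
  proof (cases "\<phi> x = 0")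
    case False
    then have "\<sigma> x \<in> V" by (rule V(2))
    then have "(\<Sum>v\<in>V. indicator {v} (\<sigma> x) * F v) = F (\<sigma> x)"
      using V(1) by (simp add: indicator_def if_distrib[of "\<lambda>t. t * _"] cong: if_cong)
    then show ?thesis by (simp add: mult.assoc flip: sum_distrib_left)
  qed simp
  have int: "(\<integral>x. \<phi> x * F (\<sigma> x) \<partial>lborel) = (\<Sum>v\<in>V. ?c v * F v)" for F :: "real^'n \<Rightarrow> complex"
    unfolding eq[of _ F] using i by (subst Bochner_Integration.integral_sum) auto
  have X: "(\<lambda>y. h (y - b)) \<in> predual q" for b by (intro decaying_predual[OF q] decaying_shift h)
  have "convolve h \<phi> \<sigma> = (\<lambda>y. \<Sum>v\<in>V. ?c v * h (y - v))"
    unfolding convolve_def[abs_def] by (rule ext) (rule int[of "\<lambda>v. h (_ - v)"])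
  then have "S (convolve h \<phi> \<sigma>) = (\<Sum>v\<in>V. S (\<lambda>y. ?c v * h (y - v)))"
    using D'_L_sum[OF q S, of V "\<lambda>v y. ?c v * h (y - v)"] predual_cmult[OF q X] by simp
  also have "\<dots> = (\<Sum>v\<in>V. ?c v * S (\<lambda>y. h (y - v)))"
    by (simp only: D'_L_cmult[OF q S X])
  also have "\<dots> = (\<integral>x. \<phi> x * S (\<lambda>y. h (y - \<sigma> x)) \<partial>lborel)"
    by (rule int[of "\<lambda>v. S (\<lambda>y. h (y - v))", symmetric])
  finally show ?thesis .
qed

text \<open>For the rounded convolution this is linearity. Both sides converge as the grid is
  refined: the left because translation is Lipschitz in the seminorm controlling S, the right by
  dominated convergence, S of a translate being continuous in the translation. No integral of
  vector-valued functions is involved.\<close>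

lemma functional_convolve:
  assumes h: "decaying h" and \<phi>: "\<phi> \<in> test_functions"
  shows "S (\<lambda>y. \<integral>x. \<phi> x * h (y - x) \<partial>lborel) = (\<integral>x. \<phi> x * S (\<lambda>y. h (y - x)) \<partial>lborel)"
proof -
  have i\<phi>: "integrable lborel \<phi>" by (intro decaying_integrable test_functions_decaying \<phi>)
  have [measurable]: "\<phi> \<in> borel_measurable borel" using i\<phi> by (auto dest: borel_measurable_integrable)
  obtain R where R: "\<And>x. norm x > R \<Longrightarrow> \<phi> x = 0" using \<phi> by (auto simp: test_functions_iff)
  let ?n = "real CARD('n)"
  let ?R = "R + ?n"
  have supp: "norm x \<le> R" if "\<phi> x \<noteq> 0" for x using R that not_le by blast
  have suppg: "norm (grid j x) \<le> ?R" if "\<phi> x \<noteq> 0" for x j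
    using supp[OF that] norm_grid_diff_le[of j x] norm_triangle_sub[of "grid j x" x] by linarith
  have supp': "norm x \<le> ?R" if "\<phi> x \<noteq> 0" for x using supp[OF that] by simp
  have idm: "(\<lambda>x::real^'n. x) \<in> borel_measurable borel" by simp
  let ?G = "\<lambda>a. S (\<lambda>y. h (y - a))"
  have cG: "continuous_on UNIV ?G" by (rule continuous_on_shifts[OF h])
  have [measurable]: "?G \<in> borel_measurable borel" by (rule borel_measurable_continuous_onI[OF cG])
  obtain m c where c: "c > 0" "\<And>\<phi>. \<phi> \<in> predual q \<Longrightarrow> norm (S \<phi>) \<le> c * D_L_seminorm (conj_exponent q) m \<phi>"
    using D'_L_bound[OF q S] by blast
  obtain D where D: "D \<ge> 0" "\<And>\<alpha> a b y. length \<alpha> \<le> m \<Longrightarrow> norm a \<le> ?R \<Longrightarrow> norm b \<le> ?R \<Longrightarrow>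
     norm (partial_derivs \<alpha> h (y - a) - partial_derivs \<alpha> h (y - b)) \<le> D * norm (a - b) * weight y"
    using shift_difference_bound[OF h] by meson
  let ?w = "Lp_norm (conj_exponent q) (\<lambda>x::real^'n. complex_of_real (weight x))"
  let ?I = "\<integral>x. norm (\<phi> x) \<partial>lborel"
  let ?U = "convolve h \<phi>"
  have Ug: "?U (grid j) \<in> predual q" for j
    by (intro decaying_predual[OF q] decaying_convolve[OF h i\<phi>, where R = ?R] suppg) auto
  have Ui: "?U (\<lambda>x. x) \<in> predual q"
    by (intro decaying_predual[OF q] decaying_convolve[OF h i\<phi>, where R = ?R] supp') auto
  have sg: "smooth (?U (grid j))" and si: "smooth (?U (\<lambda>x. x))" for j
    by (rule predual_smooth[OF q Ug], rule predual_smooth[OF q Ui])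
  have le: "norm (S (?U (grid j)) - S (?U (\<lambda>x. x))) \<le> c * ((D * ?I * ?w * ?n) * (1 / real (Suc j)))" for j
  proof -
    let ?\<eta> = "?n / real (Suc j)"
    have "D_L_seminorm (conj_exponent q) m (\<lambda>y. ?U (grid j) y - ?U (\<lambda>x. x) y) \<le> (?I * (D * ?\<eta>)) * ?w"
    proof (rule D_L_seminorm_weight_le[OF q])
      show "smooth (\<lambda>y. ?U (grid j) y - ?U (\<lambda>x. x) y)" by (intro smooth_diff sg si)
      show "0 \<le> ?I * (D * ?\<eta>)" using D(1) by simp
      fix \<alpha> :: "'n list" and y assume \<alpha>: "length \<alpha> \<le> m"
      let ?d = "\<lambda>x. \<phi> x * partial_derivs \<alpha> h (y - grid j x) - \<phi> x * partial_derivs \<alpha> h (y - x)"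
      have di: "integrable lborel ?d"
        by (intro Bochner_Integration.integrable_diff integrable_convolve[OF h i\<phi>]) auto
      have "partial_derivs \<alpha> (\<lambda>y. ?U (grid j) y - ?U (\<lambda>x. x) y) y = (\<integral>x. ?d x \<partial>lborel)"
        unfolding partial_derivs_diff[OF sg si] partial_derivs_convolve[OF h i\<phi> borel_measurable_grid]
          partial_derivs_convolve[OF h i\<phi> idm]
        by (intro Bochner_Integration.integral_diff[symmetric] integrable_convolve[OF h i\<phi>]) auto
      then have "norm (partial_derivs \<alpha> (\<lambda>y. ?U (grid j) y - ?U (\<lambda>x. x) y) y) \<le> (\<integral>x. norm (?d x) \<partial>lborel)"
        using integral_norm_bound[of lborel ?d] by simp
      also have "\<dots> \<le> (\<integral>x. norm (\<phi> x) * (D * ?\<eta> * weight y) \<partial>lborel)"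
      proof (rule integral_mono[OF integrable_norm[OF di]])
        show "integrable lborel (\<lambda>x. norm (\<phi> x) * (D * ?\<eta> * weight y))" using i\<phi> by simp
        fix x
        show "norm (?d x) \<le> norm (\<phi> x) * (D * ?\<eta> * weight y)"
        proof (cases "\<phi> x = 0")
          case False
          have "norm (partial_derivs \<alpha> h (y - grid j x) - partial_derivs \<alpha> h (y - x)) \<le> D * norm (grid j x - x) * weight y"
            by (rule D(2)[OF \<alpha> suppg[OF False] supp'[OF False]])
          also have "\<dots> \<le> D * ?\<eta> * weight y"
            by (intro mult_right_mono mult_left_mono norm_grid_diff D(1)) simp
          finally show ?thesis
            unfolding right_diff_distrib[symmetric] norm_mult by (rule mult_left_mono) simp
        qed simp
      qed
      also have "\<dots> = (?I * (D * ?\<eta>)) * weight y" by simp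
      finally show "norm (partial_derivs \<alpha> (\<lambda>y. ?U (grid j) y - ?U (\<lambda>x. x) y) y) \<le> (?I * (D * ?\<eta>)) * weight y" .
    qed
    then have "c * D_L_seminorm (conj_exponent q) m (\<lambda>y. ?U (grid j) y - ?U (\<lambda>x. x) y) \<le> c * ((?I * (D * ?\<eta>)) * ?w)"
      using c(1) by (intro mult_left_mono) auto
    moreover have "norm (S (?U (grid j)) - S (?U (\<lambda>x. x))) \<le> c * D_L_seminorm (conj_exponent q) m (\<lambda>y. ?U (grid j) y - ?U (\<lambda>x. x) y)"
      using c(2)[OF predual_diff[OF q Ug[of j] Ui]] D'_L_diff[OF q S Ug[of j] Ui] by simp
    ultimately show ?thesis by (simp add: ac_simps)
  qed
  have "(\<lambda>j. c * ((D * ?I * ?w * ?n) * (1 / real (Suc j)))) \<longlonglongrightarrow> c * ((D * ?I * ?w * ?n) * 0)"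
    by (intro tendsto_mult_left LIMSEQ_Suc[OF lim_1_over_n])
  then have "(\<lambda>j. c * ((D * ?I * ?w * ?n) * (1 / real (Suc j)))) \<longlonglongrightarrow> 0" by simp
  then have "(\<lambda>j. S (?U (grid j)) - S (?U (\<lambda>x. x))) \<longlonglongrightarrow> 0"
    by (rule Lim_null_comparison[OF always_eventually[OF allI[OF le]]])
  then have lim1: "(\<lambda>j. S (?U (grid j))) \<longlonglongrightarrow> S (?U (\<lambda>x. x))" by (rule LIM_zero_cancel)
  have "\<exists>B>0. \<forall>a\<in>cball 0 ?R. norm (?G a) \<le> B"
    using compact_imp_bounded[OF compact_continuous_image[OF continuous_on_subset[OF cG] compact_cball[of 0 ?R]]]
    unfolding bounded_pos by auto
  then obtain B where B: "B > 0" "\<And>a. norm a \<le> ?R \<Longrightarrow> norm (?G a) \<le> B" by auto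
  have lim2: "(\<lambda>j. \<integral>x. \<phi> x * ?G (grid j x) \<partial>lborel) \<longlonglongrightarrow> (\<integral>x. \<phi> x * ?G x \<partial>lborel)"
  proof (rule integral_dominated_convergence[where w = "\<lambda>x. norm (\<phi> x) * B"])
    show "AE x in lborel. (\<lambda>j. \<phi> x * ?G (grid j x)) \<longlonglongrightarrow> \<phi> x * ?G x"
    proof (rule AE_I2, rule tendsto_mult_left)
      fix x :: "real^'n"
      have "(\<lambda>j. ?n * (1 / real (Suc j))) \<longlonglongrightarrow> ?n * 0" by (intro tendsto_mult_left LIMSEQ_Suc[OF lim_1_over_n])
      then have "(\<lambda>j. ?n / real (Suc j)) \<longlonglongrightarrow> 0" by simp
      then have "(\<lambda>j. grid j x - x) \<longlonglongrightarrow> 0"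
        by (rule Lim_null_comparison[OF always_eventually[OF allI[OF norm_grid_diff]]])
      then have "(\<lambda>j. grid j x) \<longlonglongrightarrow> x" by (rule LIM_zero_cancel)
      moreover have "isCont ?G x" using cG by (simp add: continuous_on_eq_continuous_at)
      ultimately show "(\<lambda>j. ?G (grid j x)) \<longlonglongrightarrow> ?G x" by (rule isCont_tendsto_compose[rotated])
    qed
    show "AE x in lborel. norm (\<phi> x * ?G (grid j x)) \<le> norm (\<phi> x) * B" for j
    proof (rule AE_I2)
      fix x
      show "norm (\<phi> x * ?G (grid j x)) \<le> norm (\<phi> x) * B"
        using B(2)[OF suppg, of x j] by (cases "\<phi> x = 0") (auto simp: norm_mult intro!: mult_left_mono)
    qed
    show "(\<lambda>x. \<phi> x * ?G x) \<in> borel_measurable lborel" by measurable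
    show "(\<lambda>x. \<phi> x * ?G (grid j x)) \<in> borel_measurable lborel" for j
      using measurable_compose[OF borel_measurable_grid \<open>?G \<in> borel_measurable borel\<close>, of j] by measurable
  qed (use i\<phi> in simp)
  have "S (?U (grid j)) = (\<integral>x. \<phi> x * ?G (grid j x) \<partial>lborel)" for j
    by (rule functional_convolve_finite[OF h i\<phi> borel_measurable_grid finite_grid[of j R]])
       (use supp in blast)
  then have "S (?U (\<lambda>x. x)) = (\<integral>x. \<phi> x * ?G x \<partial>lborel)"
    using LIMSEQ_unique[OF lim1] lim2 by simp
  then show ?thesis by (simp add: convolve_def[abs_def])
qed

end

section \<open>Splitting the heat average in time\<close>

lemma heat_average_Un:
  fixes \<phi> :: "real^'n::finite \<Rightarrow> complex"
  assumes A: "A \<in> sets borel" "A \<subseteq> {0<..}" "integrable lborel (heat_weight k A 0)"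
    and B: "B \<in> sets borel" "B \<subseteq> {0<..}" "integrable lborel (heat_weight k B 0)"
    and AB: "A \<inter> B = {}" and \<phi>: "\<phi> \<in> test_functions"
  shows "heat_average k (A \<union> B) [] \<phi> = (\<lambda>x. heat_average k A [] \<phi> x + heat_average k B [] \<phi> x)"
proof
  fix x
  have "heat_kernel k (A \<union> B) [] w = heat_kernel k A [] w + heat_kernel k B [] w" for w :: "real \<times> (real^'n)"
    by (cases w) (simp add: heat_kernel_def heat_weight_Un[OF AB] distrib_right)
  then show "heat_average k (A \<union> B) [] \<phi> x = heat_average k A [] \<phi> x + heat_average k B [] \<phi> x"
    unfolding heat_average_def
    using integrable_heat_average[OF A(1,2) _ \<phi>, of k "[]" x] integrable_heat_average[OF B(1,2) _ \<phi>, of k "[]" x] A B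
    by (simp add: distrib_right Bochner_Integration.integral_add)
qed

lemma heat_average_cmult: "heat_average k A \<beta> (\<lambda>x. c * \<phi> x) = (\<lambda>x. c * heat_average k A \<beta> \<phi> x)"
  unfolding heat_average_def by (simp add: mult.left_commute)

lemma convolution_bessel_kernel:
  fixes \<phi> :: "real^'n::finite \<Rightarrow> complex"
  assumes \<phi>: "\<phi> \<in> test_functions" and k: "k > 0"
  shows "convolution (bessel_kernel (2 * real (Suc k))) S \<phi> = S (heat_average k {0<..} [] \<phi>)"
proof -
  have int: "integrable lborel (heat_weight k {0<..} (length ([] :: 'n list)))"
    by (intro integrable_heat_weight) auto
  have "bessel_kernel (2 * real (Suc k)) (\<lambda>y. \<phi> (x + y)) = heat_average k {0<..} [] \<phi> x" for x
  proof -
    have "(\<lambda>y. \<phi> (x + y)) \<in> test_functions"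
      using test_functions_translate[OF \<phi>, of x] by (simp add: add.commute)
    \<comment> \<open>As k > 0 the density vanishes at t = 0, the only point of its support that the
      indicator omits.\<close>
    moreover have "heat_weight k {0<..} 0 t = erlang k t" for t
      using k by (auto simp: heat_weight_def indicator_def erlang_density_def)
    ultimately show ?thesis
      using heat_average_iterated[OF _ _ int \<phi>, of x] by (simp add: bessel_kernel_heat del: of_nat_Suc)
  qed
  then show ?thesis using \<phi> by (simp add: convolution_def del: of_nat_Suc)
qed

context
  fixes q :: ennreal
  assumes q: "1 \<le> q" "q < \<infinity>"
begin

lemma D_L_seminorm_heat_average_small:
  fixes \<phi> :: "real^'n::finite \<Rightarrow> complex"
  assumes \<phi>: "\<phi> \<in> test_functions" and K: "K \<le> k" and e: "e > 0"
  shows "D_L_seminorm (conj_exponent q) K (heat_average k {0<..e} [] \<phi>) \<le> 2 * e * gauss_mass TYPE('n) K * Lp_norm (conj_exponent q) \<phi>"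
  by (rule D_L_seminorm_heat_average[OF q _ _ _ _ \<phi>])
     (use K e in \<open>auto intro!: integrable_heat_weight integral_heat_weight_small\<close>)

lemma D_L_seminorm_heat_average_bound:
  assumes A: "A \<in> sets borel" "A \<subseteq> {0<..}" and int: "\<And>j. j \<le> K \<Longrightarrow> integrable lborel (heat_weight k A j)"
  shows "\<exists>T\<ge>0. \<forall>\<phi>\<in>test_functions. D_L_seminorm (conj_exponent q) K (heat_average k A [] (\<phi> :: real^'n::finite \<Rightarrow> complex)) \<le> T * Lp_norm (conj_exponent q) \<phi>"
proof -
  have nn: "0 \<le> (\<integral>t. heat_weight k A j t \<partial>lborel)" for j
    by (intro Bochner_Integration.integral_nonneg heat_weight_nonneg A)
  have "(\<integral>t. heat_weight k A j t \<partial>lborel) \<le> (\<Sum>j\<le>K. \<integral>t. heat_weight k A j t \<partial>lborel)" if "j \<le> K" for j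
    using that nn by (intro member_le_sum) auto
  then have "\<forall>\<phi>\<in>test_functions. D_L_seminorm (conj_exponent q) K (heat_average k A [] (\<phi> :: real^'n \<Rightarrow> complex))
      \<le> ((\<Sum>j\<le>K. \<integral>t. heat_weight k A j t \<partial>lborel) * gauss_mass TYPE('n) K) * Lp_norm (conj_exponent q) \<phi>"
    by (intro ballI D_L_seminorm_heat_average[OF q A int])
  moreover have "0 \<le> (\<Sum>j\<le>K. \<integral>t. heat_weight k A j t \<partial>lborel) * gauss_mass TYPE('n) K"
    by (intro mult_nonneg_nonneg sum_nonneg nn gauss_mass_nonneg[OF q])
  ultimately show ?thesis by blast
qed

text \<open>The contribution of times in (e', e] is of size e, uniformly in e'. For t \<le> e \<le>
  1 the factor 2 (1 + 2 t) of the rescaled weight is at most 6, and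
  \<open>integral_heat_weight_small\<close> gives 2 e; its condition on the order is met since n +
  |\<alpha>| \<le> k.\<close>

lemma heat_potential_small_bound:
  fixes x :: "real^'n::finite"
  assumes C: "\<And>x. norm (partial_derivs \<alpha> gauss (x::real^'n)) \<le> C * weight x" "C > 0"
    and k: "CARD('n) + length \<alpha> \<le> k" and e: "0 < e'" "0 < e" "e \<le> 1"
  shows "norm (partial_derivs \<alpha> (heat_potential k {e'<..e}) x) \<le> C * (6 ^ CARD('n) * (2 * e)) * weight x"
proof -
  have A: "{e'<..e} \<in> sets borel" "{e'<..e} \<subseteq> {e'<..}" "{e'<..e} \<subseteq> {0<..e}" "{e'<..e} \<subseteq> {0<..}"
    using e by auto
  let ?h = "heat_weight k {e'<..e} (CARD('n) + length \<alpha>)"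
  have hw: "0 \<le> ?h t" for t by (rule heat_weight_nonneg[OF A(4)])
  have ih: "integrable lborel ?h" by (rule integrable_heat_weight[OF A(1,4) k])
  have "(\<integral>t. ?h t * (2 * (1 + 2 * t)) ^ CARD('n) \<partial>lborel) \<le> (\<integral>t. ?h t * 6 ^ CARD('n) \<partial>lborel)"
  proof (rule integral_mono[OF integrable_heat_weight_away[OF A(1,2) e(1)]])
    show "integrable lborel (\<lambda>t. ?h t * 6 ^ CARD('n))" using ih by simp
    fix t
    show "?h t * (2 * (1 + 2 * t)) ^ CARD('n) \<le> ?h t * 6 ^ CARD('n)"
    proof (cases "t \<in> {e'<..e}")
      case True
      then show ?thesis using e hw by (intro mult_left_mono power_mono) auto
    qed (simp add: heat_weight_outside)
  qed
  also have "\<dots> = (\<integral>t. ?h t \<partial>lborel) * 6 ^ CARD('n)" by simp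
  also have "\<dots> \<le> (2 * e) * 6 ^ CARD('n)"
    by (intro mult_right_mono integral_heat_weight_small[OF A(1,3) k e(2)]) simp
  finally have F: "C * (\<integral>t. ?h t * (2 * (1 + 2 * t)) ^ CARD('n) \<partial>lborel) * weight x \<le> C * ((2 * e) * 6 ^ CARD('n)) * weight x"
    using C(2) by (intro mult_right_mono mult_left_mono) auto
  show ?thesis
    using order_trans[OF heat_potential_bound_uniform[OF A(1,2) e(1) C, of k x] F]
    by (simp only: mult.commute[of "6 ^ CARD('n)"])
qed

section \<open>A continuous representative of the convolution\<close>

context
  fixes S :: "(real^'n::finite \<Rightarrow> complex) \<Rightarrow> complex" and c :: real and K k :: nat
  assumes S: "S \<in> D'_L q" and c: "c > 0"
    and bound: "\<And>\<phi>. \<phi> \<in> predual q \<Longrightarrow> norm (S \<phi>) \<le> c * D_L_seminorm (conj_exponent q) K \<phi>"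
    and k: "CARD('n) + K \<le> k"
begin

definition approximant :: "nat \<Rightarrow> real^'n \<Rightarrow> complex" where
  "approximant j x = S (\<lambda>y. heat_potential k {1 / real (Suc j)<..} (y - x))"

lemma decaying_heat_potential_Suc: "decaying (heat_potential k {1 / real (Suc j)<..} :: real^'n \<Rightarrow> complex)"
  by (rule decaying_heat_potential[where e = "1 / real (Suc j)"]) auto

text \<open>The difference is S applied to a translate of the kernel for the times between 1 / (j +
  1) and 1 / (i + 1). Its seminorm of order K is of size 1 / (i + 1), locally uniformly in the
  translation, and that seminorm controls S.\<close>

lemma approximant_Cauchy:
  "\<exists>M\<ge>0. \<forall>x i j. norm x \<le> R \<longrightarrow> i \<le> j \<longrightarrow> norm (approximant j x - approximant i x) \<le> M / real (Suc i)"
proof -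
  let ?w = "Lp_norm (conj_exponent q) (\<lambda>x::real^'n. complex_of_real (weight x))"
  have "\<forall>\<alpha>. \<exists>C>0. \<forall>x. norm (partial_derivs \<alpha> gauss (x::real^'n)) \<le> C * weight x"
    using bounded_partial_derivs_gauss by blast
  then obtain C where C: "\<And>\<alpha>. C \<alpha> > 0" "\<And>\<alpha> x. norm (partial_derivs \<alpha> gauss (x::real^'n)) \<le> C \<alpha> * weight x" by metis
  define E where "E = (\<Sum>\<alpha>\<in>{\<alpha>. length \<alpha> \<le> K}. C \<alpha>)"
  have E: "C \<alpha> \<le> E" if "length \<alpha> \<le> K" for \<alpha>
    unfolding E_def using that C(1) by (intro member_le_sum finite_short_lists) (auto intro: less_imp_le)
  have E0: "E \<ge> 0" unfolding E_def using C(1) by (intro sum_nonneg) (auto intro: less_imp_le)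
  define W where "W = (4 * (1 + R\<^sup>2)) ^ CARD('n)"
  have W0: "W \<ge> 0" by (simp add: W_def)
  define M where "M = c * (E * 6 ^ CARD('n) * 2 * W * ?w)"
  have "norm (approximant j x - approximant i x) \<le> M / real (Suc i)" if x: "norm x \<le> R" and ij: "i \<le> j" for x i j
  proof -
    let ?h = "\<lambda>j. heat_potential k {1 / real (Suc j)<..} :: real^'n \<Rightarrow> complex"
    let ?D = "{1 / real (Suc j)<..1 / real (Suc i)}"
    let ?d = "heat_potential k ?D :: real^'n \<Rightarrow> complex"
    have le: "1 / real (Suc j) \<le> 1 / real (Suc i)" using ij by (simp add: frac_le)
    have "{1 / real (Suc j)<..} - {1 / real (Suc i)<..} = ?D" by auto
    then have diff: "?h j z - ?h i z = ?d z" for z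
      using heat_potential_diff[of "{1 / real (Suc j)<..}" "1 / real (Suc j)" "{1 / real (Suc i)<..}" k z] le by auto
    have dd: "decaying ?d"
      by (rule decaying_heat_potential[where e = "1 / real (Suc j)"]) auto
    have X: "(\<lambda>y. ?h j (y - x)) \<in> predual q" for j
      by (intro decaying_predual[OF q] decaying_shift decaying_heat_potential_Suc)
    let ?T = "E * (6 ^ CARD('n) * (2 * (1 / real (Suc i)))) * W"
    have "D_L_seminorm (conj_exponent q) K (\<lambda>y. ?d (y - x)) \<le> ?T * ?w"
    proof (rule D_L_seminorm_weight_le[OF q])
      show "smooth (\<lambda>y. ?d (y - x))" by (intro decaying_smooth decaying_shift dd)
      show "0 \<le> ?T" using E0 W0 by simp
      fix \<alpha> :: "'n list" and y :: "real^'n" assume \<alpha>: "length \<alpha> \<le> K"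
      have "(norm (- x))\<^sup>2 \<le> R\<^sup>2" unfolding norm_minus_cancel using x by (intro power_mono) auto
      then have "(4 * (1 + (norm (- x))\<^sup>2)) ^ CARD('n) * weight y \<le> W * weight y"
        unfolding W_def by (intro mult_right_mono power_mono) auto
      then have "weight (y + - x) \<le> W * weight y" by (rule order_trans[OF weight_translate])
      then have w: "weight (y - x) \<le> W * weight y" by simp
      have "norm (partial_derivs \<alpha> ?d (y - x)) \<le> C \<alpha> * (6 ^ CARD('n) * (2 * (1 / real (Suc i)))) * weight (y - x)"
        by (rule heat_potential_small_bound[OF C(2) C(1)]) (use k \<alpha> in auto)
      also have "\<dots> \<le> E * (6 ^ CARD('n) * (2 * (1 / real (Suc i)))) * (W * weight y)"
        by (intro mult_mono w E \<alpha>) (use E0 in auto)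
      finally show "norm (partial_derivs \<alpha> (\<lambda>y. ?d (y - x)) y) \<le> ?T * weight y"
        by (simp only: partial_derivs_shift[OF decaying_smooth[OF dd]] mult.assoc)
    qed
    then have "c * D_L_seminorm (conj_exponent q) K (\<lambda>y. ?d (y - x)) \<le> c * (?T * ?w)"
      using c by (intro mult_left_mono) auto
    moreover have "norm (approximant j x - approximant i x) \<le> c * D_L_seminorm (conj_exponent q) K (\<lambda>y. ?d (y - x))"
      using bound[OF predual_diff[OF q X[of j] X[of i]]] D'_L_diff[OF q S X[of j] X[of i]]
      by (simp add: approximant_def diff del: of_nat_Suc)
    moreover have "c * (?T * ?w) = M / real (Suc i)" by (simp add: M_def)
    ultimately show ?thesis by linarith
  qed
  moreover have "M \<ge> 0" unfolding M_def using c E0 W0 by simp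
  ultimately show ?thesis by blast
qed

lemma functional_heat_average_truncated:
  assumes \<phi>: "\<phi> \<in> test_functions"
  shows "S (heat_average k {1 / real (Suc j)<..} [] \<phi>) = (\<integral>x. \<phi> x * approximant j x \<partial>lborel)"
proof -
  have "heat_average k {1 / real (Suc j)<..} [] \<phi> = (\<lambda>y. \<integral>x. \<phi> x * heat_potential k {1 / real (Suc j)<..} (y - x) \<partial>lborel)"
    by (rule ext, subst heat_average_potential[where e = "1 / real (Suc j)", OF _ _ _ \<phi>]) (auto simp: mult.commute)
  then show ?thesis
    unfolding approximant_def by (simp only: functional_convolve[OF q S decaying_heat_potential_Suc \<phi>])
qed

text \<open>The omitted times have length 1 / (j + 1) and contribute that order to the seminorm of
  order K, which controls S.\<close>

lemma functional_heat_average_lim: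
  assumes \<phi>: "\<phi> \<in> test_functions"
  shows "(\<lambda>j. S (heat_average k {1 / real (Suc j)<..} [] \<phi>)) \<longlonglongrightarrow> S (heat_average k {0<..} [] \<phi>)"
proof -
  let ?GN = "gauss_mass TYPE('n) K * Lp_norm (conj_exponent q) \<phi>"
  have le: "norm (S (heat_average k {1 / real (Suc j)<..} [] \<phi>) - S (heat_average k {0<..} [] \<phi>)) \<le> (c * 2 * ?GN) * (1 / real (Suc j))" for j
  proof -
    define e where "e = 1 / real (Suc j)"
    have e: "e > 0" by (simp add: e_def)
    have A: "{e<..} \<in> sets borel" "{e<..} \<subseteq> {0<..}" "integrable lborel (heat_weight k {e<..} 0)"
      using e by (auto intro!: integrable_heat_weight)
    have B: "{0<..e} \<in> sets borel" "{0<..e} \<subseteq> {0<..}" "integrable lborel (heat_weight k {0<..e} 0)"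
      by (auto intro!: integrable_heat_weight)
    have AB: "{e<..} \<inter> {0<..e} = {}" "{e<..} \<union> {0<..e} = {0<..}"
      using e by auto
    note XA = heat_average_predual[OF q A \<phi>] and XB = heat_average_predual[OF q B \<phi>]
    have "S (heat_average k {0<..} [] \<phi>) = S (heat_average k {e<..} [] \<phi>) + S (heat_average k {0<..e} [] \<phi>)"
      using heat_average_Un[OF A B AB(1) \<phi>] D'_L_add[OF q S XA XB] unfolding AB(2) by simp
    then have "norm (S (heat_average k {e<..} [] \<phi>) - S (heat_average k {0<..} [] \<phi>)) = norm (S (heat_average k {0<..e} [] \<phi>))"
      by simp
    also have "\<dots> \<le> c * D_L_seminorm (conj_exponent q) K (heat_average k {0<..e} [] \<phi>)" by (rule bound[OF XB])
    also have "\<dots> \<le> c * (2 * e * gauss_mass TYPE('n) K * Lp_norm (conj_exponent q) \<phi>)"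
      using c k by (intro mult_left_mono D_L_seminorm_heat_average_small \<phi> e) auto
    finally show ?thesis unfolding e_def[symmetric] by (simp add: ac_simps)
  qed
  have "(\<lambda>j. (c * 2 * ?GN) * (1 / real (Suc j))) \<longlonglongrightarrow> (c * 2 * ?GN) * 0"
    by (intro tendsto_mult_left LIMSEQ_Suc[OF lim_1_over_n])
  then have "(\<lambda>j. (c * 2 * ?GN) * (1 / real (Suc j))) \<longlonglongrightarrow> 0" by simp
  then have "(\<lambda>j. S (heat_average k {1 / real (Suc j)<..} [] \<phi>) - S (heat_average k {0<..} [] \<phi>)) \<longlonglongrightarrow> 0"
    by (rule Lim_null_comparison[OF always_eventually[OF allI[OF le]]])
  then show ?thesis by (rule LIM_zero_cancel)
qed

text \<open>The approximants are continuous and converge locally uniformly, so their limit g is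
  continuous and its pairings are limits of theirs. Continuity of g is what makes
  \<open>converse_Hoelder\<close> applicable.\<close>

lemma continuous_representative:
  "\<exists>g. continuous_on UNIV g \<and> (\<forall>\<phi>\<in>test_functions. pairing g \<phi> = S (heat_average k {0<..} [] \<phi>))"
proof -
  have "\<forall>R. \<exists>M\<ge>0. \<forall>x i j. norm x \<le> R \<longrightarrow> i \<le> j \<longrightarrow> norm (approximant j x - approximant i x) \<le> M / real (Suc i)"
    using approximant_Cauchy by blast
  then obtain M where M: "\<And>R. M R \<ge> 0"
    "\<And>R x i j. norm x \<le> R \<Longrightarrow> i \<le> j \<Longrightarrow> norm (approximant j x - approximant i x) \<le> M R / real (Suc i)" by metis
  have small: "(\<lambda>i. B / real (Suc i)) \<longlonglongrightarrow> 0" for B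
    using tendsto_mult_left[OF LIMSEQ_Suc[OF lim_1_over_n], of B] by simp
  have "convergent (\<lambda>j. approximant j x)" for x
  proof (rule Cauchy_convergent, rule CauchyI')
    fix e :: real assume "e > 0"
    then have "\<forall>\<^sub>F i in sequentially. M (norm x) / real (Suc i) < e"
      using order_tendstoD(2)[OF small] by blast
    then obtain N where N: "\<And>i. i \<ge> N \<Longrightarrow> M (norm x) / real (Suc i) < e"
      by (auto simp: eventually_sequentially)
    have "dist (approximant i x) (approximant j x) < e" if "i \<ge> N" "j > i" for i j
      using M(2)[of x "norm x" i j] N[OF that(1)] that(2) by (simp add: dist_norm norm_minus_commute del: of_nat_Suc)
    then show "\<exists>M. \<forall>m\<ge>M. \<forall>n>m. dist (approximant m x) (approximant n x) < e" by blast
  qed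
  then obtain g where g: "\<And>x. (\<lambda>j. approximant j x) \<longlonglongrightarrow> g x"
    unfolding convergent_def by metis
  have gM: "norm (g x - approximant i x) \<le> M R / real (Suc i)" if "norm x \<le> R" for x R i
    by (rule LIMSEQ_le_const2[OF tendsto_norm[OF tendsto_diff[OF g tendsto_const]]])
       (use M(2)[OF that] in blast)
  have ca: "continuous_on A (approximant j)" for A j
    unfolding approximant_def
    by (rule continuous_on_subset[OF continuous_on_shifts[OF q S decaying_heat_potential_Suc]]) simp
  have cg: "continuous_on (cball 0 R) g" for R
  proof (rule uniform_limit_theorem[where f = approximant and F = sequentially])
    show "uniform_limit (cball 0 R) approximant g sequentially"
    proof (rule uniform_limitI)
      fix e :: real assume "e > 0"
      then have "\<forall>\<^sub>F i in sequentially. M R / real (Suc i) < e"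
        using order_tendstoD(2)[OF small] by blast
      then show "\<forall>\<^sub>F i in sequentially. \<forall>x\<in>cball 0 R. dist (approximant i x) (g x) < e"
      proof eventually_elim
        case (elim i)
        show ?case
        proof
          fix x :: "real^'n" assume "x \<in> cball 0 R"
          then show "dist (approximant i x) (g x) < e"
            using gM[of x R i] elim by (simp add: dist_norm norm_minus_commute del: of_nat_Suc)
        qed
      qed
    qed
  qed (use ca in auto)
  have cU: "continuous_on UNIV g"
  proof (rule continuous_at_imp_continuous_on, rule ballI)
    fix x :: "real^'n"
    have "x \<in> interior (cball 0 (norm x + 1))" by simp
    then show "isCont g x" by (rule continuous_on_interior[OF cg])
  qed
  have "pairing g \<phi> = S (heat_average k {0<..} [] \<phi>)" if \<phi>: "\<phi> \<in> test_functions" for \<phi>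
  proof -
    have c\<phi>: "continuous_on UNIV \<phi>" by (intro smooth_continuous_on test_functions_smooth \<phi>)
    have i\<phi>: "integrable lborel \<phi>" by (intro decaying_integrable test_functions_decaying \<phi>)
    obtain R where R: "\<And>x. norm x > R \<Longrightarrow> \<phi> x = 0" using \<phi> by (auto simp: test_functions_iff)
    have ia: "integrable lborel (\<lambda>x. \<phi> x * approximant j x)" for j
      by (rule integrable_compact_support[of _ R]) (use ca c\<phi> R in \<open>auto intro!: continuous_intros\<close>)
    have ig: "integrable lborel (\<lambda>x. \<phi> x * g x)"
      by (rule integrable_compact_support[of _ R]) (use cU c\<phi> R in \<open>auto intro!: continuous_intros\<close>)
    have le: "norm ((\<integral>x. \<phi> x * approximant j x \<partial>lborel) - (\<integral>x. \<phi> x * g x \<partial>lborel)) \<le> ((\<integral>x. norm (\<phi> x) \<partial>lborel) * M R) / real (Suc j)" for j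
    proof -
      let ?d = "\<lambda>x. \<phi> x * approximant j x - \<phi> x * g x"
      have id: "integrable lborel ?d" using ia ig by simp
      have "(\<integral>x. \<phi> x * approximant j x \<partial>lborel) - (\<integral>x. \<phi> x * g x \<partial>lborel) = (\<integral>x. ?d x \<partial>lborel)"
        using ia ig by simp
      then have "norm ((\<integral>x. \<phi> x * approximant j x \<partial>lborel) - (\<integral>x. \<phi> x * g x \<partial>lborel)) \<le> (\<integral>x. norm (?d x) \<partial>lborel)"
        using integral_norm_bound[of lborel ?d] by simp
      also have "\<dots> \<le> (\<integral>x. norm (\<phi> x) * (M R / real (Suc j)) \<partial>lborel)"
      proof (rule integral_mono[OF integrable_norm[OF id]])
        show "integrable lborel (\<lambda>x. norm (\<phi> x) * (M R / real (Suc j)))" using i\<phi> by simp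
        fix x
        show "norm (?d x) \<le> norm (\<phi> x) * (M R / real (Suc j))"
        proof (cases "norm x > R")
          case False
          then have "norm (approximant j x - g x) \<le> M R / real (Suc j)"
            using gM[of x R j] by (simp add: norm_minus_commute del: of_nat_Suc)
          then show ?thesis
            unfolding right_diff_distrib[symmetric] norm_mult by (rule mult_left_mono) simp
        qed (simp add: R)
      qed
      also have "\<dots> = ((\<integral>x. norm (\<phi> x) \<partial>lborel) * M R) / real (Suc j)" by simp
      finally show ?thesis .
    qed
    have "(\<lambda>j. (\<integral>x. \<phi> x * approximant j x \<partial>lborel) - (\<integral>x. \<phi> x * g x \<partial>lborel)) \<longlonglongrightarrow> 0"
      by (rule Lim_null_comparison[OF always_eventually[OF allI[OF le]] small])
    then have "(\<lambda>j. \<integral>x. \<phi> x * approximant j x \<partial>lborel) \<longlonglongrightarrow> (\<integral>x. \<phi> x * g x \<partial>lborel)"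
      by (rule LIM_zero_cancel)
    then have "(\<lambda>j. S (heat_average k {1 / real (Suc j)<..} [] \<phi>)) \<longlonglongrightarrow> (\<integral>x. \<phi> x * g x \<partial>lborel)"
      by (simp only: functional_heat_average_truncated[OF \<phi>])
    from LIMSEQ_unique[OF this functional_heat_average_lim[OF \<phi>]]
    show ?thesis by (simp add: pairing_def mult.commute)
  qed
  with cU show ?thesis by blast
qed

end

end

section \<open>Compactness\<close>

lemma topspace_L_dist_topology [simp]: "topspace (L_dist_topology q) = L_dist q"
  unfolding L_dist_topology_def by simp

lemma L_dist_norm_le:
  assumes "g \<in> Lp q" "regular_distribution g = T"
  shows "L_dist_norm q T \<le> Lp_norm q g"
  unfolding L_dist_norm_def by (rule cINF_lower) (use assms in \<open>auto intro!: bdd_belowI2[of _ 0]\<close>)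

lemma openin_L_dist_ball:
  assumes "openin (L_dist_topology q) U" "T0 \<in> U"
  shows "\<exists>\<epsilon>>0. \<forall>T\<in>L_dist q. L_dist_norm q (\<lambda>\<phi>. T \<phi> - T0 \<phi>) < \<epsilon> \<longrightarrow> T \<in> U"
proof -
  obtain F \<epsilon> where F: "F \<subseteq> {L_dist_norm q}" "\<epsilon> > 0"
    "{T\<in>L_dist q. \<forall>p\<in>F. p (\<lambda>\<phi>. T \<phi> - T0 \<phi>) < \<epsilon>} \<subseteq> U"
    using bspec[OF assms(1)[unfolded L_dist_topology_def openin_seminorm_topology, THEN conjunct2] assms(2)]
    by (elim exE conjE) (rule that)
  have "T \<in> U" if "T \<in> L_dist q" "L_dist_norm q (\<lambda>\<phi>. T \<phi> - T0 \<phi>) < \<epsilon>" for T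
    using that F(1) subsetD[OF F(3), of T] by auto
  with F(2) show ?thesis by blast
qed

lemma regular_distribution_diff:
  assumes q: "1 \<le> q" "q < \<infinity>" and g: "g \<in> Lp q" "h \<in> Lp q"
  shows "regular_distribution (\<lambda>x. g x - h x) = (\<lambda>\<phi>. regular_distribution g \<phi> - regular_distribution h \<phi>)"
  unfolding regular_distribution_def
  by (auto simp: pairing_diff_left[OF q g test_functions_predual[OF q]])

section \<open>(1 - \<Delta>)^m as a continuous map from L^q into the dual\<close>

lemma helmholtz_add:
  assumes "smooth \<phi>" "smooth \<psi>"
  shows "helmholtz (\<lambda>x. \<phi> x + \<psi> x) = (\<lambda>x. helmholtz \<phi> x + helmholtz \<psi> x)"
  unfolding helmholtz_def by (simp only: partial_derivs_add[OF assms] sum.distrib) (simp add: algebra_simps)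

lemma helmholtz_cmult:
  assumes "smooth \<phi>"
  shows "helmholtz (\<lambda>x. c * \<phi> x) = (\<lambda>x. c * helmholtz \<phi> x)"
  unfolding helmholtz_def by (simp only: partial_derivs_cmult[OF assms]) (simp add: algebra_simps sum_distrib_left)

lemma helmholtz_power_add:
  assumes "smooth \<phi>" "smooth \<psi>"
  shows "(helmholtz ^^ m) (\<lambda>x. \<phi> x + \<psi> x) = (\<lambda>x. (helmholtz ^^ m) \<phi> x + (helmholtz ^^ m) \<psi> x)"
  by (induction m) (simp_all add: helmholtz_add smooth_helmholtz_power assms)

lemma helmholtz_power_cmult:
  assumes "smooth \<phi>"
  shows "(helmholtz ^^ m) (\<lambda>x. c * \<phi> x) = (\<lambda>x. c * (helmholtz ^^ m) \<phi> x)"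
  by (induction m) (simp_all add: helmholtz_cmult smooth_helmholtz_power assms)

lemma helmholtz_power_sum:
  assumes "\<And>i. i \<in> I \<Longrightarrow> smooth (f i)"
  shows "(helmholtz ^^ m) (\<lambda>x. \<Sum>i\<in>I. f i x) = (\<lambda>x. \<Sum>i\<in>I. (helmholtz ^^ m) (f i) x)"
  using assms
proof (induction I rule: infinite_finite_induct)
  case (insert i I)
  then show ?case by (simp add: helmholtz_power_add smooth_sum)
\<comment> \<open>Empty and infinite sums are 0, and the operator maps 0 to 0 by the scalar rule
  with c = 0.\<close>
qed (use helmholtz_power_cmult[OF smooth_const, of m 0 0] in simp_all)

context
  fixes q :: ennreal
  assumes q: "1 \<le> q" "q < \<infinity>"
begin

lemma predual_helmholtz: "\<phi> \<in> predual q \<Longrightarrow> helmholtz \<phi> \<in> predual q"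
  unfolding helmholtz_def by (intro predual_diff[OF q] predual_sum[OF q] predual_partial_derivs[OF q])

lemma predual_helmholtz_power: "\<phi> \<in> predual q \<Longrightarrow> (helmholtz ^^ m) \<phi> \<in> predual q"
  by (induction m) (auto intro: predual_helmholtz)

text \<open>One factor 1 - \<Delta> applied to \<phi> produces 1 + n functions, each at the cost of
  at most two orders of the seminorm. The induction peels off the innermost factor, so the
  hypothesis is applied to \<phi> and to its second derivatives.\<close>

lemma norm_pairing_helmholtz_power:
  fixes g \<phi> :: "real^'n::finite \<Rightarrow> complex"
  assumes g: "g \<in> Lp q" and \<phi>: "\<phi> \<in> predual q"
  shows "norm (pairing g ((helmholtz ^^ m) \<phi>))
    \<le> Lp_norm q g * ((1 + real CARD('n)) ^ m * D_L_seminorm (conj_exponent q) (2 * m) \<phi>)"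
  using \<phi>
proof (induction m arbitrary: \<phi>)
  case 0
  have "norm (pairing g \<phi>) \<le> Lp_norm q g * Lp_norm (conj_exponent q) \<phi>"
    by (rule norm_pairing_le[OF q g 0])
  also have "\<dots> \<le> Lp_norm q g * D_L_seminorm (conj_exponent q) 0 \<phi>"
    using Lp_norm_le_D_L_seminorm[of "[]" 0 "conj_exponent q" \<phi>] by (intro mult_left_mono) auto
  finally show ?case by simp
next
  case (Suc m)
  let ?H = "helmholtz ^^ m" and ?P = "D_L_seminorm (conj_exponent q) :: nat \<Rightarrow> (real^'n \<Rightarrow> complex) \<Rightarrow> real"
  let ?d = "\<lambda>i. partial_derivs [i, i] \<phi>"
  let ?B = "Lp_norm q g * ((1 + real CARD('n)) ^ m * ?P (2 * Suc m) \<phi>)"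
  have dX: "?d i \<in> predual q" for i by (intro predual_partial_derivs[OF q] Suc.prems)
  have sm: "smooth \<phi>" "smooth (?d i)" for i
    using predual_smooth[OF q Suc.prems] predual_smooth[OF q dX] by auto
  have "(helmholtz ^^ Suc m) \<phi> = ?H (\<lambda>x. \<phi> x + (-1) * (\<Sum>i\<in>UNIV. ?d i x))"
    unfolding funpow_Suc_right o_def by (simp add: helmholtz_def)
  also have "\<dots> = (\<lambda>x. ?H \<phi> x - (\<Sum>i\<in>UNIV. ?H (?d i) x))"
    using sm by (simp only: helmholtz_power_add helmholtz_power_cmult helmholtz_power_sum smooth_sum smooth_cmult) simp
  finally have eq: "(helmholtz ^^ Suc m) \<phi> = (\<lambda>x. ?H \<phi> x - (\<Sum>i\<in>UNIV. ?H (?d i) x))" .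
  have psum: "pairing g (\<lambda>x. \<Sum>i\<in>UNIV. ?H (?d i) x) = (\<Sum>i\<in>UNIV. pairing g (?H (?d i)))"
    unfolding pairing_def sum_distrib_left
    by (intro Bochner_Integration.integral_sum Hoelder_integrable[OF q g] predual_Lp_0[OF q]
        predual_continuous_on[OF q] predual_helmholtz_power dX)
  have "norm (pairing g ((helmholtz ^^ Suc m) \<phi>)) = norm (pairing g (?H \<phi>) - (\<Sum>i\<in>UNIV. pairing g (?H (?d i))))"
    unfolding eq psum[symmetric]
    by (subst pairing_diff[OF q g predual_helmholtz_power[OF Suc.prems] predual_sum[OF q predual_helmholtz_power[OF dX]]]) simp
  also have "\<dots> \<le> norm (pairing g (?H \<phi>)) + (\<Sum>i\<in>UNIV. norm (pairing g (?H (?d i))))"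
    by (rule order_trans[OF norm_triangle_ineq4]) (intro add_left_mono norm_sum)
  also have "\<dots> \<le> ?B + (\<Sum>i\<in>(UNIV::'n set). ?B)"
  proof (intro add_mono sum_mono)
    have "?P (2 * m) \<phi> \<le> ?P (2 * Suc m) \<phi>" by (rule D_L_seminorm_mono) simp
    then have "Lp_norm q g * ((1 + real CARD('n)) ^ m * ?P (2 * m) \<phi>) \<le> ?B"
      by (intro mult_left_mono) auto
    with Suc.IH[OF Suc.prems] show "norm (pairing g (?H \<phi>)) \<le> ?B" by (rule order_trans)
    fix i
    have "?P (2 * m) (?d i) \<le> ?P (2 * Suc m) \<phi>"
      using D_L_seminorm_partial_derivs[of "conj_exponent q" "2 * m" "[i, i]" \<phi>] by simp
    then have "Lp_norm q g * ((1 + real CARD('n)) ^ m * ?P (2 * m) (?d i)) \<le> ?B"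
      by (intro mult_left_mono) auto
    with Suc.IH[OF dX] show "norm (pairing g (?H (?d i))) \<le> ?B" by (rule order_trans)
  qed
  also have "\<dots> = Lp_norm q g * ((1 + real CARD('n)) ^ Suc m * ?P (2 * Suc m) \<phi>)"
    by (simp add: algebra_simps)
  finally show ?case .
qed

text \<open>The inverse of convolution with the Bessel kernel of order \<open>2m\<close> on \<open>L\<^sup>q\<close>.\<close>

definition helmholtz_dist :: "nat \<Rightarrow> ((real^'n::finite \<Rightarrow> complex) \<Rightarrow> complex) \<Rightarrow> (real^'n \<Rightarrow> complex) \<Rightarrow> complex" where
  "helmholtz_dist m T \<phi> = (if \<phi> \<in> predual q
     then pairing (SOME g. g \<in> Lp q \<and> regular_distribution g = T) ((helmholtz ^^ m) \<phi>) else 0)"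

lemma helmholtz_dist_eq:
  assumes g: "g \<in> Lp q" "regular_distribution g = T" and \<phi>: "\<phi> \<in> predual q"
  shows "helmholtz_dist m T \<phi> = pairing g ((helmholtz ^^ m) \<phi>)"
proof -
  let ?g = "SOME g. g \<in> Lp q \<and> regular_distribution g = T"
  have "?g \<in> Lp q \<and> regular_distribution ?g = T"
    by (rule someI[of "\<lambda>g. g \<in> Lp q \<and> regular_distribution g = T" g]) (use g in simp)
  then show ?thesis
    using \<phi> g unfolding helmholtz_dist_def
    by (auto intro!: pairing_eq[OF q] predual_helmholtz_power)
qed

lemma helmholtz_dist_D'_L:
  fixes T :: "(real^'n::finite \<Rightarrow> complex) \<Rightarrow> complex"
  assumes "T \<in> L_dist q"
  shows "helmholtz_dist m T \<in> D'_L q"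
proof -
  obtain g where g: "g \<in> Lp q" "regular_distribution g = T" using assms by (auto simp: L_dist_def)
  note eq = helmholtz_dist_eq[OF g] and X = predual_helmholtz_power
  show ?thesis
  proof (rule D'_L_I[OF q])
    show "helmholtz_dist m T \<phi> = 0" if "\<phi> \<notin> predual q" for \<phi>
      using that by (simp add: helmholtz_dist_def)
    show "helmholtz_dist m T (\<lambda>x. \<phi> x + \<psi> x) = helmholtz_dist m T \<phi> + helmholtz_dist m T \<psi>"
      if "\<phi> \<in> predual q" "\<psi> \<in> predual q" for \<phi> \<psi>
      using that by (simp add: eq predual_add[OF q] helmholtz_power_add predual_smooth[OF q] pairing_add[OF q g(1)] X)
    show "helmholtz_dist m T (\<lambda>x. c * \<phi> x) = c * helmholtz_dist m T \<phi>" if "\<phi> \<in> predual q" for c \<phi>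
      using that by (simp add: eq predual_cmult[OF q] helmholtz_power_cmult predual_smooth[OF q] pairing_cmult[OF q])
    show "norm (helmholtz_dist m T \<phi>) \<le> (Lp_norm q g * (1 + real CARD('n)) ^ m) * D_L_seminorm (conj_exponent q) (2 * m) \<phi>"
      if "\<phi> \<in> predual q" for \<phi>
      using norm_pairing_helmholtz_power[OF g(1) that, of m] by (simp add: eq[OF that] mult.assoc)
  qed
qed

text \<open>A basic neighbourhood in the strong topology involves finitely many bounded sets. On
  each the seminorm of order 2m is bounded, so the norm of the difference in L^q times the sum of
  these bounds controls them all at once.\<close>

lemma continuous_map_helmholtz_dist:
  "continuous_map (L_dist_topology q :: ((real^'n::finite \<Rightarrow> complex) \<Rightarrow> complex) topology) (D'_L_topology q) (helmholtz_dist m)"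
  unfolding continuous_map_def topspace_L_dist_topology topspace_D'_L_topology[OF q]
proof (intro conjI allI impI)
  show "helmholtz_dist m \<in> L_dist q \<rightarrow> D'_L q" using helmholtz_dist_D'_L by blast
  fix U :: "((real^'n \<Rightarrow> complex) \<Rightarrow> complex) set" assume U: "openin (D'_L_topology q) U"
  let ?X = "predual q :: (real^'n \<Rightarrow> complex) set" and ?P = "D_L_seminorm (conj_exponent q) :: nat \<Rightarrow> (real^'n \<Rightarrow> complex) \<Rightarrow> real"
  let ?\<B> = "bounded_sets ?X (range ?P)"
  show "openin (L_dist_topology q) {T \<in> L_dist q. helmholtz_dist m T \<in> U}"
    unfolding L_dist_topology_def openin_seminorm_topology
  proof (intro conjI ballI)
    fix T0 :: "(real^'n \<Rightarrow> complex) \<Rightarrow> complex" assume "T0 \<in> {T \<in> L_dist q. helmholtz_dist m T \<in> U}"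
    then have T0: "T0 \<in> L_dist q" "helmholtz_dist m T0 \<in> U" by auto
    obtain F \<epsilon> where F: "finite F" "F \<subseteq> dual_seminorm ` ?\<B>" "\<epsilon> > 0"
      "{T\<in>D'_L q. \<forall>p\<in>F. p (\<lambda>\<phi>. T \<phi> - helmholtz_dist m T0 \<phi>) < \<epsilon>} \<subseteq> U"
      using bspec[OF U[unfolded openin_D'_L_topology[OF q], THEN conjunct2] T0(2)]
      by (elim exE conjE) (rule that)
    obtain BB where BB: "finite BB" "BB \<subseteq> ?\<B>" "F = dual_seminorm ` BB"
      using finite_subset_image[OF F(1,2)] by blast
    have "\<forall>B\<in>BB. \<exists>M\<ge>0. \<forall>\<phi>\<in>B. ?P (2 * m) \<phi> \<le> M"
    proof
      fix B assume "B \<in> BB"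
      then have "B \<in> ?\<B>" using BB by auto
      then have "bdd_above (?P (2 * m) ` B)" by (auto simp: bounded_sets_def)
      then obtain M where "\<And>\<phi>. \<phi> \<in> B \<Longrightarrow> ?P (2 * m) \<phi> \<le> M" unfolding bdd_above_def by auto
      then have "\<forall>\<phi>\<in>B. ?P (2 * m) \<phi> \<le> max 0 M" by (simp add: max.coboundedI2)
      then show "\<exists>M\<ge>0. \<forall>\<phi>\<in>B. ?P (2 * m) \<phi> \<le> M" by (intro exI[of _ "max 0 M"]) simp
    qed
    then obtain M where M: "\<And>B. B \<in> BB \<Longrightarrow> M B \<ge> 0" "\<And>B \<phi>. B \<in> BB \<Longrightarrow> \<phi> \<in> B \<Longrightarrow> ?P (2 * m) \<phi> \<le> M B" by metis
    define Q where "Q = (1 + real CARD('n)) ^ m * (\<Sum>B\<in>BB. M B)"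
    have Q: "Q \<ge> 0" unfolding Q_def using M(1) by (intro mult_nonneg_nonneg sum_nonneg) auto
    define \<delta> where "\<delta> = \<epsilon> / (2 * (Q + 1))"
    have \<delta>: "\<delta> > 0" using F(3) Q by (simp add: \<delta>_def)
    have \<delta>Q: "\<delta> * Q < \<epsilon>"
    proof -
      have "\<delta> * Q \<le> \<delta> * (Q + 1)" using \<delta> by simp
      also have "\<dots> = \<epsilon> / 2" using Q by (simp add: \<delta>_def field_simps)
      finally show ?thesis using F(3) by linarith
    qed
    have "helmholtz_dist m T \<in> U" if T: "T \<in> L_dist q" "L_dist_norm q (\<lambda>\<phi>. T \<phi> - T0 \<phi>) < \<delta>" for T
    proof -
      obtain g where g: "g \<in> Lp q" "regular_distribution g = T" using T(1) by (auto simp: L_dist_def)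
      obtain g0 where g0: "g0 \<in> Lp q" "regular_distribution g0 = T0" using T0(1) by (auto simp: L_dist_def)
      have gg0: "(\<lambda>x. g x - g0 x) \<in> Lp q" by (rule Lp_diff[OF q(1) g(1) g0(1)])
      have rd: "regular_distribution (\<lambda>x. g x - g0 x) = (\<lambda>\<phi>. T \<phi> - T0 \<phi>)"
        using regular_distribution_diff[OF q g(1) g0(1)] g(2) g0(2) by simp
      have "(\<lambda>x. g x - g0 x) \<in> {h \<in> Lp q. regular_distribution h = (\<lambda>\<phi>. T \<phi> - T0 \<phi>)}" using gg0 rd by simp
      \<comment> \<open>\<open>L_dist_norm\<close> is an infimum over representatives, so its
        smallness yields some representative h of small norm; \<open>pairing_eq\<close> then lets h
        stand in for g - g0.\<close>
      then have "\<exists>h\<in>{h \<in> Lp q. regular_distribution h = (\<lambda>\<phi>. T \<phi> - T0 \<phi>)}. Lp_norm q h < \<delta>"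
        using T(2) unfolding L_dist_norm_def by (subst (asm) cINF_less_iff) (auto intro!: bdd_belowI2[of _ 0])
      then obtain h where h: "h \<in> Lp q" "regular_distribution h = (\<lambda>\<phi>. T \<phi> - T0 \<phi>)" "Lp_norm q h < \<delta>" by blast
      have "dual_seminorm B (\<lambda>\<phi>. helmholtz_dist m T \<phi> - helmholtz_dist m T0 \<phi>) < \<epsilon>" if B: "B \<in> BB" for B
      proof -
        have B': "B \<in> ?\<B>" using B BB by auto
        have "dual_seminorm B (\<lambda>\<phi>. helmholtz_dist m T \<phi> - helmholtz_dist m T0 \<phi>) \<le> \<delta> * Q"
        proof (rule dual_seminorm_le[OF q B'])
          fix \<phi> assume \<phi>B: "\<phi> \<in> B"
          then have \<phi>: "\<phi> \<in> predual q" using B' by (auto simp: bounded_sets_def)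
          have "helmholtz_dist m T \<phi> - helmholtz_dist m T0 \<phi> = pairing (\<lambda>x. g x - g0 x) ((helmholtz ^^ m) \<phi>)"
            by (simp add: helmholtz_dist_eq[OF g \<phi>] helmholtz_dist_eq[OF g0 \<phi>]
                pairing_diff_left[OF q g(1) g0(1) predual_helmholtz_power[OF \<phi>]])
          also have "\<dots> = pairing h ((helmholtz ^^ m) \<phi>)"
            by (rule pairing_eq[OF q gg0 h(1) _ predual_helmholtz_power[OF \<phi>]]) (simp only: rd h(2))
          finally have "norm (helmholtz_dist m T \<phi> - helmholtz_dist m T0 \<phi>)
              \<le> Lp_norm q h * ((1 + real CARD('n)) ^ m * ?P (2 * m) \<phi>)"
            using norm_pairing_helmholtz_power[OF h(1) \<phi>] by simp
          also have "\<dots> \<le> \<delta> * Q"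
            unfolding Q_def
          proof (intro mult_mono mult_left_mono)
            have "M B \<le> (\<Sum>B\<in>BB. M B)" using BB(1) M(1) B by (intro member_le_sum) auto
            with M(2)[OF B \<phi>B] show "?P (2 * m) \<phi> \<le> (\<Sum>B\<in>BB. M B)" by linarith
          qed (use h \<delta> in \<open>auto intro: less_imp_le\<close>)
          finally show "norm (helmholtz_dist m T \<phi> - helmholtz_dist m T0 \<phi>) \<le> \<delta> * Q" .
        qed
        with \<delta>Q show ?thesis by linarith
      qed
      then have "helmholtz_dist m T \<in> {T\<in>D'_L q. \<forall>p\<in>F. p (\<lambda>\<phi>. T \<phi> - helmholtz_dist m T0 \<phi>) < \<epsilon>}"
        using BB(3) helmholtz_dist_D'_L[OF T(1)] by simp
      then show ?thesis using F(4) by blast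
    qed
    then show "\<exists>F \<epsilon>. finite F \<and> F \<subseteq> {L_dist_norm q} \<and> \<epsilon> > 0 \<and>
        {T \<in> L_dist q. \<forall>p\<in>F. p (\<lambda>\<phi>. T \<phi> - T0 \<phi>) < \<epsilon>} \<subseteq> {T \<in> L_dist q. helmholtz_dist m T \<in> U}"
      using \<delta> by (intro exI[of _ "{L_dist_norm q}"] exI[of _ \<delta>]) auto
  qed auto
qed

text \<open>Testing the convolution on (1 - \<Delta>)^m \<phi> applies S to the function x \<mapsto>
  L (translate of (1 - \<Delta>)^m \<phi> by x). The operator commutes with translations and L is
  its fundamental solution, so this function is \<phi>.\<close>

lemma helmholtz_dist_convolution:
  fixes S :: "(real^'n::finite \<Rightarrow> complex) \<Rightarrow> complex"
  assumes S: "S \<in> D'_L q" and T: "convolution (bessel_kernel (2 * real m)) S \<in> L_dist q"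
  shows "helmholtz_dist m (convolution (bessel_kernel (2 * real m)) S) = S"
proof (rule D'_L_eqI[OF q helmholtz_dist_D'_L[OF T] S])
  let ?L = "bessel_kernel (2 * real m) :: (real^'n \<Rightarrow> complex) \<Rightarrow> complex"
  obtain g where g: "g \<in> Lp q" "regular_distribution g = convolution ?L S"
    using T by (auto simp: L_dist_def)
  fix \<phi> :: "real^'n \<Rightarrow> complex" assume \<phi>: "\<phi> \<in> test_functions"
  let ?\<psi> = "(helmholtz ^^ m) \<phi>"
  have \<psi>: "?\<psi> \<in> test_functions" by (rule test_functions_helmholtz_power[OF \<phi>])
  have L: "?L (\<lambda>y. ?\<psi> (x + y)) = \<phi> x" for x
  proof -
    have "(\<lambda>y. ?\<psi> (x + y)) = (helmholtz ^^ m) (\<lambda>y. \<phi> (y + x))"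
      using helmholtz_power_translate[OF test_functions_smooth[OF \<phi>], of m x] by (simp add: add.commute)
    then show ?thesis using bessel_kernel_helmholtz_power[OF test_functions_translate[OF \<phi>, of x], of m] by simp
  qed
  have "helmholtz_dist m (convolution ?L S) \<phi> = pairing g ?\<psi>"
    by (rule helmholtz_dist_eq[OF g test_functions_predual[OF q \<phi>]])
  also have "\<dots> = convolution ?L S ?\<psi>"
    using fun_cong[OF g(2), of ?\<psi>] \<psi> by (simp add: regular_distribution_def)
  also have "\<dots> = S \<phi>" using \<psi> by (simp add: convolution_def L)
  finally show "helmholtz_dist m (convolution ?L S) \<phi> = S \<phi>" .
qed

text \<open>C is recovered from its convolution by a continuous left inverse, and continuous images
  of compact sets are compact.\<close>

lemma compactin_of_compactin_convolution:
  fixes C :: "((real^'n::finite \<Rightarrow> complex) \<Rightarrow> complex) set"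
  assumes C: "C \<subseteq> D'_L q" and sub: "convolution (bessel_kernel (2 * real m)) ` C \<subseteq> L_dist q"
    and comp: "compactin (L_dist_topology q) (convolution (bessel_kernel (2 * real m)) ` C)"
  shows "compactin (D'_L_topology q) C"
proof -
  have "helmholtz_dist m ` convolution (bessel_kernel (2 * real m)) ` C = C"
  proof -
    have "helmholtz_dist m (convolution (bessel_kernel (2 * real m)) S) = S" if "S \<in> C" for S
      using that C sub by (intro helmholtz_dist_convolution) auto
    then show ?thesis by (force simp: image_image)
  qed
  with image_compactin[OF comp continuous_map_helmholtz_dist[of m]] show ?thesis by simp
qed

text \<open>B is the image of the L^p unit ball of test functions under smoothing over the times in
  A. It is bounded in every seminorm because the weights of all orders j are integrable, as happens
  for A bounded away from 0. The estimate is then homogeneity of S and of the average.\<close>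

lemma norm_heat_average_le_dual_seminorm:
  fixes \<phi> :: "real^'n::finite \<Rightarrow> complex" and k :: nat and A :: "real set"
  defines "B \<equiv> {heat_average k A [] \<psi> | \<psi>. \<psi> \<in> test_functions \<and> Lp_norm (conj_exponent q) \<psi> \<le> 1}"
  assumes A: "A \<in> sets borel" "A \<subseteq> {0<..}" and int: "\<And>j. integrable lborel (heat_weight k A j)"
    and S: "S \<in> D'_L q" and \<phi>: "\<phi> \<in> test_functions"
  shows "B \<in> bounded_sets (predual q) (range (D_L_seminorm (conj_exponent q)))"
    and "norm (S (heat_average k A [] \<phi>)) \<le> Lp_norm (conj_exponent q) \<phi> * dual_seminorm B S"
proof -
  let ?N = "Lp_norm (conj_exponent q) :: (real^'n \<Rightarrow> complex) \<Rightarrow> real"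
  have XA: "heat_average k A [] \<psi> \<in> predual q" if "\<psi> \<in> test_functions" for \<psi> :: "real^'n \<Rightarrow> complex"
    by (rule heat_average_predual[OF q A int that])
  show B: "B \<in> bounded_sets (predual q) (range (D_L_seminorm (conj_exponent q)))"
    unfolding bounded_sets_def
  proof (intro CollectI conjI)
    \<comment> \<open>Homogeneity bounds the norm of the zero function by 0 for every exponent; the
      zero function witnesses that B is nonempty, which \<open>bounded_sets\<close> demands.\<close>
    have "?N (\<lambda>x. 0 * gauss x) \<le> norm (0::complex) * ?N gauss"
      using decaying_predual[OF q decaying_gauss]
      by (intro Lp_norm_cmult_le[OF q] predual_Lp_0[OF q] predual_continuous_on[OF q])
    then have "?N (\<lambda>x. 0) \<le> 1" by simp
    then have "heat_average k A [] (\<lambda>x. 0) \<in> B" unfolding B_def using test_functions_zero by blast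
    then show "B \<noteq> {}" by blast
    show "B \<subseteq> predual q" unfolding B_def using XA by blast
    show "\<forall>p\<in>range (D_L_seminorm (conj_exponent q)). bdd_above (p ` B)"
    proof clarify
      fix K
      obtain T where T: "T \<ge> 0" "\<And>\<psi>::real^'n \<Rightarrow> complex. \<psi> \<in> test_functions \<Longrightarrow> D_L_seminorm (conj_exponent q) K (heat_average k A [] \<psi>) \<le> T * ?N \<psi>"
        using D_L_seminorm_heat_average_bound[OF q A int] by blast
      show "bdd_above (D_L_seminorm (conj_exponent q) K ` B)"
      proof (rule bdd_aboveI2)
        fix f assume "f \<in> B"
        then obtain \<psi> where \<psi>: "f = heat_average k A [] \<psi>" "\<psi> \<in> test_functions" "?N \<psi> \<le> 1" unfolding B_def by blast
        have "T * ?N \<psi> \<le> T * 1" using T(1) \<psi>(3) by (rule mult_left_mono[rotated])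
        with T(2)[OF \<psi>(2)] show "D_L_seminorm (conj_exponent q) K f \<le> T" unfolding \<psi>(1) by linarith
      qed
    qed
  qed
  have P0: "0 \<le> dual_seminorm B S"
  proof -
    obtain f where "f \<in> B" using B unfolding bounded_sets_def by blast
    then have "norm (S f) \<le> dual_seminorm B S" by (rule norm_le_dual_seminorm[OF q B S])
    then show ?thesis using norm_ge_zero order_trans by blast
  qed
  \<comment> \<open>The scaling factor s is taken strictly above the norm of \<phi>, which may be 0,
    and tends to it afterwards.\<close>
  have *: "norm (S (heat_average k A [] \<phi>)) \<le> s * dual_seminorm B S" if s: "s > ?N \<phi>" for s
  proof -
    have s0: "s > 0" using s Lp_norm_nonneg[of "conj_exponent q" \<phi>] by linarith
    have n: "norm (complex_of_real (1 / s)) = 1 / s" using s0 by (simp only: norm_of_real) simp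
    let ?\<psi> = "\<lambda>x. complex_of_real (1 / s) * \<phi> x"
    have "?N ?\<psi> \<le> norm (complex_of_real (1 / s)) * ?N \<phi>"
      using test_functions_predual[OF q \<phi>]
      by (intro Lp_norm_cmult_le[OF q] predual_Lp_0[OF q] predual_continuous_on[OF q])
    also have "\<dots> \<le> 1" unfolding n using s s0 by simp
    finally have "?N ?\<psi> \<le> 1" .
    then have "heat_average k A [] ?\<psi> \<in> B" unfolding B_def using test_functions_cmult[OF \<phi>] by blast
    then have "norm (S (heat_average k A [] ?\<psi>)) \<le> dual_seminorm B S" by (rule norm_le_dual_seminorm[OF q B S])
    moreover have "S (heat_average k A [] ?\<psi>) = complex_of_real (1 / s) * S (heat_average k A [] \<phi>)"
      unfolding heat_average_cmult by (rule D'_L_cmult[OF q S XA[OF \<phi>]])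
    ultimately have "1 / s * norm (S (heat_average k A [] \<phi>)) \<le> dual_seminorm B S"
      by (simp only: norm_mult n)
    then show ?thesis using s0 by (simp add: field_simps)
  qed
  show "norm (S (heat_average k A [] \<phi>)) \<le> ?N \<phi> * dual_seminorm B S"
  proof (rule field_le_epsilon)
    fix e :: real assume e: "e > 0"
    let ?P = "dual_seminorm B S"
    have "norm (S (heat_average k A [] \<phi>)) \<le> (?N \<phi> + e / (?P + 1)) * ?P"
      by (rule *) (use e P0 in simp)
    also have "\<dots> \<le> ?N \<phi> * ?P + e"
    proof -
      have "e / (?P + 1) * ?P \<le> e" using e P0 by (simp add: field_simps)
      then show ?thesis by (simp add: distrib_right)
    qed
    finally show "norm (S (heat_average k A [] \<phi>)) \<le> ?N \<phi> * ?P + e" .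
  qed
qed

lemma compactin_convolution:
  fixes C :: "((real^'n::finite \<Rightarrow> complex) \<Rightarrow> complex) set"
  assumes C: "compactin (D'_L_topology q) C"
  shows "\<exists>m::nat. convolution (bessel_kernel (2 * real m)) ` C \<subseteq> L_dist q \<and>
       compactin (L_dist_topology q) (convolution (bessel_kernel (2 * real m)) ` C)"
proof -
  let ?P = "D_L_seminorm (conj_exponent q) :: nat \<Rightarrow> (real^'n \<Rightarrow> complex) \<Rightarrow> real"
  let ?N = "Lp_norm (conj_exponent q) :: (real^'n \<Rightarrow> complex) \<Rightarrow> real"
  have sub: "C \<subseteq> D'_L q" using compactin_subset_topspace[OF C] by (simp add: topspace_D'_L_topology[OF q])
  obtain K c where c: "c > 0" "\<And>S \<phi>. S \<in> C \<Longrightarrow> \<phi> \<in> predual q \<Longrightarrow> norm (S \<phi>) \<le> c * ?P K \<phi>"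
    using compactin_imp_equicontinuous[OF q C] by blast
  \<comment> \<open>K derivatives from the seminorm controlling C, and n more square roots of t from
    the normalisation of the kernel, have to be absorbed. The resulting order is 2 (k + 1).\<close>
  define k where "k = CARD('n) + K"
  have k: "CARD('n) + K \<le> k" "k > 0" "K \<le> k" by (simp_all add: k_def)
  let ?J = "heat_average k {0<..} [] :: (real^'n \<Rightarrow> complex) \<Rightarrow> real^'n \<Rightarrow> complex"
  let ?L = "bessel_kernel (2 * real (Suc k)) :: (real^'n \<Rightarrow> complex) \<Rightarrow> complex"
  let ?conv = "convolution ?L"
  have conv: "?conv S \<phi> = S (?J \<phi>)" if "\<phi> \<in> test_functions" for S \<phi>
    by (rule convolution_bessel_kernel[OF that k(2)])
  have A: "{0<..} \<in> sets (borel :: real measure)" "{0<..} \<subseteq> {0::real<..}" by auto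
  have "\<forall>S\<in>C. \<exists>g. continuous_on UNIV g \<and> (\<forall>\<phi>\<in>test_functions. pairing g \<phi> = S (?J \<phi>))"
  proof
    fix S assume S: "S \<in> C"
    with sub have SD: "S \<in> D'_L q" by blast
    show "\<exists>g. continuous_on UNIV g \<and> (\<forall>\<phi>\<in>test_functions. pairing g \<phi> = S (?J \<phi>))"
      by (rule continuous_representative[OF q SD c(1) c(2)[OF S] k(1)])
  qed
  then obtain g where g: "\<And>S. S \<in> C \<Longrightarrow> continuous_on UNIV (g S)"
    "\<And>S \<phi>. S \<in> C \<Longrightarrow> \<phi> \<in> test_functions \<Longrightarrow> pairing (g S) \<phi> = S (?J \<phi>)" by metis
  have intJ: "integrable lborel (heat_weight k {0<..} j)" if "j \<le> K" for j
    using that k by (intro integrable_heat_weight) auto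
  have XJ: "?J \<phi> \<in> predual q" if "\<phi> \<in> test_functions" for \<phi>
    by (rule heat_average_predual[OF q A intJ that]) simp
  obtain T where T: "T \<ge> 0" "\<And>\<phi>. \<phi> \<in> test_functions \<Longrightarrow> ?P K (?J \<phi>) \<le> T * ?N \<phi>"
    using D_L_seminorm_heat_average_bound[OF q A intJ] by blast
  have gL: "g S \<in> Lp q" if S: "S \<in> C" for S
  proof (rule converse_Hoelder_Lp[OF q g(1)[OF S]])
    show "0 \<le> c * T" using c T by simp
    fix \<phi> :: "real^'n \<Rightarrow> complex" assume \<phi>: "\<phi> \<in> test_functions"
    have "c * ?P K (?J \<phi>) \<le> c * (T * ?N \<phi>)" using c(1) T(2)[OF \<phi>] by simp
    with c(2)[OF S XJ[OF \<phi>]] show "norm (pairing (g S) \<phi>) \<le> c * T * ?N \<phi>"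
      by (simp add: g(2)[OF S \<phi>] mult.assoc)
  qed
  have rg: "regular_distribution (g S) = ?conv S" if "S \<in> C" for S
  proof
    fix \<phi>
    show "regular_distribution (g S) \<phi> = ?conv S \<phi>"
    proof (cases "\<phi> \<in> test_functions")
      case True
      then show ?thesis by (simp only: regular_distribution_def g(2)[OF that True] conv if_True)
    next
      case False
      then show ?thesis by (simp add: regular_distribution_def convolution_def)
    qed
  qed
  have Lsub: "?conv ` C \<subseteq> L_dist q"
    unfolding L_dist_def using rg gL by (force simp del: of_nat_Suc)
  \<comment> \<open>Continuity is established on the subspace C, since the estimate for small times
    relies on the seminorm bound shared by the members of C.\<close>
  have "continuous_map (subtopology (D'_L_topology q) C) (L_dist_topology q) ?conv"
    unfolding continuous_map_def
  proof (intro conjI allI impI)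
    have top: "topspace (subtopology (D'_L_topology q) C) = C"
      using sub by (auto simp: topspace_D'_L_topology[OF q])
    show "?conv \<in> topspace (subtopology (D'_L_topology q) C) \<rightarrow> topspace (L_dist_topology q)"
      unfolding top topspace_L_dist_topology using Lsub by blast
    fix U :: "((real^'n \<Rightarrow> complex) \<Rightarrow> complex) set" assume U: "openin (L_dist_topology q) U"
    show "openin (subtopology (D'_L_topology q) C) {S \<in> topspace (subtopology (D'_L_topology q) C). ?conv S \<in> U}"
      unfolding top
    proof (subst openin_subopen, rule ballI)
      fix S0 assume "S0 \<in> {S \<in> C. ?conv S \<in> U}"
      then have S0: "S0 \<in> C" "?conv S0 \<in> U" by auto
      obtain \<epsilon> where \<epsilon>: "\<epsilon> > 0"
        "\<And>T. T \<in> L_dist q \<Longrightarrow> L_dist_norm q (\<lambda>\<phi>. T \<phi> - ?conv S0 \<phi>) < \<epsilon> \<Longrightarrow> T \<in> U"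
        using openin_L_dist_ball[OF U S0(2)] by blast
      let ?GM = "gauss_mass TYPE('n) K"
      have GM: "?GM \<ge> 0" by (rule gauss_mass_nonneg[OF q])
      \<comment> \<open>Chosen so that two functionals, each bounded by c times 2 \<tau> times the
        Gaussian mass, together contribute at most \<epsilon> / 4; the summand 1 keeps the
        denominator positive.\<close>
      define \<tau> where "\<tau> = \<epsilon> / (16 * c * (?GM + 1))"
      have \<tau>: "\<tau> > 0" using \<epsilon>(1) c(1) GM by (simp add: \<tau>_def)
      have \<tau>le: "2 * c * (2 * \<tau> * ?GM) \<le> \<epsilon> / 4"
      proof -
        have "2 * c * (2 * \<tau> * ?GM) \<le> 2 * c * (2 * \<tau> * (?GM + 1))"
          using c(1) \<tau> by (intro mult_left_mono) auto
        also have "\<dots> = \<epsilon> / 4"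
        proof -
          have "2 * c * (2 * (\<epsilon> / (16 * c * x)) * x) = \<epsilon> / 4" if "x \<noteq> 0" for x
            using that c(1) by simp
          moreover have "?GM + 1 \<noteq> 0" using GM by linarith
          ultimately show ?thesis unfolding \<tau>_def by blast
        qed
        finally show ?thesis .
      qed
      have A1: "{0<..\<tau>} \<in> sets borel" "{0<..\<tau>} \<subseteq> {0<..}" "integrable lborel (heat_weight k {0<..\<tau>} 0)"
        by (auto intro!: integrable_heat_weight)
      have A2: "{\<tau><..} \<in> sets borel" "{\<tau><..} \<subseteq> {0<..}" "\<And>j. integrable lborel (heat_weight k {\<tau><..} j)"
        using \<tau> by (auto intro!: integrable_heat_weight_away_0[where e = \<tau>])
      have A12: "{\<tau><..} \<inter> {0<..\<tau>} = {}" "{\<tau><..} \<union> {0<..\<tau>} = {0<..}" using \<tau> by auto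
      define B where "B = {heat_average k {\<tau><..} [] \<psi> | \<psi> :: real^'n \<Rightarrow> complex. \<psi> \<in> test_functions \<and> ?N \<psi> \<le> 1}"
      have S0D: "S0 \<in> D'_L q" using S0 sub by blast
      have B: "B \<in> bounded_sets (predual q) (range ?P)"
        unfolding B_def by (rule norm_heat_average_le_dual_seminorm(1)[OF A2 S0D test_functions_zero])
      let ?V = "{S \<in> D'_L q. dual_seminorm B (\<lambda>\<phi>. S \<phi> - S0 \<phi>) < \<epsilon> / 4}"
      have V: "openin (D'_L_topology q) ?V" by (rule openin_dual_ball[OF q B S0D])
      have "?conv S \<in> U" if S: "S \<in> C" "dual_seminorm B (\<lambda>\<phi>. S \<phi> - S0 \<phi>) < \<epsilon> / 4" for S
      proof -
        have SD: "S \<in> D'_L q" using S sub by blast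
        let ?D = "\<lambda>\<phi>. S \<phi> - S0 \<phi>"
        have DD: "?D \<in> D'_L q" by (rule D'_L_diff_closed[OF q SD S0D])
        \<comment> \<open>Late and early times contribute \<epsilon> / 4 each. Late times use
          closeness of S and S0 on the bounded set B; early times use the common bound for S and S0
          separately. Stopping at \<epsilon> / 2 leaves room for the strict inequality.\<close>
        have "Lp_norm q (\<lambda>x. g S x - g S0 x) \<le> \<epsilon> / 2"
        proof (rule converse_Hoelder[OF q])
          show "continuous_on UNIV (\<lambda>x. g S x - g S0 x)" by (intro continuous_intros g(1) S S0)
          show "0 \<le> \<epsilon> / 2" using \<epsilon>(1) by simp
          fix \<phi> :: "real^'n \<Rightarrow> complex" assume \<phi>: "\<phi> \<in> test_functions"
          let ?a = "heat_average k {\<tau><..} [] \<phi>" and ?b = "heat_average k {0<..\<tau>} [] \<phi>"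
          have Xa: "?a \<in> predual q" by (rule heat_average_predual[OF q A2(1,2) A2(3) \<phi>])
          have Xb: "?b \<in> predual q" by (rule heat_average_predual[OF q A1 \<phi>])
          have "pairing (\<lambda>x. g S x - g S0 x) \<phi> = ?D (?J \<phi>)"
            using pairing_diff_left[OF q gL[OF S(1)] gL[OF S0(1)] test_functions_predual[OF q \<phi>]]
            by (simp add: g(2)[OF S(1) \<phi>] g(2)[OF S0(1) \<phi>])
          also have "\<dots> = ?D ?a + ?D ?b"
            using heat_average_Un[OF A2(1,2) A2(3) A1 A12(1) \<phi>] D'_L_add[OF q DD Xa Xb] unfolding A12(2) by simp
          finally have "norm (pairing (\<lambda>x. g S x - g S0 x) \<phi>) \<le> norm (?D ?a) + norm (?D ?b)"
            by (simp only: norm_triangle_ineq)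
          moreover have "norm (?D ?a) \<le> \<epsilon> / 4 * ?N \<phi>"
          proof -
            have "norm (?D ?a) \<le> ?N \<phi> * dual_seminorm B ?D"
              unfolding B_def by (rule norm_heat_average_le_dual_seminorm(2)[OF A2 DD \<phi>])
            also have "\<dots> \<le> ?N \<phi> * (\<epsilon> / 4)" using S(2) by (intro mult_left_mono) auto
            finally show ?thesis by (simp add: mult.commute)
          qed
          moreover have "norm (?D ?b) \<le> \<epsilon> / 4 * ?N \<phi>"
          proof -
            have "norm (?D ?b) \<le> norm (S ?b) + norm (S0 ?b)" by (rule norm_triangle_ineq4)
            also have "\<dots> \<le> c * ?P K ?b + c * ?P K ?b"
              by (intro add_mono c(2) S S0 Xb)
            also have "\<dots> = 2 * c * ?P K ?b" by simp
            also have "\<dots> \<le> 2 * c * (2 * \<tau> * ?GM * ?N \<phi>)"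
              using c(1) by (intro mult_left_mono D_L_seminorm_heat_average_small[OF q \<phi> k(3) \<tau>]) auto
            also have "\<dots> = (2 * c * (2 * \<tau> * ?GM)) * ?N \<phi>" by simp
            also have "\<dots> \<le> \<epsilon> / 4 * ?N \<phi>" by (intro mult_right_mono \<tau>le) simp
            finally show ?thesis .
          qed
          ultimately show "norm (pairing (\<lambda>x. g S x - g S0 x) \<phi>) \<le> \<epsilon> / 2 * ?N \<phi>" by simp
        qed
        moreover have "L_dist_norm q (\<lambda>\<phi>. ?conv S \<phi> - ?conv S0 \<phi>) \<le> Lp_norm q (\<lambda>x. g S x - g S0 x)"
        proof (rule L_dist_norm_le)
          show "(\<lambda>x. g S x - g S0 x) \<in> Lp q" by (intro Lp_diff q gL S S0)
          show "regular_distribution (\<lambda>x. g S x - g S0 x) = (\<lambda>\<phi>. ?conv S \<phi> - ?conv S0 \<phi>)"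
            by (simp only: regular_distribution_diff[OF q gL[OF S(1)] gL[OF S0(1)]] rg[OF S(1)] rg[OF S0(1)])
        qed
        ultimately have "L_dist_norm q (\<lambda>\<phi>. ?conv S \<phi> - ?conv S0 \<phi>) < \<epsilon>" using \<epsilon>(1) by linarith
        then show ?thesis using Lsub S(1) by (intro \<epsilon>(2)) auto
      qed
      then have "?V \<inter> C \<subseteq> {S \<in> C. ?conv S \<in> U}" by blast
      moreover have "openin (subtopology (D'_L_topology q) C) (?V \<inter> C)"
        using V by (auto simp: openin_subtopology)
      moreover have "S0 \<in> ?V \<inter> C"
      proof -
        have "dual_seminorm B (\<lambda>\<phi>. S0 \<phi> - S0 \<phi>) \<le> 0" by (rule dual_seminorm_le[OF q B]) simp
        then show ?thesis using S0 S0D \<epsilon>(1) by simp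
      qed
      ultimately show "\<exists>W. openin (subtopology (D'_L_topology q) C) W \<and> S0 \<in> W \<and> W \<subseteq> {S \<in> C. ?conv S \<in> U}"
        by blast
    qed
  qed
  moreover have "compactin (subtopology (D'_L_topology q) C) C"
    using C by (simp add: compactin_subtopology)
  ultimately have "compactin (L_dist_topology q) (?conv ` C)"
    by (rule image_compactin[rotated])
  with Lsub show ?thesis by blast
qed

end

theorem proposition3:
  fixes q :: ennreal
    and C :: "((real^'n::finite \<Rightarrow> complex) \<Rightarrow> complex) set"
  assumes "1 \<le> q" and "q < \<infinity>"
    and "C \<subseteq> D'_L q"
  shows "compactin (D'_L_topology q) C \<longleftrightarrow>
    (\<exists>m::nat. convolution (bessel_kernel (2 * real m)) ` C \<subseteq> L_dist q \<and>
       compactin (L_dist_topology q) (convolution (bessel_kernel (2 * real m)) ` C))"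
proof
  assume "compactin (D'_L_topology q) C"
  then show "\<exists>m::nat. convolution (bessel_kernel (2 * real m)) ` C \<subseteq> L_dist q \<and>
       compactin (L_dist_topology q) (convolution (bessel_kernel (2 * real m)) ` C)"
    by (rule compactin_convolution[OF assms(1,2)])
next
  assume "\<exists>m::nat. convolution (bessel_kernel (2 * real m)) ` C \<subseteq> L_dist q \<and>
       compactin (L_dist_topology q) (convolution (bessel_kernel (2 * real m)) ` C)"
  then obtain m :: nat where "convolution (bessel_kernel (2 * real m)) ` C \<subseteq> L_dist q"
    "compactin (L_dist_topology q) (convolution (bessel_kernel (2 * real m)) ` C)"
    by blast
  with assms show "compactin (D'_L_topology q) C"
    by (rule compactin_of_compactin_convolution)
qed

end
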